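(* For every link $L$ in $S^3$, $$\mathrm{grid}(L)\le 2\cdot \mathrm{ind}_F(L).$$ Consequently, $$\mathrm{bridge}(L)\le \mathrm{braid}(L)\le \mathrm{grid}(L)/2\le \mathrm{ind}_F(L),$$ where $\mathrm{bridge}(L)$ is the bridge number and $\mathrm{braid}(L)$ the braid index of $L$.
   Context: The quantities $\mathrm{grid}(L)$, $\mathrm{ind}_F(L)$ and $\mathrm{bridge}(L)$ depend only on the underlying unoriented link; the braid index is taken with respect to any given orientation of $L$. Minimal grid number: an unoriented $m\times m$ grid diagram $\mathbb{G}$ is an $m\times m$ grid of squares, each empty or containing a marking, with exactly two marked squares in each row and in each column. Its unoriented link $\mathcal{L}(\mathbb{G})$ is obtained by joining the two markings in each row and in each column by segments, horizontal segments always crossing over vertical ones. $\mathrm{grid}(L)$ is the minimal $m$ such that $L=\mathcal{L}(\mathbb{G})$ for some $m\times m$ unoriented grid diagram $\mathbb{G}$. Thompson index: a standard dyadic (s.d.) interval is an interval $[\frac{k}{2^m},\frac{k+1}{2^m}]$ with integers $m\ge 0$, $0\le k\le 2^m-1$. An s.d. $n$-partition $\mathcal{I}$ is a partition $0=a_0<\dots<a_n=1$ all of whose subintervals $[a_i,a_{i+1}]$ are s.d. intervals. Thompson group $F$: the group of piecewise linear orientation-preserving homeomorphisms of $[0,1]$ whose slopes are powers of $2$ and whose breakpoints are dyadic rationals. If $\mathcal{I}$ ($a_0<\dots<a_n$) and $\mathcal{J}$ ($b_0<\dots<b_n$) are s.d. $n$-partitions, the map with $a_i\mapsto b_i$, linear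 on each $[a_i,a_{i+1}]$, is an element of $F$, said to be represented by $(\mathcal{I},\mathcal{J})$. The pair is reduced if there is no $i$ with $1\le i\le n-1$ such that both $[a_{i-1},a_{i+1}]$ and $[b_{i-1},b_{i+1}]$ are s.d. intervals; every $g\in F$ is represented by a unique reduced pair, and its leaf number is the number $n$ of subintervals in that pair. Let $\mathcal{S}(\mathcal{I})$ be the set of s.d. intervals of the form $[a_i,a_j]$. The planar binary tree $F_{\mathcal{I}}$ (root edge at the top) has one edge for each element of $\mathcal{S}(\mathcal{I})$; the root edge is $[0,1]$, and each $B\in\mathcal{S}(\mathcal{I})$ that is not a subinterval of $\mathcal{I}$ ends below at a trivalent vertex from which its left half and right half descend as left and right edges; the leaves are the subintervals of $\mathcal{I}$. Form a tangle $T_{\mathcal{I}}$ from $F_{\mathcal{I}}$ by attaching at each trivalent vertex a vertical strand going straight down to the bottom, and turning the resulting 4-valent vertex into a crossing whose under-strand is the parent edge continued into the added vertical strand and whose over-strand is the left edge joined to the right edge. Adding a vertical strand on the far left and joining its top by a cap to the top endpoint of $T_{\mathcal{I}}$ gives an unoriented $(0,2n)$-tangle $\widehat{T_{\mathcal{I}}}$. For a pair $(\mathcal{I},\mathcal{J})$ of s.d. $n$-partitions, $L_{(\mathcal{I},\mathcal{J})}$ is obtained by placing $\widehat{T_{\mathcal{I}}}$ on top of the reflection of the planar diagram of $\widehat{T_{\mathcal{J}}}$ in a horizontal line (keeping which strand is over at each crossing) and joining the $2n$ endpoints in order. For $g\in F$, $L_g:=L_{(\mathcal{I},\mathcal{J})}$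 with $(\mathcal{I},\mathcal{J})$ the reduced pair representing $g$. $\mathrm{ind}_F(L)$ is the smallest leaf number of an element $g\in F$ with $L_g=L$ (by a known theorem of Jones every unoriented link is $L_g$ for some $g\in F$). *)

theory Defs
  imports "HOL-Analysis.Analysis" "HOL-Library.Extended_Real"
begin

section \<open>Links in the three-sphere\<close>

type_synonym R3 = "real \<times> real \<times> real"
type_synonym R4 = "real \<times> real \<times> real \<times> real"

abbreviation S3 :: "R4 topology" where
  "S3 \<equiv> top_of_set (sphere 0 1)"

text \<open>Inverse stereographic projection. Diagrams are drawn in the plane of the first two
  coordinates of \<open>R3\<close>, a larger third coordinate meaning ``over''; they define links
  in the sphere via this embedding.\<close>

definition stereo :: "R3 \<Rightarrow> R4" where
  "stereo = (\<lambda>(x, y, z). let q = x\<^sup>2 + y\<^sup>2 + z\<^sup>2 in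
     (2 * x / (q + 1), 2 * y / (q + 1), 2 * z / (q + 1), (q - 1) / (q + 1)))"

text \<open>\<open>h\<close> is the end of an ambient isotopy, i.e. of a homotopy through homeomorphisms
  of the sphere starting at the identity.\<close>

definition isotopic_to_id :: "(R4 \<Rightarrow> R4) \<Rightarrow> bool" where
  "isotopic_to_id h \<longleftrightarrow> homotopic_with (homeomorphic_map S3 S3) S3 S3 id h"

definition ambient_isotopic :: "R4 set \<Rightarrow> R4 set \<Rightarrow> bool" where
  "ambient_isotopic K K' \<longleftrightarrow> (\<exists>h. isotopic_to_id h \<and> h ` K = K')"

fun polygonal_path :: "'a::real_normed_vector list \<Rightarrow> real \<Rightarrow> 'a" where
  "polygonal_path [] = (\<lambda>_. 0)"
| "polygonal_path [v] = linepath v v"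
| "polygonal_path [v, w] = linepath v w"
| "polygonal_path (v # w # u # vs) = linepath v w +++ polygonal_path (w # u # vs)"

definition closed_polygon :: "'a::real_normed_vector list \<Rightarrow> real \<Rightarrow> 'a" where
  "closed_polygon vs = polygonal_path (vs @ [hd vs])"

definition polygon_edges :: "'a list \<Rightarrow> ('a \<times> 'a) set" where
  "polygon_edges vs = set (zip vs (rotate1 vs))"

text \<open>A polygonal link is given by the cyclic vertex lists of its components, which also
  orient it.\<close>

definition polygonal_link :: "R3 list set \<Rightarrow> bool" where
  "polygonal_link P \<longleftrightarrow> finite P \<and> P \<noteq> {} \<and>
     (\<forall>vs\<in>P. simple_path (closed_polygon vs)) \<and>
     pairwise (\<lambda>vs ws. disjnt (path_image (closed_polygon vs)) (path_image (closed_polygon ws))) P"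

definition polygonal_support :: "R3 list set \<Rightarrow> R3 set" where
  "polygonal_support P = (\<Union>vs\<in>P. path_image (closed_polygon vs))"

text \<open>Links are tame and nonempty.\<close>

definition link :: "R4 set \<Rightarrow> bool" where
  "link K \<longleftrightarrow> (\<exists>P. polygonal_link P \<and> ambient_isotopic (stereo ` polygonal_support P) K)"

text \<open>An orientation is given by parametrizing the components as simple loops; only the
  direction of the loops matters, see \<open>same_oriented_loop\<close>.\<close>

definition orientation_of :: "R4 set \<Rightarrow> (real \<Rightarrow> R4) set \<Rightarrow> bool" where
  "orientation_of K \<Gamma> \<longleftrightarrow> finite \<Gamma> \<and>
     (\<forall>\<gamma>\<in>\<Gamma>. simple_path \<gamma> \<and> pathfinish \<gamma> = pathstart \<gamma>) \<and>
     pairwise (\<lambda>\<gamma> \<delta>. disjnt (path_image \<gamma>) (path_image \<delta>)) \<Gamma> \<and>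
     (\<Union>\<gamma>\<in>\<Gamma>. path_image \<gamma>) = K"

definition same_oriented_loop :: "(real \<Rightarrow> 'a::topological_space) \<Rightarrow> (real \<Rightarrow> 'a) \<Rightarrow> bool" where
  "same_oriented_loop \<gamma> \<delta> \<longleftrightarrow> (\<exists>a\<in>{0..1}. \<exists>\<phi>. strict_mono_on {0..1} \<phi> \<and> \<phi> ` {0..1} = {0..1} \<and>
     (\<forall>t\<in>{0..1}. \<delta> t = shiftpath a \<gamma> (\<phi> t)))"

definition oriented_ambient_isotopic :: "(real \<Rightarrow> R4) set \<Rightarrow> (real \<Rightarrow> R4) set \<Rightarrow> bool" where
  "oriented_ambient_isotopic \<Gamma> \<Delta> \<longleftrightarrow> (\<exists>h. isotopic_to_id h \<and>
     h ` (\<Union>\<gamma>\<in>\<Gamma>. path_image \<gamma>) = (\<Union>\<delta>\<in>\<Delta>. path_image \<delta>) \<and>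
     (\<forall>\<gamma>\<in>\<Gamma>. \<exists>\<delta>\<in>\<Delta>. same_oriented_loop (h \<circ> \<gamma>) \<delta>))"

text \<open>All four link invariants below are minima, taken as infima in \<^typ>\<open>enat\<close>.\<close>

section \<open>Bridge number\<close>

definition height :: "R3 \<Rightarrow> real" where
  "height = (\<lambda>(x, y, z). z)"

definition local_maxima :: "R3 list \<Rightarrow> nat" where
  "local_maxima vs = (let n = length vs; h = (\<lambda>i. height (vs ! (i mod n))) in
     card {i. i < n \<and> h i < h (i + 1) \<and> h (i + 2) < h (i + 1)})"

definition bridge_presentation :: "nat \<Rightarrow> R3 list set \<Rightarrow> bool" where
  "bridge_presentation b P \<longleftrightarrow> polygonal_link P \<and>
     (\<forall>vs\<in>P. \<forall>(v, w)\<in>polygon_edges vs. height v \<noteq> height w) \<and>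
     b = (\<Sum>vs\<in>P. local_maxima vs)"

definition bridge_number :: "R4 set \<Rightarrow> enat" where
  "bridge_number K = (INF b\<in>{b. \<exists>P. bridge_presentation b P \<and>
     ambient_isotopic (stereo ` polygonal_support P) K}. enat b)"

section \<open>Braid index\<close>

text \<open>A closed braid about the third coordinate axis: each edge avoids the axis and runs in
  the direction of increasing polar angle (by less than a half turn). The number of strands is
  the number of intersections with a half-plane bounded by the axis.\<close>

definition closed_braid :: "nat \<Rightarrow> R3 list set \<Rightarrow> bool" where
  "closed_braid n P \<longleftrightarrow> polygonal_link P \<and>
     (\<forall>vs\<in>P. \<forall>((x, y, z), (x', y', z'))\<in>polygon_edges vs. x * y' - y * x' > 0) \<and>
     n = card (polygonal_support P \<inter> {(x, y, z). x > 0 \<and> y = 0})"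

definition braid_index :: "(real \<Rightarrow> R4) set \<Rightarrow> enat" where
  "braid_index \<Gamma> = (INF n\<in>{n. \<exists>P. closed_braid n P \<and>
     oriented_ambient_isotopic ((\<lambda>vs. stereo \<circ> closed_polygon vs) ` P) \<Gamma>}. enat n)"

section \<open>Grid number\<close>

text \<open>\<open>(i, j) \<in> G\<close> means that the square in column \<open>i\<close> and row \<open>j\<close> is marked.\<close>

definition grid_diagram :: "nat \<Rightarrow> (nat \<times> nat) set \<Rightarrow> bool" where
  "grid_diagram m G \<longleftrightarrow> G \<subseteq> {..<m} \<times> {..<m} \<and>
     (\<forall>j<m. card {i. (i, j) \<in> G} = 2) \<and> (\<forall>i<m. card {j. (i, j) \<in> G} = 2)"

text \<open>Vertical segments at level 0, horizontal segments at level 1, connected at the markings.\<close>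

definition grid_link :: "(nat \<times> nat) set \<Rightarrow> R3 set" where
  "grid_link G =
     (\<Union>i. convex hull {(real i, real j, 0) | j. (i, j) \<in> G}) \<union>
     (\<Union>j. convex hull {(real i, real j, 1) | i. (i, j) \<in> G}) \<union>
     (\<Union>(i, j)\<in>G. closed_segment (real i, real j, 0) (real i, real j, 1))"

definition grid_number :: "R4 set \<Rightarrow> enat" where
  "grid_number K = (INF m\<in>{m. \<exists>G. grid_diagram m G \<and>
     ambient_isotopic (stereo ` grid_link G) K}. enat m)"

section \<open>Thompson index\<close>

definition sd_interval :: "real \<Rightarrow> real \<Rightarrow> bool" where
  "sd_interval a b \<longleftrightarrow> (\<exists>k m :: nat. k < 2 ^ m \<and> a = real k / 2 ^ m \<and> b = (real k + 1) / 2 ^ m)"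

text \<open>A partition is the list of its \<open>n + 1\<close> points.\<close>

definition sd_partition :: "nat \<Rightarrow> real list \<Rightarrow> bool" where
  "sd_partition n I \<longleftrightarrow> length I = n + 1 \<and> I ! 0 = 0 \<and> I ! n = 1 \<and> sorted_wrt (<) I \<and>
     (\<forall>i<n. sd_interval (I ! i) (I ! (i + 1)))"

text \<open>Elements of \<open>F\<close> are functions on the reals of which only the restriction to the
  unit interval matters.\<close>

definition thompson_F :: "(real \<Rightarrow> real) set" where
  "thompson_F = {g. (\<exists>g'. homeomorphism {0..1} {0..1} g g') \<and> strict_mono_on {0..1} g \<and>
     (\<exists>xs. xs \<noteq> [] \<and> sorted_wrt (<) xs \<and> hd xs = 0 \<and> last xs = 1 \<and>
        (\<forall>x\<in>set xs. \<exists>(k :: int) (m :: nat). x = of_int k / 2 ^ m) \<and>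
        (\<forall>i. i + 1 < length xs \<longrightarrow> (\<exists>k :: int. \<forall>x\<in>{xs ! i..xs ! (i + 1)}.
           g x = g (xs ! i) + 2 powi k * (x - xs ! i))))}"

definition represents :: "nat \<Rightarrow> real list \<Rightarrow> real list \<Rightarrow> (real \<Rightarrow> real) \<Rightarrow> bool" where
  "represents n I J g \<longleftrightarrow> sd_partition n I \<and> sd_partition n J \<and>
     (\<forall>i<n. \<forall>x\<in>{I ! i..I ! (i + 1)}.
        g x = J ! i + (J ! (i + 1) - J ! i) / (I ! (i + 1) - I ! i) * (x - I ! i))"

definition reduced_pair :: "nat \<Rightarrow> real list \<Rightarrow> real list \<Rightarrow> bool" where
  "reduced_pair n I J \<longleftrightarrow> sd_partition n I \<and> sd_partition n J \<and>
     \<not> (\<exists>i. 1 \<le> i \<and> i \<le> n - 1 \<and>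
          sd_interval (I ! (i - 1)) (I ! (i + 1)) \<and> sd_interval (J ! (i - 1)) (J ! (i + 1)))"

text \<open>The edges of the tree \<open>F\<^sub>I\<close>; the pair \<open>(i, j)\<close> stands for
  the interval from the \<open>i\<close>-th to the \<open>j\<close>-th point of \<open>I\<close>.\<close>

definition tree_edges :: "real list \<Rightarrow> (nat \<times> nat) set" where
  "tree_edges I = {(i, j). i < j \<and> j < length I \<and> sd_interval (I ! i) (I ! j)}"

definition split_index :: "real list \<Rightarrow> nat \<Rightarrow> nat \<Rightarrow> nat" where
  "split_index I i j = (THE k. k < length I \<and> I ! k = (I ! i + I ! j) / 2)"

text \<open>Lower end in the plane of an edge. The \<open>i\<close>-th leaf ends on the bottom line at
  abscissa \<open>2 i + 1\<close>; an edge that is halved at the \<open>k\<close>-th point of \<open>I\<close>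
  ends at abscissa \<open>2 k\<close>, at a height equal to the length of the interval. Thus the
  tree is drawn with straight edges, and neither edges nor the strands descending vertically
  from the trivalent vertices meet except at these vertices.\<close>

definition lower_end :: "real list \<Rightarrow> nat \<Rightarrow> nat \<Rightarrow> real \<times> real" where
  "lower_end I i j = (if j = i + 1 then (2 * real i + 1, 0)
     else (2 * real (split_index I i j), I ! j - I ! i))"

definition at_level :: "real \<Rightarrow> real \<times> real \<Rightarrow> R3" where
  "at_level z = (\<lambda>(x, y). (x, y, z))"

text \<open>At a vertex, the parent edge and the added vertical strand are at level 0,
  and the two child edges start at level 1, passing over.\<close>

definition tree_tangle :: "real list \<Rightarrow> R3 set" where
  "tree_tangle I = (\<Union>(i, j)\<in>{(i, j) \<in> tree_edges I. j \<noteq> i + 1}.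
     let k = split_index I i j; v = lower_end I i j in
       closed_segment (at_level 0 v) (fst v, 0, 0) \<union>
       closed_segment (at_level 1 v) (at_level 0 (lower_end I i k)) \<union>
       closed_segment (at_level 1 v) (at_level 0 (lower_end I k j)))"

text \<open>Adds the root edge (whose top is at height 2), the cap and the strand on the far left.
  The endpoints of the resulting tangle are the points \<open>(0, 0, 0), \<dots>, (2 n - 1, 0, 0)\<close>.\<close>

definition capped_tangle :: "real list \<Rightarrow> R3 set" where
  "capped_tangle I = tree_tangle I \<union>
     (let r = lower_end I 0 (length I - 1) in
       closed_segment (fst r, 2, 0) (at_level 0 r) \<union>
       closed_segment (0, 2, 0) (fst r, 2, 0) \<union>
       closed_segment (0, 0, 0) (0, 2, 0))"

definition thompson_link :: "real list \<Rightarrow> real list \<Rightarrow> R3 set" where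
  "thompson_link I J = capped_tangle I \<union> (\<lambda>(x, y, z). (x, - y, z)) ` capped_tangle J"

text \<open>Every \<open>g\<close> in \<open>F\<close> is represented by exactly one reduced pair; its \<open>n\<close>
  is the leaf number of \<open>g\<close>.\<close>

definition thompson_index :: "R4 set \<Rightarrow> enat" where
  "thompson_index K = (INF n\<in>{n. \<exists>g\<in>thompson_F. \<exists>I J. reduced_pair n I J \<and> represents n I J g \<and>
     ambient_isotopic (stereo ` thompson_link I J) K}. enat n)"

end

theory Submission
  imports Defs
begin

text \<open>Ambient isotopies are obtained from motions of straight-line graphs: if the vertices of a finite
  graph in \<open>R3\<close> move continuously while its edges stay disjoint, then the motion is a chain of
  small ones, each of which extends to a Lipschitz perturbation of the identity of \<open>R3\<close>.

  A closed braid is compressed towards the plane through the axis that contains the half-plane in which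
  the strands are counted. On either side of this plane one coordinate then becomes monotone along the
  braid, so that every strand accounts for one maximum.

  Orient the columns of a grid diagram consistently. If every column that runs downwards is led around an
  axis below the diagram, then the link becomes a closed braid about this axis, with these columns as
  strands. For one of the two directions of the axis, at most half of the columns run downwards.

  In the diagram of a Thompson link, the edges of the two trees are bent so that each child edge
  starts horizontally and then descends vertically. Once the nodes have been moved to different heights, the
  two child edges of a node occupy one row, and so does the cap of each half. Since child
  edges pass over, this is a grid diagram, with one column for each of the \<open>2 n\<close> points on the
  bottom line.\<close>

section \<open>Isotopies of the sphere\<close>

text \<open>No calculus of diagrams enters: a change of a link is a family of vertex positions, and
  what has to be checked is that straight edges stay disjoint at all times. Coordinates are chosen
  so that this follows from linear functionals, evaluated at the ends of edges. The orientation of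
  \<open>K\<close> is arbitrary and consists of loops on the sphere, so motions are followed point
  by point and not just as maps of sets. A component of a grid can be run through in two directions,
  and the order in which two points are passed tells which one is prescribed. After that only the
  direction of the axis is free; reversing it exchanges descending and ascending columns, whence the
  factor 2. For trees the sizes match because a binary tree with \<open>n\<close> leaves has
  \<open>n - 1\<close> inner nodes: its \<open>2 * n - 1\<close> edges and the strand on the far
  left are the columns, while the nodes and the cap are the rows of one half. Each edge except the
  root has one parent, so each half marks each column once. Lengths of intervals are poor row
  numbers, since many coincide; the nodes are therefore ranked by length, with ties broken from left
  to right.\<close>

definition north :: R4 where "north = (0, 0, 0, 1)"

definition ustereo :: "R4 \<Rightarrow> R3" where
  "ustereo = (\<lambda>(x, y, z, w). (x / (1 - w), y / (1 - w), z / (1 - w)))"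

lemma norm_R3: "(norm (x, y, z :: real))\<^sup>2 = x\<^sup>2 + y\<^sup>2 + z\<^sup>2" for x y :: real
  by (simp add: norm_Pair)

lemma norm_R4: "(norm (x, y, z, w :: real))\<^sup>2 = x\<^sup>2 + y\<^sup>2 + z\<^sup>2 + w\<^sup>2" for x y z :: real
  by (simp add: norm_Pair)

lemma sphere_R4: "(x, y, z, w) \<in> sphere (0::R4) 1 \<longleftrightarrow> x\<^sup>2 + y\<^sup>2 + z\<^sup>2 + w\<^sup>2 = 1"
  by (simp add: norm_Pair add.assoc)

lemma stereo_in_sphere: "stereo v \<in> sphere 0 1"
proof -
  obtain x y z where v: "v = (x, y, z)" by (metis prod_cases3)
  define q where "q = x\<^sup>2 + y\<^sup>2 + z\<^sup>2"
  have "q \<ge> 0" by (simp add: q_def)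
  then have "q + 1 \<noteq> 0" by linarith
  have "(2*x)\<^sup>2 + (2*y)\<^sup>2 + (2*z)\<^sup>2 + (q-1)\<^sup>2 = (q+1)\<^sup>2"
    unfolding q_def by (simp add: power2_eq_square algebra_simps)
  then have "(2*x/(q+1))\<^sup>2 + (2*y/(q+1))\<^sup>2 + (2*z/(q+1))\<^sup>2 + ((q-1)/(q+1))\<^sup>2 = 1"
    using \<open>q + 1 \<noteq> 0\<close> by (simp add: power_divide flip: add_divide_distrib)
  then show ?thesis
    unfolding v stereo_def Let_def prod.case sphere_R4 q_def by simp
qed

lemma stereo_ne_north: "stereo v \<noteq> north"
proof -
  obtain x y z where v: "v = (x, y, z)" by (metis prod_cases3)
  have "x\<^sup>2 + y\<^sup>2 + z\<^sup>2 \<ge> 0" by simp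
  then show ?thesis by (auto simp: v stereo_def Let_def north_def divide_eq_1_iff)
qed

lemma ustereo_stereo: "ustereo (stereo v) = v"
proof -
  obtain x y z where v: "v = (x, y, z)" by (metis prod_cases3)
  define q where "q = x\<^sup>2 + y\<^sup>2 + z\<^sup>2"
  have "q \<ge> 0" by (simp add: q_def)
  then have q: "q + 1 \<noteq> 0" by linarith
  then have "1 - (q-1)/(q+1) = 2/(q+1)" by (simp add: field_simps)
  then show ?thesis
    unfolding v stereo_def ustereo_def Let_def prod.case q_def[symmetric] using q by simp
qed

lemma stereo_ustereo:
  assumes "p \<in> sphere 0 1" "p \<noteq> north"
  shows "stereo (ustereo p) = p"
proof -
  obtain x y z w where p: "p = (x, y, z, w)" by (metis prod_cases4)
  have s: "x\<^sup>2 + y\<^sup>2 + z\<^sup>2 = 1 - w\<^sup>2" using assms(1) unfolding p sphere_R4 by linarith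
  have w: "1 - w \<noteq> 0"
  proof
    assume "1 - w = 0"
    then have "w = 1" by simp
    with s have "x\<^sup>2 + y\<^sup>2 + z\<^sup>2 = 0" by simp
    then have "x = 0 \<and> y = 0 \<and> z = 0"
      by (smt (verit, best) zero_le_power2 power2_eq_iff_nonneg zero_eq_power2)
    with \<open>w = 1\<close> assms(2) show False by (simp add: p north_def)
  qed
  have "(x/(1-w))\<^sup>2 + (y/(1-w))\<^sup>2 + (z/(1-w))\<^sup>2 = (1 - w\<^sup>2) / (1-w)\<^sup>2"
    unfolding s[symmetric] by (simp add: power_divide add_divide_distrib)
  also have "\<dots> = (1 + w) / (1 - w)"
  proof -
    have "1 - w\<^sup>2 = (1 + w) * (1 - w)" by (simp add: power2_eq_square algebra_simps)
    then show ?thesis using w by (simp add: power2_eq_square)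
  qed
  finally have q: "(x/(1-w))\<^sup>2 + (y/(1-w))\<^sup>2 + (z/(1-w))\<^sup>2 = (1 + w) / (1 - w)" .
  have q1: "(1 + w) / (1 - w) + 1 = 2 / (1 - w)" "(1 + w) / (1 - w) - 1 = 2 * w / (1 - w)"
    using w by (simp_all add: field_simps)
  show ?thesis
    unfolding p stereo_def ustereo_def Let_def prod.case q q1 using w by simp
qed

lemma inj_stereo: "inj stereo"
  by (metis injI ustereo_stereo)

lemma continuous_on_stereo: "continuous_on S stereo"
proof -
  have "x\<^sup>2 + y\<^sup>2 + z\<^sup>2 + 1 \<noteq> 0" for x y z :: real
    by (smt (verit) zero_le_power2)
  then show ?thesis
    unfolding stereo_def Let_def case_prod_unfold
    by (intro continuous_intros) auto
qed

lemma continuous_on_ustereo: "continuous_on (sphere 0 1 - {north}) ustereo"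
proof -
  have ne: "1 - snd (snd (snd p)) \<noteq> 0" if p: "p \<in> sphere 0 1 - {north}" for p :: R4
  proof
    obtain x y z w where pe: "p = (x, y, z, w)" by (metis prod_cases4)
    note that = p[unfolded pe]
    assume "1 - snd (snd (snd p)) = 0"
    with that have "w = 1" "x\<^sup>2 + y\<^sup>2 + z\<^sup>2 = 0" unfolding Diff_iff sphere_R4 pe by auto
    then have "x = 0 \<and> y = 0 \<and> z = 0"
      by (smt (verit, best) zero_le_power2 power2_eq_iff_nonneg zero_eq_power2)
    with that \<open>w = 1\<close> show False by (simp add: north_def)
  qed
  show ?thesis
    unfolding ustereo_def case_prod_unfold
    by (intro continuous_intros ballI ne)
qed

text \<open>The distance to the pole depends on the norm alone, so neighbourhoods of
  \<open>north\<close> correspond to complements of balls in \<open>R3\<close>. Continuity at the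
  pole thereby becomes a statement about growth.\<close>

lemma dist_stereo_north: "dist (stereo v) north = 2 / sqrt ((norm v)\<^sup>2 + 1)"
proof -
  obtain x y z where v: "v = (x, y, z)" by (metis prod_cases3)
  define q where "q = x\<^sup>2 + y\<^sup>2 + z\<^sup>2"
  have q0: "q \<ge> 0" by (simp add: q_def)
  then have q: "q + 1 \<noteq> 0" by linarith
  have 1: "(q-1)/(q+1) - 1 = -2/(q+1)" using q by (simp add: field_simps)
  have "(dist (stereo v) north)\<^sup>2 = (2*x/(q+1))\<^sup>2 + (2*y/(q+1))\<^sup>2 + (2*z/(q+1))\<^sup>2 + ((q-1)/(q+1) - 1)\<^sup>2"
    unfolding v stereo_def north_def Let_def prod.case q_def[symmetric]
    by (simp add: dist_norm norm_R4)
  also have "\<dots> = (4 * (x\<^sup>2 + y\<^sup>2 + z\<^sup>2) + 4) / (q+1)\<^sup>2"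
    unfolding 1 by (simp add: power_divide power_mult_distrib add_divide_distrib)
  also have "\<dots> = (4 * (q + 1)) / (q+1)\<^sup>2"
    unfolding q_def[symmetric] by simp
  also have "\<dots> = 4 / (q+1)"
    using nonzero_mult_divide_mult_cancel_right[OF q, of 4 "q + 1"] by (simp only: power2_eq_square)
  finally have "dist (stereo v) north = sqrt (4 / (q+1))"
    by (metis real_sqrt_unique zero_le_dist)
  then show ?thesis
    unfolding v norm_R3 q_def[symmetric] by (simp add: real_sqrt_divide)
qed

text \<open>Conjugation with the stereographic projection defines the maps off the pole, which is
  kept fixed. Continuity at the pole is uniform properness, the hypothesis \<open>proper\<close>;
  the inverses are continuous because the sphere is compact and Hausdorff.\<close>

lemma isotopic_to_id_from_R3:
  fixes F :: "real \<Rightarrow> R3 \<Rightarrow> R3"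
  assumes cont: "continuous_on ({0..1} \<times> UNIV) (\<lambda>(t, x). F t x)"
    and bij: "\<And>t. t \<in> {0..1} \<Longrightarrow> bij (F t)"
    and F0: "F 0 = id"
    and proper: "\<And>B. \<exists>R. \<forall>t\<in>{0..1}. \<forall>x. norm x \<ge> R \<longrightarrow> norm (F t x) \<ge> B"
  shows "\<exists>h. isotopic_to_id h \<and> (\<forall>x. h (stereo x) = stereo (F 1 x))"
proof -
  define S where "S = sphere (0::R4) 1"
  define H where "H = (\<lambda>(t, p). if p \<in> S - {north} then stereo (F t (ustereo p)) else p)"
  have north: "north \<in> S" by (simp add: S_def north_def norm_Pair)
  have HS: "H (t, p) \<in> S" if "p \<in> S" for t p
    using that stereo_in_sphere by (auto simp: H_def S_def)
  have Hst: "H (t, stereo x) = stereo (F t x)" for t x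
    using stereo_in_sphere stereo_ne_north by (auto simp: H_def S_def ustereo_stereo)
  have cover: "p = north \<or> (\<exists>x. p = stereo x)" if "p \<in> S" for p
    using that stereo_ustereo unfolding S_def by metis
  have Hn: "H (t, north) = north" for t by (simp add: H_def)
  have contH: "continuous_on ({0..1} \<times> S) H"
  proof -
    have 1: "continuous_on ({0..1} \<times> (S - {north})) (\<lambda>z. stereo ((\<lambda>(t, x). F t x) (fst z, ustereo (snd z))))"
      by (rule continuous_on_compose2[OF continuous_on_stereo[of UNIV]],
          rule continuous_on_compose2[OF cont])
        (auto intro!: continuous_intros continuous_on_compose2[OF continuous_on_ustereo] simp: S_def)
    then have 1: "continuous_on ({0..1} \<times> (S - {north})) H"
      by (rule continuous_on_eq) (auto simp: H_def split: prod.split)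
    have "continuous (at z within {0..1} \<times> S) H" if z: "z \<in> {0..1} \<times> S" for z
    proof (cases "snd z = north")
      case False
      \<comment> \<open>Continuity is known on the punctured sphere so far; as that is relatively
        open, the filter at a point off the pole is the same for both sets.\<close>
      have "at z within {0..1} \<times> S = at z within {0..1} \<times> (S - {north})"
      proof (rule at_within_nhd)
        show "z \<in> UNIV \<times> (- {north})" using False by (cases z) auto
        show "open (UNIV \<times> (- {north}) :: (real \<times> R4) set)" by (intro open_Times) auto
      qed auto
      moreover have "z \<in> {0..1} \<times> (S - {north})" using z False by (cases z) auto
      ultimately show ?thesis using 1 by (metis continuous_on_eq_continuous_within)
    next
      case True
      then obtain t where zt: "z = (t, north)" "t \<in> {0..1}" using z by (cases z) auto
      show ?thesis
        unfolding continuous_within_eps_delta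
      proof (intro allI impI)
        fix e :: real assume e: "e > 0"
        obtain R where R: "\<And>t x. t \<in> {0..1} \<Longrightarrow> norm x \<ge> R \<Longrightarrow> norm (F t x) \<ge> 2 / e"
          using proper[of "2/e"] by blast
        \<comment> \<open>The distance from the pole of the points of norm \<bar>R\<bar>: whatever
          is closer to the pole comes from outside that ball.\<close>
        define d where "d = 2 / sqrt (R\<^sup>2 + 1)"
        have pos: "R\<^sup>2 + 1 > 0" by (simp add: add_nonneg_pos)
        have "d > 0" unfolding d_def using pos by simp
        moreover have "dist (H z') (H z) < e" if z': "z' \<in> {0..1} \<times> S" and dz: "dist z' z < d" for z'
        proof -
          obtain t' p where zp: "z' = (t', p)" "t' \<in> {0..1}" "p \<in> S" using z' by (cases z') auto
          have dp: "dist p north < d"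
            using dz unfolding zp zt dist_Pair_Pair
            by (smt (verit) real_sqrt_le_mono real_sqrt_abs zero_le_power2 abs_of_nonneg zero_le_dist)
          show ?thesis
          proof (cases "p = north")
            case True then show ?thesis using e by (simp add: zp zt Hn)
          next
            case False
            then obtain x where x: "p = stereo x" using cover zp by blast
            have "2 / sqrt ((norm x)\<^sup>2 + 1) < 2 / sqrt (R\<^sup>2 + 1)"
              using dp unfolding x dist_stereo_north d_def .
            moreover have pos': "(norm x)\<^sup>2 + 1 > 0" by (simp add: add_nonneg_pos)
            ultimately have "sqrt (R\<^sup>2 + 1) < sqrt ((norm x)\<^sup>2 + 1)"
              using pos by (simp add: field_simps)
            then have "R\<^sup>2 < (norm x)\<^sup>2" by simp
            then have "R \<le> norm x" by (smt (verit) norm_ge_zero power2_le_imp_le)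
            then have n: "2 / e \<le> norm (F t' x)" using R zp by blast
            have "0 \<le> 2 / e" using e by simp
            from power_mono[OF n this, of 2] have "(2/e)\<^sup>2 < (norm (F t' x))\<^sup>2 + 1"
              by linarith
            then have "2/e < sqrt ((norm (F t' x))\<^sup>2 + 1)" by (rule real_less_rsqrt)
            then have "2 / sqrt ((norm (F t' x))\<^sup>2 + 1) < e"
              using e by (smt (verit) divide_less_eq mult.commute zero_less_divide_iff)
            then show ?thesis unfolding zp zt Hn x Hst dist_stereo_north .
          qed
        qed
        ultimately show "\<exists>d>0. \<forall>x'\<in>{0..1} \<times> S. dist x' z < d \<longrightarrow> dist (H x') (H z) < e" by blast
      qed
    qed
    then show ?thesis by (simp add: continuous_on_eq_continuous_within)
  qed
  have homeo: "homeomorphic_map S3 S3 (\<lambda>p. H (t, p))" if t: "t \<in> {0..1}" for t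
  proof (rule continuous_imp_homeomorphic_map)
    have "continuous_on S (\<lambda>p. H (t, p))"
      by (rule continuous_on_compose2[OF contH]) (use t in \<open>auto intro!: continuous_intros\<close>)
    then show "continuous_map S3 S3 (\<lambda>p. H (t, p))"
      using HS by (simp add: S_def image_subset_iff Pi_iff)
    show "compact_space S3" by (simp add: compact_space_subtopology)
    show "Hausdorff_space S3" by (simp add: Hausdorff_space_subtopology)
    have "\<exists>p\<in>S. H (t, p) = p'" if p': "p' \<in> S" for p'
    proof (cases "p' = north")
      case True then show ?thesis using north Hn by auto
    next
      case False
      then obtain x where x: "p' = stereo x" using cover p' by blast
      obtain y where "F t y = x" using bij[OF t] by (metis bij_pointE)
      then show ?thesis using Hst stereo_in_sphere x unfolding S_def by metis
    qed
    then have "(\<lambda>p. H (t, p)) ` S = S" using HS by (auto intro!: equalityI simp: image_iff) metis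
    then show "(\<lambda>p. H (t, p)) ` topspace S3 = topspace S3" by (simp add: S_def)
    have "inj_on (\<lambda>p. H (t, p)) S"
    proof (rule inj_onI)
      fix p p' assume pp: "p \<in> S" "p' \<in> S" "H (t, p) = H (t, p')"
      have "p = p'" if "p = stereo x" "p' = stereo x'" for x x'
        using pp(3) that injD[OF inj_stereo] bij[OF t] unfolding that Hst
        by (metis bij_is_inj injD)
      then show "p = p'" using cover[OF pp(1)] cover[OF pp(2)] pp(3) Hn Hst stereo_ne_north by metis
    qed
    then show "inj_on (\<lambda>p. H (t, p)) (topspace S3)" by (simp add: S_def)
  qed
  have "isotopic_to_id (\<lambda>p. H (1, p))"
    unfolding isotopic_to_id_def homotopic_with_def
  proof (intro exI[of _ H] conjI ballI allI)
    show "continuous_map (prod_topology (top_of_set {0..1}) S3) S3 H"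
      using contH HS by (auto simp: S_def image_subset_iff Pi_iff)
    show "H (0, x) = id x" for x
      using stereo_ustereo by (auto simp: H_def F0 S_def)
  qed (use homeo in auto)
  then show ?thesis using Hst by blast
qed

section \<open>Composition of isotopies, and isotopies of \<open>R3\<close> that extend to the
  sphere\<close>

lemma isotopic_to_id_homeomorphic_map:
  assumes "isotopic_to_id h" shows "homeomorphic_map S3 S3 h"
  using homotopic_with_imp_property[OF assms[unfolded isotopic_to_id_def]] by blast

text \<open>Composing the homotopy from \<open>id\<close> to \<open>k\<close> with the homeomorphism
  \<open>h\<close> gives one from \<open>h\<close> to \<open>h \<circ> k\<close>, which is appended
  to the homotopy from \<open>id\<close> to \<open>h\<close>.\<close>

lemma isotopic_to_id_compose:
  assumes "isotopic_to_id h" "isotopic_to_id k"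
  shows "isotopic_to_id (h \<circ> k)"
proof -
  have hh: "homeomorphic_map S3 S3 h" using assms(1) by (rule isotopic_to_id_homeomorphic_map)
  have "homotopic_with (homeomorphic_map S3 S3) S3 S3 (h \<circ> id) (h \<circ> k)"
  proof (rule homotopic_with_compose_continuous_map_left)
    show "homotopic_with (homeomorphic_map S3 S3) S3 S3 id k"
      using assms(2) by (simp add: isotopic_to_id_def)
    show "continuous_map S3 S3 h" using hh by (rule homeomorphic_imp_continuous_map)
    show "homeomorphic_map S3 S3 (h \<circ> j)" if "homeomorphic_map S3 S3 j" for j
      using that hh by (rule homeomorphic_map_compose)
  qed
  then show ?thesis
    using homotopic_with_trans[OF assms(1)[unfolded isotopic_to_id_def]]
    unfolding isotopic_to_id_def by simp
qed

text \<open>Requiring the inverse to extend to an isotopy as well spares a proof that the inverse of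
  an arbitrary isotopy of the sphere is an isotopy.\<close>

definition R3_isotopy :: "(R3 \<Rightarrow> R3) \<Rightarrow> (R3 \<Rightarrow> R3) \<Rightarrow> bool" where
  "R3_isotopy f g \<longleftrightarrow> (\<forall>x. g (f x) = x) \<and> (\<forall>x. f (g x) = x) \<and> continuous_on UNIV f \<and>
     (\<exists>h. isotopic_to_id h \<and> (\<forall>x. h (stereo x) = stereo (f x))) \<and>
     (\<exists>h. isotopic_to_id h \<and> (\<forall>x. h (stereo x) = stereo (g x))) \<and> continuous_on UNIV g"

lemma R3_isotopy_sym: "R3_isotopy f g \<Longrightarrow> R3_isotopy g f"
  by (auto simp: R3_isotopy_def)

lemma R3_isotopy_trans:
  assumes "R3_isotopy f g" "R3_isotopy f' g'"
  shows "R3_isotopy (f' \<circ> f) (g \<circ> g')"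
proof -
  have "\<exists>h. isotopic_to_id h \<and> (\<forall>x. h (stereo x) = stereo ((f' \<circ> f) x))"
    using assms isotopic_to_id_compose unfolding R3_isotopy_def by (metis comp_apply)
  moreover have "\<exists>h. isotopic_to_id h \<and> (\<forall>x. h (stereo x) = stereo ((g \<circ> g') x))"
    using assms isotopic_to_id_compose unfolding R3_isotopy_def by (metis comp_apply)
  moreover have "continuous_on UNIV (f' \<circ> f)" "continuous_on UNIV (g \<circ> g')"
    using assms unfolding R3_isotopy_def by (metis continuous_on_compose continuous_on_subset subset_UNIV)+
  moreover have "(g \<circ> g') ((f' \<circ> f) x) = x" "(f' \<circ> f) ((g \<circ> g') x) = x" for x
    using assms unfolding R3_isotopy_def comp_apply by metis+
  ultimately show ?thesis unfolding R3_isotopy_def by blast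
qed

text \<open>The motion has to be undone before the given isotopy is applied; this is where the
  isotopy that extends the inverse \<open>g\<close> is used.\<close>

lemma R3_isotopy_ambient:
  assumes "R3_isotopy f g" "ambient_isotopic (stereo ` A) K" "f ` A = B"
  shows "ambient_isotopic (stereo ` B) K"
proof -
  obtain h where h: "isotopic_to_id h" "h ` stereo ` A = K"
    using assms(2) by (auto simp: ambient_isotopic_def)
  obtain k where k: "isotopic_to_id k" "\<And>x. k (stereo x) = stereo (g x)"
    using assms(1) by (auto simp: R3_isotopy_def)
  have gf: "g (f x) = x" for x using assms(1) unfolding R3_isotopy_def by metis
  have "k ` stereo ` B = stereo ` A" unfolding assms(3)[symmetric] image_image k(2) gf ..
  then have "(h \<circ> k) ` stereo ` B = K" using h(2) unfolding image_comp[symmetric] by simp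
  then show ?thesis using isotopic_to_id_compose[OF h(1) k(1)] by (auto simp: ambient_isotopic_def)
qed

section \<open>Lipschitz perturbations of the identity\<close>

text \<open>Both properties come from contraction: a solution of \<open>x + G x = y\<close> is a
  fixed point of \<open>\<lambda>x. y - G x\<close>, to which Banach's theorem applies.\<close>

lemma lipschitz_perturbation_bij:
  fixes G :: "R3 \<Rightarrow> R3"
  assumes L: "0 \<le> L" "L < 1" and G: "\<And>x y. norm (G x - G y) \<le> L * norm (x - y)"
  shows "bij (\<lambda>x. x + G x)"
proof (rule bijI)
  show "inj (\<lambda>x. x + G x)"
  proof (rule injI)
    fix x y assume "x + G x = y + G y"
    then have "x - y = G y - G x" by (simp add: algebra_simps)
    then have "norm (x - y) \<le> L * norm (x - y)" using G[of y x] by (simp add: norm_minus_commute)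
    then have "norm (x - y) * (1 - L) \<le> 0" by (simp add: algebra_simps)
    then show "x = y" using L by (simp add: mult_le_0_iff)
  qed
  show "surj (\<lambda>x. x + G x)"
  proof (rule surjI)
    fix y
    have "\<exists>!x. y - G x = x"
      by (rule banach_fix_type[of L])
        (use L G in \<open>auto simp: dist_norm norm_minus_commute\<close>)
    then obtain x where x: "y - G x = x" by blast
    have "(THE x. y - G x = x) = x" using \<open>\<exists>!x. y - G x = x\<close> x by (rule the1_equality)
    then show "(THE x. y - G x = x) + G (THE x. y - G x = x) = y" using x by (simp add: algebra_simps)
  qed
qed

text \<open>The maps \<open>\<lambda>x. x + t *\<^sub>R G x\<close> for \<open>t\<close> in the unit
  interval obey the same Lipschitz bound, so all of them are bijections. Their norms are at least
  \<open>(1 - L) * norm x - norm (G 0)\<close>, which gives uniform properness.\<close>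

lemma lipschitz_perturbation_isotopic:
  fixes G :: "R3 \<Rightarrow> R3"
  assumes L: "0 \<le> L" "L < 1" and G: "\<And>x y. norm (G x - G y) \<le> L * norm (x - y)"
  shows "\<exists>h. isotopic_to_id h \<and> (\<forall>x. h (stereo x) = stereo (x + G x))"
proof -
  have contG: "continuous_on UNIV G"
    by (rule lipschitz_on_continuous_on[of L], rule lipschitz_onI)
      (use G L in \<open>auto simp: dist_norm\<close>)
  have tG: "norm (t *\<^sub>R G x - t *\<^sub>R G y) \<le> L * norm (x - y)" if "t \<in> {0..1}" for t x y
  proof -
    have "norm (t *\<^sub>R G x - t *\<^sub>R G y) = t * norm (G x - G y)"
      using that by (simp flip: scaleR_diff_right)
    also have "\<dots> \<le> 1 * norm (G x - G y)" using that by (intro mult_right_mono) auto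
    finally show ?thesis using G[of x y] by simp
  qed
  have "\<exists>h. isotopic_to_id h \<and> (\<forall>x. h (stereo x) = stereo ((\<lambda>t x. x + t *\<^sub>R G x) 1 x))"
  proof (rule isotopic_to_id_from_R3)
    show "continuous_on ({0..1} \<times> UNIV) (\<lambda>(t, x). x + t *\<^sub>R G x)"
      unfolding case_prod_unfold
      by (intro continuous_intros continuous_on_compose2[OF contG]) auto
    show "bij (\<lambda>x. x + t *\<^sub>R G x)" if "t \<in> {0..1}" for t
      using L tG[OF that] by (rule lipschitz_perturbation_bij)
    show "(\<lambda>x. x + 0 *\<^sub>R G x) = id" by auto
    fix B
    have "norm (x + t *\<^sub>R G x) \<ge> B" if t: "t \<in> {0..1}" and x: "norm x \<ge> (\<bar>B\<bar> + norm (G 0)) / (1 - L)" for t x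
    proof -
      have "norm (t *\<^sub>R G x) \<le> norm (t *\<^sub>R G x - t *\<^sub>R G 0) + norm (t *\<^sub>R G 0)"
        by (metis add.commute norm_triangle_sub)
      also have "\<dots> \<le> L * norm x + norm (G 0)"
        using tG[OF t, of x 0] t mult_right_mono[of t 1 "norm (G 0)"] by simp
      finally have "norm (x + t *\<^sub>R G x) \<ge> norm x - (L * norm x + norm (G 0))"
        using norm_diff_ineq[of x "t *\<^sub>R G x"] by linarith
      moreover have "\<bar>B\<bar> + norm (G 0) \<le> norm x * (1 - L)" using x L by (simp add: field_simps)
      ultimately show ?thesis by (simp add: algebra_simps)
    qed
    then show "\<exists>R. \<forall>t\<in>{0..1}. \<forall>x. norm x \<ge> R \<longrightarrow> norm (x + t *\<^sub>R G x) \<ge> B" by blast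
  qed
  then show ?thesis by simp
qed

text \<open>The bound 1/2 in place of 1 is due to the inverse, which is again a perturbation of the
  identity but with the constant \<open>L / (1 - L)\<close>; this has to be less than 1 as
  well.\<close>

lemma lipschitz_perturbation_R3_isotopy:
  fixes G :: "R3 \<Rightarrow> R3"
  assumes L: "0 \<le> L" "L < 1/2" and G: "\<And>x y. norm (G x - G y) \<le> L * norm (x - y)"
  shows "\<exists>g. R3_isotopy (\<lambda>x. x + G x) g"
proof -
  have L1: "L < 1" using L by simp
  define f where "f = (\<lambda>x. x + G x)"
  have bij: "bij f" unfolding f_def using L(1) L1 G by (rule lipschitz_perturbation_bij)
  define g where "g = inv f"
  have gf: "g (f x) = x" "f (g x) = x" for x
    using bij by (simp_all add: g_def bij_is_inj bij_is_surj surj_f_inv_f)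
  define G' where "G' = (\<lambda>y. - G (g y))"
  have g: "g y = y + G' y" for y using gf(2)[of y] unfolding f_def G'_def by (simp add: algebra_simps)
  define L' where "L' = L / (1 - L)"
  have L': "0 \<le> L'" "L' < 1" using L by (auto simp: L'_def field_simps)
  have G': "norm (G' x - G' y) \<le> L' * norm (x - y)" for x y
  proof -
    define a b where "a = g x" and "b = g y"
    have xy: "x = a + G a" "y = b + G b" using gf(2)[of x] gf(2)[of y] by (auto simp: a_def b_def f_def)
    have e: "x - y = (a - b) + (G a - G b)" unfolding xy by (simp add: algebra_simps)
    have "norm (a - b) - norm (G a - G b) \<le> norm (x - y)"
      unfolding e by (rule norm_diff_ineq)
    then have 1: "norm (a - b) * (1 - L) \<le> norm (x - y)" using G[of a b] by (simp add: algebra_simps)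
    have "norm (G' x - G' y) = norm (G b - G a)" by (simp add: G'_def a_def b_def algebra_simps)
    also have "\<dots> \<le> L * norm (a - b)" using G[of b a] by (simp add: norm_minus_commute)
    also have "\<dots> \<le> L * (norm (x - y) / (1 - L))"
      using 1 L L1 by (intro mult_left_mono) (auto simp: field_simps)
    finally show ?thesis by (simp add: L'_def)
  qed
  have cont: "continuous_on UNIV (\<lambda>x. x + K x)" if "0 \<le> M" "\<And>x y. norm (K x - K y) \<le> M * norm (x - y)"
    for K :: "R3 \<Rightarrow> R3" and M
    by (intro continuous_intros, rule lipschitz_on_continuous_on[of M], rule lipschitz_onI)
      (use that in \<open>auto simp: dist_norm\<close>)
  have "R3_isotopy f g"
    unfolding R3_isotopy_def
  proof (intro conjI)
    show "\<exists>h. isotopic_to_id h \<and> (\<forall>x. h (stereo x) = stereo (f x))"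
      unfolding f_def using L(1) L1 G by (rule lipschitz_perturbation_isotopic)
    show "\<exists>h. isotopic_to_id h \<and> (\<forall>x. h (stereo x) = stereo (g x))"
      unfolding g using L' G' by (rule lipschitz_perturbation_isotopic)
    show "continuous_on UNIV f" unfolding f_def using L(1) G by (rule cont)
    show "continuous_on UNIV g" unfolding g using L'(1) G' by (rule cont)
  qed (use gf in auto)
  then show ?thesis unfolding f_def by blast
qed

text \<open>McShane's extension; indexing by \<open>S\<close> allows for points that are parametrized several times.\<close>

lemma lipschitz_extension:
  fixes P :: "'i \<Rightarrow> 'a::metric_space" and g :: "'i \<Rightarrow> real"
  assumes L: "0 \<le> L" and g: "\<And>s s'. s \<in> S \<Longrightarrow> s' \<in> S \<Longrightarrow> \<bar>g s - g s'\<bar> \<le> L * dist (P s) (P s')"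
  shows "\<exists>\<phi>. (\<forall>x y. \<bar>\<phi> x - \<phi> y\<bar> \<le> L * dist x y) \<and> (\<forall>s\<in>S. \<phi> (P s) = g s)"
proof (cases "S = {}")
  case True
  then show ?thesis using L by (intro exI[of _ "\<lambda>_. 0"]) auto
next
  case False
  then obtain s0 where s0: "s0 \<in> S" by blast
  define \<phi> where "\<phi> x = (INF s\<in>S. g s + L * dist x (P s))" for x
  have lower: "g s + L * dist x (P s) \<ge> g s0 - L * dist x (P s0)" if "s \<in> S" for s x
  proof -
    have "L * dist (P s) (P s0) \<le> L * (dist x (P s) + dist x (P s0))"
      using L dist_triangle3[of "P s" "P s0" x] by (intro mult_left_mono)
    then show ?thesis using g[OF that s0] by (simp add: algebra_simps)
  qed
  have bdd: "bdd_below ((\<lambda>s. g s + L * dist x (P s)) ` S)" for x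
    using lower by (auto intro!: bdd_belowI2)
  have le: "\<phi> x \<le> \<phi> y + L * dist x y" for x y
  proof -
    have "\<phi> x - L * dist x y \<le> \<phi> y"
      unfolding \<phi>_def[of y]
    proof (rule cINF_greatest[OF False])
      fix s assume s: "s \<in> S"
      have "\<phi> x \<le> g s + L * dist x (P s)" unfolding \<phi>_def by (rule cINF_lower[OF bdd s])
      moreover have "L * dist x (P s) \<le> L * (dist x y + dist y (P s))"
        using L by (intro mult_left_mono) (auto simp: dist_triangle)
      ultimately show "\<phi> x - L * dist x y \<le> g s + L * dist y (P s)" by (simp add: algebra_simps)
    qed
    then show ?thesis by simp
  qed
  have "\<bar>\<phi> x - \<phi> y\<bar> \<le> L * dist x y" for x y
    using le[of x y] le[of y x] by (simp add: dist_commute abs_le_iff)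
  moreover have "\<phi> (P s) = g s" if s: "s \<in> S" for s
  proof (rule antisym)
    show "\<phi> (P s) \<le> g s" unfolding \<phi>_def using cINF_lower[OF bdd s, of "P s"] by simp
    show "g s \<le> \<phi> (P s)" unfolding \<phi>_def
    proof (rule cINF_greatest[OF False])
      fix s' assume "s' \<in> S"
      then show "g s \<le> g s' + L * dist (P s) (P s')" using g[OF s, of s'] by simp
    qed
  qed
  ultimately show ?thesis by blast
qed

section \<open>Motions of embedded graphs\<close>

text \<open>Common points must come from common labels. Hence \<open>p\<close> is injective on the
  ends of edges, and an edge cannot occur together with its reverse, since the two would share
  infinitely many points.\<close>

definition embedded :: "('v \<times> 'v) set \<Rightarrow> ('v \<Rightarrow> R3) \<Rightarrow> bool" where
  "embedded E p \<longleftrightarrow> (\<forall>(a, b)\<in>E. p a \<noteq> p b) \<and>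
     (\<forall>(a, b)\<in>E. \<forall>(c, d)\<in>E. (a, b) \<noteq> (c, d) \<longrightarrow>
        closed_segment (p a) (p b) \<inter> closed_segment (p c) (p d) \<subseteq> p ` ({a, b} \<inter> {c, d}))"

lemma embeddedI:
  assumes "\<And>a b. (a, b) \<in> E \<Longrightarrow> p a \<noteq> p b"
    and "\<And>a b c d x. (a, b) \<in> E \<Longrightarrow> (c, d) \<in> E \<Longrightarrow> (a, b) \<noteq> (c, d) \<Longrightarrow>
      x \<in> closed_segment (p a) (p b) \<Longrightarrow> x \<in> closed_segment (p c) (p d) \<Longrightarrow> x \<in> p ` ({a, b} \<inter> {c, d})"
  shows "embedded E p"
  unfolding embedded_def using assms by blast

lemma embedded_ne: "embedded E p \<Longrightarrow> (a, b) \<in> E \<Longrightarrow> p a \<noteq> p b"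
  unfolding embedded_def by blast

lemma embedded_meet:
  assumes "embedded E p" "(a, b) \<in> E" "(c, d) \<in> E" "(a, b) \<noteq> (c, d)"
  shows "closed_segment (p a) (p b) \<inter> closed_segment (p c) (p d) \<subseteq> p ` ({a, b} \<inter> {c, d})"
  using assms unfolding embedded_def by blast

definition realize :: "('v \<times> 'v) set \<Rightarrow> ('v \<Rightarrow> 'a::real_normed_vector) \<Rightarrow> 'a set" where
  "realize E p = (\<Union>(a, b)\<in>E. closed_segment (p a) (p b))"

lemma linepath_reverse: "linepath b a u = linepath a b (1 - u)"
  by (simp add: linepath_def)

lemma linepath_mem: "u \<in> {0..1} \<Longrightarrow> linepath a b u \<in> closed_segment a b"
  by (auto simp: linepath_in_path)

text \<open>\<open>edge_control p a b c d C\<close>: displacing the four end points by at most \<open>\<delta>\<close>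
  displaces the points of the two segments by a \<open>C \<delta>\<close>-Lipschitz function.\<close>

definition edge_control :: "('v \<Rightarrow> R3) \<Rightarrow> 'v \<Rightarrow> 'v \<Rightarrow> 'v \<Rightarrow> 'v \<Rightarrow> real \<Rightarrow> bool" where
  "edge_control p a b c d C \<longleftrightarrow> C \<ge> 0 \<and> (\<forall>g :: 'v \<Rightarrow> R3. \<forall>\<delta>. (\<forall>v\<in>{a, b, c, d}. norm (g v) \<le> \<delta>) \<longrightarrow>
     (\<forall>u\<in>{0..1}. \<forall>w\<in>{0..1}. norm (linepath (g a) (g b) u - linepath (g c) (g d) w)
        \<le> C * \<delta> * dist (linepath (p a) (p b) u) (linepath (p c) (p d) w)))"

lemma edge_control_flip1: "edge_control p b a c d C \<Longrightarrow> edge_control p a b c d C"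
proof -
  assume h: "edge_control p b a c d C"
  show ?thesis
    unfolding edge_control_def
  proof (intro conjI allI impI ballI)
    show "0 \<le> C" using h by (simp add: edge_control_def)
    fix g :: "'a \<Rightarrow> R3" and \<delta> u w assume g: "\<forall>v\<in>{a, b, c, d}. norm (g v) \<le> \<delta>"
      and u: "u \<in> {0..1::real}" "w \<in> {0..1::real}"
    have "\<forall>v\<in>{b, a, c, d}. norm (g v) \<le> \<delta>" "1 - u \<in> {0..1}" using g u by auto
    then have "norm (linepath (g b) (g a) (1 - u) - linepath (g c) (g d) w)
        \<le> C * \<delta> * dist (linepath (p b) (p a) (1 - u)) (linepath (p c) (p d) w)"
      using h u(2) unfolding edge_control_def by blast
    then show "norm (linepath (g a) (g b) u - linepath (g c) (g d) w)
        \<le> C * \<delta> * dist (linepath (p a) (p b) u) (linepath (p c) (p d) w)"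
      by (simp add: linepath_reverse[of "g b" "g a" "1 - u"] linepath_reverse[of "p b" "p a" "1 - u"])
  qed
qed

lemma edge_control_swap: "edge_control p c d a b C \<Longrightarrow> edge_control p a b c d C"
  unfolding edge_control_def by (simp add: norm_minus_commute dist_commute insert_commute)

lemma edge_control_flip2: "edge_control p a b d c C \<Longrightarrow> edge_control p a b c d C"
  by (meson edge_control_flip1 edge_control_swap)

lemma norm_linepath_le:
  assumes "norm a \<le> \<delta>" "norm b \<le> \<delta>" "u \<in> {0..1}"
  shows "norm (linepath a b u) \<le> (\<delta>::real)"
proof -
  have "linepath a b u \<in> closed_segment a b" using assms(3) by (rule linepath_mem)
  also have "closed_segment a b \<subseteq> cball 0 \<delta>"
    using assms by (intro closed_segment_subset) auto
  finally show ?thesis by simp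
qed

text \<open>Both maps are affine in the parameter, with slopes \<open>g b - g a\<close> and
  \<open>p b - p a\<close>; the first is bounded by \<open>2 * \<delta>\<close>, the second is a
  fixed nonzero vector.\<close>

lemma edge_control_same:
  assumes "p a \<noteq> p b" shows "\<exists>C. edge_control p a b a b C"
proof -
  have pos: "norm (p b - p a) > 0" using assms by simp
  have lin: "linepath x y u - linepath x y w = (u - w) *\<^sub>R (y - x)" for x y :: R3 and u w
    by (simp add: linepath_def algebra_simps)
  have "edge_control p a b a b (2 / norm (p b - p a))"
    unfolding edge_control_def dist_norm lin norm_scaleR
  proof (intro conjI allI impI ballI)
    fix g :: "'a \<Rightarrow> R3" and \<delta> u w assume g: "\<forall>v\<in>{a, b, a, b}. norm (g v) \<le> \<delta>"
    have "norm (g b - g a) \<le> 2 * \<delta>" using g norm_triangle_ineq4[of "g b" "g a"] by auto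
    then have "\<bar>u - w\<bar> * norm (g b - g a) \<le> \<bar>u - w\<bar> * (2 * \<delta>)" by (intro mult_left_mono) auto
    also have "\<dots> = 2 / norm (p b - p a) * \<delta> * (\<bar>u - w\<bar> * norm (p b - p a))"
      using pos by simp
    finally show "\<bar>u - w\<bar> * norm (g b - g a) \<le> 2 / norm (p b - p a) * \<delta> * (\<bar>u - w\<bar> * norm (p b - p a))" .
  qed simp
  then show ?thesis by blast
qed

text \<open>Compactness gives a positive distance \<open>k\<close> between the segments, and two
  displacements differ by at most \<open>2 * \<delta>\<close>.\<close>

lemma edge_control_disjoint:
  assumes "closed_segment (p a) (p b) \<inter> closed_segment (p c) (p d) = {}"
  shows "\<exists>C. edge_control p a b c d C"
proof -
  obtain k where k: "k > 0"
    "\<And>x y. x \<in> closed_segment (p a) (p b) \<Longrightarrow> y \<in> closed_segment (p c) (p d) \<Longrightarrow> k \<le> dist x y"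
    using separate_compact_closed[OF compact_segment closed_segment assms] by blast
  have "edge_control p a b c d (2 / k)"
    unfolding edge_control_def
  proof (intro conjI allI impI ballI)
    fix g :: "'a \<Rightarrow> R3" and \<delta> u w assume g: "\<forall>v\<in>{a, b, c, d}. norm (g v) \<le> \<delta>"
      and u: "u \<in> {0..1::real}" "w \<in> {0..1::real}"
    have \<delta>: "0 \<le> \<delta>" using g by (meson insertI1 norm_ge_zero order_trans)
    have "norm (linepath (g a) (g b) u - linepath (g c) (g d) w) \<le> \<delta> + \<delta>"
      by (intro order_trans[OF norm_triangle_ineq4] add_mono norm_linepath_le) (use g u in auto)
    also have "\<dots> = 2 / k * \<delta> * k" using k by simp
    also have "\<dots> \<le> 2 / k * \<delta> * dist (linepath (p a) (p b) u) (linepath (p c) (p d) w)"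
      by (intro mult_left_mono k linepath_mem u) (use k(1) \<delta> in auto)
    finally show "norm (linepath (g a) (g b) u - linepath (g c) (g d) w) \<le> \<dots>" .
  qed (use k in auto)
  then show ?thesis by blast
qed

text \<open>Near the common vertex both sides tend to 0, so compactness is applied to directions.
  With the vertex subtracted, both sides are homogeneous in the pair of parameters
  \<open>(u, w)\<close>, and it suffices to bound \<open>u *\<^sub>R x - w *\<^sub>R y\<close> from
  below where \<open>u + w = 1\<close>.\<close>

lemma edge_control_adjacent:
  assumes ne: "p v \<noteq> p a" "p v \<noteq> p c"
    and meet: "closed_segment (p v) (p a) \<inter> closed_segment (p v) (p c) \<subseteq> {p v}"
  shows "\<exists>C. edge_control p v a v c C"
proof -
  define x y where "x = p a - p v" and "y = p c - p v"
  define m where "m s = norm ((1 - s) *\<^sub>R x - s *\<^sub>R y)" for s :: real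
  have "continuous_on {0..1} m" unfolding m_def by (intro continuous_intros)
  then obtain s0 where s0: "s0 \<in> {0..1}" "\<And>s. s \<in> {0..1} \<Longrightarrow> m s0 \<le> m s"
    using continuous_attains_inf[of "{0..1::real}" m] by auto
  have k: "m s0 > 0"
  proof (rule ccontr)
    assume "\<not> m s0 > 0"
    then have e: "(1 - s0) *\<^sub>R x = s0 *\<^sub>R y" by (simp add: m_def)
    have xy: "x \<noteq> 0" "y \<noteq> 0" using ne by (auto simp: x_def y_def)
    have "p v + (1 - s0) *\<^sub>R x = linepath (p v) (p a) (1 - s0)"
      by (simp add: linepath_def x_def algebra_simps)
    moreover have "p v + s0 *\<^sub>R y = linepath (p v) (p c) s0"
      by (simp add: linepath_def y_def algebra_simps)
    \<comment> \<open>If the minimum vanished, this point would lie on both segments, hence be the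
      vertex, which is impossible as neither edge is degenerate.\<close>
    ultimately have "p v + s0 *\<^sub>R y \<in> closed_segment (p v) (p a) \<inter> closed_segment (p v) (p c)"
      using linepath_mem[of "1 - s0" "p v" "p a"] linepath_mem[of s0 "p v" "p c"] s0(1) e by auto
    then have "s0 *\<^sub>R y = 0" using meet by auto
    then show False using xy e by auto
  qed
  define k where "k = m s0"
  have bound: "k * (u + w) \<le> norm (u *\<^sub>R x - w *\<^sub>R y)" if "u \<in> {0..1}" "w \<in> {0..1}" for u w
  proof (cases "u + w = 0")
    case False
    then have uw: "u + w > 0" using that by auto
    define s where "s = w / (u + w)"
    have s: "s \<in> {0..1}" "w = (u + w) * s" "u = (u + w) * (1 - s)"
      using uw that by (auto simp: s_def field_simps)
    have "norm (u *\<^sub>R x - w *\<^sub>R y) = norm ((u + w) *\<^sub>R ((1 - s) *\<^sub>R x - s *\<^sub>R y))"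
      unfolding scaleR_diff_right scaleR_scaleR s(2,3)[symmetric] ..
    also have "\<dots> = (u + w) * m s" using uw by (simp add: m_def)
    finally show ?thesis using s0(2)[OF s(1)] uw by (simp add: k_def mult.commute)
  qed simp
  have lin: "linepath z z1 u - linepath z z2 w = u *\<^sub>R (z1 - z) - w *\<^sub>R (z2 - z)" for z z1 z2 :: R3 and u w
    by (simp add: linepath_def algebra_simps)
  have "edge_control p v a v c (2 / k)"
    unfolding edge_control_def dist_norm lin x_def[symmetric] y_def[symmetric]
  proof (intro conjI allI impI ballI)
    fix g :: "'a \<Rightarrow> R3" and \<delta> u w assume g: "\<forall>z\<in>{v, a, v, c}. norm (g z) \<le> \<delta>"
      and u: "u \<in> {0..1::real}" "w \<in> {0..1::real}"
    have \<delta>: "0 \<le> \<delta>" using g by (meson insertI1 norm_ge_zero order_trans)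
    have "norm (g a - g v) \<le> 2 * \<delta>" "norm (g c - g v) \<le> 2 * \<delta>"
      using g norm_triangle_ineq4[of "g a" "g v"] norm_triangle_ineq4[of "g c" "g v"] by auto
    then have "norm (u *\<^sub>R (g a - g v) - w *\<^sub>R (g c - g v)) \<le> u * (2 * \<delta>) + w * (2 * \<delta>)"
      using u by (intro order_trans[OF norm_triangle_ineq4] add_mono) (auto intro: mult_left_mono)
    also have "\<dots> = 2 / k * \<delta> * (k * (u + w))" using k by (simp add: k_def algebra_simps)
    also have "\<dots> \<le> 2 / k * \<delta> * norm (u *\<^sub>R x - w *\<^sub>R y)"
      by (intro mult_left_mono bound u) (use k \<delta> in \<open>auto simp: k_def\<close>)
    finally show "norm (u *\<^sub>R (g a - g v) - w *\<^sub>R (g c - g v)) \<le> \<dots>" .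
  qed (use k in \<open>auto simp: k_def\<close>)
  then show ?thesis by blast
qed

lemma infinite_closed_segment:
  fixes a b :: "'a::real_normed_vector"
  assumes "a \<noteq> b" "finite S" shows "\<not> closed_segment a b \<subseteq> S"
  using assms finite_closed_segment[of a b] finite_subset by blast

lemma embedded_edge_control:
  assumes E: "embedded E p" and ab: "(a, b) \<in> E" "(c, d) \<in> E"
  shows "\<exists>C. edge_control p a b c d C"
proof (cases "(a, b) = (c, d)")
  case True
  then show ?thesis using edge_control_same[of p a b] embedded_ne[OF E ab(1)] by simp
next
  case False
  have ne: "p a \<noteq> p b" "p c \<noteq> p d" using E ab embedded_ne by metis+
  have meet: "closed_segment (p a) (p b) \<inter> closed_segment (p c) (p d) \<subseteq> p ` ({a, b} \<inter> {c, d})"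
    using embedded_meet[OF E ab False] .
  \<comment> \<open>Two different edges with the same ends, that is an edge and its reverse, would
    overlap in a whole segment.\<close>
  have "{a, b} \<noteq> {c, d}"
  proof
    assume e: "{a, b} = {c, d}"
    then have "closed_segment (p c) (p d) = closed_segment (p a) (p b)"
      by (auto simp: doubleton_eq_iff closed_segment_commute)
    then have "closed_segment (p a) (p b) \<subseteq> p ` ({a, b} \<inter> {c, d})" using meet by (metis Int_absorb)
    then show False using infinite_closed_segment[OF ne(1)] by auto
  qed
  then consider "{a, b} \<inter> {c, d} = {}" | "a = c" "b \<noteq> d" | "a = d" "b \<noteq> c" | "b = c" "a \<noteq> d" | "b = d" "a \<noteq> c"
    by auto
  then show ?thesis
  proof cases
    case 1
    then show ?thesis using meet by (intro edge_control_disjoint) auto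
  next
    case 2
    then have "{a, b} \<inter> {c, d} = {a}" using ne by auto
    then show ?thesis
      using edge_control_adjacent[of p a b d] ne meet 2 by auto
  next
    case 3
    then have "{a, b} \<inter> {c, d} = {a}" using ne by auto
    then have "\<exists>C. edge_control p a b a c C"
      using edge_control_adjacent[of p a b c] ne meet 3 by (auto simp: closed_segment_commute)
    then show ?thesis by (metis edge_control_flip2 3(1))
  next
    case 4
    then have "{a, b} \<inter> {c, d} = {b}" using ne by auto
    then have "\<exists>C. edge_control p b a b d C"
      using edge_control_adjacent[of p b a d] ne meet 4 by (auto simp: closed_segment_commute)
    then show ?thesis by (metis edge_control_flip1 4(1))
  next
    case 5
    then have "{a, b} \<inter> {c, d} = {b}" using ne by auto
    then have "\<exists>C. edge_control p b a b c C"
      using edge_control_adjacent[of p b a c] ne meet 5 by (auto simp: closed_segment_commute)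
    then show ?thesis by (metis edge_control_flip1 edge_control_flip2 5(1))
  qed
qed

definition edge_vertices :: "('v \<times> 'v) set \<Rightarrow> 'v set" where
  "edge_vertices E = fst ` E \<union> snd ` E"

text \<open>The parametrization of each edge is respected and not only its image, so that
  orientations of loops can be followed through a motion.\<close>

definition carries :: "('v \<times> 'v) set \<Rightarrow> ('v \<Rightarrow> R3) \<Rightarrow> ('v \<Rightarrow> R3) \<Rightarrow> (R3 \<Rightarrow> R3) \<Rightarrow> bool" where
  "carries E p q f \<longleftrightarrow> (\<exists>g. R3_isotopy f g) \<and>
     (\<forall>(a, b)\<in>E. \<forall>u\<in>{0..1}. f (linepath (p a) (p b) u) = linepath (q a) (q b) u)"

text \<open>By \<open>edge_control\<close>, moving the vertices by less than \<delta> displaces the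
  points of the graph by a Lipschitz function whose constant is proportional to \<delta>. Extending
  its three coordinates yields a perturbation of the identity, which is an isotopy once \<delta> is
  small.\<close>

lemma small_motion:
  assumes E: "embedded E p" "finite E"
  shows "\<exists>\<delta>>0. \<forall>q. (\<forall>v\<in>edge_vertices E. norm (q v - p v) < \<delta>) \<longrightarrow> (\<exists>f. carries E p q f)"
proof -
  have "\<forall>e\<in>E. \<forall>e'\<in>E. \<exists>C. edge_control p (fst e) (snd e) (fst e') (snd e') C"
    using embedded_edge_control[OF E(1)] by auto
  then obtain C where C: "\<And>e e'. e \<in> E \<Longrightarrow> e' \<in> E \<Longrightarrow> edge_control p (fst e) (snd e) (fst e') (snd e') (C e e')"
    by metis
  define D where "D = (\<Sum>e\<in>E. \<Sum>e'\<in>E. C e e')"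
  have C0: "0 \<le> C e e'" if "e \<in> E" "e' \<in> E" for e e' using C[OF that] by (simp add: edge_control_def)
  have CD: "C e e' \<le> D" if "e \<in> E" "e' \<in> E" for e e'
  proof -
    have "C e e' \<le> (\<Sum>e'\<in>E. C e e')" using that C0 E(2) by (intro member_le_sum) auto
    also have "\<dots> \<le> D" unfolding D_def using that C0 E(2)
      by (intro member_le_sum[where f = "\<lambda>e. \<Sum>e'\<in>E. C e e'"]) (auto intro: sum_nonneg)
    finally show ?thesis .
  qed
  have D0: "D \<ge> 0" unfolding D_def using C0 by (intro sum_nonneg) auto
  \<comment> \<open>Extending the coordinates separately costs a factor 3, and the total
    \<open>3 * D * \<delta>\<close> has to stay below the 1/2 demanded by
    \<open>lipschitz_perturbation_R3_isotopy\<close>.\<close>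
  define \<delta> where "\<delta> = 1 / (6 * (D + 1))"
  have \<delta>: "\<delta> > 0" using D0 by (simp add: \<delta>_def)
  define L where "L = D * \<delta>"
  have L: "0 \<le> L" "3 * L < 1 / 2" using D0 by (auto simp: L_def \<delta>_def field_simps)
  have "\<exists>f. carries E p q f" if q: "\<forall>v\<in>edge_vertices E. norm (q v - p v) < \<delta>" for q
  proof -
    define S where "S = E \<times> {0..1::real}"
    define P where "P = (\<lambda>((a, b), u). linepath (p a) (p b) u)"
    define G where "G = (\<lambda>((a, b), u). linepath (q a - p a) (q b - p b) u)"
    have lip: "norm (G s - G s') \<le> L * dist (P s) (P s')" if s: "s \<in> S" "s' \<in> S" for s s'
    proof -
      obtain a b u c d w where ss: "s = ((a, b), u)" "s' = ((c, d), w)" by (metis surj_pair)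
      have e: "(a, b) \<in> E" "(c, d) \<in> E" "u \<in> {0..1}" "w \<in> {0..1}" using s by (auto simp: ss S_def)
      have "\<forall>v\<in>{a, b, c, d}. norm (q v - p v) \<le> \<delta>"
        using q e unfolding edge_vertices_def
    by (metis UnI1 UnI2 empty_iff fst_conv image_eqI insert_iff less_imp_le snd_conv)
      from C[OF e(1,2), unfolded edge_control_def fst_conv snd_conv, THEN conjunct2, THEN spec, THEN spec, THEN mp, OF this]
      have "norm (G s - G s') \<le> C (a, b) (c, d) * \<delta> * dist (P s) (P s')"
        unfolding ss G_def P_def prod.case using e(3,4) by blast
      also have "\<dots> \<le> D * \<delta> * dist (P s) (P s')"
        using CD[OF e(1,2)] \<delta> by (intro mult_right_mono) auto
      finally show ?thesis by (simp add: L_def)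
    qed
    have comp: "\<exists>\<phi>. (\<forall>x y. \<bar>\<phi> x - \<phi> y\<bar> \<le> L * dist x y) \<and> (\<forall>s\<in>S. \<phi> (P s) = c (G s))"
      if "\<And>x y. \<bar>c x - c y\<bar> \<le> norm (x - y)" for c :: "R3 \<Rightarrow> real"
      by (rule lipschitz_extension[OF L(1)]) (use that lip order_trans in blast)
    have n3: "norm (x, y, z) \<le> \<bar>x\<bar> + \<bar>y\<bar> + \<bar>z\<bar>" for x y z :: real
      using norm_Pair_le[of x "(y, z)"] norm_Pair_le[of y z] by simp
    have "\<bar>fst x - fst y\<bar> \<le> norm (x - y)" for x y :: R3
      using norm_fst_le[of "fst (x - y)" "snd (x - y)"] unfolding prod.collapse by simp
    from comp[OF this] obtain \<phi>1 where 1: "\<And>x y. \<bar>\<phi>1 x - \<phi>1 y\<bar> \<le> L * dist x y"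
      "\<And>s. s \<in> S \<Longrightarrow> \<phi>1 (P s) = fst (G s)" by metis
    have "\<bar>fst (snd x) - fst (snd y)\<bar> \<le> norm (x - y)" for x y :: R3
      using norm_fst_le[of "fst (snd (x - y))" "snd (snd (x - y))"] norm_snd_le[of "snd (x - y)" "fst (x - y)"]
      unfolding prod.collapse by simp
    from comp[OF this] obtain \<phi>2 where 2: "\<And>x y. \<bar>\<phi>2 x - \<phi>2 y\<bar> \<le> L * dist x y"
      "\<And>s. s \<in> S \<Longrightarrow> \<phi>2 (P s) = fst (snd (G s))" by metis
    have "\<bar>snd (snd x) - snd (snd y)\<bar> \<le> norm (x - y)" for x y :: R3
      using norm_snd_le[of "snd (snd (x - y))" "fst (snd (x - y))"] norm_snd_le[of "snd (x - y)" "fst (x - y)"]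
      unfolding prod.collapse by simp
    from comp[OF this] obtain \<phi>3 where 3: "\<And>x y. \<bar>\<phi>3 x - \<phi>3 y\<bar> \<le> L * dist x y"
      "\<And>s. s \<in> S \<Longrightarrow> \<phi>3 (P s) = snd (snd (G s))" by metis
    define \<Phi> where "\<Phi> x = (\<phi>1 x, \<phi>2 x, \<phi>3 x)" for x
    have \<Phi>: "norm (\<Phi> x - \<Phi> y) \<le> 3 * L * norm (x - y)" for x y
      using n3[of "\<phi>1 x - \<phi>1 y" "\<phi>2 x - \<phi>2 y" "\<phi>3 x - \<phi>3 y"] 1(1)[of x y] 2(1)[of x y] 3(1)[of x y]
      by (simp add: \<Phi>_def dist_norm)
    have \<Phi>P: "\<Phi> (P s) = G s" if "s \<in> S" for s using 1(2) 2(2) 3(2) that by (simp add: \<Phi>_def)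
    have "\<exists>g. R3_isotopy (\<lambda>x. x + \<Phi> x) g"
      by (rule lipschitz_perturbation_R3_isotopy[OF _ L(2) \<Phi>]) (use L in simp)
    moreover have "linepath (p a) (p b) u + \<Phi> (linepath (p a) (p b) u) = linepath (q a) (q b) u"
      if "(a, b) \<in> E" "u \<in> {0..1}" for a b u
    proof -
      have "\<Phi> (linepath (p a) (p b) u) = linepath (q a - p a) (q b - p b) u"
        using \<Phi>P[of "((a, b), u)"] that by (simp add: S_def P_def G_def)
      then show ?thesis by (simp add: linepath_def algebra_simps)
    qed
    ultimately have "carries E p q (\<lambda>x. x + \<Phi> x)" unfolding carries_def by blast
    then show ?thesis by blast
  qed
  then show ?thesis using \<delta> by blast
qed

lemma carries_sym: "carries E p q f \<Longrightarrow> \<exists>f. carries E q p f"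
proof -
  assume f: "carries E p q f"
  then obtain g where g: "R3_isotopy f g" by (auto simp: carries_def)
  have gf: "g (f x) = x" for x using g unfolding R3_isotopy_def by metis
  have "g (linepath (q a) (q b) u) = linepath (p a) (p b) u" if "(a, b) \<in> E" "u \<in> {0..1}" for a b u
  proof -
    have "f (linepath (p a) (p b) u) = linepath (q a) (q b) u" using f that unfolding carries_def by blast
    then show ?thesis using gf by metis
  qed
  then show ?thesis using R3_isotopy_sym[OF g] unfolding carries_def by blast
qed

lemma carries_trans: "carries E p q f \<Longrightarrow> carries E q r f' \<Longrightarrow> carries E p r (f' \<circ> f)"
proof -
  assume f: "carries E p q f" and f': "carries E q r f'"
  have "(f' \<circ> f) (linepath (p a) (p b) u) = linepath (r a) (r b) u" if "(a, b) \<in> E" "u \<in> {0..1}" for a b u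
  proof -
    have "f (linepath (p a) (p b) u) = linepath (q a) (q b) u" "f' (linepath (q a) (q b) u) = linepath (r a) (r b) u"
      using f f' that unfolding carries_def by blast+
    then show ?thesis by simp
  qed
  then show ?thesis using f f' R3_isotopy_trans unfolding carries_def by blast
qed

text \<open>Being carried is an equivalence relation between times. By \<open>small_motion\<close>
  every time is equivalent to all times nearby, so connectedness of the unit interval does the
  rest.\<close>

theorem motion_isotopy:
  assumes E: "finite E" and emb: "\<And>t. t \<in> {0..1::real} \<Longrightarrow> embedded E (p t)"
    and cont: "\<And>v. v \<in> edge_vertices E \<Longrightarrow> continuous_on {0..1} (\<lambda>t. p t v)"
  shows "\<exists>f. carries E (p 0) (p 1) f"
proof -
  have fin: "finite (edge_vertices E)" using E by (simp add: edge_vertices_def)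
  show ?thesis
  proof (rule connected_equivalence_relation[where S = "{0..1::real}" and R = "\<lambda>s t. \<exists>f. carries E (p s) (p t) f"])
    fix a :: real assume a: "a \<in> {0..1}"
    obtain \<delta> where \<delta>: "\<delta> > 0" "\<And>q. \<forall>v\<in>edge_vertices E. norm (q v - p a v) < \<delta> \<Longrightarrow> \<exists>f. carries E (p a) q f"
      using small_motion[OF emb[OF a] E] by blast
    \<comment> \<open>The times at which every vertex is within \<delta> of its position at time
      \<open>a\<close>; an open set, since there are finitely many vertices.\<close>
    define T where "T = {0..1} \<inter> (\<Inter>v\<in>edge_vertices E. {t \<in> {0..1}. norm (p t v - p a v) \<in> {..<\<delta>}})"
    have "openin (top_of_set {0..1}) T"
    proof (cases "edge_vertices E = {}")
      case True then show ?thesis by (simp add: T_def)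
    next
      case False
      have "openin (top_of_set {0..1}) {t \<in> {0..1}. norm (p t v - p a v) \<in> {..<\<delta>}}" if "v \<in> edge_vertices E" for v
        using continuous_openin_preimage_gen[of "{0..1}" "\<lambda>t. norm (p t v - p a v)" "{..<\<delta>}"] cont[OF that]
        by (simp add: vimage_def Int_def conj_commute continuous_intros)
      then show ?thesis unfolding T_def using fin False
        by (intro openin_Int openin_INT) auto
    qed
    moreover have "a \<in> T" using a \<delta> by (simp add: T_def)
    moreover have "\<forall>x\<in>T. \<exists>f. carries E (p a) (p x) f" using \<delta>(2) by (auto simp: T_def)
    ultimately show "\<exists>T. openin (top_of_set {0..1}) T \<and> a \<in> T \<and> (\<forall>x\<in>T. \<exists>f. carries E (p a) (p x) f)" by blast
    show "\<exists>f. carries E (p y) (p x) f" if "\<exists>f. carries E (p x) (p y) f" for x y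
      using that carries_sym by blast
    show "\<exists>f. carries E (p x) (p z) f" if "\<exists>f. carries E (p x) (p y) f" "\<exists>f. carries E (p y) (p z) f" for x y z
      using that carries_trans by blast
  qed auto
qed

lemma carries_realize: "carries E p q f \<Longrightarrow> f ` realize E p = realize E q"
proof -
  assume f: "carries E p q f"
  have "f ` closed_segment (p a) (p b) = closed_segment (q a) (q b)" if "(a, b) \<in> E" for a b
  proof -
    have "f ` linepath (p a) (p b) ` {0..1} = linepath (q a) (q b) ` {0..1}"
      unfolding image_image using f that unfolding carries_def by (intro image_cong) auto
    then show ?thesis unfolding path_image_linepath[symmetric] path_image_def .
  qed
  then show ?thesis unfolding realize_def image_UN by (intro SUP_cong) auto
qed

lemma carries_ambient:
  assumes "carries E p q f" "ambient_isotopic (stereo ` realize E p) K"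
  shows "ambient_isotopic (stereo ` realize E q) K"
  using assms R3_isotopy_ambient[OF _ assms(2) carries_realize[OF assms(1)]] by (auto simp: carries_def)

text \<open>The map may bend segments in their parametrization: it suffices that the straight
  segment between the images of the ends lies in the image of the edge. This admits the projective
  map \<open>squeeze\<close>.\<close>

lemma embedded_image:
  assumes "embedded E p" "inj f"
    and seg: "\<And>a b. (a, b) \<in> E \<Longrightarrow> closed_segment (f (p a)) (f (p b)) \<subseteq> f ` closed_segment (p a) (p b)"
  shows "embedded E (\<lambda>v. f (p v))"
proof -
  have 1: "f (p a) \<noteq> f (p b)" if "(a, b) \<in> E" for a b
    using embedded_ne[OF assms(1) that] assms(2) by (metis injD)
  have 2: "x \<in> (\<lambda>v. f (p v)) ` ({a, b} \<inter> {c, d})" if e: "(a, b) \<in> E" "(c, d) \<in> E"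
    and x: "x \<in> closed_segment (f (p a)) (f (p b))" "x \<in> closed_segment (f (p c)) (f (p d))"
    and n: "(a, b) \<noteq> (c, d)" for a b c d x
  proof -
  obtain y y' where y: "y \<in> closed_segment (p a) (p b)" "x = f y" "y' \<in> closed_segment (p c) (p d)" "x = f y'"
    using seg[OF e(1)] seg[OF e(2)] x by blast
  then have "y = y'" using assms(2) by (auto dest: injD)
  then have "y \<in> p ` ({a, b} \<inter> {c, d})" using embedded_meet[OF assms(1) e n] y by blast
  then show ?thesis using y(2) by blast
  qed
  show ?thesis using 1 2 by (intro embeddedI) metis+
qed

lemma embedded_linear_image:
  assumes "embedded E p" "linear f" "inj f"
  shows "embedded E (\<lambda>v. f (p v) + w)"
proof (rule embedded_image[OF assms(1), of "\<lambda>x. f x + w"])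
  show "inj (\<lambda>x. f x + w)" using assms(3) by (simp add: inj_def)
  show "closed_segment (f (p a) + w) (f (p b) + w) \<subseteq> (\<lambda>x. f x + w) ` closed_segment (p a) (p b)" for a b
    using closed_segment_linear_image[OF assms(2), of "p a" "p b"] closed_segment_translation[of w "f (p a)" "f (p b)"]
    by (simp add: add.commute image_image)
qed

text \<open>The straight line from the identity to \<open>R\<close> in the space of matrices must
  avoid singular ones; then it moves the graph through injective linear images, while the
  translation by \<open>w\<close> is phased in.\<close>

lemma linear_motion:
  assumes E: "finite E" "embedded E p" and R: "linear R"
    and nonsing: "\<And>t x. t \<in> {0..1} \<Longrightarrow> (1 - t) *\<^sub>R x + t *\<^sub>R R x = 0 \<Longrightarrow> x = 0"
  shows "\<exists>f. carries E p (\<lambda>v. R (p v) + w) f"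
proof -
  define q where "q t v = ((\<lambda>x. (1 - t) *\<^sub>R x + t *\<^sub>R R x) (p v)) + t *\<^sub>R w" for t v
  have "\<exists>f. carries E (q 0) (q 1) f"
  proof (rule motion_isotopy[OF E(1)])
    fix t :: real assume t: "t \<in> {0..1}"
    let ?f = "\<lambda>x. (1 - t) *\<^sub>R x + t *\<^sub>R R x"
    have lin: "linear ?f"
      by (intro linear_compose_add linear_compose_scale_right R linear_id[unfolded id_def])
    have "inj ?f" using linear_injective_0[OF lin] nonsing[OF t] by blast
    then show "embedded E (q t)" unfolding q_def by (rule embedded_linear_image[OF E(2) lin])
  next
    show "continuous_on {0..1} (\<lambda>t. q t v)" for v unfolding q_def by (intro continuous_intros)
  qed
  moreover have "q 0 = p" "q 1 = (\<lambda>v. R (p v) + w)" by (simp_all add: q_def fun_eq_iff)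
  ultimately show ?thesis by simp
qed

text \<open>The matrix that interpolates between the identity and a quarter turn has the positive
  determinant \<open>(1 - t)\<^sup>2 + t\<^sup>2\<close>. The two identities are multiplications
  with its adjugate; \<open>s\<close> is the sense of the turn.\<close>

lemma quarter_turn_nonsing:
  fixes a c t s :: real
  assumes "s * s = 1" "(1 - t) * a + t * (s * c) = 0" "(1 - t) * c - t * (s * a) = 0"
  shows "a = 0" "c = 0"
proof -
  have pos: "(1 - t)\<^sup>2 + t\<^sup>2 > 0" by (cases "t = 0") (auto intro!: add_nonneg_pos)
  have "((1 - t)\<^sup>2 + t\<^sup>2 * (s * s)) * a = (1 - t) * ((1 - t) * a + t * (s * c)) - t * s * ((1 - t) * c - t * (s * a))"
    by (simp add: power2_eq_square algebra_simps)
  then have "((1 - t)\<^sup>2 + t\<^sup>2) * a = 0" unfolding assms by simp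
  then show "a = 0" using pos by (metis less_irrefl mult_eq_0_iff)
  have "((1 - t)\<^sup>2 + t\<^sup>2 * (s * s)) * c = (1 - t) * ((1 - t) * c - t * (s * a)) + t * s * ((1 - t) * a + t * (s * c))"
    by (simp add: power2_eq_square algebra_simps)
  then have "((1 - t)\<^sup>2 + t\<^sup>2) * c = 0" unfolding assms by simp
  then show "c = 0" using pos by (metis less_irrefl mult_eq_0_iff)
qed

lemma quarter_turn_motion:
  assumes E: "finite E" "embedded E p"
    and R: "R = (\<lambda>(x, y, z). (z, y, - x)) \<or> R = (\<lambda>(x, y, z). (- z, y, x)) \<or> R = (\<lambda>(x, y, z). (- y, x, z))"
  shows "\<exists>f. carries E p (\<lambda>v. R (p v) + w) f"
proof (rule linear_motion[OF E])
  show "linear R" using R by (auto intro!: linearI)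
  fix t :: real and x :: R3 assume t: "(1 - t) *\<^sub>R x + t *\<^sub>R R x = 0"
  obtain a b c where x: "x = (a, b, c)" by (metis prod_cases3)
  from R show "x = 0"
  proof (elim disjE)
    assume "R = (\<lambda>(x, y, z). (z, y, - x))"
    then show ?thesis
      using t quarter_turn_nonsing[of 1 t a c] by (auto simp: x zero_prod_def algebra_simps)
  next
    assume "R = (\<lambda>(x, y, z). (- z, y, x))"
    then show ?thesis
      using t quarter_turn_nonsing[of "-1" t a c] by (auto simp: x zero_prod_def algebra_simps)
  next
    assume "R = (\<lambda>(x, y, z). (- y, x, z))"
    then show ?thesis
      using t quarter_turn_nonsing[of "-1" t a b] by (auto simp: x zero_prod_def algebra_simps)
  qed
qed

section \<open>Polygons\<close>

definition path_edges :: "'v list \<Rightarrow> ('v \<times> 'v) set" where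
  "path_edges xs = set (zip xs (tl xs))"

lemma path_edges_Cons: "path_edges (v # w # xs) = insert (v, w) (path_edges (w # xs))"
  by (simp add: path_edges_def)

lemma path_edges_vertices: "(a, b) \<in> path_edges xs \<Longrightarrow> a \<in> set xs \<and> b \<in> set xs"
  unfolding path_edges_def by (metis list.set_sel(2) set_zip_leftD set_zip_rightD tl_Nil)

lemma path_edges_source:
  assumes "(a, b) \<in> path_edges (xs @ [v])" shows "a \<in> set xs"
  using assms unfolding path_edges_def in_set_zip by (auto simp: nth_append)

lemma polygon_edges_path_edges: "vs \<noteq> [] \<Longrightarrow> polygon_edges vs = path_edges (vs @ [hd vs])"
proof (cases vs)
  case (Cons a xs)
  have "zip ((a # xs) @ [a]) (xs @ [a]) = zip (a # xs) (xs @ [a])" by (subst zip_append1) simp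
  then show ?thesis by (simp add: Cons polygon_edges_def path_edges_def)
qed simp

lemma polygon_edges_vertices: "(a, b) \<in> polygon_edges vs \<Longrightarrow> a \<in> set vs \<and> b \<in> set vs"
  unfolding polygon_edges_def by (metis set_rotate1 set_zip_leftD set_zip_rightD)

lemma finite_polygon_edges: "finite (polygon_edges vs)"
  by (simp add: polygon_edges_def)

lemma path_polygonal_path: "path (polygonal_path xs) \<and> (xs \<noteq> [] \<longrightarrow> pathstart (polygonal_path xs) = hd xs \<and>
   pathfinish (polygonal_path xs) = last xs)"
proof (induction xs rule: polygonal_path.induct)
  case 1
  show ?case by (simp add: path_def)
next
  case (2 v)
  show ?case by (simp add: path_def pathstart_def pathfinish_def)
qed auto

lemma pathstart_polygonal_path: "xs \<noteq> [] \<Longrightarrow> pathstart (polygonal_path xs) = hd xs"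
  and pathfinish_polygonal_path: "xs \<noteq> [] \<Longrightarrow> pathfinish (polygonal_path xs) = last xs"
  using path_polygonal_path by blast+

lemma path_image_polygonal_path:
  "2 \<le> length xs \<Longrightarrow> path_image (polygonal_path xs) = realize (path_edges xs) (\<lambda>x. x)"
proof (induction xs rule: polygonal_path.induct)
  case (4 v w u vs)
  then show ?case
    by (simp add: path_image_join pathstart_polygonal_path path_edges_Cons[of v] realize_def)
qed (auto simp: realize_def path_edges_def)

lemma path_image_closed_polygon:
  "vs \<noteq> [] \<Longrightarrow> path_image (closed_polygon vs) = realize (polygon_edges vs) (\<lambda>x. x)"
  unfolding closed_polygon_def polygon_edges_path_edges
  by (rule path_image_polygonal_path) (cases vs; simp)

lemma path_edges_map: "path_edges (map p xs) = map_prod p p ` path_edges xs"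
  by (simp add: path_edges_def map_tl[symmetric] zip_map_map map_prod_def)

lemma polygon_edges_map: "polygon_edges (map p xs) = map_prod p p ` polygon_edges xs"
  by (simp add: polygon_edges_def rotate1_map zip_map_map map_prod_def)

lemma realize_map: "realize (map_prod p p ` E) (\<lambda>x. x) = realize E p"
  by (auto simp: realize_def)

lemma path_image_closed_polygon_map:
  "vs \<noteq> [] \<Longrightarrow> path_image (closed_polygon (map p vs)) = realize (polygon_edges vs) p"
  by (simp add: path_image_closed_polygon polygon_edges_map realize_map)

lemma polygonal_path_carried:
  assumes "\<And>a b u. (a, b) \<in> path_edges ls \<Longrightarrow> u \<in> {0..1} \<Longrightarrow> f (linepath (p a) (p b) u) = linepath (q a) (q b) u"
    and "2 \<le> length ls" "u \<in> {0..1}"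
  shows "f (polygonal_path (map p ls) u) = polygonal_path (map q ls) u"
  using assms
proof (induction ls arbitrary: u rule: induct_list012)
  case (3 a b cs)
  show ?case
  proof (cases cs)
    case Nil
    then show ?thesis using 3(3)[of a b u] 3(5) by (simp add: path_edges_def)
  next
    case (Cons c ds)
    have IH: "f (polygonal_path (map p (b # cs)) u) = polygonal_path (map q (b # cs)) u" if "u \<in> {0..1}" for u
      using 3(2)[OF 3(3)] that Cons by (simp add: path_edges_Cons[of a])
    show ?thesis
      using 3(3)[of a b "2 * u"] IH[of "2 * u - 1"] 3(5) Cons
      by (auto simp: joinpaths_def path_edges_Cons[of a])
  qed
qed auto

lemma closed_polygon_carried:
  assumes "carries E p q f" "polygon_edges ls \<subseteq> E" "ls \<noteq> []" "u \<in> {0..1}"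
  shows "f (closed_polygon (map p ls) u) = closed_polygon (map q ls) u"
proof -
  have "f (polygonal_path (map p (ls @ [hd ls])) u) = polygonal_path (map q (ls @ [hd ls])) u"
  proof (rule polygonal_path_carried)
    show "2 \<le> length (ls @ [hd ls])" using assms(3) by (cases ls) auto
    show "f (linepath (p a) (p b) u) = linepath (q a) (q b) u"
      if "(a, b) \<in> path_edges (ls @ [hd ls])" "u \<in> {0..1}" for a b u
      using assms(1,2) that unfolding polygon_edges_path_edges[OF assms(3)] carries_def by blast
  qed (rule assms)
  then show ?thesis using assms(3) by (simp add: closed_polygon_def hd_map)
qed

section \<open>Simple polygons as embedded graphs\<close>

lemma arc_polygonal_path:
  assumes "embedded E p" "distinct ls" "2 \<le> length ls" "path_edges ls \<subseteq> E"
  shows "arc (polygonal_path (map p ls))"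
  using assms(2-)
proof (induction ls rule: induct_list012)
  case (3 a b cs)
  have ab: "(a, b) \<in> E" using 3(5) by (simp add: path_edges_Cons)
  then have ne: "p a \<noteq> p b" by (rule embedded_ne[OF assms(1)])
  show ?case
  proof (cases cs)
    case Nil
    then show ?thesis using ne by simp
  next
    case (Cons c ds)
    have sub: "path_edges (b # cs) \<subseteq> E" using 3(5) by (simp add: path_edges_Cons[of a])
    have "arc (polygonal_path (map p (b # cs)))" using 3 Cons sub by simp
    moreover have "closed_segment (p a) (p b) \<inter> path_image (polygonal_path (map p (b # cs))) \<subseteq> {p b}"
    proof -
      have "closed_segment (p a) (p b) \<inter> closed_segment (p c') (p d') \<subseteq> {p b}"
        if "(c', d') \<in> path_edges (b # cs)" for c' d'
      proof -
        have "c' \<noteq> a" "d' \<noteq> a" using path_edges_vertices[OF that] 3(3) by auto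
        then show ?thesis using embedded_meet[OF assms(1) ab, of c' d'] that sub by auto
      qed
      moreover have "path_image (polygonal_path (map p (b # cs))) = realize (path_edges (b # cs)) p"
        by (subst path_image_polygonal_path) (use Cons in simp, simp only: path_edges_map realize_map)
      ultimately show ?thesis by (auto simp: realize_def)
    qed
    ultimately show ?thesis using ne Cons
      by (simp add: arc_join_eq pathstart_polygonal_path)
  qed
qed auto

lemma simple_path_closed_polygon:
  assumes "embedded E p" "distinct ls" "3 \<le> length ls" "polygon_edges ls \<subseteq> E"
  shows "simple_path (closed_polygon (map p ls))"
proof -
  obtain a b c cs where ls: "ls = a # b # c # cs"
    using assms(3) by (auto simp: numeral_3_eq_3 Suc_le_length_iff)
  have e: "polygon_edges ls = insert (a, b) (path_edges ((b # c # cs) @ [a]))"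
    unfolding ls by (subst polygon_edges_path_edges) (simp_all add: path_edges_Cons)
  have ab: "(a, b) \<in> E" and sub: "path_edges ((b # c # cs) @ [a]) \<subseteq> E" using e assms(4) by auto
  have ne: "p a \<noteq> p b" by (rule embedded_ne[OF assms(1) ab])
  have "arc (polygonal_path (map p ((b # c # cs) @ [a])))"
    by (rule arc_polygonal_path[OF assms(1)]) (use assms(2) sub ls in auto)
  moreover have "closed_segment (p a) (p b) \<inter> path_image (polygonal_path (map p ((b # c # cs) @ [a]))) \<subseteq> {p a, p b}"
  proof -
    have "closed_segment (p a) (p b) \<inter> closed_segment (p c') (p d') \<subseteq> {p a, p b}"
      if "(c', d') \<in> path_edges ((b # c # cs) @ [a])" for c' d'
    proof -
      have "c' \<noteq> a" using path_edges_source[OF that] assms(2) ls by auto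
      then show ?thesis using embedded_meet[OF assms(1) ab, of c' d'] that sub by auto
    qed
    moreover have "path_image (polygonal_path (map p ((b # c # cs) @ [a]))) = realize (path_edges ((b # c # cs) @ [a])) p"
      by (subst path_image_polygonal_path) (simp, simp only: path_edges_map realize_map)
    ultimately show ?thesis by (auto simp: realize_def)
  qed
  ultimately show ?thesis using ne
    unfolding ls closed_polygon_def
    by (simp add: simple_path_join_loop_eq pathstart_polygonal_path pathfinish_polygonal_path)
qed

lemma embedded_vertex_on_edge:
  assumes "embedded E (\<lambda>x. x)" "(a, b) \<in> E" "(c, d) \<in> E" "v \<in> {a, b}" "v \<in> closed_segment c d"
  shows "v \<in> {c, d}"
proof (cases "(a, b) = (c, d)")
  case False
  have "v \<in> closed_segment a b" using assms(4) by auto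
  then show ?thesis using embedded_meet[OF assms(1-3) False] assms(5) by auto
qed (use assms in auto)

text \<open>A point of \<open>S\<close> is a vertex of \<open>E\<close>, so an old edge that passes
  through it ends there by \<open>embedded_vertex_on_edge\<close>. This turns a condition on points
  into the condition on labels that \<open>embedded\<close> asks for.\<close>

lemma embedded_insert:
  assumes E: "embedded E (\<lambda>x. x)" and "a \<noteq> b"
    and meet: "\<And>c d. (c, d) \<in> E \<Longrightarrow> (c, d) \<noteq> (a, b) \<Longrightarrow> closed_segment a b \<inter> closed_segment c d \<subseteq> S"
    and S: "S \<subseteq> {a, b}" "\<And>v. v \<in> S \<Longrightarrow> \<exists>(c, d)\<in>E. v \<in> {c, d}"
  shows "embedded (insert (a, b) E) (\<lambda>x. x)"
proof -
  have m: "x \<in> {a, b} \<inter> {c, d}"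
    if cd: "(c, d) \<in> E" "(c, d) \<noteq> (a, b)" "x \<in> closed_segment a b" "x \<in> closed_segment c d" for c d x
  proof -
    have x: "x \<in> S" using meet cd by blast
    obtain c' d' where "(c', d') \<in> E" "x \<in> {c', d'}" using S(2)[OF x] by blast
    then have "x \<in> {c, d}" using embedded_vertex_on_edge[OF E] cd by blast
    then show ?thesis using x S(1) by blast
  qed
  show ?thesis
  proof (rule embeddedI)
    show "x \<noteq> y" if "(x, y) \<in> insert (a, b) E" for x y
      using that assms(2) embedded_ne[OF E, of x y] by blast
    fix u v c d x assume h: "(u, v) \<in> insert (a, b) E" "(c, d) \<in> insert (a, b) E" "(u, v) \<noteq> (c, d)"
      "x \<in> closed_segment u v" "x \<in> closed_segment c d"
    show "x \<in> (\<lambda>x. x) ` ({u, v} \<inter> {c, d})"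
    proof (cases "(u, v) = (a, b)")
      case True
      then show ?thesis using m[of c d x] h by auto
    next
      case False
      show ?thesis
      proof (cases "(c, d) = (a, b)")
        case True
        then show ?thesis using m[of u v x] h by auto
      next
        case F: False
        then show ?thesis using embedded_meet[OF E, of u v c d] h False by auto
      qed
    qed
  qed
qed

lemma arc_polygonal_path_embedded:
  fixes xs :: "R3 list"
  assumes "arc (polygonal_path xs)" "2 \<le> length xs"
  shows "distinct xs \<and> embedded (path_edges xs) (\<lambda>x. x)"
  using assms
proof (induction xs rule: induct_list012)
  case (3 a b cs)
  show ?case
  proof (cases cs)
    case Nil
    then show ?thesis using arc_distinct_ends[OF 3(3)] by (auto simp: path_edges_def intro!: embeddedI)
  next
    case (Cons c ds)
    have h: "arc (linepath a b)" "arc (polygonal_path (b # cs))"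
      "closed_segment a b \<inter> path_image (polygonal_path (b # cs)) \<subseteq> {b}"
      using 3(3) unfolding Cons by (auto simp: arc_join_eq pathstart_polygonal_path)
    have IH: "distinct (b # cs)" "embedded (path_edges (b # cs)) (\<lambda>x. x)"
      using 3(2)[OF h(2)] Cons by auto
    have ne: "a \<noteq> b" using arc_distinct_ends[OF h(1)] by simp
    have pi: "path_image (polygonal_path (b # cs)) = realize (path_edges (b # cs)) (\<lambda>x. x)"
      using Cons by (subst path_image_polygonal_path) auto
    have "a \<notin> set (b # cs)"
    proof
      assume a: "a \<in> set (b # cs)"
      have "\<exists>(x, y)\<in>path_edges (b # cs). a \<in> {x, y}"
      proof (cases "a = b")
        case False
        then obtain i where i: "i < length cs" "cs ! i = a" using a by (auto simp: in_set_conv_nth)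
        then have "((b # cs) ! i, a) \<in> path_edges (b # cs)"
          unfolding path_edges_def in_set_zip by (intro exI[of _ i]) auto
        then show ?thesis by blast
      qed (use ne in auto)
      then have "a \<in> path_image (polygonal_path (b # cs))" unfolding pi realize_def by force
      then show False using h(3) ne by auto
    qed
    moreover have "embedded (insert (a, b) (path_edges (b # cs))) (\<lambda>x. x)"
    proof (rule embedded_insert[where S = "{b}", OF IH(2) ne])
      show "closed_segment a b \<inter> closed_segment c d \<subseteq> {b}" if "(c, d) \<in> path_edges (b # cs)" for c d
        using h(3) that unfolding pi realize_def by blast
    qed (use Cons in \<open>auto simp: path_edges_Cons\<close>)
    ultimately show ?thesis using IH by (simp add: path_edges_Cons)
  qed
qed auto

text \<open>\<open>closed_polygon\<close> is also defined for degenerate lists, and simplicity has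
  to rule them out: at most one vertex gives a constant path, and two give a segment that is run
  through twice.\<close>

lemma simple_path_closed_polygon_embedded:
  fixes vs :: "R3 list"
  assumes "simple_path (closed_polygon vs)"
  shows "3 \<le> length vs \<and> distinct vs \<and> embedded (polygon_edges vs) (\<lambda>x. x)"
proof -
  consider "length vs \<le> 1" | a b where "vs = [a, b]" | a b c cs where "vs = a # b # c # cs"
    by (cases vs; cases "tl vs"; cases "tl (tl vs)") auto
  then show ?thesis
  proof cases
    case 1
    then have "closed_polygon vs = (\<lambda>_. hd vs)" by (cases vs) (simp_all add: closed_polygon_def linepath_refl)
    then have "closed_polygon vs (1/3) = closed_polygon vs (2/3)" by simp
    then show ?thesis
      using assms[unfolded simple_path_def loop_free_def, THEN conjunct2, rule_format, of "1/3" "2/3"] by simp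
  next
    case 2
    then have "simple_path (linepath a b +++ linepath b a)" using assms by (simp add: closed_polygon_def)
    then have h: "arc (linepath a b)" "closed_segment a b \<inter> closed_segment b a \<subseteq> {a, b}"
      by (auto simp: simple_path_join_loop_eq)
    have "a \<noteq> b" using arc_distinct_ends[OF h(1)] by simp
    then show ?thesis using infinite_closed_segment[of a b "{a, b}"] h(2) by (auto simp: closed_segment_commute)
  next
    case 3
    let ?r = "(b # c # cs) @ [a]"
    have e: "polygon_edges vs = insert (a, b) (path_edges ?r)"
      unfolding 3 by (subst polygon_edges_path_edges) (simp_all add: path_edges_Cons)
    have h: "arc (linepath a b)" "arc (polygonal_path ?r)"
      "closed_segment a b \<inter> path_image (polygonal_path ?r) \<subseteq> {a, b}"
      using assms unfolding 3 closed_polygon_def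
      by (auto simp: simple_path_join_loop_eq pathstart_polygonal_path pathfinish_polygonal_path)
    have r: "distinct ?r" "embedded (path_edges ?r) (\<lambda>x. x)"
      using arc_polygonal_path_embedded[OF h(2)] by auto
    have ne: "a \<noteq> b" using arc_distinct_ends[OF h(1)] by simp
    have pi: "path_image (polygonal_path ?r) = realize (path_edges ?r) (\<lambda>x. x)"
      by (subst path_image_polygonal_path) auto
    have last: "(last (c # cs), a) \<in> path_edges ?r"
      unfolding path_edges_def in_set_zip
      by (intro exI[of _ "length cs + 1"]) (auto simp: nth_append last_conv_nth nth_Cons' split: if_splits)
    have "embedded (insert (a, b) (path_edges ?r)) (\<lambda>x. x)"
    proof (rule embedded_insert[where S = "{a, b}", OF r(2) ne])
      show "closed_segment a b \<inter> closed_segment c d \<subseteq> {a, b}" if "(c, d) \<in> path_edges ?r" for c d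
        using h(3) that unfolding pi realize_def by blast
      show "\<exists>(c, d)\<in>path_edges ?r. v \<in> {c, d}" if "v \<in> {a, b}" for v
      proof (cases "v = a")
        case True
        then show ?thesis using last by blast
      next
        case False
        then have "v = b" using that by auto
        then show ?thesis by (auto simp: path_edges_Cons)
      qed
    qed auto
    then show ?thesis using r 3 e by auto
  qed
qed

lemma polygonal_link_embedded:
  assumes "polygonal_link P"
  shows "embedded (\<Union>vs\<in>P. polygon_edges vs) (\<lambda>x. x)"
proof -
  have s: "simple_path (closed_polygon vs)" if "vs \<in> P" for vs
    using assms that by (simp add: polygonal_link_def)
  note emb = simple_path_closed_polygon_embedded[OF s]
  show ?thesis
  proof (rule embeddedI)
    show "a \<noteq> b" if "(a, b) \<in> (\<Union>vs\<in>P. polygon_edges vs)" for a b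
      using that emb embedded_ne by fast
    fix a b c d x assume h: "(a, b) \<in> (\<Union>vs\<in>P. polygon_edges vs)" "(c, d) \<in> (\<Union>vs\<in>P. polygon_edges vs)"
      "(a, b) \<noteq> (c, d)" "x \<in> closed_segment a b" "x \<in> closed_segment c d"
    obtain vs ws where vw: "vs \<in> P" "(a, b) \<in> polygon_edges vs" "ws \<in> P" "(c, d) \<in> polygon_edges ws"
      using h by blast
    show "x \<in> (\<lambda>x. x) ` ({a, b} \<inter> {c, d})"
    proof (cases "vs = ws")
      case True
      then show ?thesis using embedded_meet[of "polygon_edges vs" "\<lambda>x. x" a b c d] emb[OF vw(1)] vw h by auto
    next
      case False
      have "vs \<noteq> []" "ws \<noteq> []" using emb[OF vw(1)] emb[OF vw(3)] by auto
      then have "x \<in> path_image (closed_polygon vs)" "x \<in> path_image (closed_polygon ws)"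
        using vw h by (auto simp: path_image_closed_polygon realize_def)
      moreover have "disjnt (path_image (closed_polygon vs)) (path_image (closed_polygon ws))"
        using assms False vw by (auto simp: polygonal_link_def pairwise_def)
      ultimately show ?thesis by (auto simp: disjnt_def)
    qed
  qed
qed

text \<open>Links that result from motions are presented in this form: the vertex lists consist of
  labels, fixed once and for all, and only the position \<open>p\<close> varies.\<close>

lemma polygonal_link_map:
  assumes E: "embedded E p" and LS: "finite LS" "LS \<noteq> {}"
    and ls: "\<And>ls. ls \<in> LS \<Longrightarrow> distinct ls \<and> 3 \<le> length ls \<and> polygon_edges ls \<subseteq> E"
    and disj: "\<And>ls ls'. ls \<in> LS \<Longrightarrow> ls' \<in> LS \<Longrightarrow> ls \<noteq> ls' \<Longrightarrow> set ls \<inter> set ls' = {}"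
  shows "polygonal_link (map p ` LS)"
    and "polygonal_support (map p ` LS) = realize (\<Union>ls\<in>LS. polygon_edges ls) p"
    and "inj_on (map p) LS"
proof -
  have im: "path_image (closed_polygon (map p ls)) = realize (polygon_edges ls) p" if "ls \<in> LS" for ls
    using ls[OF that] by (intro path_image_closed_polygon_map) auto
  show "polygonal_support (map p ` LS) = realize (\<Union>ls\<in>LS. polygon_edges ls) p"
    unfolding polygonal_support_def using im by (auto simp: realize_def)
  have d: "disjnt (path_image (closed_polygon (map p ls))) (path_image (closed_polygon (map p ls')))"
    if l: "ls \<in> LS" "ls' \<in> LS" "ls \<noteq> ls'" for ls ls'
  proof -
    have "closed_segment (p a) (p b) \<inter> closed_segment (p c) (p d) = {}"
      if "(a, b) \<in> polygon_edges ls" "(c, d) \<in> polygon_edges ls'" for a b c d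
    proof -
      have "{a, b} \<inter> {c, d} = {}"
        using polygon_edges_vertices[OF that(1)] polygon_edges_vertices[OF that(2)] disj[OF l] by auto
      moreover from this have "(a, b) \<noteq> (c, d)" by auto
      moreover have "(a, b) \<in> E" "(c, d) \<in> E" using that ls l by blast+
      ultimately show ?thesis using embedded_meet[OF E, of a b c d] by auto
    qed
    then show ?thesis unfolding im[OF l(1)] im[OF l(2)] disjnt_def realize_def by fast
  qed
  have sp: "simple_path (closed_polygon (map p ls))" if "ls \<in> LS" for ls
    using ls[OF that] by (intro simple_path_closed_polygon[OF E]) auto
  then show "polygonal_link (map p ` LS)"
    unfolding polygonal_link_def using LS d by (auto simp: pairwise_def)
  show "inj_on (map p) LS"
  proof (rule inj_onI, rule ccontr)
    fix ls ls' assume "ls \<in> LS" "ls' \<in> LS" "map p ls = map p ls'" "ls \<noteq> ls'"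
    then have "disjnt (path_image (closed_polygon (map p ls))) (path_image (closed_polygon (map p ls)))"
      using d by metis
    then show False by (simp add: disjnt_def)
  qed
qed

section \<open>Orientations of loops\<close>

lemma loop_eqD:
  assumes "simple_path \<gamma>" "\<gamma> s = \<gamma> t" "s \<in> {0<..<1}" "t \<in> {0..1}"
  shows "s = t"
  using assms unfolding simple_path_def loop_free_def by force

text \<open>Away from the common starting point, \<open>\<psi>\<close> is the change of parameter
  from \<open>\<delta>\<close> to \<open>\<gamma>\<close>. It is continuous and injective on an open
  interval, hence strictly monotone, and the two points in \<open>st\<close> exclude that it
  decreases.\<close>

lemma same_start_loops:
  fixes \<gamma> \<delta> :: "real \<Rightarrow> 'a::euclidean_space"
  assumes \<gamma>: "simple_path \<gamma>" "pathfinish \<gamma> = pathstart \<gamma>"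
    and \<delta>: "simple_path \<delta>" "pathfinish \<delta> = pathstart \<delta>"
    and eq: "path_image \<gamma> = path_image \<delta>" "pathstart \<gamma> = pathstart \<delta>"
    and s: "0 < s1" "s1 < s2" "s2 < 1" and t: "0 < t1" "t1 < t2" "t2 < 1"
    and st: "\<delta> s1 = \<gamma> t1" "\<delta> s2 = \<gamma> t2"
  shows "\<exists>\<phi>. strict_mono_on {0..1} \<phi> \<and> \<phi> ` {0..1} = {0..1} \<and> \<phi> 0 = 0 \<and> \<phi> 1 = 1 \<and>
    (\<forall>t\<in>{0..1}. \<delta> t = \<gamma> (\<phi> t))"
proof -
  have ex: "\<exists>t\<in>{0<..<1}. \<beta> t = \<alpha> s"
    if ab: "simple_path \<alpha>" "simple_path \<beta>" "pathfinish \<beta> = pathstart \<beta>" "path_image \<alpha> = path_image \<beta>"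
      "pathstart \<alpha> = pathstart \<beta>" and s: "s \<in> {0<..<1}" for \<alpha> \<beta> :: "real \<Rightarrow> 'a" and s
  proof -
    have "\<alpha> s \<in> path_image \<beta>" using s ab(4)[symmetric] by (auto simp: path_image_def)
    then obtain t where t: "t \<in> {0..1}" "\<beta> t = \<alpha> s" by (auto simp: path_image_def)
    have "\<alpha> s \<noteq> \<alpha> 0" using loop_eqD[OF ab(1) _ s, of 0] s by auto
    then have "t \<noteq> 0" "t \<noteq> 1" using t ab(3,5) by (auto simp: pathstart_def pathfinish_def)
    then show ?thesis using t by force
  qed
  define \<psi> where "\<psi> s = (SOME t. t \<in> {0<..<1} \<and> \<gamma> t = \<delta> s)" for s
  have \<psi>: "\<psi> s \<in> {0<..<1} \<and> \<gamma> (\<psi> s) = \<delta> s" if s': "s \<in> {0<..<1}" for s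
  proof -
    obtain t where "t \<in> {0<..<1}" "\<gamma> t = \<delta> s"
      using ex[OF \<delta>(1) \<gamma> eq(1)[symmetric] eq(2)[symmetric] s'] by metis
    then have "t \<in> {0<..<1} \<and> \<gamma> t = \<delta> s" by simp
    then show ?thesis unfolding \<psi>_def by (rule someI)
  qed
  have uniq: "t = \<psi> s" if "s \<in> {0<..<1}" "t \<in> {0..1}" "\<gamma> t = \<delta> s" for s t
    using loop_eqD[OF \<gamma>(1), of "\<psi> s" t] \<psi>[OF that(1)] that by simp
  \<comment> \<open>A function into a compact interval is continuous if its graph is closed. The
    ends are avoided because a loop takes the same value at both, so that the parameter is ambiguous
    there.\<close>
  have cont: "continuous_on {a..b} \<psi>" if ab: "0 < a" "b < 1" for a b
  proof (rule continuous_from_closed_graph[of "{0..1}"])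
    show "\<psi> \<in> {a..b} \<rightarrow> {0..1}"
    proof (rule Pi_I)
      fix x assume "x \<in> {a..b}"
      then have "x \<in> {0<..<1}" using ab by auto
      then show "\<psi> x \<in> {0..1}" using \<psi>[of x] by auto
    qed
    have "closed {z \<in> {a..b} \<times> {0..1}. \<delta> (fst z) - \<gamma> (snd z) = 0}"
    proof (rule continuous_closed_preimage_constant)
      have "continuous_on {0..1} \<gamma>" "continuous_on {0..1} \<delta>"
        using \<gamma> \<delta> by (auto simp: simple_path_def path_def)
      then show "continuous_on ({a..b} \<times> {0..1}) (\<lambda>z. \<delta> (fst z) - \<gamma> (snd z))"
        by (intro continuous_intros) (use ab in \<open>auto intro!: continuous_intros elim!: continuous_on_compose2\<close>)
    qed (intro closed_Times; simp)
    moreover have "{z \<in> {a..b} \<times> {0..1}. \<delta> (fst z) - \<gamma> (snd z) = 0} = (\<lambda>x. (x, \<psi> x)) ` {a..b}"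
    proof (intro equalityI subsetI)
      fix z assume z: "z \<in> {z \<in> {a..b} \<times> {0..1}. \<delta> (fst z) - \<gamma> (snd z) = 0}"
      then have "snd z = \<psi> (fst z)" using ab by (intro uniq) auto
      then show "z \<in> (\<lambda>x. (x, \<psi> x)) ` {a..b}" using z by (cases z) auto
    next
      fix z assume "z \<in> (\<lambda>x. (x, \<psi> x)) ` {a..b}"
      then obtain x where x: "z = (x, \<psi> x)" "x \<in> {a..b}" by blast
      then have "x \<in> {0<..<1}" using ab by auto
      then show "z \<in> {z \<in> {a..b} \<times> {0..1}. \<delta> (fst z) - \<gamma> (snd z) = 0}" using x \<psi>[of x] by auto
    qed
    ultimately show "closed ((\<lambda>x. (x, \<psi> x)) ` {a..b})" by simp
  qed simp
  have "isCont \<psi> s" if "s \<in> {0<..<1}" for s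
  proof -
    have "continuous_on {s/2..(1+s)/2} \<psi>" using that by (intro cont) auto
    then show ?thesis by (rule continuous_on_interior) (use that in auto)
  qed
  then have "continuous_on {0<..<1} \<psi>" by (simp add: continuous_at_imp_continuous_on)
  moreover have "inj_on \<psi> {0<..<1}"
  proof (rule inj_onI)
    fix x y assume xy: "x \<in> {0<..<1}" "y \<in> {0<..<1}" "\<psi> x = \<psi> y"
    then have "\<delta> x = \<delta> y" using \<psi> by metis
    then show "x = y" using loop_eqD[OF \<delta>(1), of x y] xy by auto
  qed
  ultimately have "strict_mono_on {0<..<1} \<psi> \<or> strict_antimono_on {0<..<1} \<psi>"
    using injective_eq_monotone_map[of "{0<..<1}" \<psi>] is_interval_oo by blast
  moreover have "\<psi> s1 < \<psi> s2"
    using uniq[of s1 t1] uniq[of s2 t2] s t st by auto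
  moreover have "\<not> strict_antimono_on {0<..<1} \<psi>"
  proof
    assume "strict_antimono_on {0<..<1} \<psi>"
    then have "\<psi> s2 < \<psi> s1" using s by (auto simp: monotone_on_def)
    then show False using \<open>\<psi> s1 < \<psi> s2\<close> by simp
  qed
  ultimately have mono: "strict_mono_on {0<..<1} \<psi>" by blast
  \<comment> \<open>The description of \<open>\<psi>\<close> is meaningful in the open interval
    only; the values at the ends are filled in.\<close>
  define \<phi> where "\<phi> s = (if s \<le> 0 then 0 else if s \<ge> 1 then 1 else \<psi> s)" for s
  have \<phi>01: "\<phi> 0 = 0" "\<phi> 1 = 1" by (auto simp: \<phi>_def)
  have sm: "strict_mono_on {0..1} \<phi>"
  proof (rule strict_mono_onI)
    fix x y :: real assume xy: "x \<in> {0..1}" "y \<in> {0..1}" "x < y"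
    have "0 < \<psi> x" if "0 < x" using \<psi>[of x] that xy by auto
    moreover have "\<psi> x < 1" if "0 < x" using \<psi>[of x] that xy by auto
    moreover have "0 < \<psi> y" if "y < 1" using \<psi>[of y] that xy by auto
    moreover have "\<psi> x < \<psi> y" if "0 < x" "y < 1" using mono that xy by (auto simp: monotone_on_def)
    ultimately show "\<phi> x < \<phi> y" using xy by (auto simp: \<phi>_def)
  qed
  have "\<exists>x\<in>{0..1}. \<phi> x = t" if "t \<in> {0..1}" for t
  proof (cases "t = 0 \<or> t = 1")
    case True then show ?thesis using \<phi>01 by force
  next
    case False
    then have t: "t \<in> {0<..<1}" using that by auto
    obtain x where x: "x \<in> {0<..<1}" "\<delta> x = \<gamma> t"
      using ex[OF \<gamma>(1) \<delta> eq t] by blast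
    then have "t = \<psi> x" using uniq[of x t] that by auto
    then have "\<phi> x = t" using x by (auto simp: \<phi>_def)
    then show ?thesis using x by force
  qed
  moreover have "\<phi> x \<in> {0..1}" if "x \<in> {0..1}" for x
    using \<psi>[of x] that by (auto simp: \<phi>_def)
  ultimately have "\<phi> ` {0..1} = {0..1}" by (auto simp: image_iff) (metis atLeastAtMost_iff)
  moreover have "\<forall>t\<in>{0..1}. \<delta> t = \<gamma> (\<phi> t)"
  proof
    fix t :: real assume t: "t \<in> {0..1}"
    consider "t = 0" | "t = 1" | "t \<in> {0<..<1}" using t by force
    then show "\<delta> t = \<gamma> (\<phi> t)"
      by cases (use \<gamma>(2) \<delta>(2) eq(2) \<phi>01 \<psi>[of t] in \<open>auto simp: pathstart_def pathfinish_def \<phi>_def\<close>)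
  qed
  ultimately show ?thesis using sm \<phi>01 by blast
qed

text \<open>The hypothesis moves the starting point of \<open>\<gamma>\<close>, whereas
  \<open>same_oriented_loop\<close> moves that of \<open>L\<close>. Undoing the shift by
  \<open>b\<close> amounts to starting \<open>\<phi>\<close> at time \<open>1 - b\<close> and
  wrapping it around.\<close>

lemma same_oriented_loop_shift:
  fixes L \<gamma> :: "real \<Rightarrow> 'a::euclidean_space"
  assumes \<gamma>: "pathfinish \<gamma> = pathstart \<gamma>" and b: "b \<in> {0..1}"
    and \<phi>: "strict_mono_on {0..1} \<phi>" "\<phi> ` {0..1} = {0..1}" "\<phi> 0 = 0" "\<phi> 1 = 1"
    and eq: "\<And>t. t \<in> {0..1} \<Longrightarrow> shiftpath b \<gamma> t = L (\<phi> t)"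
  shows "same_oriented_loop L \<gamma>"
proof -
  define c where "c = 1 - b"
  define d where "d = \<phi> c"
  have c: "c \<in> {0..1}" using b by (auto simp: c_def)
  have m: "\<phi> x < \<phi> y" if "x < y" "0 \<le> x" "y \<le> 1" for x y
    using \<phi>(1) that by (auto simp: monotone_on_def)
  have r: "\<phi> x \<in> {0..1}" if "x \<in> {0..1}" for x using \<phi>(2) that by blast
  have d: "d \<in> {0..1}" using r c by (simp add: d_def)
  \<comment> \<open>The increment of \<open>\<phi>\<close> since time \<open>c\<close>. Beyond time
    1 the function \<open>\<phi>\<close> restarts at 0, which the summand 1 makes up for.\<close>
  define \<psi> where "\<psi> t = (if c + t \<le> 1 then \<phi> (c + t) - d else \<phi> (c + t - 1) + 1 - d)" for t
  have sm: "strict_mono_on {0..1} \<psi>"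
  proof (rule strict_mono_onI)
    fix x y :: real assume xy: "x \<in> {0..1}" "y \<in> {0..1}" "x < y"
    consider "c + y \<le> 1" | "c + x \<le> 1" "c + y > 1" | "c + x > 1" by linarith
    then show "\<psi> x < \<psi> y"
    proof cases
      case 1 then show ?thesis using m[of "c + x" "c + y"] xy c by (auto simp: \<psi>_def)
    next
      case 2
      then have "\<phi> (c + x) \<le> 1" using r[of "c + x"] xy c by auto
      moreover have "0 < \<phi> (c + y - 1)" using m[of 0 "c + y - 1"] 2 xy c \<phi>(3) by auto
      ultimately show ?thesis using 2 by (simp add: \<psi>_def)
    next
      case 3 then show ?thesis using m[of "c + x - 1" "c + y - 1"] xy c by (auto simp: \<psi>_def)
    qed
  qed
  have "\<psi> x \<in> {0..1}" if x: "x \<in> {0..1}" for x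
  proof (cases "c + x \<le> 1")
    case True
    then have "d \<le> \<phi> (c + x)" using m[of c "c + x"] x c by (cases "x = 0") (auto simp: d_def)
    then show ?thesis using r[of "c + x"] True x c d by (auto simp: \<psi>_def)
  next
    case False
    then have "\<phi> (c + x - 1) \<le> d" using m[of "c + x - 1" c] x c by (cases "x = 1") (auto simp: d_def)
    then show ?thesis using r[of "c + x - 1"] False x c d by (auto simp: \<psi>_def)
  qed
  moreover have "\<exists>x\<in>{0..1}. \<psi> x = y" if y: "y \<in> {0..1}" for y
  proof (cases "y \<le> 1 - d")
    case True
    then have "y + d \<in> \<phi> ` {0..1}" using y d \<phi>(2) by auto
    then obtain z where z: "z \<in> {0..1}" "\<phi> z = y + d" by auto
    have "c \<le> z" using m[of z c] z y c by (force simp: d_def)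
    then show ?thesis using z c by (intro bexI[of _ "z - c"]) (auto simp: \<psi>_def)
  next
    case False
    then have "y + d - 1 \<in> \<phi> ` {0..1}" using y d \<phi>(2) by auto
    then obtain z where z: "z \<in> {0..1}" "\<phi> z = y + d - 1" by auto
    have "z \<le> c" using m[of c z] z y c by (force simp: d_def)
    moreover have "z \<noteq> 0" using z False \<phi>(3) by auto
    ultimately show ?thesis using z c by (intro bexI[of _ "z + 1 - c"]) (auto simp: \<psi>_def)
  qed
  ultimately have im: "\<psi> ` {0..1} = {0..1}" by (auto simp: image_iff) (metis atLeastAtMost_iff)
  have "\<gamma> t = shiftpath d L (\<psi> t)" if t: "t \<in> {0..1}" for t
  proof -
    have "\<gamma> t = shiftpath c (shiftpath b \<gamma>) t"
      unfolding c_def using shiftpath_shiftpath[OF \<gamma> b t] by simp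
    also have "\<dots> = shiftpath d L (\<psi> t)"
    proof (cases "c + t \<le> 1")
      case True
      then show ?thesis using eq[of "c + t"] r[of "c + t"] c t by (simp add: shiftpath_def \<psi>_def)
    next
      case False
      then have "0 < \<phi> (c + t - 1)" using m[of 0 "c + t - 1"] c t \<phi>(3) by auto
      then show ?thesis using False eq[of "c + t - 1"] c t by (simp add: shiftpath_def \<psi>_def)
    qed
    finally show ?thesis .
  qed
  then show ?thesis unfolding same_oriented_loop_def using sm im d by blast
qed

text \<open>The orientation of a loop is detected by the order in which it passes two points after
  its starting point.\<close>

lemma same_oriented_loop_or_reverse:
  fixes L L' \<gamma> :: "real \<Rightarrow> 'a::euclidean_space"
  assumes L: "simple_path L" "pathfinish L = pathstart L" "path_image L = path_image \<gamma>"
    and L': "simple_path L'" "pathfinish L' = pathstart L'" "path_image L' = path_image \<gamma>"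
    and start: "pathstart L' = pathstart L"
    and \<gamma>: "simple_path \<gamma>" "pathfinish \<gamma> = pathstart \<gamma>"
    and s: "0 < s1" "s1 < s2" "s2 < 1" and t: "0 < t1" "t1 < t2" "t2 < 1"
    and pts: "L s1 = L' t2" "L s2 = L' t1"
  shows "same_oriented_loop L \<gamma> \<or> same_oriented_loop L' \<gamma>"
proof -
  have "pathstart L \<in> path_image \<gamma>" using L(3) by auto
  then obtain b where b: "b \<in> {0..1}" "\<gamma> b = pathstart L" by (auto simp: path_image_def)
  define \<gamma>' where "\<gamma>' = shiftpath b \<gamma>"
  have \<gamma>': "simple_path \<gamma>'" "pathfinish \<gamma>' = pathstart \<gamma>'" "path_image \<gamma>' = path_image \<gamma>"
    "pathstart \<gamma>' = pathstart L"
    using b \<gamma> by (simp_all add: \<gamma>'_def simple_path_shiftpath path_image_shiftpath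
        closed_shiftpath pathstart_shiftpath)
  have *: "\<exists>r. 0 < r \<and> r < 1 \<and> \<gamma>' r = L s" if s: "0 < s" "s < 1" for s
  proof -
    have "L s \<in> path_image \<gamma>'" using s L(3) \<gamma>'(3) by (auto simp: path_image_def)
    then obtain r where r: "r \<in> {0..1}" "\<gamma>' r = L s" by (auto simp: path_image_def)
    have "L s \<noteq> L 0" using loop_eqD[OF L(1), of s 0] s by auto
    then have "r \<noteq> 0" "r \<noteq> 1" using r \<gamma>'(2,4) by (auto simp: pathstart_def pathfinish_def)
    then show ?thesis using r by (intro exI[of _ r]) (auto simp: less_le)
  qed
  obtain r1 where r1: "0 < r1" "r1 < 1" "\<gamma>' r1 = L s1" using *[of s1] s by auto
  obtain r2 where r2: "0 < r2" "r2 < 1" "\<gamma>' r2 = L s2" using *[of s2] s by auto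
  have "r1 \<noteq> r2" using r1 r2 loop_eqD[OF L(1), of s1 s2] s by auto
  then consider "r1 < r2" | "r2 < r1" by linarith
  then show ?thesis
  proof cases
    case 1
    obtain \<phi> where "strict_mono_on {0..1} \<phi>" "\<phi> ` {0..1} = {0..1}" "\<phi> 0 = 0" "\<phi> 1 = 1"
      "\<forall>t\<in>{0..1}. \<gamma>' t = L (\<phi> t)"
      using same_start_loops[OF L(1,2) \<gamma>'(1,2) _ \<gamma>'(4)[symmetric], of r1 r2 s1 s2] L(3) \<gamma>'(3) r1 r2 s 1 by auto
    then have "same_oriented_loop L \<gamma>"
      by (intro same_oriented_loop_shift[OF \<gamma>(2) b(1)]) (auto simp: \<gamma>'_def)
    then show ?thesis ..
  next
    case 2
    obtain \<phi> where "strict_mono_on {0..1} \<phi>" "\<phi> ` {0..1} = {0..1}" "\<phi> 0 = 0" "\<phi> 1 = 1"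
      "\<forall>t\<in>{0..1}. \<gamma>' t = L' (\<phi> t)"
      using same_start_loops[OF L'(1,2) \<gamma>'(1,2), of r2 r1 t1 t2] L'(3) \<gamma>'(3,4) start pts r1 r2 t 2 by auto
    then have "same_oriented_loop L' \<gamma>"
      by (intro same_oriented_loop_shift[OF \<gamma>(2) b(1)]) (auto simp: \<gamma>'_def)
    then show ?thesis ..
  qed
qed

section \<open>Bridge number and braid index\<close>

lemma polygon_edges_nth:
  "polygon_edges xs = (\<lambda>i. (xs ! i, xs ! (Suc i mod length xs))) ` {..<length xs}"
  unfolding polygon_edges_def set_zip by (auto simp: nth_rotate1)

lemma set_nth: "set vs = (\<lambda>i. vs ! i) ` {..<length vs}"
  by (auto simp: set_conv_nth)

lemma set_polygon_edges: "set vs = (\<Union>(v, w)\<in>polygon_edges vs. {v, w})"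
proof -
  have "set vs = fst ` polygon_edges vs"
    unfolding polygon_edges_nth image_image fst_conv by (rule set_nth)
  then show ?thesis using polygon_edges_vertices by fastforce
qed

lemma realize_UN: "realize (\<Union>x\<in>A. F x) p = (\<Union>x\<in>A. realize (F x) p)"
  by (auto simp: realize_def)

lemma polygonal_support_realize:
  assumes "\<And>vs. vs \<in> P \<Longrightarrow> vs \<noteq> []"
  shows "polygonal_support P = realize (\<Union>vs\<in>P. polygon_edges vs) (\<lambda>x. x)"
  unfolding polygonal_support_def realize_UN
  using assms by (intro SUP_cong refl path_image_closed_polygon)

section \<open>Subdivision of polygons\<close>

definition subdivide :: "('a \<Rightarrow> 'a \<Rightarrow> 'a) \<Rightarrow> 'a list \<Rightarrow> 'a list" where
  "subdivide m vs = map (\<lambda>r. if even r then vs ! (r div 2)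
     else m (vs ! (r div 2)) (vs ! (Suc (r div 2) mod length vs))) [0..<2 * length vs]"

definition half_edges :: "('a \<Rightarrow> 'a \<Rightarrow> 'a) \<Rightarrow> ('a \<times> 'a) set \<Rightarrow> ('a \<times> 'a) set" where
  "half_edges m E = (\<lambda>(v, w). (v, m v w)) ` E \<union> (\<lambda>(v, w). (m v w, w)) ` E"

lemma half_edges_iff:
  "(a, b) \<in> half_edges m E \<longleftrightarrow> (\<exists>w. (a, w) \<in> E \<and> b = m a w) \<or> (\<exists>v. (v, b) \<in> E \<and> a = m v b)"
  by (force simp: half_edges_def)

lemma half_edgesE:
  assumes "(a, b) \<in> half_edges m E"
  obtains v w where "(v, w) \<in> E" "(a, b) = (v, m v w) \<or> (a, b) = (m v w, w)"
  using assms unfolding half_edges_iff by blast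

lemma realize_half_edges_eq:
  "realize (half_edges m E) (\<lambda>x. x) = (\<Union>(v, w)\<in>E. closed_segment v (m v w) \<union> closed_segment (m v w) w)"
  by (auto simp: realize_def half_edges_def)

lemma realize_Int: "realize E (\<lambda>x. x) \<inter> H = (\<Union>e\<in>E. closed_segment (fst e) (snd e) \<inter> H)"
  by (auto simp: realize_def case_prod_unfold)

lemma half_edges_UN: "half_edges m (\<Union>x\<in>A. F x) = (\<Union>x\<in>A. half_edges m (F x))"
  by (auto simp: half_edges_def)

lemma lessThan_double: "{..<2 * n} = (\<lambda>i. 2 * i) ` {..<n} \<union> (\<lambda>i. Suc (2 * i)) ` {..<n}" for n :: nat
proof (intro equalityI subsetI)
  fix r assume r: "r \<in> {..<2 * n}"
  show "r \<in> (\<lambda>i. 2 * i) ` {..<n} \<union> (\<lambda>i. Suc (2 * i)) ` {..<n}"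
  proof (cases "even r")
    case True then show ?thesis using r by (intro UnI1 image_eqI[of _ _ "r div 2"]) auto
  next
    case False then show ?thesis using r by (intro UnI2 image_eqI[of _ _ "r div 2"]) auto
  qed
qed auto

lemma polygon_edges_subdivide: "polygon_edges (subdivide m vs) = half_edges m (polygon_edges vs)"
proof -
  define n where "n = length vs"
  define f where "f r = (if even r then vs ! (r div 2)
     else m (vs ! (r div 2)) (vs ! (Suc (r div 2) mod n)))" for r
  have s: "subdivide m vs = map f [0..<2 * n]" by (simp add: subdivide_def f_def n_def)
  have "polygon_edges (subdivide m vs) = (\<lambda>r. (f r, f (Suc r mod (2 * n)))) ` {..<2 * n}"
    unfolding polygon_edges_nth s by (intro image_cong) auto
  also have "\<dots> = (\<lambda>i. (f (2 * i), f (Suc (2 * i) mod (2 * n)))) ` {..<n} \<union>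
      (\<lambda>i. (f (Suc (2 * i)), f (Suc (Suc (2 * i)) mod (2 * n)))) ` {..<n}"
    unfolding lessThan_double image_Un image_image ..
  also have "(\<lambda>i. (f (2 * i), f (Suc (2 * i) mod (2 * n)))) ` {..<n} =
      (\<lambda>i. (vs ! i, m (vs ! i) (vs ! (Suc i mod n)))) ` {..<n}"
    by (intro image_cong) (auto simp: f_def)
  also have "(\<lambda>i. (f (Suc (2 * i)), f (Suc (Suc (2 * i)) mod (2 * n)))) ` {..<n} =
      (\<lambda>i. (m (vs ! i) (vs ! (Suc i mod n)), vs ! (Suc i mod n))) ` {..<n}"
  proof (intro image_cong refl)
    fix i
    have "Suc (Suc (2 * i)) mod (2 * n) = 2 * (Suc i mod n)"
      by (metis mult_Suc_right mult_mod_right add_2_eq_Suc)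
    then show "(f (Suc (2 * i)), f (Suc (Suc (2 * i)) mod (2 * n))) =
        (m (vs ! i) (vs ! (Suc i mod n)), vs ! (Suc i mod n))" by (simp add: f_def)
  qed
  finally show ?thesis
    unfolding half_edges_def polygon_edges_nth[of vs] image_image by (simp add: n_def)
qed

lemma set_subdivide:
  "set (subdivide m vs) = set vs \<union> (\<lambda>(v, w). m v w) ` polygon_edges vs"
proof -
  have "set (subdivide m vs) = (\<lambda>i. vs ! i) ` {..<length vs} \<union>
     (\<lambda>i. m (vs ! i) (vs ! (Suc i mod length vs))) ` {..<length vs}"
    unfolding subdivide_def set_map set_upt atLeast0LessThan lessThan_double image_Un image_image by simp
  then show ?thesis
    unfolding polygon_edges_nth image_image prod.case by (simp only: set_nth[symmetric])
qed

lemma distinct_subdivide: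
  assumes "distinct vs" "inj_on (\<lambda>(v, w). m v w) (polygon_edges vs)"
    and "\<And>v w. (v, w) \<in> polygon_edges vs \<Longrightarrow> m v w \<notin> set vs"
  shows "distinct (subdivide m vs)"
proof -
  define n where "n = length vs"
  define e where "e i = (vs ! i, vs ! (Suc i mod n))" for i
  have e: "e i \<in> polygon_edges vs" if "i < n" for i
    using that unfolding polygon_edges_nth e_def n_def by auto
  have m1: "i = j" if "i < n" "j < n" "m (fst (e i)) (snd (e i)) = m (fst (e j)) (snd (e j))" for i j
  proof -
    have "e i = e j" using inj_onD[OF assms(2) _ e[OF that(1)] e[OF that(2)]] that by (simp add: e_def)
    then show ?thesis using assms(1) that by (simp add: e_def nth_eq_iff_index_eq n_def)
  qed
  have m2: "m (fst (e i)) (snd (e i)) \<noteq> vs ! j" if "i < n" "j < n" for i j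
    using assms(3)[of "fst (e i)" "snd (e i)"] e[OF that(1)] that by (auto simp: n_def in_set_conv_nth)
  have "r = s" if rs: "r < 2 * n" "s < 2 * n" and eq: "(if even r then vs ! (r div 2) else m (fst (e (r div 2))) (snd (e (r div 2)))) =
     (if even s then vs ! (s div 2) else m (fst (e (s div 2))) (snd (e (s div 2))))" for r s
  proof -
    have d: "r div 2 < n" "s div 2 < n" using rs by auto
    consider "even r" "even s" | "odd r" "odd s" | "even r" "odd s" | "odd r" "even s" by blast
    then have "even r = even s \<and> r div 2 = s div 2"
    proof cases
      case 1 then show ?thesis using eq d assms(1) by (simp add: nth_eq_iff_index_eq n_def)
    next
      case 2 then show ?thesis using eq d m1 by simp
    next
      case 3 then show ?thesis using eq d m2[of "s div 2" "r div 2"] by simp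
    next
      case 4 then show ?thesis using eq d m2[of "r div 2" "s div 2"] by simp
    qed
    then show ?thesis by (metis even_two_times_div_two odd_two_times_div_two_succ)
  qed
  then have "inj_on (\<lambda>r. if even r then vs ! (r div 2) else m (fst (e (r div 2))) (snd (e (r div 2)))) {..<2 * n}"
    by (intro inj_onI) auto
  then show ?thesis
    unfolding subdivide_def distinct_map set_upt atLeast0LessThan e_def n_def fst_conv snd_conv by simp
qed

text \<open>Of the two ends of its edge, a half contains only the one it keeps. Halves of different
  edges thus meet, if at all, in an old vertex that both keep, and the two halves of one edge meet
  in the new point.\<close>

lemma embedded_half_edges:
  fixes E :: "(R3 \<times> R3) set"
  assumes E: "embedded E (\<lambda>x. x)" and m: "\<And>v w. (v, w) \<in> E \<Longrightarrow> m v w \<in> open_segment v w"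
  shows "embedded (half_edges m E) (\<lambda>x. x)"
    and "inj_on (\<lambda>(v, w). m v w) E"
    and "\<And>v w a b. (v, w) \<in> E \<Longrightarrow> (a, b) \<in> E \<Longrightarrow> m v w \<notin> {a, b}"
proof -
  have mc: "m v w \<in> closed_segment v w" "m v w \<noteq> v" "m v w \<noteq> w" if "(v, w) \<in> E" for v w
    using m[OF that] by (auto simp: open_segment_def)
  have mm: "closed_segment v (m v w) \<inter> closed_segment (m v w) w = {m v w}" if "(v, w) \<in> E" for v w
    by (rule Int_closed_segment) (use mc[OF that] in auto)
  have par: "closed_segment a b \<subseteq> closed_segment v w \<and> (\<forall>x\<in>closed_segment a b. x \<in> {v, w} \<longrightarrow> x \<in> {a, b})"
    if e: "(v, w) \<in> E" "(a, b) = (v, m v w) \<or> (a, b) = (m v w, w)" for v w a b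
  proof -
    have "closed_segment a b \<subseteq> closed_segment v w"
      using e(2) mc(1)[OF e(1)] by (auto intro!: subset_closed_segment[THEN iffD2])
    moreover have "w \<notin> closed_segment v (m v w)" "v \<notin> closed_segment (m v w) w"
      by (metis IntI ends_in_segment(2) singletonD mm[OF e(1)] mc(3)[OF e(1)])
        (metis IntI ends_in_segment(1) singletonD mm[OF e(1)] mc(2)[OF e(1)])
    ultimately show ?thesis using e(2) by auto
  qed
  show "embedded (half_edges m E) (\<lambda>x. x)"
  proof (rule embeddedI)
    show "a \<noteq> b" if "(a, b) \<in> half_edges m E" for a b
      using that mc by (metis half_edges_iff)
    fix a b c d x assume h: "(a, b) \<in> half_edges m E" "(c, d) \<in> half_edges m E" "(a, b) \<noteq> (c, d)"
      "x \<in> closed_segment a b" "x \<in> closed_segment c d"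
    obtain v w where vw: "(v, w) \<in> E" "(a, b) = (v, m v w) \<or> (a, b) = (m v w, w)"
      using h(1) by (rule half_edgesE)
    obtain v' w' where vw': "(v', w') \<in> E" "(c, d) = (v', m v' w') \<or> (c, d) = (m v' w', w')"
      using h(2) by (rule half_edgesE)
    show "x \<in> (\<lambda>x. x) ` ({a, b} \<inter> {c, d})"
    proof (cases "(v, w) = (v', w')")
      case True
      then have "x \<in> closed_segment v (m v w) \<inter> closed_segment (m v w) w" using h(3-5) vw(2) vw'(2) by blast
      then have "x = m v w" using mm[OF vw(1)] by blast
      then show ?thesis using vw vw' True by blast
    next
      case False
      then have "x \<in> {v, w} \<inter> {v', w'}"
        using embedded_meet[OF E vw(1) vw'(1) False] h(4,5) par[OF vw] par[OF vw'] unfolding image_ident by blast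
      then show ?thesis using h(4,5) par[OF vw] par[OF vw'] by blast
    qed
  qed
  show "inj_on (\<lambda>(v, w). m v w) E"
  proof (rule inj_onI, clarify)
    fix v w a b assume e: "(v, w) \<in> E" "(a, b) \<in> E" "m v w = m a b"
    show "v = a \<and> w = b"
    proof (rule ccontr)
      assume "\<not> (v = a \<and> w = b)"
      then have "(v, w) \<noteq> (a, b)" by simp
      then show False using embedded_meet[OF E e(1,2)] mc[OF e(1)] mc[OF e(2)] e(3) by auto
    qed
  qed
  show "m v w \<notin> {a, b}" if "(v, w) \<in> E" "(a, b) \<in> E" for v w a b
  proof
    assume x: "m v w \<in> {a, b}"
    then have "m v w \<in> closed_segment a b" by auto
    then show False
      using embedded_meet[OF E that] mc[OF that(1)] x by (cases "(v, w) = (a, b)") auto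
  qed
qed

lemma realize_half_edges:
  fixes E :: "(R3 \<times> R3) set"
  assumes m: "\<And>v w. (v, w) \<in> E \<Longrightarrow> m v w \<in> open_segment v w"
  shows "realize (half_edges m E) (\<lambda>x. x) = realize E (\<lambda>x. x)"
proof -
  have "closed_segment v (m v w) \<union> closed_segment (m v w) w = closed_segment v w" if "(v, w) \<in> E" for v w
    by (rule Un_closed_segment) (use m[OF that] in \<open>auto simp: open_segment_def\<close>)
  then show ?thesis
    unfolding realize_half_edges_eq unfolding realize_def case_prod_unfold
    by (intro SUP_cong refl) (metis prod.collapse)
qed

section \<open>Compression of a closed braid\<close>

text \<open>For positive \<open>t\<close>, division by \<open>1 + t * \<bar>y\<bar>\<close> fixes
  the plane \<open>y = 0\<close> and moves everything else into the slab
  \<open>\<bar>y\<bar> < 1 / t\<close>. Scaling all coordinates alike, and not just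
  \<open>y\<close>, keeps the segments on either side straight.\<close>

definition squeeze :: "real \<Rightarrow> R3 \<Rightarrow> R3" where
  "squeeze t v = (1 / (1 + t * \<bar>fst (snd v)\<bar>)) *\<^sub>R v"

text \<open>The sign of \<open>y\<close> is preserved, so the terms with absolute values cancel in
  \<open>e\<close>; thus \<open>y\<close>, and with it the scaling factor, is determined by the
  image.\<close>

lemma inj_squeeze:
  assumes "t \<ge> 0" shows "inj (squeeze t)"
proof (rule injI)
  fix v w assume eq: "squeeze t v = squeeze t w"
  define y y' where "y = fst (snd v)" and "y' = fst (snd w)"
  have pos: "1 + t * \<bar>y\<bar> > 0" "1 + t * \<bar>y'\<bar> > 0" using assms by (auto intro: add_pos_nonneg)
  have "fst (snd (squeeze t v)) = fst (snd (squeeze t w))" using eq by simp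
  then have "y / (1 + t * \<bar>y\<bar>) = y' / (1 + t * \<bar>y'\<bar>)" by (simp add: squeeze_def y_def y'_def)
  then have e: "y * (1 + t * \<bar>y'\<bar>) = y' * (1 + t * \<bar>y\<bar>)" using pos by (simp add: field_simps)
  have "sgn (y * (1 + t * \<bar>y'\<bar>)) = sgn (y' * (1 + t * \<bar>y\<bar>))" using e by simp
  then have s: "sgn y = sgn y'" using pos by (simp add: sgn_mult)
  have "y * \<bar>y'\<bar> = y' * \<bar>y\<bar>" using s by (auto simp: sgn_if abs_if split: if_splits)
  then have "y = y'" using e by (simp add: algebra_simps)
  then show "v = w" using eq pos by (simp add: squeeze_def y_def[symmetric] y'_def[symmetric])
qed

text \<open>On each of the half-spaces bounded by the plane \<open>y = 0\<close>, \<^term>\<open>squeeze t\<close> is projective.\<close>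

lemma squeeze_segment:
  assumes t: "t \<ge> 0" and same: "(fst (snd a) \<ge> 0 \<and> fst (snd b) \<ge> 0) \<or> (fst (snd a) \<le> 0 \<and> fst (snd b) \<le> 0)"
  shows "closed_segment (squeeze t a) (squeeze t b) \<subseteq> squeeze t ` closed_segment a b"
proof
  fix z assume "z \<in> closed_segment (squeeze t a) (squeeze t b)"
  then obtain l where l: "0 \<le> l" "l \<le> 1" "z = (1 - l) *\<^sub>R squeeze t a + l *\<^sub>R squeeze t b"
    by (auto simp: in_segment)
  \<comment> \<open>The common sign of the two \<open>y\<close>-coordinates, which makes
    \<bar>y\<bar> linear along the segment.\<close>
  obtain s :: real where s: "\<bar>fst (snd a)\<bar> = s * fst (snd a)" "\<bar>fst (snd b)\<bar> = s * fst (snd b)" "\<bar>s\<bar> = 1"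
    using same by (elim disjE) (auto intro: that[of 1] that[of "-1"])
  have sgn: "\<bar>(1 - u) * fst (snd a) + u * fst (snd b)\<bar> = s * ((1 - u) * fst (snd a) + u * fst (snd b))"
    if "0 \<le> u" "u \<le> 1" for u
  proof -
    have "s * ((1 - u) * fst (snd a) + u * fst (snd b)) = (1 - u) * \<bar>fst (snd a)\<bar> + u * \<bar>fst (snd b)\<bar>"
      unfolding s by (simp add: algebra_simps)
    also have "\<dots> \<ge> 0" using that by simp
    finally show ?thesis using s(3) by (metis abs_mult abs_of_nonneg mult_1)
  qed
  define ka kb where "ka = 1 + t * \<bar>fst (snd a)\<bar>" and "kb = 1 + t * \<bar>fst (snd b)\<bar>"
  have k: "ka > 0" "kb > 0" using t by (auto simp: ka_def kb_def intro: add_pos_nonneg)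
  define D where "D = (1 - l) / ka + l / kb"
  have D: "D > 0"
  proof (cases "l = 0")
    case False
    then have "l / kb > 0" using l k by auto
    moreover have "(1 - l) / ka \<ge> 0" using l k by auto
    ultimately show ?thesis by (simp add: D_def)
  qed (use k in \<open>simp add: D_def\<close>)
  \<comment> \<open>A projective map does not preserve division ratios: the weights of
    \<open>a\<close> and \<open>b\<close> are divided by the denominators \<open>ka\<close> and
    \<open>kb\<close> and then normalized by \<open>D\<close>.\<close>
  define u where "u = l / kb / D"
  have "(1 - l) / ka / D + l / kb / D = 1"
    using D unfolding add_divide_distrib[symmetric] D_def[symmetric] by simp
  then have u1: "1 - u = (1 - l) / ka / D" by (simp add: u_def)
  have "0 \<le> u" using l k D by (simp add: u_def)
  moreover have "0 \<le> 1 - u" unfolding u1 using l k D by simp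
  ultimately have u: "0 \<le> u" "u \<le> 1" by auto
  define c where "c = (1 - u) *\<^sub>R a + u *\<^sub>R b"
  have "1 + t * \<bar>fst (snd c)\<bar> = 1 + t * (s * ((1 - u) * fst (snd a) + u * fst (snd b)))"
    using sgn[OF u] by (simp add: c_def)
  also have "\<dots> = (1 - u) * ka + u * kb" unfolding ka_def kb_def s by (simp add: algebra_simps)
  also have "(1 - u) * ka = (1 - l) / D" unfolding u1 using k by simp
  also have "u * kb = l / D" unfolding u_def using k by simp
  also have "(1 - l) / D + l / D = 1 / D" by (simp add: add_divide_distrib[symmetric])
  finally have "squeeze t c = D *\<^sub>R c" by (simp add: squeeze_def)
  also have "\<dots> = (D * (1 - u)) *\<^sub>R a + (D * u) *\<^sub>R b" by (simp add: c_def algebra_simps)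
  also have "\<dots> = z"
    using D l(3) unfolding u1 by (simp add: u_def squeeze_def ka_def[symmetric] kb_def[symmetric])
  finally have "z = squeeze t c" ..
  moreover have "c \<in> closed_segment a b" using u by (auto simp: c_def in_segment)
  ultimately show "z \<in> squeeze t ` closed_segment a b" by blast
qed

text \<open>The quotient \<open>y / (y - y')\<close> is the parameter at which an edge crosses the
  plane \<open>y = 0\<close>. The other edges are halved, so that one subdivision scheme serves all
  edges.\<close>

definition cut_point :: "R3 \<Rightarrow> R3 \<Rightarrow> R3" where
  "cut_point v w = (let y = fst (snd v); y' = fst (snd w) in
     linepath v w (if y * y' < 0 then y / (y - y') else 1 / 2))"

text \<open>The determinant of the projections to the first two coordinates; its positivity is the
  condition on edges in \<open>closed_braid\<close>.\<close>

definition wedge :: "R3 \<Rightarrow> R3 \<Rightarrow> real" where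
  "wedge v w = fst v * fst (snd w) - fst (snd v) * fst w"

text \<open>\<open>wedge\<close> is bilinear and alternating, so the two pieces inherit the
  fractions \<open>u\<close> and \<open>1 - u\<close> of its positive value.\<close>

lemma cut_point:
  assumes "wedge v w > 0"
  shows "cut_point v w \<in> open_segment v w"
    and "wedge v (cut_point v w) > 0" "wedge (cut_point v w) w > 0"
    and "(fst (snd v) \<ge> 0 \<and> fst (snd (cut_point v w)) \<ge> 0) \<or> (fst (snd v) \<le> 0 \<and> fst (snd (cut_point v w)) \<le> 0)"
    and "(fst (snd (cut_point v w)) \<ge> 0 \<and> fst (snd w) \<ge> 0) \<or> (fst (snd (cut_point v w)) \<le> 0 \<and> fst (snd w) \<le> 0)"
proof -
  define y y' where "y = fst (snd v)" and "y' = fst (snd w)"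
  define u where "u = (if y * y' < 0 then y / (y - y') else 1 / 2)"
  have c: "cut_point v w = linepath v w u" by (simp add: cut_point_def u_def y_def y'_def Let_def)
  have u: "0 < u" "u < 1"
    by (auto simp: u_def mult_less_0_iff divide_less_eq zero_less_divide_iff)
  have "v \<noteq> w" using assms by (auto simp: wedge_def)
  then show "cut_point v w \<in> open_segment v w"
    unfolding c using u by (auto simp: in_segment linepath_def)
  have "wedge v (cut_point v w) = u * wedge v w" "wedge (cut_point v w) w = (1 - u) * wedge v w"
    unfolding c by (auto simp: wedge_def linepath_def algebra_simps)
  then show "wedge v (cut_point v w) > 0" "wedge (cut_point v w) w > 0" using u assms by simp_all
  have "fst (snd (cut_point v w)) = (1 - u) * y + u * y'"
    by (simp add: c linepath_def y_def y'_def)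
  also have "\<dots> = y - u * (y - y')" by (simp add: algebra_simps)
  also have "\<dots> = (if y * y' < 0 then 0 else (y + y') / 2)"
  proof (cases "y * y' < 0")
    case True
    then have "u * (y - y') = y" by (auto simp: u_def)
    then show ?thesis using True by simp
  qed (simp add: u_def field_simps)
  finally have fc: "fst (snd (cut_point v w)) = (if y * y' < 0 then 0 else (y + y') / 2)" .
  show "(fst (snd v) \<ge> 0 \<and> fst (snd (cut_point v w)) \<ge> 0) \<or> (fst (snd v) \<le> 0 \<and> fst (snd (cut_point v w)) \<le> 0)"
    "(fst (snd (cut_point v w)) \<ge> 0 \<and> fst (snd w) \<ge> 0) \<or> (fst (snd (cut_point v w)) \<le> 0 \<and> fst (snd w) \<le> 0)"
    unfolding fc y_def[symmetric] y'_def[symmetric] by (auto simp: mult_less_0_iff not_less)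
qed

text \<open>For large \<open>t\<close>, the first coordinate of the squeezed point is, up to a factor, close to \<open>x / \<bar>y\<bar>\<close>,
  which is monotone along a braid in each of the two half-spaces.\<close>

lemma squeeze_monotone:
  assumes t: "t \<ge> 0" "t * wedge a b > \<bar>fst a - fst b\<bar>"
  shows "fst (snd a) \<ge> 0 \<Longrightarrow> fst (snd b) \<ge> 0 \<Longrightarrow> fst (squeeze t b) < fst (squeeze t a)"
    and "fst (snd a) \<le> 0 \<Longrightarrow> fst (snd b) \<le> 0 \<Longrightarrow> fst (squeeze t a) < fst (squeeze t b)"
proof -
  define ka kb where "ka = 1 + t * \<bar>fst (snd a)\<bar>" and "kb = 1 + t * \<bar>fst (snd b)\<bar>"
  have k: "ka > 0" "kb > 0" using t by (auto simp: ka_def kb_def intro: add_pos_nonneg)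
  have s: "fst (squeeze t a) = fst a / ka" "fst (squeeze t b) = fst b / kb"
    by (simp_all add: squeeze_def ka_def kb_def)
  show "fst (squeeze t b) < fst (squeeze t a)" if "fst (snd a) \<ge> 0" "fst (snd b) \<ge> 0"
  proof -
    have "fst a * kb - fst b * ka = fst a - fst b + t * wedge a b"
      using that by (simp add: ka_def kb_def wedge_def algebra_simps)
    then have "fst b * ka < fst a * kb" using t(2) by linarith
    then show ?thesis unfolding s using k by (simp add: field_simps)
  qed
  show "fst (squeeze t a) < fst (squeeze t b)" if "fst (snd a) \<le> 0" "fst (snd b) \<le> 0"
  proof -
    have "fst b * ka - fst a * kb = fst b - fst a + t * wedge a b"
      using that by (simp add: ka_def kb_def wedge_def algebra_simps)
    then have "fst a * kb < fst b * ka" using t(2) by linarith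
    then show ?thesis unfolding s using k by (simp add: field_simps)
  qed
qed

abbreviation half_plane :: "R3 set" where "half_plane \<equiv> {(x, y, z). x > 0 \<and> y = 0}"

text \<open>\<open>closed_braid\<close> counts strands by \<open>card\<close>, which is 0 on
  infinite sets, so bounding it from below needs finiteness. An edge with positive
  \<open>wedge\<close> does not lie in the plane \<open>y = 0\<close>, hence crosses it at most
  once.\<close>

lemma finite_half_plane_meet:
  assumes "finite P" "\<And>vs v w. vs \<in> P \<Longrightarrow> (v, w) \<in> polygon_edges vs \<Longrightarrow> wedge v w > 0"
    and "\<And>vs. vs \<in> P \<Longrightarrow> vs \<noteq> []"
  shows "finite (polygonal_support P \<inter> half_plane)"
proof -
  have seg: "finite (closed_segment v w \<inter> half_plane)" if "wedge v w > 0" for v w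
  proof -
    define y y' where "y = fst (snd v)" and "y' = fst (snd w)"
    have "closed_segment v w \<inter> half_plane \<subseteq> {linepath v w (y / (y - y'))}"
    proof
      fix p assume p: "p \<in> closed_segment v w \<inter> half_plane"
      then obtain u where u: "p = (1 - u) *\<^sub>R v + u *\<^sub>R w" by (auto simp: in_segment)
      have "fst (snd p) = 0" using p by (cases p) auto
      then have z: "(1 - u) * y + u * y' = 0" unfolding u by (simp add: y_def y'_def)
      have "y \<noteq> y'"
      proof
        assume "y = y'"
        then have "y = 0" "y' = 0" using z by (auto simp: algebra_simps)
        then show False using that by (simp add: wedge_def y_def y'_def)
      qed
      then have "u = y / (y - y')" using z by (simp add: field_simps)
      then show "p \<in> {linepath v w (y / (y - y'))}" using u by (simp add: linepath_def)
    qed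
    then show ?thesis by (rule finite_subset) simp
  qed
  have sup: "polygonal_support P = realize (\<Union>vs\<in>P. polygon_edges vs) (\<lambda>x. x)"
    by (rule polygonal_support_realize) (rule assms(3))
  have "polygonal_support P \<inter> half_plane = (\<Union>e\<in>(\<Union>vs\<in>P. polygon_edges vs). closed_segment (fst e) (snd e) \<inter> half_plane)"
    unfolding sup realize_Int ..
  also have "finite \<dots>"
  proof (rule finite_UN_I)
    show "finite (\<Union>vs\<in>P. polygon_edges vs)" using assms(1) finite_polygon_edges by blast
    show "finite (closed_segment (fst e) (snd e) \<inter> half_plane)" if "e \<in> (\<Union>vs\<in>P. polygon_edges vs)" for e
      using that assms(2) by (intro seg) (metis UN_E prod.collapse)
  qed
  finally show ?thesis .
qed

text \<open>A maximum is counted at the index before it; as the vertices are distinct, passing to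
  the vertex itself is injective.\<close>

lemma local_maxima_le:
  assumes "distinct vs" "A = {v \<in> set vs. \<exists>u w. (u, v) \<in> polygon_edges vs \<and> (v, w) \<in> polygon_edges vs \<and>
     height (f u) < height (f v) \<and> height (f w) < height (f v)}"
  shows "local_maxima (map f vs) \<le> card A"
proof -
  define n where "n = length vs"
  define h where "h i = height (f (vs ! (i mod n)))" for i
  have hh: "height (map f vs ! (i mod length (map f vs))) = h i" if "n > 0" for i
    using that by (simp add: h_def n_def)
  have "local_maxima (map f vs) = card {i. i < n \<and> h i < h (i + 1) \<and> h (i + 2) < h (i + 1)}"
    unfolding local_maxima_def Let_def using hh by (cases "n = 0") (auto simp: n_def)
  also have "\<dots> \<le> card A"
  proof (rule card_inj_on_le[where f = "\<lambda>i. vs ! (Suc i mod n)"])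
    show "inj_on (\<lambda>i. vs ! (Suc i mod n)) {i. i < n \<and> h i < h (i + 1) \<and> h (i + 2) < h (i + 1)}"
    proof (rule inj_onI)
      fix i j assume ij: "i \<in> {i. i < n \<and> h i < h (i + 1) \<and> h (i + 2) < h (i + 1)}"
        "j \<in> {i. i < n \<and> h i < h (i + 1) \<and> h (i + 2) < h (i + 1)}" "vs ! (Suc i mod n) = vs ! (Suc j mod n)"
      then have "n > 0" by auto
      then have "Suc i mod n = Suc j mod n"
        using ij(3) assms(1) by (simp add: n_def nth_eq_iff_index_eq)
      then show "i = j" using ij(1,2) by (auto simp: mod_Suc split: if_splits)
    qed
    show "finite A" unfolding assms(2) by simp
    show "(\<lambda>i. vs ! (Suc i mod n)) ` {i. i < n \<and> h i < h (i + 1) \<and> h (i + 2) < h (i + 1)} \<subseteq> A"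
    proof clarify
      fix i assume i: "i < n" "h i < h (i + 1)" "h (i + 2) < h (i + 1)"
      define j where "j = Suc i mod n"
      have j: "j < n" using i by (simp add: j_def)
      have "(vs ! i, vs ! j) \<in> polygon_edges vs" "(vs ! j, vs ! (Suc j mod n)) \<in> polygon_edges vs"
        unfolding polygon_edges_nth n_def[symmetric] using i j by (auto simp: j_def)
      moreover have "h i = height (f (vs ! i))" "h (i + 1) = height (f (vs ! j))"
        "h (i + 2) = height (f (vs ! (Suc j mod n)))"
        using i by (auto simp: h_def j_def mod_Suc_eq)
      ultimately have "vs ! j \<in> A" unfolding assms(2) using i j by (auto simp: n_def)
      then show "vs ! (Suc i mod n) \<in> A" by (simp add: j_def)
    qed
  qed
  finally show ?thesis .
qed

text \<open>After compression the first coordinate serves as height: along the braid it falls where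
  \<open>y\<close> is nonnegative and rises where \<open>y\<close> is nonpositive. A maximum is
  therefore a vertex where \<open>y\<close> passes from negative to positive values, and turning
  positively about the axis forces \<open>x > 0\<close> there.\<close>

theorem closed_braid_bridge_presentation:
  assumes br: "closed_braid n P" and K: "ambient_isotopic (stereo ` polygonal_support P) K"
  shows "\<exists>b\<le>n. \<exists>P'. bridge_presentation b P' \<and> ambient_isotopic (stereo ` polygonal_support P') K"
proof -
  have pl: "polygonal_link P" and n: "n = card (polygonal_support P \<inter> half_plane)"
    using br by (auto simp: closed_braid_def)
  have w0: "wedge v w > 0" if "vs \<in> P" "(v, w) \<in> polygon_edges vs" for vs v w
  proof -
    have B: "\<forall>((x, y, z), (x', y', z'))\<in>polygon_edges vs. x * y' - y * x' > 0"
      using br that(1) unfolding closed_braid_def by blast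
    show ?thesis using bspec[OF B that(2)] by (simp add: wedge_def case_prod_unfold)
  qed
  have fin: "finite P" "P \<noteq> {}" using pl by (auto simp: polygonal_link_def)
  have sp: "3 \<le> length vs \<and> distinct vs" if "vs \<in> P" for vs
    using pl that simple_path_closed_polygon_embedded by (auto simp: polygonal_link_def)
  then have ne: "vs \<noteq> []" if "vs \<in> P" for vs using that by fastforce
  define E where "E = (\<Union>vs\<in>P. polygon_edges vs)"
  have E: "embedded E (\<lambda>x. x)" unfolding E_def by (rule polygonal_link_embedded[OF pl])
  have wE: "wedge v w > 0" if "(v, w) \<in> E" for v w using that w0 unfolding E_def by blast
  have op: "cut_point v w \<in> open_segment v w" if "(v, w) \<in> E" for v w using cut_point(1) wE[OF that] .
  define E' where "E' = half_edges cut_point E"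
  note sub = embedded_half_edges[OF E op, folded E'_def]
  have finE: "finite E'" using fin by (auto simp: E'_def half_edges_def E_def finite_polygon_edges)
  have "realize E' (\<lambda>x. x) = realize E (\<lambda>x. x)"
    unfolding E'_def by (rule realize_half_edges) (rule op)
  moreover have "polygonal_support P = realize E (\<lambda>x. x)"
    unfolding E_def by (rule polygonal_support_realize) (rule ne)
  ultimately have sup: "realize E' (\<lambda>x. x) = polygonal_support P" by simp
  have wE': "wedge a b > 0" if "(a, b) \<in> E'" for a b
    using that cut_point(2,3) wE unfolding E'_def half_edges_iff by blast
  have same: "(fst (snd a) \<ge> 0 \<and> fst (snd b) \<ge> 0) \<or> (fst (snd a) \<le> 0 \<and> fst (snd b) \<le> 0)" if ab: "(a, b) \<in> E'" for a b
  proof -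
    obtain v w where "(v, w) \<in> E" "(a, b) = (v, cut_point v w) \<or> (a, b) = (cut_point v w, w)"
      using ab[unfolded E'_def] by (rule half_edgesE)
    then show ?thesis using cut_point(4,5)[OF wE, of v w] by blast
  qed
  \<comment> \<open>Exceeds each of the finitely many quotients that \<open>squeeze_monotone\<close>
    has to beat; the summand 1 makes the inequality strict.\<close>
  define t where "t = 1 + (\<Sum>(a, b)\<in>E'. \<bar>fst a - fst b\<bar> / wedge a b)"
  have t0: "t \<ge> 0"
    unfolding t_def using wE' by (intro add_nonneg_nonneg sum_nonneg) (auto intro!: divide_nonneg_pos)
  have tw: "t * wedge a b > \<bar>fst a - fst b\<bar>" if "(a, b) \<in> E'" for a b
  proof -
    have "(\<lambda>(a, b). \<bar>fst a - fst b\<bar> / wedge a b) (a, b) \<le> (\<Sum>(a, b)\<in>E'. \<bar>fst a - fst b\<bar> / wedge a b)"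
      using wE' by (intro member_le_sum[OF that _ finE]) (auto intro!: divide_nonneg_pos)
    then have "\<bar>fst a - fst b\<bar> / wedge a b < t" by (simp add: t_def)
    then show ?thesis using wE'[OF that] by (simp add: field_simps)
  qed
  obtain f1 where f1: "carries E' (\<lambda>x. squeeze (0 * t) x) (\<lambda>x. squeeze (1 * t) x) f1"
  proof -
    have "\<exists>f. carries E' ((\<lambda>s x. squeeze (s * t) x) 0) ((\<lambda>s x. squeeze (s * t) x) 1) f"
    proof (rule motion_isotopy[OF finE])
      fix s :: real assume "s \<in> {0..1}"
      then have "s * t \<ge> 0" using t0 by simp
      then show "embedded E' (\<lambda>x. squeeze (s * t) x)"
        by (intro embedded_image[OF sub(1)] inj_squeeze squeeze_segment same)
    next
      fix v :: R3
      have "1 + s * t * \<bar>fst (snd v)\<bar> \<noteq> 0" if "s \<in> {0..1}" for s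
        using that t0 by (smt (verit) atLeastAtMost_iff mult_nonneg_nonneg)
      then show "continuous_on {0..1} (\<lambda>s. squeeze (s * t) v)"
        unfolding squeeze_def by (intro continuous_intros) auto
    qed
    then show ?thesis using that by auto
  qed
  have s0: "squeeze (0 * t) x = x" for x by (simp add: squeeze_def)
  have emb1: "embedded E' (squeeze t)"
    by (intro embedded_image[OF sub(1)] inj_squeeze squeeze_segment same t0)
  \<comment> \<open>A quarter turn that makes the first coordinate the third, in which
    \<open>height\<close> is measured.\<close>
  define R :: "R3 \<Rightarrow> R3" where "R = (\<lambda>(x, y, z). (- z, y, x))"
  have linR: "linear R" by (rule linearI) (auto simp: R_def)
  define q where "q = (\<lambda>x. R (squeeze t x) + 0)"
  obtain f2 where f2: "carries E' (squeeze t) q f2"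
    unfolding q_def using quarter_turn_motion[OF finE emb1, of R 0] R_def by blast
  have "inj R" by (rule injI) (auto simp: R_def)
  then have emb2: "embedded E' q"
    unfolding q_def using embedded_linear_image[OF emb1 linR] by blast
  define LS where "LS = subdivide cut_point ` P"
  have LSE: "polygon_edges (subdivide cut_point vs) \<subseteq> E'" if "vs \<in> P" for vs
    unfolding polygon_edges_subdivide E'_def half_edges_def E_def using that by blast
  have UE: "(\<Union>ls\<in>LS. polygon_edges ls) = E'"
    unfolding LS_def image_image E'_def E_def polygon_edges_subdivide half_edges_UN ..
  note vset = set_polygon_edges
  have dist: "distinct (subdivide cut_point vs)" if vs: "vs \<in> P" for vs
  proof (rule distinct_subdivide)
    have "polygon_edges vs \<subseteq> E" using vs by (auto simp: E_def)
    then show "inj_on (\<lambda>(v, w). cut_point v w) (polygon_edges vs)" using sub(2) inj_on_subset by blast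
    show "cut_point v w \<notin> set vs" if "(v, w) \<in> polygon_edges vs" for v w
      using sub(3) \<open>polygon_edges vs \<subseteq> E\<close> that unfolding vset[of vs] by blast
  qed (use sp vs in auto)
  have link: "polygonal_link (map q ` LS)" "polygonal_support (map q ` LS) = realize E' q" "inj_on (map q) LS"
  proof -
    have a: "distinct ls \<and> 3 \<le> length ls \<and> polygon_edges ls \<subseteq> E'" if "ls \<in> LS" for ls
      using that dist LSE sp unfolding LS_def by (auto simp: subdivide_def) fastforce
    have b: "set ls \<inter> set ls' = {}" if l: "ls \<in> LS" "ls' \<in> LS" "ls \<noteq> ls'" for ls ls'
    proof -
      obtain vs ws where vw: "ls = subdivide cut_point vs" "ls' = subdivide cut_point ws" "vs \<in> P" "ws \<in> P" "vs \<noteq> ws"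
        using l by (auto simp: LS_def)
      have "disjnt (path_image (closed_polygon vs)) (path_image (closed_polygon ws))"
        using pl vw by (auto simp: polygonal_link_def pairwise_def)
      moreover have "set (subdivide cut_point us) \<subseteq> path_image (closed_polygon us)" if us: "us \<in> P" for us
      proof -
        have "cut_point v w \<in> closed_segment v w" if "(v, w) \<in> polygon_edges us" for v w
          using op[of v w] us that by (auto simp: E_def open_segment_def)
        then show ?thesis
          unfolding set_subdivide vset[of us] path_image_closed_polygon[OF ne[OF us]] realize_def by fastforce
      qed
      ultimately show ?thesis using vw unfolding disjnt_def by blast
    qed
    have "finite LS" "LS \<noteq> {}" using fin by (auto simp: LS_def)
    from polygonal_link_map[OF emb2 this a b, unfolded UE]
    show "polygonal_link (map q ` LS)" "polygonal_support (map q ` LS) = realize E' q" "inj_on (map q) LS" by auto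
  qed
  have iso: "ambient_isotopic (stereo ` polygonal_support (map q ` LS)) K"
    unfolding link(2)
    by (rule carries_ambient[OF f2], rule carries_ambient[OF f1[unfolded s0, simplified]]) (simp add: sup K)
  have hq: "height (q x) = fst (squeeze t x)" for x
    by (simp add: q_def R_def height_def case_prod_unfold)
  note mono = squeeze_monotone[OF t0 tw]
  have nonhor: "height v \<noteq> height w" if "vs \<in> map q ` LS" "(v, w) \<in> polygon_edges vs" for vs v w
  proof -
    obtain a b where ab: "v = q a" "w = q b" "(a, b) \<in> E'"
    proof -
      obtain ls where ls: "vs = map q ls" "ls \<in> LS" using \<open>vs \<in> map q ` LS\<close> by blast
      obtain e where "(v, w) = map_prod q q e" "e \<in> polygon_edges ls"
        using \<open>(v, w) \<in> polygon_edges vs\<close> unfolding ls(1) polygon_edges_map by (rule imageE)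
      then show ?thesis using that[of "fst e" "snd e"] ls(2) UE by (simp add: map_prod_def case_prod_unfold) blast
    qed
    show ?thesis unfolding ab(1,2) hq using same[OF ab(3)] mono[OF ab(3)] by fastforce
  qed
  define A where "A ls = {v \<in> set ls. \<exists>u w. (u, v) \<in> polygon_edges ls \<and> (v, w) \<in> polygon_edges ls \<and>
     height (q u) < height (q v) \<and> height (q w) < height (q v)}" for ls
  have AH: "A ls \<subseteq> polygonal_support P \<inter> half_plane" if ls: "ls \<in> LS" for ls
  proof
    fix v assume "v \<in> A ls"
    then obtain u w where e: "(u, v) \<in> E'" "(v, w) \<in> E'" "height (q u) < height (q v)" "height (q w) < height (q v)"
      using ls UE unfolding A_def by blast
    \<comment> \<open>A rising edge cannot lie in the half-space where the height falls, so it ends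
      with \<open>y \<le> 0\<close>; likewise the falling edge starts with
      \<open>y \<ge> 0\<close>.\<close>
    have "\<not> (fst (snd u) \<ge> 0 \<and> fst (snd v) \<ge> 0)" using mono(1)[OF e(1)] e(3) unfolding hq by force
    then have uv: "fst (snd u) \<le> 0" "fst (snd v) \<le> 0" using same[OF e(1)] by auto
    have "\<not> (fst (snd v) \<le> 0 \<and> fst (snd w) \<le> 0)" using mono(2)[OF e(2)] e(4) unfolding hq by force
    then have "fst (snd v) \<ge> 0" using same[OF e(2)] by auto
    then have y: "fst (snd v) = 0" using uv by simp
    have "- (fst (snd u) * fst v) > 0" using wE'[OF e(1)] y by (simp add: wedge_def)
    then have "fst v > 0" using uv by (auto simp: mult_less_0_iff)
    moreover have "v \<in> closed_segment u v" by simp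
    then have "v \<in> polygonal_support P" unfolding sup[symmetric] realize_def using e(1) by blast
    ultimately show "v \<in> polygonal_support P \<inter> half_plane" using y by (cases v) auto
  qed
  have finH: "finite (polygonal_support P \<inter> half_plane)"
    by (rule finite_half_plane_meet[OF fin(1)]) (use w0 ne in auto)
  have disjLS: "set ls \<inter> set ls' = {}" if l: "ls \<in> LS" "ls' \<in> LS" "ls \<noteq> ls'" for ls ls'
  proof -
    have "map q ls \<noteq> map q ls'" using link(3) l by (auto dest: inj_onD)
    then have d: "disjnt (path_image (closed_polygon (map q ls))) (path_image (closed_polygon (map q ls')))"
      using link(1) l by (auto simp: polygonal_link_def pairwise_def)
    have m: "q v \<in> path_image (closed_polygon (map q ls))" if "v \<in> set ls" for v ls
    proof -
      have "ls \<noteq> []" using that by auto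
      moreover have "\<exists>e\<in>polygon_edges ls. v = fst e \<or> v = snd e"
        using that unfolding set_polygon_edges[of ls] by force
      then obtain e where "e \<in> polygon_edges ls" "v = fst e \<or> v = snd e" by blast
      moreover from this have "q v \<in> closed_segment (q (fst e)) (q (snd e))" by auto
      ultimately show ?thesis
        unfolding path_image_closed_polygon_map[OF \<open>ls \<noteq> []\<close>] realize_def case_prod_unfold by blast
    qed
    show ?thesis using d m unfolding disjnt_def by blast
  qed
  have "(\<Sum>vs\<in>map q ` LS. local_maxima vs) = (\<Sum>ls\<in>LS. local_maxima (map q ls))"
    by (simp add: sum.reindex[OF link(3)])
  also have "\<dots> \<le> (\<Sum>ls\<in>LS. card (A ls))"
    using dist by (intro sum_mono local_maxima_le) (auto simp: A_def LS_def)
  also have "\<dots> = card (\<Union>ls\<in>LS. A ls)"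
  proof (rule card_UN_disjoint[symmetric])
    show "\<forall>i\<in>LS. \<forall>j\<in>LS. i \<noteq> j \<longrightarrow> A i \<inter> A j = {}" using disjLS unfolding A_def by blast
  qed (use fin in \<open>auto simp: LS_def A_def\<close>)
  also have "\<dots> \<le> n" unfolding n by (rule card_mono[OF finH]) (use AH in blast)
  finally have "(\<Sum>vs\<in>map q ` LS. local_maxima vs) \<le> n" .
  moreover have "bridge_presentation (\<Sum>vs\<in>map q ` LS. local_maxima vs) (map q ` LS)"
    unfolding bridge_presentation_def using link(1) nonhor by blast
  ultimately show ?thesis using iso by blast
qed

text \<open>Each competitor in the infimum for the braid index yields one for the bridge number that
  is not larger; the orientation is forgotten on the way.\<close>

theorem bridge_number_le_braid_index:
  assumes "orientation_of K \<Gamma>"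
  shows "bridge_number K \<le> braid_index \<Gamma>"
  unfolding braid_index_def
proof (rule INF_greatest)
  fix n assume "n \<in> {n. \<exists>P. closed_braid n P \<and>
     oriented_ambient_isotopic ((\<lambda>vs. stereo \<circ> closed_polygon vs) ` P) \<Gamma>}"
  then obtain P where P: "closed_braid n P"
    "oriented_ambient_isotopic ((\<lambda>vs. stereo \<circ> closed_polygon vs) ` P) \<Gamma>" by blast
  have "(\<Union>\<gamma>\<in>(\<lambda>vs. stereo \<circ> closed_polygon vs) ` P. path_image \<gamma>) = stereo ` polygonal_support P"
    by (auto simp: polygonal_support_def path_image_def image_comp)
  moreover have "(\<Union>\<delta>\<in>\<Gamma>. path_image \<delta>) = K" using assms by (simp add: orientation_of_def)
  ultimately have "ambient_isotopic (stereo ` polygonal_support P) K"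
    using P(2) unfolding oriented_ambient_isotopic_def ambient_isotopic_def by metis
  then obtain b P' where b: "b \<le> n" "bridge_presentation b P'" "ambient_isotopic (stereo ` polygonal_support P') K"
    using closed_braid_bridge_presentation[OF P(1)] by blast
  then have "bridge_number K \<le> enat b" unfolding bridge_number_def by (intro INF_lower) blast
  then show "bridge_number K \<le> enat n" using b(1) by (meson enat_ord_simps(1) order_trans)
qed

section \<open>Braid index and grid number\<close>

text \<open>\<open>\<sigma>\<close> and \<open>\<tau>\<close> exchange the two markings of a column
  and of a row. That they are involutions follows from \<open>column\<close> and
  \<open>row\<close>.\<close>

locale markings =
  fixes G :: "(nat \<times> nat) set" and \<sigma> \<tau> :: "nat \<times> nat \<Rightarrow> nat \<times> nat"
  assumes finite_G: "finite G"
    and \<sigma>: "x \<in> G \<Longrightarrow> \<sigma> x \<in> G" "x \<in> G \<Longrightarrow> \<sigma> x \<noteq> x" "x \<in> G \<Longrightarrow> fst (\<sigma> x) = fst x"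
    and \<tau>: "x \<in> G \<Longrightarrow> \<tau> x \<in> G" "x \<in> G \<Longrightarrow> \<tau> x \<noteq> x" "x \<in> G \<Longrightarrow> snd (\<tau> x) = snd x"
    and column: "x \<in> G \<Longrightarrow> y \<in> G \<Longrightarrow> fst y = fst x \<Longrightarrow> y = x \<or> y = \<sigma> x"
    and row: "x \<in> G \<Longrightarrow> y \<in> G \<Longrightarrow> snd y = snd x \<Longrightarrow> y = x \<or> y = \<tau> x"
begin

text \<open>One step along the link: through the column of \<open>x\<close> to its other end, and
  then along the row to the marking where the next column is entered.\<close>

definition \<rho> :: "nat \<times> nat \<Rightarrow> nat \<times> nat" where "\<rho> x = \<tau> (\<sigma> x)"

lemma \<sigma>\<sigma>: "x \<in> G \<Longrightarrow> \<sigma> (\<sigma> x) = x"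
  using column[of "\<sigma> x" x] \<sigma> by metis

lemma \<tau>\<tau>: "x \<in> G \<Longrightarrow> \<tau> (\<tau> x) = x"
  using row[of "\<tau> x" x] \<tau> by metis

lemma \<rho>_in: "x \<in> G \<Longrightarrow> \<rho> x \<in> G"
  by (simp add: \<rho>_def \<sigma> \<tau>)

lemma \<rho>_inverse: "x \<in> G \<Longrightarrow> \<sigma> (\<tau> (\<rho> x)) = x"
  by (simp add: \<rho>_def \<sigma> \<sigma>\<sigma> \<tau>\<tau>)

text \<open>\<open>\<sigma>\<close> conjugates \<open>\<rho>\<close> into its inverse: entering
  every column at its other end reverses the direction of travel.\<close>

lemma \<sigma>\<rho>: "x \<in> G \<Longrightarrow> \<rho> (\<sigma> (\<rho> x)) = \<sigma> x"
  by (simp add: \<rho>_def \<sigma> \<sigma>\<sigma> \<tau> \<tau>\<tau>)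

lemma inj_\<rho>: "x \<in> G \<Longrightarrow> y \<in> G \<Longrightarrow> \<rho> x = \<rho> y \<Longrightarrow> x = y"
  by (metis \<rho>_inverse)

lemma funpow_\<rho>_in: "x \<in> G \<Longrightarrow> (\<rho> ^^ n) x \<in> G"
  by (induction n) (auto simp: \<rho>_in)

lemma inj_funpow_\<rho>: "x \<in> G \<Longrightarrow> y \<in> G \<Longrightarrow> (\<rho> ^^ n) x = (\<rho> ^^ n) y \<Longrightarrow> x = y"
  by (induction n) (auto dest!: inj_\<rho>[rotated 2] simp: funpow_\<rho>_in)

lemma \<rho>_periodic: "x \<in> G \<Longrightarrow> \<exists>k>0. (\<rho> ^^ k) x = x"
proof -
  assume x: "x \<in> G"
  have "\<not> inj_on (\<lambda>n. (\<rho> ^^ n) x) (UNIV :: nat set)"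
    using finite_imageD[of "\<lambda>n. (\<rho> ^^ n) x" UNIV] finite_subset[OF _ finite_G] funpow_\<rho>_in[OF x]
    by (metis image_subsetI infinite_UNIV_nat)
  then obtain i j where ij: "i < j" "(\<rho> ^^ i) x = (\<rho> ^^ j) x"
    unfolding inj_on_def by (metis linorder_neqE_nat)
  have "(\<rho> ^^ j) x = (\<rho> ^^ i) ((\<rho> ^^ (j - i)) x)"
    using ij(1) by (metis comp_apply funpow_add le_add_diff_inverse less_imp_le)
  then have "x = (\<rho> ^^ (j - i)) x"
    using inj_funpow_\<rho>[OF x funpow_\<rho>_in[OF x], of i "j - i"] ij(2) by simp
  then show ?thesis using ij(1) by (intro exI[of _ "j - i"]) auto
qed

definition period :: "nat \<times> nat \<Rightarrow> nat" where
  "period x = (LEAST k. 0 < k \<and> (\<rho> ^^ k) x = x)"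

lemma period: "x \<in> G \<Longrightarrow> 0 < period x \<and> (\<rho> ^^ period x) x = x"
  unfolding period_def using \<rho>_periodic by (rule LeastI_ex)

lemma period_least: "0 < k \<Longrightarrow> (\<rho> ^^ k) x = x \<Longrightarrow> period x \<le> k"
  unfolding period_def by (rule Least_le) simp

lemma funpow_\<rho>_mod: "x \<in> G \<Longrightarrow> (\<rho> ^^ (n mod period x)) x = (\<rho> ^^ n) x"
  using period funpow_mod_eq by metis

definition orb :: "nat \<times> nat \<Rightarrow> (nat \<times> nat) set" where
  "orb x = (\<lambda>n. (\<rho> ^^ n) x) ` {..<period x}"

lemma orb_iff: "x \<in> G \<Longrightarrow> y \<in> orb x \<longleftrightarrow> (\<exists>n. y = (\<rho> ^^ n) x)"
  unfolding orb_def using funpow_\<rho>_mod[of x] period[of x] by (auto simp: image_iff) (metis lessThan_iff mod_less_divisor)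

lemma orb_self: "x \<in> G \<Longrightarrow> x \<in> orb x"
  using orb_iff[of x x] by (metis funpow_0)

lemma orb_subset: "x \<in> G \<Longrightarrow> orb x \<subseteq> G"
  by (auto simp: orb_iff funpow_\<rho>_in)

lemma \<rho>_orb: "x \<in> G \<Longrightarrow> y \<in> orb x \<Longrightarrow> \<rho> y \<in> orb x"
  by (auto simp: orb_iff) (metis comp_apply funpow.simps(2))

lemma orb_trans: "x \<in> G \<Longrightarrow> y \<in> orb x \<Longrightarrow> orb y \<subseteq> orb x"
  by (auto simp: orb_iff funpow_\<rho>_in) (metis comp_apply funpow_add)

lemma orb_sym: "x \<in> G \<Longrightarrow> y \<in> orb x \<Longrightarrow> x \<in> orb y"
proof -
  assume x: "x \<in> G" and y: "y \<in> orb x"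
  then obtain n where n: "n < period x" "y = (\<rho> ^^ n) x" by (auto simp: orb_def)
  have "(\<rho> ^^ (period x - n)) y = (\<rho> ^^ (period x - n + n)) x" by (simp add: n(2) funpow_add)
  then have "(\<rho> ^^ (period x - n)) y = x" using period[OF x] n(1) by simp
  then show ?thesis using orb_iff[of y x] orb_subset[OF x] y by (metis subsetD)
qed

lemma orb_eq: "x \<in> G \<Longrightarrow> y \<in> orb x \<Longrightarrow> orb y = orb x"
  using orb_trans orb_sym orb_subset by (metis subset_antisym subsetD)

lemma orb_disjoint: "x \<in> G \<Longrightarrow> y \<in> G \<Longrightarrow> orb x \<noteq> orb y \<Longrightarrow> orb x \<inter> orb y = {}"
  using orb_eq by blast

lemma \<sigma>_orb: "x \<in> G \<Longrightarrow> \<sigma> ` orb x = orb (\<sigma> x)"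
proof -
  have *: "\<sigma> ((\<rho> ^^ n) x) \<in> orb (\<sigma> x)" if x: "x \<in> G" for x n
  proof (induction n)
    case 0
    then show ?case using orb_self \<sigma>(1) x by simp
  next
    case (Suc n)
    let ?y = "(\<rho> ^^ n) x"
    have y: "?y \<in> G" using funpow_\<rho>_in x .
    have z: "\<sigma> (\<rho> ?y) \<in> G" using \<sigma>(1) \<rho>_in y by blast
    have "\<rho> (\<sigma> (\<rho> ?y)) = \<sigma> ?y" using \<sigma>\<rho>[OF y] .
    then have "\<sigma> ?y \<in> orb (\<sigma> (\<rho> ?y))" using \<rho>_orb[OF z orb_self[OF z]] by simp
    then have "\<sigma> (\<rho> ?y) \<in> orb (\<sigma> ?y)" using orb_sym[OF z] by simp
    then show ?case using orb_eq[OF \<sigma>(1)[OF x] Suc] by simp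
  qed
  assume x: "x \<in> G"
  have "\<sigma> ` orb x \<subseteq> orb (\<sigma> x)" using *[OF x] by (auto simp: orb_iff[OF x])
  moreover have "\<sigma> ` orb (\<sigma> x) \<subseteq> orb x" using *[OF \<sigma>(1)[OF x]] by (auto simp: orb_iff[OF \<sigma>(1)[OF x]] \<sigma>\<sigma>[OF x])
  moreover have "\<sigma> (\<sigma> y) = y" if "y \<in> orb (\<sigma> x)" for y using that orb_subset[OF \<sigma>(1)[OF x]] \<sigma>\<sigma> by blast
  ultimately show ?thesis by (smt (verit, best) image_eqI image_subset_iff subset_antisym subset_iff)
qed

text \<open>A coincidence for \<open>n\<close> yields one for \<open>n - 2\<close> at
  \<open>\<rho> x\<close>, by \<open>\<sigma>\<rho>\<close> and injectivity, until \<open>n\<close>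
  is 0 or 1 and \<open>\<sigma>\<close> or \<open>\<tau>\<close> would have a fixed point. So a
  traversal never runs through a column in both directions.\<close>

lemma funpow_\<rho>_ne_\<sigma>: "x \<in> G \<Longrightarrow> (\<rho> ^^ n) x \<noteq> \<sigma> x"
proof (induction n arbitrary: x rule: less_induct)
  case (less n)
  consider "n = 0" | "n = 1" | k where "n = Suc (Suc k)" by (metis One_nat_def not0_implies_Suc)
  then show ?case
  proof cases
    case 1 then show ?thesis using \<sigma>(2)[OF less.prems] by auto
  next
    case 2 then show ?thesis using \<tau>(2)[OF \<sigma>(1)[OF less.prems]] by (auto simp: \<rho>_def)
  next
    case 3
    show ?thesis
    proof
      assume e: "(\<rho> ^^ n) x = \<sigma> x"
      have "\<rho> ((\<rho> ^^ k) (\<rho> x)) = \<sigma> x" using e 3 by (simp add: funpow_swap1)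
      also have "\<dots> = \<rho> (\<sigma> (\<rho> x))" using \<sigma>\<rho>[OF less.prems] by simp
      finally have "(\<rho> ^^ k) (\<rho> x) = \<sigma> (\<rho> x)"
        by (rule inj_\<rho>[OF funpow_\<rho>_in[OF \<rho>_in[OF less.prems]] \<sigma>(1)[OF \<rho>_in[OF less.prems]]])
      then show False using less.IH[of k "\<rho> x"] 3 \<rho>_in[OF less.prems] by simp
    qed
  qed
qed

lemma orb_\<sigma>_disjoint: "x \<in> G \<Longrightarrow> orb x \<inter> orb (\<sigma> x) = {}"
proof (rule ccontr)
  assume x: "x \<in> G" and "orb x \<inter> orb (\<sigma> x) \<noteq> {}"
  then have "orb x = orb (\<sigma> x)" using orb_disjoint[OF x \<sigma>(1)[OF x]] by blast
  then have "\<sigma> x \<in> orb x" using orb_self[OF \<sigma>(1)[OF x]] by simp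
  then show False using funpow_\<rho>_ne_\<sigma>[OF x] unfolding orb_iff[OF x] by metis
qed

text \<open>A choice of direction on some components: \<open>X\<close> consists of the markings at
  which columns are entered, and no column is entered at both ends.\<close>

definition consistent :: "(nat \<times> nat) set \<Rightarrow> bool" where
  "consistent X \<longleftrightarrow> X \<subseteq> G \<and> (\<forall>x\<in>X. \<rho> x \<in> X) \<and> X \<inter> \<sigma> ` X = {}"

lemma consistent_orb: "x \<in> G \<Longrightarrow> consistent (orb x)"
  using orb_subset \<rho>_orb orb_\<sigma>_disjoint \<sigma>_orb by (simp add: consistent_def)

type_synonym lab = "(nat \<times> nat) \<times> nat"

text \<open>The vertices \<open>(x, 0), \<dots>, (x, 5)\<close> lead from the marking \<open>x\<close> along its column to the
  marking \<open>\<sigma> x\<close>; the sixth edge runs along a row.\<close>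

definition strand_edges :: "(nat \<times> nat) set \<Rightarrow> (lab \<times> lab) set" where
  "strand_edges X = (\<lambda>(x, k). ((x, k), if k = 5 then (\<rho> x, 0) else (x, Suc k))) ` (X \<times> {..<6})"

lemma strand_edges_UN: "strand_edges (\<Union>i\<in>I. X i) = (\<Union>i\<in>I. strand_edges (X i))"
  unfolding strand_edges_def by blast

definition cycle_list :: "nat \<times> nat \<Rightarrow> lab list" where
  "cycle_list g = map (\<lambda>r. ((\<rho> ^^ (r div 6)) g, r mod 6)) [0..<6 * period g]"

lemma funpow_\<rho>_inj_on:
  assumes x: "x \<in> G" and ij: "i < period x" "j < period x" "(\<rho> ^^ i) x = (\<rho> ^^ j) x"
  shows "i = j"
proof -
  have no: False if ij: "i < j" "j < period x" "(\<rho> ^^ i) x = (\<rho> ^^ j) x" for i j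
  proof -
    have "(\<rho> ^^ j) x = (\<rho> ^^ i) ((\<rho> ^^ (j - i)) x)"
      using ij(1) by (metis comp_apply funpow_add le_add_diff_inverse less_imp_le)
    then have "x = (\<rho> ^^ (j - i)) x" using inj_funpow_\<rho>[OF x funpow_\<rho>_in[OF x]] ij(3) by metis
    then have "period x \<le> j - i" using ij(1) by (intro period_least) auto
    then show False using ij by simp
  qed
  show ?thesis using no[of i j] no[of j i] ij by (metis linorder_neqE_nat)
qed

lemma distinct_cycle_list: "g \<in> G \<Longrightarrow> distinct (cycle_list g)"
  unfolding cycle_list_def distinct_map
proof (intro conjI inj_onI)
  assume g: "g \<in> G"
  fix r s assume rs: "r \<in> set [0..<6 * period g]" "s \<in> set [0..<6 * period g]"
    "((\<rho> ^^ (r div 6)) g, r mod 6) = ((\<rho> ^^ (s div 6)) g, s mod 6)"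
  then have "r div 6 = s div 6" by (intro funpow_\<rho>_inj_on[OF g]) auto
  moreover have "r mod 6 = s mod 6" using rs(3) by simp
  ultimately show "r = s" by (metis div_mult_mod_eq)
qed simp

lemma length_cycle_list: "length (cycle_list g) = 6 * period g"
  by (simp add: cycle_list_def)

lemma nth_cycle_list_mod:
  assumes g: "g \<in> G" shows "cycle_list g ! (r mod (6 * period g)) = ((\<rho> ^^ (r div 6)) g, r mod 6)"
proof -
  have p: "6 * period g > 0" using period[OF g] by simp
  have "(r mod (6 * period g)) div 6 = (r div 6) mod period g"
    by (simp add: mod_mult2_eq)
  moreover have "(r mod (6 * period g)) mod 6 = r mod 6" by (simp add: mod_mod_cancel)
  ultimately show ?thesis using p funpow_\<rho>_mod[OF g] by (simp add: cycle_list_def)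
qed

lemma polygon_edges_cycle_list:
  assumes g: "g \<in> G" shows "polygon_edges (cycle_list g) = strand_edges (orb g)"
proof -
  define e where "e = (\<lambda>(x, k). ((x, k), if k = 5 then (\<rho> x, 0) else (x, Suc k)) :: lab \<times> lab)"
  have suc: "((\<rho> ^^ (Suc r div 6)) g, Suc r mod 6) = snd (e ((\<rho> ^^ (r div 6)) g, r mod 6))" for r
  proof (cases "r mod 6 = 5")
    case True
    then have "Suc r div 6 = Suc (r div 6)" "Suc r mod 6 = 0" by presburger+
    then show ?thesis using True by (simp add: e_def)
  next
    case False
    then have "Suc r div 6 = r div 6" "Suc r mod 6 = Suc (r mod 6)" by presburger+
    then show ?thesis using False by (simp add: e_def)
  qed
  have fe: "fst (e z) = z" for z by (cases z) (simp add: e_def)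
  have "polygon_edges (cycle_list g) = (\<lambda>r. e ((\<rho> ^^ (r div 6)) g, r mod 6)) ` {..<6 * period g}"
    unfolding polygon_edges_nth length_cycle_list
  proof (intro image_cong refl)
    fix r assume "r \<in> {..<6 * period g}"
    then have "cycle_list g ! r = ((\<rho> ^^ (r div 6)) g, r mod 6)" by (simp add: cycle_list_def)
    then show "(cycle_list g ! r, cycle_list g ! (Suc r mod (6 * period g))) = e ((\<rho> ^^ (r div 6)) g, r mod 6)"
      using nth_cycle_list_mod[OF g, of "Suc r"] suc[of r] fe by (metis prod.collapse)
  qed
  also have "\<dots> = e ` (orb g \<times> {..<6})"
  proof (intro equalityI subsetI)
    fix z assume "z \<in> (\<lambda>r. e ((\<rho> ^^ (r div 6)) g, r mod 6)) ` {..<6 * period g}"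
    then obtain r where r: "r < 6 * period g" "z = e ((\<rho> ^^ (r div 6)) g, r mod 6)" by blast
    then have "((\<rho> ^^ (r div 6)) g, r mod 6) \<in> orb g \<times> {..<6}" by (auto simp: orb_def)
    then show "z \<in> e ` (orb g \<times> {..<6})" using r(2) by blast
  next
    fix z assume "z \<in> e ` (orb g \<times> {..<6})"
    then obtain n k where nk: "n < period g" "k < 6" "z = e ((\<rho> ^^ n) g, k)" by (auto simp: orb_def)
    then have "6 * n + k < 6 * period g" "(6 * n + k) div 6 = n" "(6 * n + k) mod 6 = k" by auto
    then show "z \<in> (\<lambda>r. e ((\<rho> ^^ (r div 6)) g, r mod 6)) ` {..<6 * period g}"
      using nk(3) by (intro image_eqI[of _ _ "6 * n + k"]) auto
  qed
  finally show ?thesis by (simp add: strand_edges_def e_def)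
qed

lemma polygon_edges_rotate1: "polygon_edges (rotate1 ys) = polygon_edges ys"
proof (cases "ys = []")
  case False
  have "zip (rotate1 ys) (rotate1 (rotate1 ys)) = rotate1 (zip ys (rotate1 ys))"
    by (rule nth_equalityI) (auto simp: nth_rotate1 False)
  then show ?thesis unfolding polygon_edges_def by (metis set_rotate1)
qed simp

lemma polygon_edges_rotate: "polygon_edges (rotate n xs) = polygon_edges xs"
  by (induction n) (simp_all add: polygon_edges_rotate1)

text \<open>Data for comparing the two traversals of a component. The list for the reverse direction
  is rotated by 5, so as to begin with the vertex above the end of a column, which is where the
  other traversal starts.\<close>

lemma cycle_list_ends:
  assumes g: "g \<in> G"
  shows "cycle_list g ! 0 = (g, 0)" "cycle_list g ! 1 = (g, 1)"
    "\<exists>x. last (cycle_list g) = (x, 5) \<and> x \<in> G \<and> \<sigma> x = \<tau> g"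
    "rotate 5 (cycle_list g) ! 0 = (g, 5)" "rotate 5 (cycle_list g) ! 1 = (\<rho> g, 0)"
    "last (rotate 5 (cycle_list g)) = (g, 4)"
proof -
  have p: "period g > 0" "(\<rho> ^^ period g) g = g" using period[OF g] by auto
  have len: "length (cycle_list g) = 6 * period g" by (rule length_cycle_list)
  have ne: "cycle_list g \<noteq> []" using len p by auto
  show "cycle_list g ! 0 = (g, 0)" "cycle_list g ! 1 = (g, 1)"
    using p nth_cycle_list_mod[OF g, of 0] nth_cycle_list_mod[OF g, of 1] by auto
  have "rotate 5 (cycle_list g) ! n = cycle_list g ! ((5 + n) mod (6 * period g))" if "n < 6 * period g" for n
    using nth_rotate[of n "cycle_list g" 5] that len by simp
  note rot = this[unfolded nth_cycle_list_mod[OF g]]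
  show "rotate 5 (cycle_list g) ! 0 = (g, 5)" "rotate 5 (cycle_list g) ! 1 = (\<rho> g, 0)"
    using rot[of 0] rot[of 1] p by auto
  have "last (rotate 5 (cycle_list g)) = rotate 5 (cycle_list g) ! (6 * period g - 1)"
    using ne len by (simp add: last_conv_nth)
  also have "\<dots> = ((\<rho> ^^ ((5 + (6 * period g - 1)) div 6)) g, (5 + (6 * period g - 1)) mod 6)"
    by (rule rot) (use p in simp)
  also have "5 + (6 * period g - 1) = 6 * period g + 4" using p by simp
  finally show "last (rotate 5 (cycle_list g)) = (g, 4)" using p by simp
  have "last (cycle_list g) = cycle_list g ! (6 * period g - 1)" using ne len by (simp add: last_conv_nth)
  also have "\<dots> = cycle_list g ! ((6 * (period g - 1) + 5) mod (6 * period g))"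
    using p by (simp add: algebra_simps)
  also have "\<dots> = ((\<rho> ^^ (period g - 1)) g, 5)"
    unfolding nth_cycle_list_mod[OF g] by simp
  finally have l: "last (cycle_list g) = ((\<rho> ^^ (period g - 1)) g, 5)" .
  let ?x = "(\<rho> ^^ (period g - 1)) g"
  have x: "?x \<in> G" using funpow_\<rho>_in[OF g] .
  have "\<rho> ?x = g" using p by (metis Suc_diff_1 comp_apply funpow.simps(2))
  then have "\<sigma> ?x = \<tau> g" using \<tau>\<tau>[OF \<sigma>(1)[OF x]] by (auto simp: \<rho>_def)
  then show "\<exists>x. last (cycle_list g) = (x, 5) \<and> x \<in> G \<and> \<sigma> x = \<tau> g" using l x by blast
qed

end

lemma card_2_other:
  assumes "card A = 2" "a \<in> A"
  shows "\<exists>b. b \<in> A \<and> b \<noteq> a \<and> (\<forall>c\<in>A. c = a \<or> c = b)"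
proof -
  obtain x y where "A = {x, y}" "x \<noteq> y" using assms(1) by (auto simp: card_2_iff)
  then show ?thesis using assms(2) by auto
qed

lemma grid_diagram_markings:
  assumes "grid_diagram m G"
  obtains \<sigma> \<tau> where "markings G \<sigma> \<tau>"
proof -
  have GS: "G \<subseteq> {..<m} \<times> {..<m}" using assms by (simp add: grid_diagram_def)
  have "\<forall>x\<in>G. \<exists>y. y \<in> G \<and> y \<noteq> x \<and> fst y = fst x \<and> (\<forall>z\<in>G. fst z = fst x \<longrightarrow> z = x \<or> z = y)"
  proof
    fix x assume x: "x \<in> G"
    then have "card {j. (fst x, j) \<in> G} = 2" "snd x \<in> {j. (fst x, j) \<in> G}"
      using assms GS by (auto simp: grid_diagram_def)
    from card_2_other[OF this] obtain b where b: "(fst x, b) \<in> G" "b \<noteq> snd x"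
      "\<forall>c. (fst x, c) \<in> G \<longrightarrow> c = snd x \<or> c = b" by auto
    then show "\<exists>y. y \<in> G \<and> y \<noteq> x \<and> fst y = fst x \<and> (\<forall>z\<in>G. fst z = fst x \<longrightarrow> z = x \<or> z = y)"
      by (intro exI[of _ "(fst x, b)"]) (metis fst_conv prod.collapse snd_conv)
  qed
  then obtain \<sigma> where s: "\<And>x. x \<in> G \<Longrightarrow> \<sigma> x \<in> G \<and> \<sigma> x \<noteq> x \<and> fst (\<sigma> x) = fst x \<and> (\<forall>z\<in>G. fst z = fst x \<longrightarrow> z = x \<or> z = \<sigma> x)"
    by metis
  have "\<forall>x\<in>G. \<exists>y. y \<in> G \<and> y \<noteq> x \<and> snd y = snd x \<and> (\<forall>z\<in>G. snd z = snd x \<longrightarrow> z = x \<or> z = y)"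
  proof
    fix x assume x: "x \<in> G"
    then have "card {i. (i, snd x) \<in> G} = 2" "fst x \<in> {i. (i, snd x) \<in> G}"
      using assms GS by (auto simp: grid_diagram_def)
    from card_2_other[OF this] obtain b where b: "(b, snd x) \<in> G" "b \<noteq> fst x"
      "\<forall>c. (c, snd x) \<in> G \<longrightarrow> c = fst x \<or> c = b" by auto
    then show "\<exists>y. y \<in> G \<and> y \<noteq> x \<and> snd y = snd x \<and> (\<forall>z\<in>G. snd z = snd x \<longrightarrow> z = x \<or> z = y)"
      by (intro exI[of _ "(b, snd x)"]) (metis fst_conv prod.collapse snd_conv)
  qed
  then obtain \<tau> where t: "\<And>x. x \<in> G \<Longrightarrow> \<tau> x \<in> G \<and> \<tau> x \<noteq> x \<and> snd (\<tau> x) = snd x \<and> (\<forall>z\<in>G. snd z = snd x \<longrightarrow> z = x \<or> z = \<tau> x)"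
    by metis
  have "markings G \<sigma> \<tau>"
    by unfold_locales (use s t finite_subset[OF GS] in auto)
  then show thesis by (rule that)
qed

text \<open>On a segment a linear functional takes its extreme values at the ends. The disjointness
  proofs below separate segments in this way, mostly by a single coordinate.\<close>

lemma seg_ge: "linear f \<Longrightarrow> x \<in> closed_segment a b \<Longrightarrow> c \<le> f a \<Longrightarrow> c \<le> f b \<Longrightarrow> c \<le> f x"
  and seg_gt: "linear f \<Longrightarrow> x \<in> closed_segment a b \<Longrightarrow> c < f a \<Longrightarrow> c < f b \<Longrightarrow> c < f x"
  and seg_le: "linear f \<Longrightarrow> x \<in> closed_segment a b \<Longrightarrow> f a \<le> c \<Longrightarrow> f b \<le> c \<Longrightarrow> f x \<le> c"
  and seg_lt: "linear f \<Longrightarrow> x \<in> closed_segment a b \<Longrightarrow> f a < c \<Longrightarrow> f b < c \<Longrightarrow> f x < c"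
  for f :: "'a::real_normed_vector \<Rightarrow> real"
proof -
  assume f: "linear f" and x: "x \<in> closed_segment a b"
  obtain u where u01: "0 \<le> u" "u \<le> 1" and xu: "x = (1 - u) *\<^sub>R a + u *\<^sub>R b"
    using x by (auto simp: in_segment)
  have "f x = (1 - u) * f a + u * f b" unfolding xu using f by (simp add: linear_add linear_cmul)
  then have u: "0 \<le> u" "u \<le> 1" "f x = f a + u * (f b - f a)" using u01 by (auto simp: algebra_simps)
  have m: "0 \<le> u * (f b - f a) \<and> u * (f b - f a) \<le> f b - f a" if "f a \<le> f b"
    using u that mult_right_mono[of u 1 "f b - f a"] by auto
  have m': "0 \<le> u * (f a - f b) \<and> u * (f a - f b) \<le> f a - f b" if "f b \<le> f a"
    using u that mult_right_mono[of u 1 "f a - f b"] by auto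
  have "min (f a) (f b) \<le> f x" "f x \<le> max (f a) (f b)"
    using m m' u(3) by (cases "f a \<le> f b"; simp add: min_def max_def algebra_simps; linarith)+
  then show "c \<le> f a \<Longrightarrow> c \<le> f b \<Longrightarrow> c \<le> f x" "c < f a \<Longrightarrow> c < f b \<Longrightarrow> c < f x"
    "f a \<le> c \<Longrightarrow> f b \<le> c \<Longrightarrow> f x \<le> c" "f a < c \<Longrightarrow> f b < c \<Longrightarrow> f x < c" by auto
qed

lemma seg_end: "linear f \<Longrightarrow> x \<in> closed_segment a b \<Longrightarrow> f x = f b \<Longrightarrow> f a \<noteq> f b \<Longrightarrow> x = b"
  for f :: "'a::real_normed_vector \<Rightarrow> real"
proof -
  assume f: "linear f" and x: "x \<in> closed_segment a b" and e: "f x = f b" "f a \<noteq> f b"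
  obtain u where u: "x = (1 - u) *\<^sub>R a + u *\<^sub>R b" using x by (auto simp: in_segment)
  have "f x = (1 - u) * f a + u * f b" unfolding u using f by (simp add: linear_add linear_cmul)
  then have "(1 - u) * (f a - f b) = 0" using e(1) by (simp add: algebra_simps)
  then show ?thesis using e(2) u by simp
qed

lemma seg_start: "linear f \<Longrightarrow> x \<in> closed_segment a b \<Longrightarrow> f x = f a \<Longrightarrow> f a \<noteq> f b \<Longrightarrow> x = a"
  for f :: "'a::real_normed_vector \<Rightarrow> real"
  using seg_end[of f x b a] by (simp add: closed_segment_commute)

abbreviation X1 :: "R3 \<Rightarrow> real" where "X1 p \<equiv> fst p"
abbreviation X2 :: "R3 \<Rightarrow> real" where "X2 p \<equiv> fst (snd p)"
abbreviation X3 :: "R3 \<Rightarrow> real" where "X3 p \<equiv> snd (snd p)"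

lemma linear_X: "linear (\<lambda>p. X1 p)" "linear (\<lambda>p. s * X2 p)" "linear (\<lambda>p. X2 p)" "linear (\<lambda>p. X3 p)"
  by (auto intro!: linearI simp: algebra_simps)

text \<open>A planar path that starts and ends on the upper side of the plane \<open>X3 = 0\<close>, and between
  either runs within this plane, in one direction, or is bent downwards.\<close>

lemma bent_path:
  fixes v :: "nat \<Rightarrow> R3" and s :: real
  defines "Y \<equiv> \<lambda>p. s * X2 p"
  assumes z: "X3 (v 0) = 1" "X3 (v 1) = 0" "X3 (v 4) = 0" "X3 (v 5) = 1"
    and sep: "Y (v 4) < Y (v 0)" "Y (v 4) < Y (v 1)" "Y (v 5) < Y (v 0)" "Y (v 5) < Y (v 1)"
    and bent: "(X3 (v 2) = 0 \<and> X3 (v 3) = 0 \<and> Y (v 2) < Y (v 1) \<and> Y (v 3) < Y (v 2) \<and> Y (v 4) < Y (v 3)) \<or>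
      (X3 (v 2) = X3 (v 3) \<and> X3 (v 3) < 0 \<and> Y (v 3) < Y (v 1) \<and> Y (v 3) < Y (v 2) \<and> Y (v 4) < Y (v 2))"
    and x: "x \<in> closed_segment (v k) (v (Suc k))" "x \<in> closed_segment (v l) (v (Suc l))" and kl: "k < l" "l < 5"
  shows "l = Suc k \<and> x = v l"
proof -
  note Y = linear_X(2)[of s, folded Y_def] and Z = linear_X(4)
  define e where "e j = (x \<in> closed_segment (v j) (v (Suc j)))" for j
  \<comment> \<open>Separates the last edge, where \<open>Y\<close> is at most \<open>c0\<close>,
    from the first, where it is larger.\<close>
  define c0 where "c0 = max (Y (v 4)) (Y (v 5))"
  have E0: "0 \<le> X3 x \<and> (X3 x = 0 \<longrightarrow> x = v 1) \<and> c0 < Y x" if "e 0"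
    using that[unfolded e_def] seg_ge[OF Z, of x "v 0" "v 1" 0] seg_end[OF Z, of x "v 0" "v 1"]
      seg_gt[OF Y, of x "v 0" "v 1" c0] z sep by (auto simp: c0_def)
  have E4: "0 \<le> X3 x \<and> (X3 x = 0 \<longrightarrow> x = v 4) \<and> Y x \<le> c0" if "e 4"
    using that[unfolded e_def] seg_ge[OF Z, of x "v 4" "v 5" 0] seg_start[OF Z, of x "v 4" "v 5"]
      seg_le[OF Y, of x "v 4" "v 5" c0] z by (auto simp: c0_def)
  have ekl: "e k" "e l" using x by (auto simp: e_def)
  have cases: "k = 0 \<and> l = 1 \<or> k = 0 \<and> l = 2 \<or> k = 0 \<and> l = 3 \<or> k = 0 \<and> l = 4 \<or> k = 1 \<and> l = 2 \<or>
      k = 1 \<and> l = 3 \<or> k = 1 \<and> l = 4 \<or> k = 2 \<and> l = 3 \<or> k = 2 \<and> l = 4 \<or> k = 3 \<and> l = 4"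
    using kl by presburger
  from bent show ?thesis
  proof (elim disjE conjE)
    assume b: "X3 (v 2) = 0" "X3 (v 3) = 0" "Y (v 2) < Y (v 1)" "Y (v 3) < Y (v 2)" "Y (v 4) < Y (v 3)"
    have E1: "X3 x \<le> 0 \<and> Y (v 2) \<le> Y x \<and> (Y x = Y (v 2) \<longrightarrow> x = v 2)" if "e 1"
      using that[unfolded e_def] seg_le[OF Z, of x "v 1" "v 2" 0] seg_end[OF Y, of x "v 1" "v 2"]
        seg_ge[OF Y, of x "v 1" "v 2" "Y (v 2)"] z b by (auto simp: numeral_2_eq_2)
    have E2: "X3 x \<le> 0 \<and> Y (v 3) \<le> Y x \<and> Y x \<le> Y (v 2) \<and> (Y x = Y (v 3) \<longrightarrow> x = v 3)" if "e 2"
      using that[unfolded e_def] seg_le[OF Z, of x "v 2" "v 3" 0] seg_end[OF Y, of x "v 2" "v 3"]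
        seg_ge[OF Y, of x "v 2" "v 3" "Y (v 3)"] seg_le[OF Y, of x "v 2" "v 3" "Y (v 2)"] z b by auto
    have E3: "X3 x \<le> 0 \<and> Y x \<le> Y (v 3)" if "e 3"
      using that[unfolded e_def] seg_le[OF Z, of x "v 3" "v 4" 0]
        seg_le[OF Y, of x "v 3" "v 4" "Y (v 3)"] z b by auto
    show ?thesis using cases by (elim disjE conjE) (use ekl E0 E1 E2 E3 E4 b in force)+
  next
    assume b: "X3 (v 2) = X3 (v 3)" "X3 (v 3) < 0" "Y (v 3) < Y (v 1)" "Y (v 3) < Y (v 2)" "Y (v 4) < Y (v 2)"
    \<comment> \<open>Separates the edge that rejoins the plane, where \<open>Y\<close> is at most
      \<open>c1\<close>, from the edge that leaves it.\<close>
    define c1 where "c1 = max (Y (v 3)) (Y (v 4))"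
    have c1: "Y (v 4) \<le> c1" "c1 < Y (v 1)" "c1 < Y (v 2)" using b sep by (auto simp: c1_def)
    have E1: "X3 x \<le> 0 \<and> c1 < Y x \<and> (X3 x = X3 (v 2) \<longrightarrow> x = v 2)" if "e 1"
      using that[unfolded e_def] seg_le[OF Z, of x "v 1" "v 2" 0] seg_end[OF Z, of x "v 1" "v 2"]
        seg_gt[OF Y, of x "v 1" "v 2" c1] z b c1 by (auto simp: numeral_2_eq_2)
    have E2: "X3 x = X3 (v 2)" if "e 2"
      using that[unfolded e_def] seg_le[OF Z, of x "v 2" "v 3" "X3 (v 2)"]
        seg_ge[OF Z, of x "v 2" "v 3" "X3 (v 2)"] b by auto
    have E3: "X3 x \<le> 0 \<and> Y x \<le> c1 \<and> (X3 x = X3 (v 3) \<longrightarrow> x = v 3)" if "e 3"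
      using that[unfolded e_def] seg_le[OF Z, of x "v 3" "v 4" 0] seg_start[OF Z, of x "v 3" "v 4"]
        seg_le[OF Y, of x "v 3" "v 4" c1] z b by (auto simp: c1_def)
    show ?thesis using cases by (elim disjE conjE) (use ekl E0 E1 E2 E3 E4 b c1 z in force)+
  qed
qed

text \<open>Positions of the vertices along a column: \<open>a\<close> and \<open>b\<close> are the rows where the column starts
  and ends. At time 1, a column that runs downwards is led around the braid axis, which passes
  through \<open>X2 = -1\<close>, \<open>X3 = -M\<close>.\<close>

definition place :: "real \<Rightarrow> real \<Rightarrow> real \<Rightarrow> real \<Rightarrow> real \<Rightarrow> real \<Rightarrow> nat \<Rightarrow> R3" where
  "place N M t i a b k =
    (if k = 0 then (i, a + t / 8, 1) else if k = 1 then (i, a + t / 4, 0)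
     else if k = 2 then (if a < b then (i, (2 * (a + t / 4) + (b - t / 4)) / 3, 0)
       else (i, (1 - t) * ((2 * a + b) / 3) + t * (N - 1), - (2 * M * t)))
     else if k = 3 then (if a < b then (i, ((a + t / 4) + 2 * (b - t / 4)) / 3, 0)
       else (i, (1 - t) * ((a + 2 * b) / 3) - t * (N + 1), - (2 * M * t)))
     else if k = 4 then (i, b - t / 4, 0) else (i, b - t / 8, 1))"

lemma place_X1: "X1 (place N M t i a b k) = i"
  by (simp add: place_def)

lemma continuous_on_place: "continuous_on S (\<lambda>t. place N M t i a b k)"
proof -
  have *: "continuous_on S f \<Longrightarrow> continuous_on S g \<Longrightarrow> continuous_on S (\<lambda>t. if P then f t else g t)"
    for f g :: "real \<Rightarrow> R3" and P
    by (cases P) auto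
  show ?thesis
    unfolding place_def
    by (intro * continuous_intros) auto
qed

text \<open>These are the hypotheses of \<open>bent_path\<close>, at every time. The sign
  \<open>s\<close> lets \<open>s * X2\<close> decrease from the start to the end of a column in both
  directions. A descending column lies in the plane, apart from its raised ends, at time 0 and is
  bent below it at all later times.\<close>

lemma place_sep:
  fixes i :: real
  assumes ab: "1 \<le> \<bar>a - b\<bar>" "0 \<le> a" "0 \<le> b" "a \<le> N - 2" "b \<le> N - 2"
    and M: "0 < M" and t: "0 \<le> t" "t \<le> 1"
  defines "v \<equiv> place N M t i a b" and "s \<equiv> if a < b then -1 else 1 :: real"
  shows "X3 (v 0) = 1" "X3 (v 1) = 0" "X3 (v 4) = 0" "X3 (v 5) = 1"
    "s * X2 (v 4) < s * X2 (v 0)" "s * X2 (v 4) < s * X2 (v 1)" "s * X2 (v 5) < s * X2 (v 0)" "s * X2 (v 5) < s * X2 (v 1)"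
    "(X3 (v 2) = 0 \<and> X3 (v 3) = 0 \<and> s * X2 (v 2) < s * X2 (v 1) \<and> s * X2 (v 3) < s * X2 (v 2) \<and> s * X2 (v 4) < s * X2 (v 3)) \<or>
      (X3 (v 2) = X3 (v 3) \<and> X3 (v 3) < 0 \<and> s * X2 (v 3) < s * X2 (v 1) \<and> s * X2 (v 3) < s * X2 (v 2) \<and> s * X2 (v 4) < s * X2 (v 2))"
proof -
  show "X3 (v 0) = 1" "X3 (v 1) = 0" "X3 (v 4) = 0" "X3 (v 5) = 1" by (simp_all add: v_def place_def)
  show "s * X2 (v 4) < s * X2 (v 0)" "s * X2 (v 4) < s * X2 (v 1)" "s * X2 (v 5) < s * X2 (v 0)" "s * X2 (v 5) < s * X2 (v 1)"
    using ab(1) t by (auto simp: v_def s_def place_def abs_if split: if_splits)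
  consider "a < b" | "b < a" "t = 0" | "b < a" "t > 0" using ab(1) t by fastforce
  then show "(X3 (v 2) = 0 \<and> X3 (v 3) = 0 \<and> s * X2 (v 2) < s * X2 (v 1) \<and> s * X2 (v 3) < s * X2 (v 2) \<and> s * X2 (v 4) < s * X2 (v 3)) \<or>
      (X3 (v 2) = X3 (v 3) \<and> X3 (v 3) < 0 \<and> s * X2 (v 3) < s * X2 (v 1) \<and> s * X2 (v 3) < s * X2 (v 2) \<and> s * X2 (v 4) < s * X2 (v 2))"
  proof cases
    case 1
    then have "1 \<le> b - a" using ab by auto
    then show ?thesis using 1 t by (intro disjI1) (simp add: v_def s_def place_def field_simps)
  next
    case 2
    then show ?thesis by (intro disjI1) (simp add: v_def s_def place_def field_simps)
  next
    case 3
    then have ba: "1 \<le> a - b" using ab by auto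
    \<comment> \<open>The three differences below are sums of such products and of multiples of
      \<open>t\<close>, which shows their signs.\<close>
    have T: "0 \<le> (1 - t) * (a - b)" "0 \<le> t * a" "0 \<le> t * b" "0 \<le> t * (N - 2 - b)" "0 \<le> t * (N - 2)" "0 < t * N"
      using t ab ba 3 by auto
    have "(1 - t) * ((a + 2 * b) / 3) - t * (N + 1) = a + t / 4 - (2 * ((1 - t) * (a - b)) / 3 + t * a + t * N + 5 / 4 * t)"
      by (simp add: field_simps)
    then have 1: "(1 - t) * ((a + 2 * b) / 3) - t * (N + 1) < a + t / 4" using T 3 by linarith
    have "(1 - t) * ((2 * a + b) / 3) + t * (N - 1) = b - t / 4 + (2 * ((1 - t) * (a - b)) / 3 + t * (N - 2 - b) + 5 / 4 * t)"
      by (simp add: field_simps)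
    then have 2: "b - t / 4 < (1 - t) * ((2 * a + b) / 3) + t * (N - 1)" using T 3 by linarith
    have "(1 - t) * ((2 * a + b) / 3) + t * (N - 1) = (1 - t) * ((a + 2 * b) / 3) - t * (N + 1) + ((1 - t) * (a - b) / 3 + 2 * (t * N))"
      by (simp add: field_simps)
    then have "(1 - t) * ((a + 2 * b) / 3) - t * (N + 1) < (1 - t) * ((2 * a + b) / 3) + t * (N - 1)" using T 3 by linarith
    then show ?thesis using 1 2 3 M by (intro disjI2) (simp add: v_def s_def place_def)
  qed
qed

section \<open>The motion of a whole grid\<close>

context markings
begin

text \<open>\<open>\<xi>\<close> and \<open>\<alpha>\<close> place the columns and the rows on the
  real line. They are kept variable in order to treat the diagram turned by 180 degrees as
  well.\<close>

definition pos :: "(nat \<Rightarrow> real) \<Rightarrow> (nat \<Rightarrow> real) \<Rightarrow> real \<Rightarrow> real \<Rightarrow> real \<Rightarrow> lab \<Rightarrow> R3" where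
  "pos \<xi> \<alpha> N M t = (\<lambda>(x, k). place N M t (\<xi> (fst x)) (\<alpha> (snd x)) (\<alpha> (snd (\<sigma> x))) k)"

lemma finite_strand_edges: "X \<subseteq> G \<Longrightarrow> finite (strand_edges X)"
  unfolding strand_edges_def using finite_subset[OF _ finite_G] by blast

lemma strand_edgesE:
  assumes "(l, l') \<in> strand_edges X"
  obtains x k where "x \<in> X" "k < 5" "l = (x, k)" "l' = (x, Suc k)" | x where "x \<in> X" "l = (x, 5)" "l' = (\<rho> x, 0)"
proof -
  obtain x k where xk: "x \<in> X" "k < 6" "l = (x, k)" "l' = (if k = 5 then (\<rho> x, 0) else (x, Suc k))"
    using assms unfolding strand_edges_def by auto
  show thesis
  proof (cases "k = 5")
    case True then show thesis using xk that(2) by simp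
  next
    case False
    then have "k < 5" using xk(2) by simp
    then show thesis using xk False that(1) by simp
  qed
qed

lemma snd_\<sigma>_ne: "x \<in> G \<Longrightarrow> snd (\<sigma> x) \<noteq> snd x"
  using \<sigma> by (metis prod.expand)

lemma fst_\<tau>_ne: "x \<in> G \<Longrightarrow> fst (\<tau> x) \<noteq> fst x"
  using \<tau> by (metis prod.expand)

text \<open>Different columns lie in different planes of constant \<open>X1\<close>, and each of
  them is simple by \<open>bent_path\<close>. The edges along rows lie at level 1, which a column
  reaches only at its two ends; they stray from their row by at most \<open>t / 8\<close>, while
  different rows are at distance at least 1.\<close>

lemma embedded_pos:
  assumes X: "consistent X"
    and \<xi>: "\<And>x y. x \<in> G \<Longrightarrow> y \<in> G \<Longrightarrow> \<xi> (fst x) = \<xi> (fst y) \<Longrightarrow> fst x = fst y"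
    and \<alpha>: "\<And>x y. x \<in> G \<Longrightarrow> y \<in> G \<Longrightarrow> snd x \<noteq> snd y \<Longrightarrow> 1 \<le> \<bar>\<alpha> (snd x) - \<alpha> (snd y)\<bar>"
    and N: "\<And>x. x \<in> G \<Longrightarrow> 0 \<le> \<alpha> (snd x) \<and> \<alpha> (snd x) \<le> N - 2"
    and M: "0 < M" and t: "t \<in> {0..1}"
  shows "embedded (strand_edges X) (pos \<xi> \<alpha> N M t)"
proof -
  define p where "p = pos \<xi> \<alpha> N M t"
  have XG: "x \<in> X \<Longrightarrow> x \<in> G" and \<rho>X: "x \<in> X \<Longrightarrow> \<rho> x \<in> X" and X\<sigma>: "x \<in> X \<Longrightarrow> y \<in> X \<Longrightarrow> \<sigma> x \<noteq> y" for x y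
    using X by (auto simp: consistent_def)
  define v where "v x = place N M t (\<xi> (fst x)) (\<alpha> (snd x)) (\<alpha> (snd (\<sigma> x)))" for x
  have p: "p (x, k) = v x k" for x k by (simp add: p_def pos_def v_def)
  have X1v: "X1 (v x k) = \<xi> (fst x)" for x k by (simp add: v_def place_X1)
  note sep = place_sep[of "\<alpha> (snd x)" "\<alpha> (snd (\<sigma> x))" N M t "\<xi> (fst x)" for x, folded v_def]
  have sepx: "1 \<le> \<bar>\<alpha> (snd x) - \<alpha> (snd (\<sigma> x))\<bar>" "0 \<le> \<alpha> (snd x)" "0 \<le> \<alpha> (snd (\<sigma> x))" "\<alpha> (snd x) \<le> N - 2"
    "\<alpha> (snd (\<sigma> x)) \<le> N - 2" if "x \<in> X" for x
    using \<alpha>[of x "\<sigma> x"] N[of x] N[of "\<sigma> x"] \<sigma>(1)[of x] snd_\<sigma>_ne[of x] XG[OF that] by auto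
  have t': "0 \<le> t" "t \<le> 1" using t by auto
  note sep = sep[OF sepx M t']
  have bent: "l = Suc k \<and> q = v x l"
    if "x \<in> X" "q \<in> closed_segment (v x k) (v x (Suc k))" "q \<in> closed_segment (v x l) (v x (Suc l))" "k < l" "l < 5"
    for x q k l
    using bent_path[OF sep[OF that(1) that(1) that(1) that(1) that(1)] that(2-)] .
  have v0: "v x 0 = (\<xi> (fst x), \<alpha> (snd x) + t / 8, 1)" and v5: "v x 5 = (\<xi> (fst x), \<alpha> (snd (\<sigma> x)) - t / 8, 1)" for x
    by (simp_all add: v_def place_def)
  have X1seg: "X1 q = \<xi> (fst x)" if "q \<in> closed_segment (v x k) (v x l)" for q x k l
    using seg_le[OF linear_X(1) that, of "\<xi> (fst x)"] seg_ge[OF linear_X(1) that, of "\<xi> (fst x)"] X1v by auto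
  have low: "X3 q \<le> 0" if "x \<in> X" "k \<in> {1,2,3}" "q \<in> closed_segment (v x k) (v x (Suc k))" for q x k
  proof -
    have "X3 (v x 1) \<le> 0" "X3 (v x 2) \<le> 0" "X3 (v x 3) \<le> 0" "X3 (v x 4) \<le> 0"
      using sep[OF that(1) that(1) that(1) that(1) that(1)] by auto
    then have "X3 (v x k) \<le> 0" "X3 (v x (Suc k)) \<le> 0" using that(2) by (auto simp: eval_nat_numeral)
    then show ?thesis using seg_le[OF linear_X(4) that(3), of 0] by simp
  qed
  have top: "(k = 0 \<and> q = v x 0) \<or> (k = 4 \<and> q = v x 5)"
    if "x \<in> X" "k < 5" "q \<in> closed_segment (v x k) (v x (Suc k))" "X3 q = 1" for x k q
  proof -
    note s = sep[OF that(1) that(1) that(1) that(1) that(1)]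
    have "k \<notin> {1,2,3}" using low[OF that(1) _ that(3)] that(4) by force
    then have "k = 0 \<or> k = 4" using that(2) by auto
    then show ?thesis
    proof
      assume 1: "k = 0"
      then have "q = v x 0" using seg_start[OF linear_X(4), of q "v x 0" "v x 1"] that(3,4) s(1,2) by simp
      then show ?thesis using 1 by simp
    next
      assume 2: "k = 4"
      then have "q = v x 5" using seg_end[OF linear_X(4), of q "v x 4" "v x 5"] that(3,4) s(3,4) by simp
      then show ?thesis using 2 by simp
    qed
  qed
  have row_seg: "X3 q = 1 \<and> \<bar>X2 q - \<alpha> (snd (\<sigma> x))\<bar> \<le> t / 8"
    if "x \<in> X" "q \<in> closed_segment (v x 5) (v (\<rho> x) 0)" for x q
  proof -
    have "snd (\<rho> x) = snd (\<sigma> x)" using \<tau>(3)[OF \<sigma>(1)[OF XG[OF that(1)]]] by (simp add: \<rho>_def)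
    then have e: "v (\<rho> x) 0 = (\<xi> (fst (\<rho> x)), \<alpha> (snd (\<sigma> x)) + t / 8, 1)" using v0 by simp
    show ?thesis
      using seg_le[OF linear_X(4) that(2), of 1] seg_ge[OF linear_X(4) that(2), of 1]
        seg_le[OF linear_X(3) that(2), of "\<alpha> (snd (\<sigma> x)) + t / 8"]
        seg_ge[OF linear_X(3) that(2), of "\<alpha> (snd (\<sigma> x)) - t / 8"] t'
      unfolding e v5 abs_le_iff by simp
  qed
  have close: "snd y = snd z" if "y \<in> G" "z \<in> G" "\<bar>\<alpha> (snd y) - \<alpha> (snd z)\<bar> \<le> t / 2" for y z
    using \<alpha>[OF that(1,2)] that(3) t' by fastforce
  have row_col: "(k = 0 \<and> x = \<rho> y \<and> q = v x 0) \<or> (k = 4 \<and> x = y \<and> q = v x 5)"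
    if "x \<in> X" "k < 5" "q \<in> closed_segment (v x k) (v x (Suc k))" "y \<in> X" "q \<in> closed_segment (v y 5) (v (\<rho> y) 0)"
    for x k q y
  proof -
    have q: "X3 q = 1" "\<bar>X2 q - \<alpha> (snd (\<sigma> y))\<bar> \<le> t / 8" using row_seg[OF that(4,5)] by auto
    from top[OF that(1-3) q(1)] show ?thesis
    proof
      assume k: "k = 0 \<and> q = v x 0"
      then have "X2 q = \<alpha> (snd x) + t / 8" by (simp add: v0)
      then have "\<bar>\<alpha> (snd x) - \<alpha> (snd (\<sigma> y))\<bar> \<le> t / 2" using q(2) t' by linarith
      then have "snd x = snd (\<sigma> y)" using close[of x "\<sigma> y"] XG that \<sigma>(1) by auto
      then have "x = \<sigma> y \<or> x = \<rho> y" using row[of "\<sigma> y" x] XG that \<sigma>(1) by (auto simp: \<rho>_def)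
      then show ?thesis using X\<sigma>[OF that(4,1)] k by auto
    next
      assume k: "k = 4 \<and> q = v x 5"
      then have "X2 q = \<alpha> (snd (\<sigma> x)) - t / 8" by (simp add: v5)
      then have "\<bar>\<alpha> (snd (\<sigma> x)) - \<alpha> (snd (\<sigma> y))\<bar> \<le> t / 2" using q(2) t' by linarith
      then have "snd (\<sigma> x) = snd (\<sigma> y)" using close[of "\<sigma> x" "\<sigma> y"] XG that \<sigma>(1) by auto
      then have "\<sigma> x = \<sigma> y \<or> \<sigma> x = \<rho> y" using row[of "\<sigma> y" "\<sigma> x"] XG that \<sigma>(1) by (auto simp: \<rho>_def)
      then have "x = y" using X\<sigma>[OF that(1) \<rho>X[OF that(4)]] \<sigma>\<sigma> XG that by metis
      then show ?thesis using k by auto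
    qed
  qed
  have same_col: "x = y" if "x \<in> X" "y \<in> X" "\<xi> (fst x) = \<xi> (fst y)" for x y
    using \<xi>[of y x] column[of x y] X\<sigma>[OF that(1,2)] XG that by metis
  have "embedded (strand_edges X) p"
  proof (rule embeddedI)
    fix l l' assume "(l, l') \<in> strand_edges X"
    then show "p l \<noteq> p l'"
    proof (cases rule: strand_edgesE)
      case (1 x k)
      note s = sep[OF 1(1) 1(1) 1(1) 1(1) 1(1)]
      have "k \<in> {0,1,2,3,4}" using 1(2) by auto
      moreover have "v x 1 \<noteq> v x 2" "v x 2 \<noteq> v x 3" "v x 3 \<noteq> v x 4" "v x 0 \<noteq> v x 1" "v x 4 \<noteq> v x 5"
        using s by fastforce+
      ultimately show ?thesis using 1 p by (auto simp: eval_nat_numeral)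
    next
      case (2 x)
      have "\<xi> (fst (\<rho> x)) \<noteq> \<xi> (fst x)"
        using \<xi>[of "\<rho> x" x] fst_\<tau>_ne[OF \<sigma>(1)] \<sigma>(3) XG[OF 2(1)] \<rho>_in by (metis \<rho>_def)
      then show ?thesis using 2 p v0 v5 by simp
    qed
  next
    fix l l' r r' q
    assume h: "(l, l') \<in> strand_edges X" "(r, r') \<in> strand_edges X" "(l, l') \<noteq> (r, r')"
      "q \<in> closed_segment (p l) (p l')" "q \<in> closed_segment (p r) (p r')"
    from h(1) show "q \<in> p ` ({l, l'} \<inter> {r, r'})"
    proof (cases rule: strand_edgesE)
      case L: (1 x k)
      from h(2) show ?thesis
      proof (cases rule: strand_edgesE)
        case R: (1 y j)
        have q: "q \<in> closed_segment (v x k) (v x (Suc k))" "q \<in> closed_segment (v y j) (v y (Suc j))"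
          using h(4,5) L R p by auto
        have xy: "x = y" using same_col[OF L(1) R(1)] X1seg[OF q(1)] X1seg[OF q(2)] by simp
        have "k \<noteq> j" using h(3) L R xy by auto
        then consider "k < j" | "j < k" by linarith
        then show ?thesis
        proof cases
          case 1
          then show ?thesis using bent[of x q k j] q L R xy p by auto
        next
          case 2
          then show ?thesis using bent[of x q j k] q L R xy p by auto
        qed
      next
        case R: (2 y)
        have q: "q \<in> closed_segment (v x k) (v x (Suc k))" "q \<in> closed_segment (v y 5) (v (\<rho> y) 0)"
          using h(4,5) L R p by auto
        show ?thesis using row_col[OF L(1,2) q(1) R(1) q(2)] L R by (auto simp: p)
      qed
    next
      case L: (2 y)
      from h(2) show ?thesis
      proof (cases rule: strand_edgesE)
        case R: (1 x k)
        have q: "q \<in> closed_segment (v x k) (v x (Suc k))" "q \<in> closed_segment (v y 5) (v (\<rho> y) 0)"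
          using h(4,5) L R p by auto
        show ?thesis using row_col[OF R(1,2) q(1) L(1) q(2)] L R by (auto simp: p)
      next
        case R: (2 x)
        have q: "q \<in> closed_segment (v x 5) (v (\<rho> x) 0)" "q \<in> closed_segment (v y 5) (v (\<rho> y) 0)"
          using h(4,5) L R p by auto
        have "\<bar>\<alpha> (snd (\<sigma> x)) - \<alpha> (snd (\<sigma> y))\<bar> \<le> t / 2"
          using row_seg[OF R(1) q(1)] row_seg[OF L(1) q(2)] t' by linarith
        then have "snd (\<sigma> x) = snd (\<sigma> y)" using close[of "\<sigma> x" "\<sigma> y"] XG R L \<sigma>(1) by auto
        then have "\<sigma> x = \<sigma> y \<or> \<sigma> x = \<rho> y" using row[of "\<sigma> y" "\<sigma> x"] XG R L \<sigma>(1) by (auto simp: \<rho>_def)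
        then have "x = y" using X\<sigma>[OF R(1) \<rho>X[OF L(1)]] \<sigma>\<sigma> XG R L by metis
        then show ?thesis using h(3) L R by auto
      qed
    qed
  qed
  then show ?thesis by (simp add: p_def)
qed

end

section \<open>Matching the traversals of a grid with a given orientation\<close>

text \<open>The first edge occupies the times up to 1/2, so the second vertex is passed at 1/2 and
  the last one later. These are the two points by which \<open>same_oriented_loop_or_reverse\<close>
  tells the directions apart.\<close>

lemma closed_polygon_times:
  fixes vs :: "'a::real_normed_vector list"
  assumes "3 \<le> length vs" "distinct vs"
  shows "closed_polygon vs 0 = vs ! 0" "closed_polygon vs 1 = vs ! 0" "closed_polygon vs (1/2) = vs ! 1"
    and "\<exists>s. 1/2 < s \<and> s < 1 \<and> closed_polygon vs s = last vs"
proof -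
  obtain a b c cs where vs: "vs = a # b # c # cs"
    using assms(1) by (auto simp: numeral_3_eq_3 Suc_le_length_iff)
  define r where "r = polygonal_path ((b # c # cs) @ [a])"
  have cp: "closed_polygon vs = linepath a b +++ r" by (simp add: closed_polygon_def vs r_def)
  have r: "r 0 = b" "r 1 = a"
    using pathstart_polygonal_path[of "(b # c # cs) @ [a]"] pathfinish_polygonal_path[of "(b # c # cs) @ [a]"]
    by (auto simp: r_def pathstart_def pathfinish_def)
  show "closed_polygon vs 0 = vs ! 0" "closed_polygon vs 1 = vs ! 0" "closed_polygon vs (1/2) = vs ! 1"
    unfolding cp by (simp_all add: r vs joinpaths_def linepath_def)
  have "(last vs, a) \<in> path_edges ((b # c # cs) @ [a])"
    unfolding path_edges_def in_set_zip vs
    by (intro exI[of _ "length cs + 1"]) (auto simp: nth_append last_conv_nth nth_Cons' split: if_splits)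
  then have "last vs \<in> path_image r"
    unfolding r_def by (subst path_image_polygonal_path) (auto simp: realize_def)
  then obtain u where u: "u \<in> {0..1}" "r u = last vs" by (auto simp: path_image_def)
  have "last vs \<noteq> a" "last vs \<noteq> b" using assms(2) by (auto simp: vs last_conv_nth nth_Cons' split: if_splits)
  then have "u \<noteq> 0" "u \<noteq> 1" using u r by auto
  then have "0 < u" "u < 1" using u by auto
  have e: "2 * ((u + 1) / 2) - 1 = u" by (simp add: field_simps)
  have "closed_polygon vs ((u + 1) / 2) = r (2 * ((u + 1) / 2) - 1)"
    unfolding cp joinpaths_def using \<open>0 < u\<close> by simp
  then have "closed_polygon vs ((u + 1) / 2) = last vs" unfolding e u(2) .
  then show "\<exists>s. 1/2 < s \<and> s < 1 \<and> closed_polygon vs s = last vs"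
    using \<open>0 < u\<close> \<open>u < 1\<close> by (intro exI[of _ "(u + 1) / 2"]) auto
qed

lemma same_oriented_loop_cong:
  assumes "\<And>u. u \<in> {0..1} \<Longrightarrow> \<gamma>' u = \<gamma> u" "same_oriented_loop \<gamma> \<delta>"
  shows "same_oriented_loop \<gamma>' \<delta>"
proof -
  obtain a \<phi> where a: "a \<in> {0..1}" and \<phi>: "strict_mono_on {0..1} \<phi>" "\<phi> ` {0..1} = {0..1}"
    "\<forall>t\<in>{0..1}. \<delta> t = shiftpath a \<gamma> (\<phi> t)"
    using assms(2) unfolding same_oriented_loop_def by blast
  have "shiftpath a \<gamma>' (\<phi> t) = shiftpath a \<gamma> (\<phi> t)" if "t \<in> {0..1}" for t
  proof -
    have "\<phi> t \<in> {0..1}" using \<phi>(2) that by blast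
    then show ?thesis using a assms(1) by (auto simp: shiftpath_def)
  qed
  then have "\<forall>t\<in>{0..1}. \<delta> t = shiftpath a \<gamma>' (\<phi> t)" using \<phi>(3) by simp
  then show ?thesis unfolding same_oriented_loop_def using a \<phi>(1,2) by blast
qed

lemma simple_path_injective_image:
  assumes "simple_path \<gamma>" "continuous_on UNIV F" "inj F"
  shows "simple_path (F \<circ> \<gamma>)"
  using assms continuous_on_subset[OF assms(2)]
  by (auto simp: simple_path_def loop_free_def path_continuous_image dest!: injD)

lemma connected_subset_member:
  assumes "connected A" "A \<noteq> {}" "finite \<B>" "\<And>B. B \<in> \<B> \<Longrightarrow> closed B"
    "pairwise disjnt \<B>" "A \<subseteq> \<Union>\<B>"
  shows "\<exists>B\<in>\<B>. A \<subseteq> B"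
proof -
  obtain x B where x: "x \<in> A" "x \<in> B" "B \<in> \<B>" using assms(2,6) by blast
  have "A \<subseteq> B \<union> \<Union>(\<B> - {B})" using assms(6) by blast
  moreover have "closed (\<Union>(\<B> - {B}))" using assms(3,4) by (intro closed_Union) auto
  moreover have "B \<inter> \<Union>(\<B> - {B}) \<inter> A = {}"
    using assms(5) x(3) by (fastforce simp: pairwise_def disjnt_def)
  ultimately have "B \<inter> A = {} \<or> \<Union>(\<B> - {B}) \<inter> A = {}"
    using connected_closedD[OF assms(1)] assms(4)[OF x(3)] by blast
  then have "\<Union>(\<B> - {B}) \<inter> A = {}" using x(1,2) by blast
  with \<open>A \<subseteq> B \<union> \<Union>(\<B> - {B})\<close> have "A \<subseteq> B" by fast
  then show ?thesis by (rule bexI[OF _ x(3)])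
qed

text \<open>Both families consist of the connected components of one set. This matches the
  components of the grid with the loops of an arbitrary orientation.\<close>

lemma component_families_eq:
  assumes "\<And>A. A \<in> \<A> \<Longrightarrow> connected A \<and> closed A \<and> A \<noteq> {}" "\<And>B. B \<in> \<B> \<Longrightarrow> connected B \<and> closed B \<and> B \<noteq> {}"
    and "finite \<A>" "finite \<B>" "pairwise disjnt \<A>" "pairwise disjnt \<B>" "\<Union>\<A> = \<Union>\<B>" "A \<in> \<A>"
  shows "A \<in> \<B>"
proof -
  obtain B where B: "B \<in> \<B>" "A \<subseteq> B"
    using connected_subset_member[of A \<B>] assms by blast
  obtain A' where A': "A' \<in> \<A>" "B \<subseteq> A'"
    using connected_subset_member[of B \<A>] assms B(1) by blast
  have "A \<inter> A' \<noteq> {}" using B A' assms(1)[OF assms(8)] by blast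
  then have "A = A'" using assms(5,8) A'(1) by (metis disjnt_def pairwiseD)
  then show ?thesis using B A' by auto
qed

context markings
begin

definition low :: "nat \<times> nat \<Rightarrow> R3" where "low x = (real (fst x), real (snd x), 0)"
definition high :: "nat \<times> nat \<Rightarrow> R3" where "high x = (real (fst x), real (snd x), 1)"

definition mesh :: "(nat \<times> nat) set \<Rightarrow> R3 set" where
  "mesh C = (\<Union>x\<in>C. closed_segment (low x) (high x) \<union> closed_segment (low x) (low (\<sigma> x)) \<union>
     closed_segment (high x) (high (\<tau> x)))"

lemma grid_link_mesh: "grid_link G = mesh G"
proof -
  have hull: "convex hull {a, b} = closed_segment a b" for a b :: R3
    by (simp add: segment_convex_hull)
  have col: "{(real i, real j, 0) | j. (i, j) \<in> G} = {low x, low (\<sigma> x)}" if "x \<in> G" "fst x = i" for x i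
  proof -
    have "(i, j) \<in> G \<longleftrightarrow> (i, j) = x \<or> (i, j) = \<sigma> x" for j using column[OF that(1), of "(i, j)"] that \<sigma>(1)[OF that(1)] by auto
    moreover have "x = (i, snd x)" "\<sigma> x = (i, snd (\<sigma> x))" using that \<sigma>(3) by (auto simp: prod_eq_iff)
    ultimately have "(i, j) \<in> G \<longleftrightarrow> j = snd x \<or> j = snd (\<sigma> x)" for j by (metis snd_conv)
    then show ?thesis using that \<sigma>(3) by (auto simp: low_def)
  qed
  have row': "{(real i, real j, 1) | i. (i, j) \<in> G} = {high x, high (\<tau> x)}" if "x \<in> G" "snd x = j" for x j
  proof -
    have "(i, j) \<in> G \<longleftrightarrow> (i, j) = x \<or> (i, j) = \<tau> x" for i using row[OF that(1), of "(i, j)"] that \<tau>(1)[OF that(1)] by auto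
    moreover have "x = (fst x, j)" "\<tau> x = (fst (\<tau> x), j)" using that \<tau>(3) by (auto simp: prod_eq_iff)
    ultimately have "(i, j) \<in> G \<longleftrightarrow> i = fst x \<or> i = fst (\<tau> x)" for i by (metis fst_conv)
    then show ?thesis using that \<tau>(3) by (auto simp: high_def)
  qed
  have 1: "(\<Union>i. convex hull {(real i, real j, 0) | j. (i, j) \<in> G}) = (\<Union>x\<in>G. closed_segment (low x) (low (\<sigma> x)))"
  proof (intro equalityI subsetI)
    fix q :: R3 assume "q \<in> (\<Union>i. convex hull {(real i, real j, 0) | j. (i, j) \<in> G})"
    then obtain i where i: "q \<in> convex hull {(real i, real j, 0) | j. (i, j) \<in> G}" by blast
    then have "{(real i, real j, 0 :: real) | j. (i, j) \<in> G} \<noteq> {}" by (metis convex_hull_empty empty_iff)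
    then obtain j where j: "(i, j) \<in> G" by blast
    then show "q \<in> (\<Union>x\<in>G. closed_segment (low x) (low (\<sigma> x)))"
      using i col[OF j] hull by (intro UN_I[OF j]) simp
  next
    fix q :: R3 assume "q \<in> (\<Union>x\<in>G. closed_segment (low x) (low (\<sigma> x)))"
    then obtain x where "x \<in> G" "q \<in> closed_segment (low x) (low (\<sigma> x))" by blast
    then show "q \<in> (\<Union>i. convex hull {(real i, real j, 0) | j. (i, j) \<in> G})"
      using col[of x "fst x"] hull by (intro UN_I[of "fst x"]) simp_all
  qed
  have 2: "(\<Union>j. convex hull {(real i, real j, 1) | i. (i, j) \<in> G}) = (\<Union>x\<in>G. closed_segment (high x) (high (\<tau> x)))"
  proof (intro equalityI subsetI)
    fix q :: R3 assume "q \<in> (\<Union>j. convex hull {(real i, real j, 1) | i. (i, j) \<in> G})"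
    then obtain j where i: "q \<in> convex hull {(real i, real j, 1) | i. (i, j) \<in> G}" by blast
    then have "{(real i, real j, 1 :: real) | i. (i, j) \<in> G} \<noteq> {}" by (metis convex_hull_empty empty_iff)
    then obtain i where j: "(i, j) \<in> G" by blast
    then show "q \<in> (\<Union>x\<in>G. closed_segment (high x) (high (\<tau> x)))"
      using i row'[OF j] hull by (intro UN_I[OF j]) simp
  next
    fix q :: R3 assume "q \<in> (\<Union>x\<in>G. closed_segment (high x) (high (\<tau> x)))"
    then obtain x where "x \<in> G" "q \<in> closed_segment (high x) (high (\<tau> x))" by blast
    then show "q \<in> (\<Union>j. convex hull {(real i, real j, 1) | i. (i, j) \<in> G})"
      using row'[of x "snd x"] hull by (intro UN_I[of "snd x"]) simp_all
  qed
  have 3: "(\<Union>(i, j)\<in>G. closed_segment (real i, real j, 0) (real i, real j, 1)) = (\<Union>x\<in>G. closed_segment (low x) (high x))"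
    by (simp add: low_def high_def case_prod_unfold)
  show ?thesis unfolding grid_link_def 1 2 3 mesh_def UN_Un_distrib by (simp only: Un_ac)
qed

lemma realize_strand_edges:
  "realize (strand_edges X) p = (\<Union>x\<in>X. closed_segment (p (x, 0)) (p (x, 1)) \<union> (closed_segment (p (x, 1)) (p (x, 2)) \<union>
     closed_segment (p (x, 2)) (p (x, 3)) \<union> closed_segment (p (x, 3)) (p (x, 4))) \<union> closed_segment (p (x, 4)) (p (x, 5)) \<union>
     closed_segment (p (x, 5)) (p (\<rho> x, 0)))"
proof -
  have s: "{..<6::nat} = {0, 1, 2, 3, 4, 5}" by auto
  have "(\<lambda>(x, k). f x k) ` (X \<times> A) = (\<Union>x\<in>X. f x ` A)" for f :: "nat \<times> nat \<Rightarrow> nat \<Rightarrow> lab \<times> lab" and A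
    by auto
  then have "strand_edges X = (\<Union>x\<in>X. {((x, 0), (x, 1)), ((x, 1), (x, 2)), ((x, 2), (x, 3)), ((x, 3), (x, 4)),
      ((x, 4), (x, 5)), ((x, 5), (\<rho> x, 0))})"
    unfolding strand_edges_def s by (simp add: numeral_eq_Suc)
  then show ?thesis unfolding realize_UN by (simp add: realize_def Un_assoc)
qed

abbreviation pos0 :: "real \<Rightarrow> real \<Rightarrow> lab \<Rightarrow> R3" where
  "pos0 N M \<equiv> pos real real N M 0"

lemma pos0:
  assumes "x \<in> G"
  shows "pos0 N M (x, 0) = high x" "pos0 N M (x, 1) = low x" "pos0 N M (x, 4) = low (\<sigma> x)" "pos0 N M (x, 5) = high (\<sigma> x)"
    "pos0 N M (x, 2) = (2/3) *\<^sub>R low x + (1/3) *\<^sub>R low (\<sigma> x)" "pos0 N M (x, 3) = (1/3) *\<^sub>R low x + (2/3) *\<^sub>R low (\<sigma> x)"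
  using \<sigma>(3)[OF assms] by (auto simp: pos_def place_def low_def high_def field_simps)

lemma consistent_surj: "consistent X \<Longrightarrow> \<rho> ` X = X"
proof -
  assume X: "consistent X"
  have "finite X" using X finite_G finite_subset unfolding consistent_def by blast
  moreover have "inj_on \<rho> X" using X inj_\<rho> unfolding consistent_def by (meson inj_onI subsetD)
  moreover have "\<rho> ` X \<subseteq> X" using X unfolding consistent_def by blast
  ultimately show ?thesis by (simp add: endo_inj_surj)
qed

text \<open>At time 0 the strands trace the grid itself: the inner vertices merely trisect the
  columns and, as \<open>\<rho>\<close> permutes \<open>X\<close>, the last edges of the strands
  cover all rows involved.\<close>

lemma realize_pos0:
  assumes X: "consistent X"
  shows "realize (strand_edges X) (pos0 N M) = mesh (X \<union> \<sigma> ` X)"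
proof -
  have XG: "x \<in> X \<Longrightarrow> x \<in> G" for x using X by (auto simp: consistent_def)
  have mid: "closed_segment a ((2/3) *\<^sub>R a + (1/3) *\<^sub>R b) \<union> closed_segment ((2/3) *\<^sub>R a + (1/3) *\<^sub>R b) ((1/3) *\<^sub>R a + (2/3) *\<^sub>R b) \<union>
      closed_segment ((1/3) *\<^sub>R a + (2/3) *\<^sub>R b) b = closed_segment a b" for a b :: R3
  proof -
    have m2: "(1/3) *\<^sub>R a + (2/3) *\<^sub>R b \<in> closed_segment a b"
      unfolding in_segment by (intro exI[of _ "2/3"]) auto
    have m1: "(2/3) *\<^sub>R a + (1/3) *\<^sub>R b \<in> closed_segment a ((1/3) *\<^sub>R a + (2/3) *\<^sub>R b)"
      unfolding in_segment
      by (intro exI[of _ "1/2"]) (simp add: prod_eq_iff field_simps)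
    show ?thesis unfolding Un_closed_segment[OF m1] Un_closed_segment[OF m2] ..
  qed
  have "realize (strand_edges X) (pos0 N M) = (\<Union>x\<in>X. closed_segment (low x) (high x) \<union> closed_segment (low x) (low (\<sigma> x)) \<union>
     closed_segment (low (\<sigma> x)) (high (\<sigma> x)) \<union> closed_segment (high (\<sigma> x)) (high (\<rho> x)))"
    unfolding realize_strand_edges
  proof (intro SUP_cong refl)
    fix x assume "x \<in> X"
    then have x: "x \<in> G" "\<rho> x \<in> G" using XG \<rho>_in by auto
    show "closed_segment (pos0 N M (x, 0)) (pos0 N M (x, 1)) \<union>
         (closed_segment (pos0 N M (x, 1)) (pos0 N M (x, 2)) \<union>
          closed_segment (pos0 N M (x, 2)) (pos0 N M (x, 3)) \<union>
          closed_segment (pos0 N M (x, 3)) (pos0 N M (x, 4))) \<union>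
         closed_segment (pos0 N M (x, 4)) (pos0 N M (x, 5)) \<union>
         closed_segment (pos0 N M (x, 5)) (pos0 N M (\<rho> x, 0)) =
         closed_segment (low x) (high x) \<union> closed_segment (low x) (low (\<sigma> x)) \<union>
         closed_segment (low (\<sigma> x)) (high (\<sigma> x)) \<union> closed_segment (high (\<sigma> x)) (high (\<rho> x))"
      unfolding pos0[OF x(1)] pos0(1)[OF x(2)] mid by (simp only: closed_segment_commute)
  qed
  also have "\<dots> = mesh (X \<union> \<sigma> ` X)"
  proof -
    have a: "(\<Union>x\<in>X \<union> \<sigma> ` X. closed_segment (low x) (high x)) =
      (\<Union>x\<in>X. closed_segment (low x) (high x)) \<union> (\<Union>x\<in>X. closed_segment (low (\<sigma> x)) (high (\<sigma> x)))" by auto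
    have "closed_segment (low (\<sigma> x)) (low (\<sigma> (\<sigma> x))) = closed_segment (low x) (low (\<sigma> x))" if "x \<in> X" for x
      using \<sigma>\<sigma>[OF XG[OF that]] by (simp add: closed_segment_commute)
    then have "(\<Union>x\<in>\<sigma> ` X. closed_segment (low x) (low (\<sigma> x))) = (\<Union>x\<in>X. closed_segment (low x) (low (\<sigma> x)))"
      unfolding image_image by (rule SUP_cong[OF refl])
    then have b: "(\<Union>x\<in>X \<union> \<sigma> ` X. closed_segment (low x) (low (\<sigma> x))) = (\<Union>x\<in>X. closed_segment (low x) (low (\<sigma> x)))"
      unfolding UN_Un by simp
    have "closed_segment (high (\<rho> x)) (high (\<tau> (\<rho> x))) = closed_segment (high (\<sigma> x)) (high (\<rho> x))" if "x \<in> X" for x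
      using \<tau>\<tau>[OF \<sigma>(1)[OF XG[OF that]]] by (simp add: \<rho>_def closed_segment_commute)
    then have "(\<Union>x\<in>\<rho> ` X. closed_segment (high x) (high (\<tau> x))) = (\<Union>x\<in>X. closed_segment (high (\<sigma> x)) (high (\<rho> x)))"
      unfolding image_image by (rule SUP_cong[OF refl])
    moreover have "(\<Union>x\<in>\<sigma> ` X. closed_segment (high x) (high (\<tau> x))) = (\<Union>x\<in>X. closed_segment (high (\<sigma> x)) (high (\<rho> x)))"
      unfolding image_image \<rho>_def ..
    ultimately have c: "(\<Union>x\<in>X \<union> \<sigma> ` X. closed_segment (high x) (high (\<tau> x))) = (\<Union>x\<in>X. closed_segment (high (\<sigma> x)) (high (\<rho> x)))"
      unfolding consistent_surj[OF X] UN_Un by simp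
    show ?thesis unfolding mesh_def UN_Un_distrib a b c by (simp only: Un_ac)
  qed
  finally show ?thesis .
qed

text \<open>The markings of one component of the link: the entry markings for its two directions
  taken together.\<close>

definition cls :: "nat \<times> nat \<Rightarrow> (nat \<times> nat) set" where "cls g = orb g \<union> orb (\<sigma> g)"

lemma cls_\<sigma>: "g \<in> G \<Longrightarrow> cls (\<sigma> g) = cls g"
  using \<sigma>\<sigma> by (auto simp: cls_def)

lemma cls_self: "g \<in> G \<Longrightarrow> g \<in> cls g"
  using orb_self by (auto simp: cls_def)

lemma cls_subset: "g \<in> G \<Longrightarrow> cls g \<subseteq> G"
  using orb_subset \<sigma>(1) by (auto simp: cls_def)

lemma cls_eq: assumes "g \<in> G" "x \<in> cls g" shows "cls x = cls g"
proof (cases "x \<in> orb g")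
  case True
  then have "orb x = orb g" using orb_eq assms by blast
  moreover have "orb (\<sigma> x) = orb (\<sigma> g)"
    using \<sigma>_orb[of x] \<sigma>_orb[of g] \<open>orb x = orb g\<close> assms cls_subset by (metis subsetD)
  ultimately show ?thesis by (simp add: cls_def)
next
  case False
  then have x: "x \<in> orb (\<sigma> g)" using assms by (auto simp: cls_def)
  then have "orb x = orb (\<sigma> g)" using orb_eq[OF \<sigma>(1)] assms by blast
  moreover have "orb (\<sigma> x) = orb g"
    using \<sigma>_orb[of x] \<sigma>_orb[of "\<sigma> g"] \<sigma>\<sigma> \<open>orb x = orb (\<sigma> g)\<close> assms cls_subset \<sigma>(1) by (metis subsetD)
  ultimately show ?thesis by (auto simp: cls_def)
qed

lemma orb_Un_\<sigma>: "x \<in> G \<Longrightarrow> orb x \<union> \<sigma> ` orb x = cls x"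
  by (simp add: \<sigma>_orb cls_def)

text \<open>The directions of the components can be chosen independently: a class is closed under
  \<open>\<sigma>\<close>, so markings from different classes never share a column.\<close>

lemma consistent_UN:
  assumes "\<And>C. C \<in> \<C> \<Longrightarrow> x C \<in> G \<and> cls (x C) = C"
  shows "consistent (\<Union>C\<in>\<C>. orb (x C))"
    and "(\<Union>C\<in>\<C>. orb (x C)) \<union> \<sigma> ` (\<Union>C\<in>\<C>. orb (x C)) = \<Union>\<C>"
proof -
  have "y \<noteq> \<sigma> z" if "C \<in> \<C>" "D \<in> \<C>" "y \<in> orb (x C)" "z \<in> orb (x D)" for C D y z
  proof
    assume e: "y = \<sigma> z"
    have z: "z \<in> G" "y \<in> G" using orb_subset assms that by blast+
    have "cls y = C" "cls z = D" using cls_eq[of "x C" y] cls_eq[of "x D" z] that assms by (auto simp: cls_def)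
    then have "C = D" using cls_\<sigma>[OF z(1)] e by simp
    then have "y \<in> orb (x C) \<inter> orb (\<sigma> (x C))" using e that \<sigma>_orb[of "x C"] assms by blast
    then show False using orb_\<sigma>_disjoint assms that(1) by blast
  qed
  then have "(\<Union>C\<in>\<C>. orb (x C)) \<inter> \<sigma> ` (\<Union>C\<in>\<C>. orb (x C)) = {}" by fastforce
  moreover have "(\<Union>C\<in>\<C>. orb (x C)) \<subseteq> G" using orb_subset assms by (intro UN_least) blast
  moreover have "\<forall>y\<in>(\<Union>C\<in>\<C>. orb (x C)). \<rho> y \<in> (\<Union>C\<in>\<C>. orb (x C))" using \<rho>_orb assms by blast
  ultimately show "consistent (\<Union>C\<in>\<C>. orb (x C))" by (simp add: consistent_def)
  have "(\<Union>C\<in>\<C>. orb (x C)) \<union> \<sigma> ` (\<Union>C\<in>\<C>. orb (x C)) = (\<Union>C\<in>\<C>. orb (x C) \<union> \<sigma> ` orb (x C))" by blast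
  also have "\<dots> = (\<Union>C\<in>\<C>. C)" using orb_Un_\<sigma> assms by (intro SUP_cong) auto
  finally show "(\<Union>C\<in>\<C>. orb (x C)) \<union> \<sigma> ` (\<Union>C\<in>\<C>. orb (x C)) = \<Union>\<C>" by simp
qed

lemma strand_edges_labels:
  assumes "\<And>y. y \<in> X \<Longrightarrow> \<rho> y \<in> X" "(l, l') \<in> strand_edges X" shows "fst l \<in> X" "fst l' \<in> X"
  using assms(2,1) by (auto elim!: strand_edgesE)

text \<open>The component is traversed from \<open>g\<close> and, in reverse, from
  \<open>\<sigma> g\<close>, both times starting at the point \<open>high g\<close>. The first loop
  passes \<open>low g\<close> before \<open>high (\<tau> g)\<close>, the second one after it, so one
  of them has the direction of \<open>\<gamma>\<close>.\<close>

lemma oriented_cycle: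
  assumes F: "continuous_on UNIV F" "inj F" and \<gamma>: "simple_path \<gamma>" "pathfinish \<gamma> = pathstart \<gamma>"
    and im: "path_image \<gamma> = (F :: R3 \<Rightarrow> R4) ` mesh (cls g)" and g: "g \<in> G"
    and emb: "\<And>X. consistent X \<Longrightarrow> embedded (strand_edges X) (pos0 N M)"
  shows "\<exists>x ls. x \<in> G \<and> cls x = cls g \<and> polygon_edges ls = strand_edges (orb x) \<and> distinct ls \<and> 3 \<le> length ls \<and>
     same_oriented_loop (F \<circ> closed_polygon (map (pos0 N M) ls)) \<gamma>"
proof -
  let ?p = "pos0 N M"
  have sg: "\<sigma> g \<in> G" using g \<sigma>(1) by blast
  define l1 l2 where "l1 = cycle_list g" and "l2 = rotate 5 (cycle_list (\<sigma> g))"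
  define L1 L2 where "L1 = F \<circ> closed_polygon (map ?p l1)" and "L2 = F \<circ> closed_polygon (map ?p l2)"
  have e: "polygon_edges l1 = strand_edges (orb g)" "polygon_edges l2 = strand_edges (orb (\<sigma> g))"
    using polygon_edges_cycle_list g sg by (simp_all add: l1_def l2_def polygon_edges_rotate)
  have d: "distinct l1" "distinct l2" using distinct_cycle_list g sg by (simp_all add: l1_def l2_def)
  have len: "3 \<le> length l1" "3 \<le> length l2"
    using period[OF g] period[OF sg] by (simp_all add: l1_def l2_def length_cycle_list)
  have E: "embedded (strand_edges (orb g)) ?p" "embedded (strand_edges (orb (\<sigma> g))) ?p"
    using emb consistent_orb g sg by blast+
  have sp: "simple_path (closed_polygon (map ?p l1))" "simple_path (closed_polygon (map ?p l2))"
    using simple_path_closed_polygon[OF E(1) d(1) len(1)] simple_path_closed_polygon[OF E(2) d(2) len(2)] e by simp_all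
  have dp: "distinct (map ?p l1)" "distinct (map ?p l2)" "3 \<le> length (map ?p l1)" "3 \<le> length (map ?p l2)"
    using sp simple_path_closed_polygon_embedded by blast+
  have ne: "l1 \<noteq> []" "l2 \<noteq> []" using len by auto
  have pi: "path_image (closed_polygon (map ?p l1)) = mesh (cls g)" "path_image (closed_polygon (map ?p l2)) = mesh (cls g)"
    using path_image_closed_polygon_map[OF ne(1), of ?p] path_image_closed_polygon_map[OF ne(2), of ?p] e
      realize_pos0[OF consistent_orb[OF g]] realize_pos0[OF consistent_orb[OF sg]] orb_Un_\<sigma>[OF g] orb_Un_\<sigma>[OF sg]
      cls_\<sigma>[OF g] by auto
  note t1 = closed_polygon_times[OF dp(3,1)] and t2 = closed_polygon_times[OF dp(4,2)]
  obtain s where s: "1/2 < s" "s < 1" "closed_polygon (map ?p l1) s = last (map ?p l1)" using t1(4) by blast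
  obtain r where r: "1/2 < r" "r < 1" "closed_polygon (map ?p l2) r = last (map ?p l2)" using t2(4) by blast
  obtain x where x: "last l1 = (x, 5)" "x \<in> G" "\<sigma> x = \<tau> g" using cycle_list_ends(3)[OF g] by (auto simp: l1_def)
  have \<tau>\<sigma>: "\<rho> (\<sigma> g) = \<tau> g" using \<sigma>\<sigma>[OF g] by (simp add: \<rho>_def)
  have v1: "map ?p l1 ! 0 = high g" "map ?p l1 ! 1 = low g" "last (map ?p l1) = high (\<tau> g)"
    using cycle_list_ends(1,2)[OF g] x len(1) pos0[OF g] pos0(4)[OF x(2)] ne by (auto simp: l1_def[symmetric] last_map)
  have v2: "map ?p l2 ! 0 = high g" "map ?p l2 ! 1 = high (\<tau> g)" "last (map ?p l2) = low g"
    using cycle_list_ends(4-6)[OF sg] len(2) pos0[OF sg] pos0(1)[OF \<tau>(1)[OF g]] ne \<sigma>\<sigma>[OF g] \<tau>\<sigma>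
    by (auto simp: l2_def[symmetric] last_map)
  have "same_oriented_loop L1 \<gamma> \<or> same_oriented_loop L2 \<gamma>"
  proof (rule same_oriented_loop_or_reverse)
    show "simple_path L1" "simple_path L2" using sp simple_path_injective_image[OF _ F] by (auto simp: L1_def L2_def)
    show "pathfinish L1 = pathstart L1" "pathfinish L2 = pathstart L2"
      using t1(1,2) t2(1,2) by (simp_all add: L1_def L2_def pathstart_def pathfinish_def)
    show "path_image L1 = path_image \<gamma>" "path_image L2 = path_image \<gamma>"
      using pi unfolding L1_def L2_def path_image_compose im by simp_all
    show "pathstart L2 = pathstart L1"
      using t1(1) t2(1) v1(1) v2(1) by (simp add: L1_def L2_def pathstart_def)
    show "L1 (1/2) = L2 r" "L1 s = L2 (1/2)"
      using t1(3) t2(3) s(3) r(3) v1 v2 by (simp_all add: L1_def L2_def)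
  qed (use s r \<gamma> in auto)
  then show ?thesis
  proof
    assume "same_oriented_loop L1 \<gamma>"
    then show ?thesis using e(1) d(1) len(1) g unfolding L1_def by blast
  next
    assume "same_oriented_loop L2 \<gamma>"
    then show ?thesis using e(2) d(2) len(2) sg cls_\<sigma>[OF g] unfolding L2_def by blast
  qed
qed

lemma mesh_disjoint:
  assumes g: "g \<in> G" "g' \<in> G" "cls g \<noteq> cls g'" and emb: "\<And>X. consistent X \<Longrightarrow> embedded (strand_edges X) (pos0 N M)"
  shows "mesh (cls g) \<inter> mesh (cls g') = {}"
proof -
  define x where "x C = (if C = cls g then g else g')" for C
  \<comment> \<open>Both components are put into one consistent set, so that disjointness can be
    read off from a single embedded graph.\<close>
  have "consistent (\<Union>C\<in>{cls g, cls g'}. orb (x C))"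
    by (rule consistent_UN(1)) (use g in \<open>auto simp: x_def\<close>)
  then have c: "consistent (orb g \<union> orb g')" using g(3) by (auto simp: x_def)
  have E: "embedded (strand_edges (orb g \<union> orb g')) (pos0 N M)" by (rule emb[OF c])
  have disj: "orb g \<inter> orb g' = {}"
  proof (rule ccontr)
    assume "orb g \<inter> orb g' \<noteq> {}"
    then have "g' \<in> orb g" using orb_disjoint[OF g(1,2)] orb_self[OF g(2)] by auto
    then have "g' \<in> cls g" by (simp add: cls_def)
    then show False using cls_eq[OF g(1)] g(3) by simp
  qed
  have s: "closed_segment (pos0 N M a) (pos0 N M b) \<inter> closed_segment (pos0 N M c) (pos0 N M d) = {}"
    if "(a, b) \<in> strand_edges (orb g)" "(c, d) \<in> strand_edges (orb g')" for a b c d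
  proof -
    have "fst a \<in> orb g" "fst b \<in> orb g" "fst c \<in> orb g'" "fst d \<in> orb g'"
      using strand_edges_labels[of "orb g"] strand_edges_labels[of "orb g'"] \<rho>_orb g that by blast+
    then have i: "{a, b} \<inter> {c, d} = {}" using disj by auto
    then have "(a, b) \<noteq> (c, d)" by auto
    moreover have "(a, b) \<in> strand_edges (orb g \<union> orb g')" "(c, d) \<in> strand_edges (orb g \<union> orb g')"
      using that unfolding strand_edges_def by blast+
    ultimately show ?thesis using embedded_meet[OF E, of a b c d] i by auto
  qed
  have "realize (strand_edges (orb g)) (pos0 N M) \<inter> realize (strand_edges (orb g')) (pos0 N M) = {}"
    unfolding realize_def using s by fast
  then show ?thesis
    using realize_pos0[OF consistent_orb] orb_Un_\<sigma> g by simp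
qed

end

text \<open>At time 1 all edges run in the positive direction around the axis \<open>X2 = -1\<close>, \<open>X3 = -M\<close>,
  and only the columns that run downwards pass below the axis.\<close>

definition axis_turn :: "real \<Rightarrow> R3 \<Rightarrow> R3" where
  "axis_turn M p = (\<lambda>(x, y, z). (z, y, - x)) p + (M, 1, 0)"

lemma axis_turn: "X1 (axis_turn M p) = X3 p + M" "X2 (axis_turn M p) = X2 p + 1" "X3 (axis_turn M p) = - X1 p"
  by (simp_all add: axis_turn_def case_prod_unfold)

text \<open>The offsets 1/8 and 1/4 in \<open>place\<close> make the short edges between the levels
  turn about the axis: their \<open>wedge\<close> contains the term \<open>M / 8\<close>, and
  \<open>M = 8 * N\<close> is large enough for it to outweigh the height \<open>b\<close> of the
  row.\<close>

lemma wedge_place: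
  fixes i :: real
  assumes ab: "a \<noteq> b" "1 \<le> \<bar>a - b\<bar>" "0 \<le> a" "0 \<le> b" "a \<le> N - 2" "b \<le> N - 2" and M: "M = 8 * N" and k: "k < 5"
  defines "q \<equiv> \<lambda>k. axis_turn M (place N M 1 i a b k)"
  shows "wedge (q k) (q (Suc k)) > 0"
proof -
  have N: "N \<ge> 2" "M > 0" using ab M by auto
  have k5: "k = 0 \<or> k = 1 \<or> k = 2 \<or> k = 3 \<or> k = 4" using k by presburger
  define y where "y k = X2 (place N M 1 i a b k)" for k
  define z where "z k = X3 (place N M 1 i a b k)" for k
  have w: "wedge (q k) (q l) = (z k + M) * (y l + 1) - (y k + 1) * (z l + M)" for k l
    by (simp add: wedge_def q_def axis_turn y_def z_def)
  have ends: "y 0 = a + 1/8" "z 0 = 1" "y 1 = a + 1/4" "z 1 = 0" "y 4 = b - 1/4" "z 4 = 0" "y 5 = b - 1/8" "z 5 = 1"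
    by (simp_all add: y_def z_def place_def)
  have w0: "wedge (q 0) (q 1) > 0"
  proof -
    have "wedge (q 0) (q 1) = M / 8 + a + 5/4" unfolding w ends by (simp add: field_simps)
    then show ?thesis using N ab by simp
  qed
  have w4: "wedge (q 4) (q 5) > 0"
  proof -
    have "wedge (q 4) (q 5) = M / 8 - b - 3/4" unfolding w ends by (simp add: field_simps)
    then show ?thesis using N ab M by simp
  qed
  show ?thesis
  proof (cases "a < b")
    case True
    then have "1 \<le> b - a" using ab by auto
    have m: "y 2 = (2 * (a + 1/4) + (b - 1/4)) / 3" "z 2 = 0" "y 3 = ((a + 1/4) + 2 * (b - 1/4)) / 3" "z 3 = 0"
      using True by (simp_all add: y_def z_def place_def)
    have "y 1 < y 2" "y 2 < y 3" "y 3 < y 4" using \<open>1 \<le> b - a\<close> unfolding ends m by (auto simp: field_simps)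
    moreover have "wedge (q 1) (q 2) = M * (y 2 - y 1)" "wedge (q 2) (q 3) = M * (y 3 - y 2)" "wedge (q 3) (q 4) = M * (y 4 - y 3)"
      unfolding w ends(4,6) m(2,4) by (simp_all add: algebra_simps)
    ultimately have "wedge (q 1) (q 2) > 0" "wedge (q 2) (q 3) > 0" "wedge (q 3) (q 4) > 0" using N by simp_all
    then show ?thesis using k5 w0 w4 by (auto simp: eval_nat_numeral)
  next
    case False
    \<comment> \<open>Relative to the axis, the corners of the detour are at \<open>N\<close> and
      \<open>- N\<close> in the direction of \<open>X2\<close> and at \<open>- M\<close> in that of
      \<open>X3\<close>.\<close>
    have m: "y 2 = N - 1" "z 2 = - (2 * M)" "y 3 = - (N + 1)" "z 3 = - (2 * M)"
      using False by (simp_all add: y_def z_def place_def)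
    have "wedge (q 1) (q 2) = M * (N + a + 5/4)" "wedge (q 2) (q 3) = M * (2 * N)" "wedge (q 3) (q 4) = M * (N - b - 3/4)"
      unfolding w ends m by (simp_all add: field_simps)
    then have "wedge (q 1) (q 2) > 0" "wedge (q 2) (q 3) > 0" "wedge (q 3) (q 4) > 0" using N ab by simp_all
    then show ?thesis using k5 w0 w4 by (auto simp: eval_nat_numeral)
  qed
qed

text \<open>An edge both of whose ends have \<open>X2 > 0\<close> after the turn misses the
  half-plane. The others occur on descending columns: the edge that passes below the axis crosses
  the plane on the wrong side, which leaves the edge that comes back up.\<close>

lemma place_half_plane:
  fixes i :: real
  assumes ab: "a \<noteq> b" "1 \<le> \<bar>a - b\<bar>" "0 \<le> a" "0 \<le> b" "a \<le> N - 2" "b \<le> N - 2" and M: "M = 8 * N" and k: "k < 5"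
  defines "q \<equiv> \<lambda>k. axis_turn M (place N M 1 i a b k)"
  assumes x: "x \<in> closed_segment (q k) (q (Suc k))" "x \<in> half_plane"
  shows "b < a \<and> x = linepath (q 3) (q 4) (N / (N + b + 3/4))"
proof -
  have N: "N \<ge> 2" "M > 0" using ab M by auto
  have k5: "k = 0 \<or> k = 1 \<or> k = 2 \<or> k = 3 \<or> k = 4" using k by presburger
  have xh: "X1 x > 0" "X2 x = 0" using x(2) by auto
  have pos: "\<not> (X2 (q k) > 0 \<and> X2 (q (Suc k)) > 0)"
    using seg_gt[OF linear_X(3) x(1), of 0] xh by auto
  have ends: "X2 (q 0) = a + 9/8" "X2 (q 1) = a + 5/4" "X2 (q 4) = b + 3/4" "X2 (q 5) = b + 7/8"
    by (simp_all add: q_def axis_turn place_def)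
  have "\<not> a < b"
  proof
    assume l: "a < b"
    have e: "X2 (q 2) = (2 * a + b) / 3 + 13/12" "X2 (q 3) = (a + 2 * b) / 3 + 11/12"
      using l by (simp_all add: q_def axis_turn place_def field_simps)
    have "X2 (q 2) > 0 \<and> X2 (q 3) > 0"
      unfolding e using ab(3,4) by (intro conjI add_nonneg_pos) simp_all
    then have "X2 (q k) > 0 \<and> X2 (q (Suc k)) > 0" using k5 ends ab by (auto simp: eval_nat_numeral)
    then show False using pos by simp
  qed
  then have ba: "b < a" using ab by simp
  have m: "q 2 = (- M, N, - i)" "q 3 = (- M, - N, - i)" "q 4 = (M, b + 3/4, - i)"
    using ba by (simp_all add: q_def axis_turn_def place_def)
  have ends_pos: "X2 (q 0) > 0" "X2 (q 1) > 0" "X2 (q 2) > 0" "X2 (q 4) > 0" "X2 (q 5) > 0"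
    using ends ab N m(1) by simp_all
  have "Suc 0 = 1" "Suc 1 = 2" "Suc 4 = 5" by simp_all
  then have "k \<noteq> 0" "k \<noteq> 1" "k \<noteq> 4" using pos ends_pos by metis+
  moreover have "k \<noteq> 2"
  proof
    assume "k = 2"
    then have "X1 x \<le> 0" using seg_le[OF linear_X(1) x(1), of 0] m N by (auto simp: eval_nat_numeral)
    then show False using xh by simp
  qed
  ultimately have "k = 3" using k5 by simp
  then obtain u where u: "x = (1 - u) *\<^sub>R q 3 + u *\<^sub>R q 4" using x(1) by (auto simp: in_segment eval_nat_numeral)
  have "(1 - u) * (- N) + u * (b + 3/4) = 0" using xh(2) unfolding u m by simp
  then have "u * (N + b + 3/4) = N" by (simp add: algebra_simps)
  then have "u = N / (N + b + 3/4)" using N ab by (simp add: field_simps)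
  then show ?thesis using u ba by (simp add: linepath_def)
qed

context markings
begin

text \<open>The motion is followed by a quarter turn that takes the braid axis to the third
  coordinate axis. Edges along rows miss the half-plane, so the strands are accounted for by the
  descending columns.\<close>

lemma closed_braid_from_cycles:
  assumes X: "consistent X"
    and \<xi>: "\<And>x y. x \<in> G \<Longrightarrow> y \<in> G \<Longrightarrow> \<xi> (fst x) = \<xi> (fst y) \<Longrightarrow> fst x = fst y"
    and \<alpha>: "\<And>x y. x \<in> G \<Longrightarrow> y \<in> G \<Longrightarrow> snd x \<noteq> snd y \<Longrightarrow> 1 \<le> \<bar>\<alpha> (snd x) - \<alpha> (snd y)\<bar>"
    and N: "\<And>x. x \<in> G \<Longrightarrow> 0 \<le> \<alpha> (snd x) \<and> \<alpha> (snd x) \<le> N - 2" "2 \<le> N"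
    and M: "M = 8 * N"
    and LS: "finite LS" "LS \<noteq> {}" "\<And>ls. ls \<in> LS \<Longrightarrow> distinct ls \<and> 3 \<le> length ls \<and> polygon_edges ls \<subseteq> strand_edges X"
    and disj: "\<And>ls ls'. ls \<in> LS \<Longrightarrow> ls' \<in> LS \<Longrightarrow> ls \<noteq> ls' \<Longrightarrow> set ls \<inter> set ls' = {}"
  shows "\<exists>q f n. carries (strand_edges X) (pos \<xi> \<alpha> N M 0) q f \<and> closed_braid n (map q ` LS) \<and>
    n \<le> card {x \<in> X. \<alpha> (snd (\<sigma> x)) < \<alpha> (snd x)}"
proof -
  define E where "E = strand_edges X"
  have XG: "x \<in> X \<Longrightarrow> x \<in> G" for x using X by (auto simp: consistent_def)
  have finE: "finite E" using finite_strand_edges X by (auto simp: consistent_def E_def)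
  have M0: "0 < M" using M N by simp
  have emb: "embedded E (pos \<xi> \<alpha> N M t)" if "t \<in> {0..1}" for t
    unfolding E_def using \<xi> \<alpha> N(1) by (intro embedded_pos[OF X _ _ _ M0 that]) blast+
  have "continuous_on {0..1} (\<lambda>t. pos \<xi> \<alpha> N M t l)" for l
    unfolding pos_def case_prod_unfold by (rule continuous_on_place)
  then obtain f1 where f1: "carries E (pos \<xi> \<alpha> N M 0) (pos \<xi> \<alpha> N M 1) f1"
    using motion_isotopy[OF finE, of "pos \<xi> \<alpha> N M"] emb by blast
  define q where "q l = axis_turn M (pos \<xi> \<alpha> N M 1 l)" for l
  have emb1: "embedded E (pos \<xi> \<alpha> N M 1)" by (rule emb) simp
  obtain f2 where f2: "carries E (pos \<xi> \<alpha> N M 1) q f2"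
    unfolding q_def axis_turn_def using quarter_turn_motion[OF finE emb1] by blast
  have embq: "embedded E q"
    unfolding q_def axis_turn_def
    by (rule embedded_linear_image[OF emb1]) (auto intro!: linearI injI)
  have sepx: "\<alpha> (snd x) \<noteq> \<alpha> (snd (\<sigma> x))" "1 \<le> \<bar>\<alpha> (snd x) - \<alpha> (snd (\<sigma> x))\<bar>" "0 \<le> \<alpha> (snd x)" "0 \<le> \<alpha> (snd (\<sigma> x))" "\<alpha> (snd x) \<le> N - 2"
    "\<alpha> (snd (\<sigma> x)) \<le> N - 2" if "x \<in> X" for x
    using \<alpha>[of x "\<sigma> x"] N(1)[of x] N(1)[of "\<sigma> x"] \<sigma>(1)[of x] snd_\<sigma>_ne[of x] XG[OF that] by auto
  have qx: "q (x, k) = axis_turn M (place N M 1 (\<xi> (fst x)) (\<alpha> (snd x)) (\<alpha> (snd (\<sigma> x))) k)" for x k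
    by (simp add: q_def pos_def)
  \<comment> \<open>A column ends slightly below its row and the next one starts slightly above,
    which makes the edge along the row turn in the positive direction, too.\<close>
  have \<rho>row: "q (\<rho> x, 0) = (M + 1, \<alpha> (snd (\<sigma> x)) + 9/8, - \<xi> (fst (\<rho> x)))"
    "q (x, 5) = (M + 1, \<alpha> (snd (\<sigma> x)) + 7/8, - \<xi> (fst x))" if "x \<in> X" for x
  proof -
    have "snd (\<rho> x) = snd (\<sigma> x)" using \<tau>(3)[OF \<sigma>(1)[OF XG[OF that]]] by (simp add: \<rho>_def)
    then show "q (\<rho> x, 0) = (M + 1, \<alpha> (snd (\<sigma> x)) + 9/8, - \<xi> (fst (\<rho> x)))"
      "q (x, 5) = (M + 1, \<alpha> (snd (\<sigma> x)) + 7/8, - \<xi> (fst x))"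
      by (simp_all add: qx axis_turn_def place_def)
  qed
  have wedge: "wedge (q l) (q l') > 0" if "(l, l') \<in> E" for l l'
    using that[unfolded E_def]
  proof (cases rule: strand_edgesE)
    case (1 x k)
    then show ?thesis using wedge_place[OF sepx[OF 1(1)] M 1(2)] by (simp add: qx)
  next
    case (2 x)
    then show ?thesis using M0 \<rho>row[OF 2(1)] by (simp add: wedge_def algebra_simps)
  qed
  from polygonal_link_map[OF embq LS(1,2) LS(3)[folded E_def] disj]
  have link: "polygonal_link (map q ` LS)"
    "polygonal_support (map q ` LS) = realize (\<Union>ls\<in>LS. polygon_edges ls) q" by auto
  define D where "D = {x \<in> X. \<alpha> (snd (\<sigma> x)) < \<alpha> (snd x)}"
  define c where "c x = linepath (q (x, 3)) (q (x, 4)) (N / (N + \<alpha> (snd (\<sigma> x)) + 3/4))" for x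
  have seg: "r \<in> c ` D" if "(l, l') \<in> E" "r \<in> closed_segment (q l) (q l')" "r \<in> half_plane" for l l' r
    using that(1)[unfolded E_def]
  proof (cases rule: strand_edgesE)
    case (1 x k)
    then have "\<alpha> (snd (\<sigma> x)) < \<alpha> (snd x) \<and> r = c x"
      using place_half_plane[OF sepx[OF 1(1)] M 1(2)] that(2,3) by (simp add: qx c_def)
    then show ?thesis using 1(1) by (auto simp: D_def)
  next
    case (2 x)
    have "X2 (q l) > 0" "X2 (q l') > 0" using 2 \<rho>row[OF 2(1)] sepx(4)[OF 2(1)] by auto
    then have "X2 r > 0" using seg_gt[OF linear_X(3) that(2), of 0] by simp
    then show ?thesis using that(3) by auto
  qed
  have sub: "(\<Union>ls\<in>LS. polygon_edges ls) \<subseteq> E" using LS(3) by (auto simp: E_def)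
  have supp: "polygonal_support (map q ` LS) \<inter> half_plane \<subseteq> c ` D"
  proof
    fix r assume r: "r \<in> polygonal_support (map q ` LS) \<inter> half_plane"
    then obtain l l' where "(l, l') \<in> (\<Union>ls\<in>LS. polygon_edges ls)" "r \<in> closed_segment (q l) (q l')"
      unfolding link(2) realize_def by blast
    then show "r \<in> c ` D" using seg sub r by blast
  qed
  have finD: "finite D" unfolding D_def using XG finite_subset[OF _ finite_G] by (metis (mono_tags, lifting) mem_Collect_eq subsetI)
  have "card (polygonal_support (map q ` LS) \<inter> half_plane) \<le> card D"
    using card_mono[OF finite_imageI[OF finD] supp] card_image_le[OF finD, of c] by simp
  moreover have "closed_braid (card (polygonal_support (map q ` LS) \<inter> half_plane)) (map q ` LS)"
    unfolding closed_braid_def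
  proof (intro conjI ballI)
    fix vs e assume "vs \<in> map q ` LS" "e \<in> polygon_edges vs"
    then obtain ls e' where ls': "ls \<in> LS" "e' \<in> polygon_edges ls" "e = map_prod q q e'"
      by (metis (no_types, lifting) imageE polygon_edges_map)
    define l l' where "l = fst e'" and "l' = snd e'"
    have ls: "ls \<in> LS" "(l, l') \<in> polygon_edges ls" "e = (q l, q l')"
      using ls' by (simp_all add: l_def l'_def map_prod_def case_prod_unfold)
    then have "wedge (q l) (q l') > 0" using LS(3) wedge unfolding E_def by blast
    then show "case e of (x, xa) \<Rightarrow> (case x of (x, y, z) \<Rightarrow> \<lambda>(x', y', z'). 0 < x * y' - y * x') xa"
      by (simp add: ls(3) wedge_def case_prod_unfold)
  qed (use link(1) in simp_all)
  ultimately show ?thesis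
    using carries_trans[OF f1 f2] unfolding D_def E_def by blast
qed

end

section \<open>From oriented grids to closed braids\<close>

text \<open>The straight line from the identity to a half turn contains a singular matrix, at time
  1/2; hence two quarter turns.\<close>

lemma half_turn_motion:
  assumes E: "finite E" "embedded E p"
  shows "\<exists>f. carries E p (\<lambda>v. (\<lambda>(x, y, z). (- x, - y, z)) (p v) + w) f"
proof -
  let ?R = "(\<lambda>(x, y, z). (- y, x, z)) :: R3 \<Rightarrow> R3"
  have lin: "linear ?R" "inj ?R" by (auto intro!: linearI injI)
  have emb: "embedded E (\<lambda>v. ?R (p v) + 0)" using embedded_linear_image[OF E(2) lin] .
  obtain f where f: "carries E p (\<lambda>v. ?R (p v) + 0) f" using quarter_turn_motion[OF E, of ?R 0] by blast
  obtain f' where f': "carries E (\<lambda>v. ?R (p v) + 0) (\<lambda>v. ?R (?R (p v) + 0) + w) f'"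
    using quarter_turn_motion[OF E(1) emb, of ?R w] by blast
  have "(\<lambda>v. ?R (?R (p v) + 0) + w) = (\<lambda>v. (\<lambda>(x, y, z). (- x, - y, z)) (p v) + w)"
    by (simp add: fun_eq_iff case_prod_unfold)
  then show ?thesis using carries_trans[OF f f'] by auto
qed

theorem grid_closed_braid:
  assumes gd: "grid_diagram m G" and iso: "ambient_isotopic (stereo ` grid_link G) K"
    and or: "orientation_of K \<Gamma>" and K: "K \<noteq> {}"
  shows "\<exists>n P. 2 * n \<le> m \<and> closed_braid n P \<and>
     oriented_ambient_isotopic ((\<lambda>vs. stereo \<circ> closed_polygon vs) ` P) \<Gamma>"
proof -
  obtain \<sigma> \<tau> where "markings G \<sigma> \<tau>" using grid_diagram_markings[OF gd] .
  then interpret markings G \<sigma> \<tau> .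
  have GS: "G \<subseteq> {..<m} \<times> {..<m}" using gd by (simp add: grid_diagram_def)
  obtain h where h: "isotopic_to_id h" "h ` stereo ` grid_link G = K"
    using iso by (auto simp: ambient_isotopic_def)
  \<comment> \<open>The grid gives \<open>K\<close> up to the isotopy \<open>h\<close> only, so its
    loops are compared with those of \<open>\<Gamma>\<close> on the sphere, through
    \<open>F\<close>.\<close>
  define F where "F = h \<circ> stereo"
  have hh: "homeomorphic_map S3 S3 h" by (rule isotopic_to_id_homeomorphic_map[OF h(1)])
  have st: "stereo v \<in> sphere 0 1" for v by (rule stereo_in_sphere)
  have Fc: "continuous_on UNIV F"
    unfolding F_def using homeomorphic_imp_continuous_map[OF hh] st
    by (intro continuous_on_compose continuous_on_stereo) (auto intro: continuous_on_subset)
  have Fi: "inj F"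
    unfolding F_def using homeomorphic_imp_injective_map[OF hh] st inj_stereo
    by (intro comp_inj_on) (auto intro: inj_on_subset)
  have KF: "F ` mesh G = K" using h(2) by (simp add: F_def image_comp grid_link_mesh)
  define N where "N = real m + 1"
  define M where "M = 8 * N"
  have Gne: "G \<noteq> {}" using KF K by (auto simp: mesh_def)
  then have m1: "m \<ge> 1" using GS by (cases m) auto
  have N2: "2 \<le> N" and M0: "0 < M" using m1 by (auto simp: N_def M_def)
  have Gm: "fst x < m" "snd x < m" if "x \<in> G" for x using GS that by auto
  have Gm': "real (snd x) \<le> real m - 1" if "x \<in> G" for x using Gm(2)[OF that] by linarith
  have c1: "1 \<le> \<bar>real j - real j'\<bar>" if "j \<noteq> j'" for j j' :: nat using that by linarith
  have emb0: "embedded (strand_edges X) (pos0 N M)" if "consistent X" for X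
    by (rule embedded_pos[OF that _ c1 _ M0]) (simp_all add: N_def Gm')
  define \<C> where "\<C> = cls ` G"
  have finC: "finite \<C>" "\<C> \<noteq> {}" using finite_G Gne by (auto simp: \<C>_def)
  have UC: "\<Union>\<C> = G" using cls_self cls_subset unfolding \<C>_def by blast
  have \<Gamma>: "finite \<Gamma>" "\<And>\<gamma>. \<gamma> \<in> \<Gamma> \<Longrightarrow> simple_path \<gamma> \<and> pathfinish \<gamma> = pathstart \<gamma>"
    "pairwise (\<lambda>\<gamma> \<delta>. disjnt (path_image \<gamma>) (path_image \<delta>)) \<Gamma>" "(\<Union>\<gamma>\<in>\<Gamma>. path_image \<gamma>) = K"
    using or by (auto simp: orientation_of_def)
  have meshc: "connected (mesh C) \<and> compact (mesh C) \<and> mesh C \<noteq> {}" if C: "C \<in> \<C>" for C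
  proof -
    obtain g where g: "g \<in> G" "C = cls g" using C unfolding \<C>_def by blast
    have e: "embedded (strand_edges (orb g)) (pos0 N M)" using emb0[OF consistent_orb[OF g(1)]] .
    have l: "distinct (cycle_list g)" "3 \<le> length (cycle_list g)" "polygon_edges (cycle_list g) = strand_edges (orb g)"
      using distinct_cycle_list[OF g(1)] period[OF g(1)] polygon_edges_cycle_list[OF g(1)] by (auto simp: length_cycle_list)
    then have "simple_path (closed_polygon (map (pos0 N M) (cycle_list g)))"
      using simple_path_closed_polygon[OF e] by auto
    moreover have "cycle_list g \<noteq> []" using l(2) by auto
    then have "path_image (closed_polygon (map (pos0 N M) (cycle_list g))) = mesh C"
      using path_image_closed_polygon_map[of "cycle_list g" "pos0 N M"] l(3) realize_pos0[OF consistent_orb[OF g(1)], of N M]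
        orb_Un_\<sigma>[OF g(1)] g(2) by simp
    ultimately show ?thesis
      by (metis connected_simple_path_image compact_simple_path_image path_image_nonempty)
  qed
  have "\<forall>C\<in>\<C>. \<exists>\<gamma>\<in>\<Gamma>. path_image \<gamma> = F ` mesh C"
  proof
    fix C assume C: "C \<in> \<C>"
    have "F ` mesh C \<in> path_image ` \<Gamma>"
    proof (rule component_families_eq[where \<A> = "(\<lambda>C. F ` mesh C) ` \<C>"])
      show "connected A \<and> closed A \<and> A \<noteq> {}" if A: "A \<in> (\<lambda>C. F ` mesh C) ` \<C>" for A
      proof -
        obtain C' where C': "C' \<in> \<C>" "A = F ` mesh C'" using A by blast
        have "continuous_on (mesh C') F" using Fc continuous_on_subset by blast
        then show ?thesis using meshc[OF C'(1)] connected_continuous_image compact_continuous_image compact_imp_closed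
          unfolding C'(2) by blast
      qed
      show "connected B \<and> closed B \<and> B \<noteq> {}" if "B \<in> path_image ` \<Gamma>" for B
        using that \<Gamma>(2) connected_simple_path_image closed_simple_path_image path_image_nonempty by blast
      show "pairwise disjnt ((\<lambda>C. F ` mesh C) ` \<C>)"
        unfolding pairwise_image
      proof (rule pairwiseI, rule impI)
        fix C D assume CD: "C \<in> \<C>" "D \<in> \<C>" "C \<noteq> D"
        then obtain g g' where "g \<in> G" "g' \<in> G" "C = cls g" "D = cls g'" unfolding \<C>_def by blast
        then have "mesh C \<inter> mesh D = {}" using mesh_disjoint[of g g' N M] emb0 CD(3) by simp
        then show "disjnt (F ` mesh C) (F ` mesh D)" unfolding disjnt_def by (simp add: image_Int[OF Fi, symmetric])
      qed
      show "pairwise disjnt (path_image ` \<Gamma>)"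
        using \<Gamma>(3) unfolding pairwise_image by (simp add: pairwise_def)
      have "\<Union>((\<lambda>C. F ` mesh C) ` \<C>) = F ` mesh (\<Union>\<C>)" unfolding mesh_def by blast
      then show "\<Union>((\<lambda>C. F ` mesh C) ` \<C>) = \<Union>(path_image ` \<Gamma>)" using KF \<Gamma>(4) UC by simp
    qed (use finC \<Gamma>(1) C in auto)
    then show "\<exists>\<gamma>\<in>\<Gamma>. path_image \<gamma> = F ` mesh C" by force
  qed
  then obtain gam where gam: "\<And>C. C \<in> \<C> \<Longrightarrow> gam C \<in> \<Gamma> \<and> path_image (gam C) = F ` mesh C" by metis
  have "\<forall>C\<in>\<C>. \<exists>x ls. x \<in> G \<and> cls x = C \<and> polygon_edges ls = strand_edges (orb x) \<and> distinct ls \<and> 3 \<le> length ls \<and>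
     same_oriented_loop (F \<circ> closed_polygon (map (pos0 N M) ls)) (gam C)"
  proof
    fix C assume C: "C \<in> \<C>"
    then obtain g where g: "g \<in> G" "C = cls g" unfolding \<C>_def by blast
    have "simple_path (gam C)" "pathfinish (gam C) = pathstart (gam C)" using gam[OF C] \<Gamma>(2) by auto
    then show "\<exists>x ls. x \<in> G \<and> cls x = C \<and> polygon_edges ls = strand_edges (orb x) \<and> distinct ls \<and> 3 \<le> length ls \<and>
     same_oriented_loop (F \<circ> closed_polygon (map (pos0 N M) ls)) (gam C)"
      using oriented_cycle[OF Fc Fi, of "gam C" g N M] g gam[OF C] emb0 by simp
  qed
  then obtain xc lc where xl: "\<And>C. C \<in> \<C> \<Longrightarrow> xc C \<in> G \<and> cls (xc C) = C \<and> polygon_edges (lc C) = strand_edges (orb (xc C)) \<and>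
      distinct (lc C) \<and> 3 \<le> length (lc C) \<and> same_oriented_loop (F \<circ> closed_polygon (map (pos0 N M) (lc C))) (gam C)"
    by metis
  define X where "X = (\<Union>C\<in>\<C>. orb (xc C))"
  have X: "consistent X" "X \<union> \<sigma> ` X = G"
    using consistent_UN[of \<C> xc] xl UC by (auto simp: X_def)
  have SX: "strand_edges X = (\<Union>C\<in>\<C>. polygon_edges (lc C))"
    unfolding X_def strand_edges_UN using xl by (intro SUP_cong) auto
  define LS where "LS = lc ` \<C>"
  have LS: "finite LS" "LS \<noteq> {}" "\<And>ls. ls \<in> LS \<Longrightarrow> distinct ls \<and> 3 \<le> length ls \<and> polygon_edges ls \<subseteq> strand_edges X"
    using finC xl SX by (auto simp: LS_def)
  have setlc: "fst l \<in> C" if C: "C \<in> \<C>" and l: "l \<in> set (lc C)" for C l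
  proof -
    have g: "xc C \<in> G" "polygon_edges (lc C) = strand_edges (orb (xc C))" "cls (xc C) = C" using xl[OF C] by auto
    have "\<exists>e\<in>polygon_edges (lc C). l = fst e \<or> l = snd e"
      using l unfolding set_polygon_edges[of "lc C"] by force
    then have "fst l \<in> orb (xc C)"
      using strand_edges_labels[of "orb (xc C)"] \<rho>_orb[OF g(1)] g(2) by (metis prod.collapse)
    then show ?thesis using g(3) by (auto simp: cls_def)
  qed
  have disj: "set ls \<inter> set ls' = {}" if "ls \<in> LS" "ls' \<in> LS" "ls \<noteq> ls'" for ls ls'
  proof -
    obtain C D where CD: "C \<in> \<C>" "D \<in> \<C>" "ls = lc C" "ls' = lc D" "C \<noteq> D" using \<open>ls \<in> LS\<close> \<open>ls' \<in> LS\<close> \<open>ls \<noteq> ls'\<close> unfolding LS_def by blast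
    have "cls y = C" if "C \<in> \<C>" "y \<in> C" for y C using that cls_eq unfolding \<C>_def by blast
    then have "C \<inter> D = {}" using CD by blast
    then show ?thesis using setlc[OF CD(1)] setlc[OF CD(2)] unfolding CD(3,4) by blast
  qed
  \<comment> \<open>Of the two directions of the axis, choose the one with fewer descending columns.\<close>
  define D where "D = {x \<in> X. snd (\<sigma> x) < snd x}"
  have XG: "X \<subseteq> G" using X(1) by (simp add: consistent_def)
  have finX: "finite X" using XG finite_G finite_subset by blast
  \<comment> \<open>\<open>X\<close> contains one marking of each column at most, because the other
    one is its image under \<open>\<sigma>\<close>.\<close>
  have cardX: "card X \<le> m"
  proof -
    have "inj_on fst X"
    proof (rule inj_onI)
      fix x y assume xy: "x \<in> X" "y \<in> X" "fst x = fst y"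
      then have "y = x \<or> y = \<sigma> x" using column[of x y] XG by auto
      then show "x = y" using X(1) xy unfolding consistent_def by blast
    qed
    moreover have "fst ` X \<subseteq> {..<m}" using Gm XG by auto
    ultimately show ?thesis using card_inj_on_le[of fst X "{..<m}"] by simp
  qed
  have "\<exists>q f n. carries (strand_edges X) (pos0 N M) q f \<and> closed_braid n (map q ` LS) \<and> 2 * n \<le> m"
  proof (cases "2 * card D \<le> m")
    case True
    have "\<exists>q f n. carries (strand_edges X) (pos0 N M) q f \<and> closed_braid n (map q ` LS) \<and>
        n \<le> card {x \<in> X. real (snd (\<sigma> x)) < real (snd x)}"
      by (rule closed_braid_from_cycles[OF X(1) _ c1 _ N2 M_def LS disj]) (simp_all add: N_def Gm')
    then obtain q f n where "carries (strand_edges X) (pos0 N M) q f" "closed_braid n (map q ` LS)" "n \<le> card D"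
      by (auto simp: D_def)
    then show ?thesis using True by (intro exI[of _ q] exI[of _ f] exI[of _ n]) auto
  next
    case False
    \<comment> \<open>The coordinates after a half turn of the grid in its plane, which exchanges
      descending and ascending columns and keeps the range from 0 to \<open>m - 1\<close>.\<close>
    define \<xi> where "\<xi> i = real m - 1 - real i" for i :: nat
    have "\<exists>q f n. carries (strand_edges X) (pos \<xi> \<xi> N M 0) q f \<and> closed_braid n (map q ` LS) \<and>
        n \<le> card {x \<in> X. \<xi> (snd (\<sigma> x)) < \<xi> (snd x)}"
    proof (rule closed_braid_from_cycles[OF X(1) _ _ _ N2 M_def LS disj])
      show "1 \<le> \<bar>\<xi> (snd x) - \<xi> (snd y)\<bar>" if "snd x \<noteq> snd y" for x y :: "nat \<times> nat"
        using c1[OF that] by (simp add: \<xi>_def abs_minus_commute)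
      show "0 \<le> \<xi> (snd x) \<and> \<xi> (snd x) \<le> N - 2" if "x \<in> G" for x
        using Gm(2)[OF that] by (simp add: \<xi>_def N_def)
    qed (simp_all add: \<xi>_def)
    then obtain q f n where q: "carries (strand_edges X) (pos \<xi> \<xi> N M 0) q f" "closed_braid n (map q ` LS)"
      "n \<le> card {x \<in> X. \<xi> (snd (\<sigma> x)) < \<xi> (snd x)}" by blast
    have "{x \<in> X. \<xi> (snd (\<sigma> x)) < \<xi> (snd x)} = {x \<in> X. snd x < snd (\<sigma> x)}" by (auto simp: \<xi>_def)
    then have "n \<le> card (X - D)" using q(3) card_mono[of "X - D" "{x \<in> X. snd x < snd (\<sigma> x)}"] finX
      by (simp add: D_def subset_iff)
    also have "\<dots> = card X - card D" using finX by (intro card_Diff_subset) (auto simp: D_def)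
    finally have n: "2 * n \<le> m" using False cardX by linarith
    have rot: "pos \<xi> \<xi> N M 0 = (\<lambda>l. (\<lambda>(x, y, z). (- x, - y, z)) (pos0 N M l) + (real m - 1, real m - 1, 0))"
    proof
      fix l :: lab
      obtain i j k where l: "l = ((i, j), k)" by (metis surj_pair)
      show "pos \<xi> \<xi> N M 0 l = (\<lambda>(x, y, z). (- x, - y, z)) (pos0 N M l) + (real m - 1, real m - 1, 0)"
        by (simp add: l pos_def place_def \<xi>_def field_simps)
    qed
    obtain f0 where "carries (strand_edges X) (pos0 N M) (pos \<xi> \<xi> N M 0) f0"
      unfolding rot using half_turn_motion[OF finite_strand_edges[OF XG] emb0[OF X(1)]] by blast
    then show ?thesis using carries_trans[OF _ q(1)] q(2) n by blast
  qed
  then obtain q f n where q: "carries (strand_edges X) (pos0 N M) q f" "closed_braid n (map q ` LS)" "2 * n \<le> m" by blast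
  obtain g where fg: "R3_isotopy f g" using q(1) by (auto simp: carries_def)
  have gf: "g (f v) = v" for v using fg unfolding R3_isotopy_def by metis
  obtain k where k: "isotopic_to_id k" "\<And>v. k (stereo v) = stereo (g v)" using fg unfolding R3_isotopy_def by blast
  \<comment> \<open>Undoes the motion and then applies the isotopy onto \<open>K\<close>.\<close>
  define H where "H = h \<circ> k"
  have H: "isotopic_to_id H" unfolding H_def by (rule isotopic_to_id_compose[OF h(1) k(1)])
  have Hq: "H (stereo (closed_polygon (map q (lc C)) u)) = F (closed_polygon (map (pos0 N M) (lc C)) u)"
    if "C \<in> \<C>" "u \<in> {0..1}" for C u
  proof -
    have "f (closed_polygon (map (pos0 N M) (lc C)) u) = closed_polygon (map q (lc C)) u"
      by (rule closed_polygon_carried[OF q(1)]) (use that xl[OF that(1)] SX in auto)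
    then show ?thesis using gf k(2) by (simp add: H_def F_def) metis
  qed
  have "oriented_ambient_isotopic ((\<lambda>vs. stereo \<circ> closed_polygon vs) ` (map q ` LS)) \<Gamma>"
    unfolding oriented_ambient_isotopic_def
  proof (intro exI[of _ H] conjI ballI)
    show "isotopic_to_id H" by (rule H)
    have im: "H ` path_image (stereo \<circ> closed_polygon (map q (lc C))) = path_image (gam C)" if C: "C \<in> \<C>" for C
    proof -
      have x: "xc C \<in> G" "cls (xc C) = C" "lc C \<noteq> []" "polygon_edges (lc C) = strand_edges (orb (xc C))"
        using xl[OF C] by auto
      have "H ` path_image (stereo \<circ> closed_polygon (map q (lc C))) = F ` path_image (closed_polygon (map (pos0 N M) (lc C)))"
        unfolding path_image_def image_image comp_apply using Hq[OF C] by (intro image_cong) auto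
      also have "path_image (closed_polygon (map (pos0 N M) (lc C))) = mesh C"
        using path_image_closed_polygon_map[OF x(3), of "pos0 N M"] x(4) realize_pos0[OF consistent_orb[OF x(1)], of N M]
          orb_Un_\<sigma>[OF x(1)] x(2) by simp
      finally show ?thesis using gam[OF C] by metis
    qed
    have "(\<Union>\<gamma>\<in>(\<lambda>vs. stereo \<circ> closed_polygon vs) ` (map q ` LS). path_image \<gamma>) =
        (\<Union>C\<in>\<C>. path_image (stereo \<circ> closed_polygon (map q (lc C))))" by (simp add: LS_def)
    then have "H ` (\<Union>\<gamma>\<in>(\<lambda>vs. stereo \<circ> closed_polygon vs) ` (map q ` LS). path_image \<gamma>) =
        (\<Union>C\<in>\<C>. H ` path_image (stereo \<circ> closed_polygon (map q (lc C))))" by (simp only: image_UN)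
    also have "\<dots> = (\<Union>C\<in>\<C>. F ` mesh C)" using im gam by (intro SUP_cong) auto
    also have "\<dots> = F ` mesh (\<Union>\<C>)" unfolding mesh_def by blast
    finally show "H ` (\<Union>\<gamma>\<in>(\<lambda>vs. stereo \<circ> closed_polygon vs) ` (map q ` LS). path_image \<gamma>) = (\<Union>\<delta>\<in>\<Gamma>. path_image \<delta>)"
      using KF UC \<Gamma>(4) by simp
    fix \<gamma> assume "\<gamma> \<in> (\<lambda>vs. stereo \<circ> closed_polygon vs) ` (map q ` LS)"
    then obtain C where C: "C \<in> \<C>" "\<gamma> = stereo \<circ> closed_polygon (map q (lc C))" by (auto simp: LS_def)
    have "same_oriented_loop (H \<circ> \<gamma>) (gam C)"
      by (rule same_oriented_loop_cong[where \<gamma> = "F \<circ> closed_polygon (map (pos0 N M) (lc C))"])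
        (use Hq[OF C(1)] xl[OF C(1)] in \<open>simp_all add: C(2)\<close>)
    then show "\<exists>\<delta>\<in>\<Gamma>. same_oriented_loop (H \<circ> \<gamma>) \<delta>" using gam[OF C(1)] by blast
  qed
  then show ?thesis using q(2,3) by blast
qed

text \<open>Without any grid diagram the right-hand side is infinite; otherwise the infimum is
  attained, \<open>enat\<close> being well-ordered, and a single diagram has to be
  considered.\<close>

theorem braid_index_le_half_grid:
  assumes "orientation_of K \<Gamma>" "K \<noteq> {}"
  shows "ereal_of_enat (braid_index \<Gamma>) \<le> ereal_of_enat (grid_number K) / 2"
proof (cases "{m. \<exists>G. grid_diagram m G \<and> ambient_isotopic (stereo ` grid_link G) K} = {}")
  case True
  then have "grid_number K = \<infinity>" unfolding grid_number_def True by (simp add: top_enat_def)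
  then show ?thesis by simp
next
  case False
  then obtain m0 where "m0 \<in> {m. \<exists>G. grid_diagram m G \<and> ambient_isotopic (stereo ` grid_link G) K}" by blast
  then have "grid_number K \<in> enat ` {m. \<exists>G. grid_diagram m G \<and> ambient_isotopic (stereo ` grid_link G) K}"
    unfolding grid_number_def by (intro wellorder_InfI) (rule imageI)
  then obtain m G where m: "grid_number K = enat m" "grid_diagram m G" "ambient_isotopic (stereo ` grid_link G) K"
    by blast
  obtain n P where n: "2 * n \<le> m" "closed_braid n P"
    "oriented_ambient_isotopic ((\<lambda>vs. stereo \<circ> closed_polygon vs) ` P) \<Gamma>"
    using grid_closed_braid[OF m(2,3) assms] by blast
  have "braid_index \<Gamma> \<le> enat n" unfolding braid_index_def by (rule INF_lower) (use n in blast)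
  then obtain b where b: "braid_index \<Gamma> = enat b" "b \<le> n" by (metis enat_ile enat_ord_simps(1))
  have "real b \<le> real m / 2" using b(2) n(1) by simp
  then show ?thesis unfolding m(1) b(1) by simp
qed

section \<open>Plane trees of dyadic partitions\<close>

text \<open>The intervals of a partition tree, as pairs of indices; \<open>sp\<close> is the index of the midpoint.\<close>

locale plane_tree =
  fixes n :: nat and T :: "(nat \<times> nat) set" and sp :: "nat \<times> nat \<Rightarrow> nat"
  assumes T_less: "A \<in> T \<Longrightarrow> fst A < snd A \<and> snd A \<le> n"
    and root_in: "(0, n) \<in> T"
    and leaf_in: "i < n \<Longrightarrow> (i, Suc i) \<in> T"
    and split: "A \<in> T \<Longrightarrow> snd A \<noteq> Suc (fst A) \<Longrightarrow>
      fst A < sp A \<and> sp A < snd A \<and> (fst A, sp A) \<in> T \<and> (sp A, snd A) \<in> T"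
    and laminar: "A \<in> T \<Longrightarrow> B \<in> T \<Longrightarrow> snd A \<le> fst B \<or> snd B \<le> fst A \<or> A = B \<or>
      (snd B \<noteq> Suc (fst B) \<and> (fst B \<le> fst A \<and> snd A \<le> sp B \<or> sp B \<le> fst A \<and> snd A \<le> snd B)) \<or>
      (snd A \<noteq> Suc (fst A) \<and> (fst A \<le> fst B \<and> snd B \<le> sp A \<or> sp A \<le> fst B \<and> snd B \<le> snd A))"
begin

definition leaf :: "nat \<times> nat \<Rightarrow> bool" where "leaf A \<longleftrightarrow> snd A = Suc (fst A)"

definition nodes :: "(nat \<times> nat) set" where "nodes = {A \<in> T. \<not> leaf A}"

definition below :: "nat \<times> nat \<Rightarrow> nat \<times> nat \<Rightarrow> bool" where
  "below A B \<longleftrightarrow> \<not> leaf B \<and> (fst B \<le> fst A \<and> snd A \<le> sp B \<or> sp B \<le> fst A \<and> snd A \<le> snd B)"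

definition chd :: "nat \<times> nat \<Rightarrow> bool \<Rightarrow> nat \<times> nat" where
  "chd B d = (if d then (fst B, sp B) else (sp B, snd B))"

text \<open>The abscissa prescribed by \<open>lower_end\<close>. Over all edges of the tree it takes
  each value from 1 to \<open>2 * n - 1\<close> once, which leaves 0 for the strand on the far
  left.\<close>

definition col :: "nat \<times> nat \<Rightarrow> nat" where
  "col A = (if leaf A then 2 * fst A + 1 else 2 * sp A)"

lemma laminar':
  "A \<in> T \<Longrightarrow> B \<in> T \<Longrightarrow> snd A \<le> fst B \<or> snd B \<le> fst A \<or> A = B \<or> below A B \<or> below B A"
  using laminar unfolding below_def leaf_def by blast

lemma nodes_T: "B \<in> nodes \<Longrightarrow> B \<in> T" and nodes_leaf: "B \<in> nodes \<Longrightarrow> \<not> leaf B"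
  by (auto simp: nodes_def)

lemma node_split:
  "B \<in> nodes \<Longrightarrow> fst B < sp B" "B \<in> nodes \<Longrightarrow> sp B < snd B" "B \<in> nodes \<Longrightarrow> chd B d \<in> T"
  using split[of B] by (auto simp: nodes_def leaf_def chd_def)

lemma T_split: "A \<in> T \<Longrightarrow> \<not> leaf A \<Longrightarrow> fst A < sp A \<and> sp A < snd A"
  using split[of A] by (auto simp: leaf_def)

lemma finite_T: "finite T"
  by (rule finite_subset[of _ "{..n} \<times> {..n}"]) (use T_less in fastforce)+

lemma finite_nodes: "finite nodes"
  using finite_T by (simp add: nodes_def)

lemma col_range: "A \<in> T \<Longrightarrow> 2 * fst A < col A \<and> col A < 2 * snd A"
  using T_less[of A] T_split[of A] by (auto simp: col_def leaf_def)

lemma col_node: "B \<in> nodes \<Longrightarrow> col B = 2 * sp B"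
  by (simp add: col_def nodes_leaf)

lemma chd_range: "B \<in> nodes \<Longrightarrow> fst B \<le> fst (chd B d) \<and> snd (chd B d) \<le> snd B"
  using node_split(1,2)[of B] by (auto simp: chd_def)

lemma col_chd: "B \<in> nodes \<Longrightarrow> if d then col (chd B d) < col B else col B < col (chd B d)"
  using col_range[OF node_split(3), of B d] col_node[of B] by (auto simp: chd_def)

lemma below_chd:
  assumes "below A B" "A \<in> T" "B \<in> T"
  obtains d where "A = chd B d \<or> below A (chd B d)"
proof -
  have B: "B \<in> nodes" using assms by (auto simp: nodes_def below_def)
  obtain d where d: "fst (chd B d) \<le> fst A" "snd A \<le> snd (chd B d)"
    using assms(1) unfolding below_def by (metis chd_def fst_conv snd_conv)
  have C: "chd B d \<in> T" using node_split(3)[OF B] .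
  have "\<not> below (chd B d) A"
    using d T_split[OF assms(2)] T_less[OF C] T_less[OF assms(2)] unfolding below_def by linarith
  moreover have "\<not> snd A \<le> fst (chd B d)" "\<not> snd (chd B d) \<le> fst A"
    using d T_less[OF assms(2)] by linarith+
  ultimately show thesis using laminar'[OF assms(2) C] that by blast
qed

lemma below_range: "below A B \<Longrightarrow> B \<in> T \<Longrightarrow> fst B \<le> fst A \<and> snd A \<le> snd B"
  using T_split[of B] unfolding below_def by auto

lemma below_strict: "below A B \<Longrightarrow> B \<in> T \<Longrightarrow> fst B < fst A \<or> snd A < snd B"
  using T_split[of B] unfolding below_def by auto

lemma chd_below: "B \<in> nodes \<Longrightarrow> below (chd B d) B"
  using nodes_leaf by (auto simp: below_def chd_def)

lemma between_chd:
  assumes "B \<in> nodes"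
  shows "min (col (chd B d)) (col B) = (if d then col (chd B d) else col B)"
    "max (col (chd B d)) (col B) = (if d then col B else col (chd B d))"
  using col_chd[OF assms, of d] by (auto split: if_splits)

lemma other_half:
  assumes B: "B \<in> nodes" and A: "A = chd B (\<not> d) \<or> below A (chd B (\<not> d))" and c: "2 * fst A < c" "c < 2 * snd A"
  shows "if d then max (col (chd B d)) (col B) < c else c < min (col (chd B d)) (col B)"
proof -
  have "fst (chd B (\<not> d)) \<le> fst A \<and> snd A \<le> snd (chd B (\<not> d))"
    using A below_range node_split(3)[OF B] by blast
  then have "if d then sp B \<le> fst A else snd A \<le> sp B" by (auto simp: chd_def)
  then show ?thesis using c between_chd[OF B, of d] col_node[OF B] by (cases d) auto
qed

text \<open>Planarity in combinatorial form: a vertical line within the range of \<open>C\<close>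
  can meet the edge from \<open>B\<close> to its child only if \<open>C\<close> and \<open>B\<close>
  lie on one branch and, in case \<open>C\<close> is beneath \<open>B\<close>, on the side
  \<open>d\<close>.\<close>

lemma node_vs_edge:
  assumes B: "B \<in> nodes" and C: "C \<in> T" and c: "2 * fst C < c" "c < 2 * snd C"
  shows "C = chd B d \<or> below C (chd B d) \<or> C = B \<or> below B C \<or> c < min (col (chd B d)) (col B) \<or> max (col (chd B d)) (col B) < c"
proof -
  have hull: "2 * fst B \<le> min (col (chd B d)) (col B)" "max (col (chd B d)) (col B) \<le> 2 * snd B"
    using col_range[OF node_split(3)[OF B, of d]] col_range[OF nodes_T[OF B]] chd_range[OF B, of d] by auto
  from laminar'[OF C nodes_T[OF B]] show ?thesis
  proof (elim disjE)
    assume b: "below C B"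
    obtain e where e: "C = chd B e \<or> below C (chd B e)" using below_chd[OF b C nodes_T[OF B]] .
    show ?thesis
    proof (cases "e = d")
      case True then show ?thesis using e by blast
    next
      case False
      then have "e = (\<not> d)" by auto
      then show ?thesis using other_half[OF B e[unfolded \<open>e = (\<not> d)\<close>] c] by (auto split: if_splits)
    qed
  qed (use c hull in auto)
qed

text \<open>The companion for two edges: their horizontal spans are disjoint unless one of them
  hangs somewhere beneath the other.\<close>

lemma edge_vs_edge:
  assumes B: "B \<in> nodes" "B' \<in> nodes" "B \<noteq> B'"
  shows "max (col (chd B d)) (col B) < min (col (chd B' d')) (col B') \<or>
    max (col (chd B' d')) (col B') < min (col (chd B d)) (col B) \<or>
    below B' (chd B d) \<or> below B (chd B' d') \<or> B' = chd B d \<or> B = chd B' d'"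
proof -
  have in_range: "2 * fst B < c \<and> c < 2 * snd B" if "B \<in> nodes" "c = col (chd B d) \<or> c = col B" for B d c
    using col_range[OF node_split(3)[OF that(1), of d]] col_range[OF nodes_T[OF that(1)]] chd_range[OF that(1), of d] that(2) by auto
  have one: "max (col (chd B d)) (col B) < min (col (chd B' d')) (col B') \<or>
    max (col (chd B' d')) (col B') < min (col (chd B d)) (col B) \<or> below B' (chd B d) \<or> B' = chd B d"
    if B: "B \<in> nodes" "B' \<in> nodes" and b: "below B' B" for B B' d d'
  proof -
    obtain e where e: "B' = chd B e \<or> below B' (chd B e)" using below_chd[OF b nodes_T[OF B(2)] nodes_T[OF B(1)]] .
    show ?thesis
    proof (cases "e = d")
      case True then show ?thesis using e by blast
    next
      case False
      then have ed: "e = (\<not> d)" by auto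
      have "if d then max (col (chd B d)) (col B) < c else c < min (col (chd B d)) (col B)"
        if "c = col (chd B' d') \<or> c = col B'" for c
        using other_half[OF B(1) e[unfolded ed], of c] in_range[OF B(2) that] by auto
      from this[of "col (chd B' d')"] this[of "col B'"] show ?thesis by (cases d) auto
    qed
  qed
  from laminar'[OF nodes_T[OF B(1)] nodes_T[OF B(2)]] show ?thesis
  proof (elim disjE)
    assume "snd B \<le> fst B'"
    then have "c < c'" if "c = col (chd B d) \<or> c = col B" "c' = col (chd B' d') \<or> c' = col B'" for c c'
      using in_range[OF B(1) that(1)] in_range[OF B(2) that(2)] by auto
    then show ?thesis by (auto simp: max_def min_def)
  next
    assume "snd B' \<le> fst B"
    then have "c' < c" if "c = col (chd B d) \<or> c = col B" "c' = col (chd B' d') \<or> c' = col B'" for c c'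
      using in_range[OF B(1) that(1)] in_range[OF B(2) that(2)] by auto
    then show ?thesis by (auto simp: max_def min_def)
  next
    assume "below B B'"
    then show ?thesis using one[OF B(2,1), of d' d] by blast
  next
    assume "below B' B"
    then show ?thesis using one[OF B(1,2), of d d'] by blast
  qed (use B in auto)
qed

lemma col_inj: assumes "A \<in> T" "B \<in> T" "col A = col B" shows "A = B"
proof (rule ccontr)
  assume ne: "A \<noteq> B"
  have no: "\<not> below A B" if "A \<in> T" "B \<in> T" "col A = col B" for A B
  proof
    assume "below A B"
    then show False using col_range[OF that(1)] that(3) by (auto simp: below_def col_def)
  qed
  show False
    using laminar'[OF assms(1,2)] ne no[OF assms] no[OF assms(2,1) assms(3)[symmetric]]
      col_range[OF assms(1)] col_range[OF assms(2)] assms(3) by auto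
qed

text \<open>Bisection: an index other than the midpoint lies inside one of the two halves, which are
  shorter.\<close>

lemma sp_surj: "(a, b) \<in> T \<Longrightarrow> a < k \<Longrightarrow> k < b \<Longrightarrow> \<exists>B\<in>nodes. sp B = k"
proof (induction "b - a" arbitrary: a b rule: less_induct)
  case less
  have B: "(a, b) \<in> nodes" using less.prems by (auto simp: nodes_def leaf_def)
  note s = node_split[OF B]
  consider "k < sp (a, b)" | "k = sp (a, b)" | "sp (a, b) < k" by linarith
  then show ?case
  proof cases
    case 1
    then show ?thesis using less.hyps[of "sp (a, b)" a] s(1,2) s(3)[of True] less.prems by (auto simp: chd_def)
  next
    case 2 then show ?thesis using B by blast
  next
    case 3
    then show ?thesis using less.hyps[of b "sp (a, b)"] s(1,2) s(3)[of False] less.prems by (auto simp: chd_def)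
  qed
qed

lemma col_surj: assumes "1 \<le> c" "c < 2 * n" shows "\<exists>A\<in>T. col A = c"
proof (cases "even c")
  case True
  then obtain k where k: "c = 2 * k" by blast
  then obtain B where "B \<in> nodes" "sp B = k" using sp_surj[OF root_in, of k] assms by auto
  then show ?thesis using k col_node nodes_T by blast
next
  case False
  then obtain k where k: "c = 2 * k + 1" by (rule oddE)
  then have "(k, Suc k) \<in> T" using leaf_in assms by simp
  then show ?thesis using k by (intro bexI[of _ "(k, Suc k)"]) (auto simp: col_def leaf_def)
qed

lemma below_root: assumes "A \<in> T" "A \<noteq> (0, n)" shows "below A (0, n)"
proof -
  have "\<not> below (0, n) A" using below_range[of "(0, n)" A] below_strict[of "(0, n)" A] assms T_less[OF assms(1)] by auto
  then show ?thesis using laminar'[OF assms(1) root_in] assms(2) T_less[OF assms(1)] by auto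
qed

lemma parent_within:
  "B \<in> T \<Longrightarrow> A \<in> T \<Longrightarrow> below A B \<Longrightarrow> \<exists>C\<in>nodes. \<exists>d. A = chd C d"
proof (induction "snd B - fst B" arbitrary: B rule: less_induct)
  case less
  have B: "B \<in> nodes" using less.prems by (auto simp: nodes_def below_def)
  obtain d where d: "A = chd B d \<or> below A (chd B d)" using below_chd[OF less.prems(3,2,1)] .
  then show ?case
  proof
    assume "A = chd B d" then show ?thesis using B by blast
  next
    assume b: "below A (chd B d)"
    have "snd (chd B d) - fst (chd B d) < snd B - fst B" using node_split(1,2)[OF B] by (auto simp: chd_def)
    then show ?thesis using less.hyps[OF _ node_split(3)[OF B] less.prems(2) b] by blast
  qed
qed

lemma parent: "A \<in> T \<Longrightarrow> A \<noteq> (0, n) \<Longrightarrow> \<exists>C\<in>nodes. \<exists>d. A = chd C d"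
  using parent_within[OF root_in] below_root by blast

lemma chd_inj: assumes "B \<in> nodes" "B' \<in> nodes" "chd B d = chd B' d'" shows "B = B' \<and> d = d'"
proof -
  have "B = B'"
  proof (rule ccontr)
    assume ne: "B \<noteq> B'"
    have no: "\<not> below B' (chd B d) \<and> B' \<noteq> chd B d"
      if "B \<in> nodes" "B' \<in> nodes" "chd B d = chd B' d'" for B B' d d'
    proof -
      have "\<not> (fst (chd B' d') \<le> fst B' \<and> snd B' \<le> snd (chd B' d'))"
        using node_split(1,2)[OF that(2)] by (cases d') (auto simp: chd_def)
      then show ?thesis using below_range[OF _ node_split(3)[OF that(1), of d], of B'] that(3) by auto
    qed
    show False using edge_vs_edge[OF assms(1,2) ne, of d d'] no[OF assms] no[OF assms(2,1) assms(3)[symmetric]] assms(3) by auto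
  qed
  moreover from this have "d = d'"
    using assms node_split(1,2)[OF assms(1)] by (auto simp: chd_def split: if_splits)
  ultimately show ?thesis ..
qed

lemma chd_not_root: "B \<in> nodes \<Longrightarrow> chd B d \<noteq> (0, n)"
  using node_split(1,2)[of B] T_less[OF nodes_T, of B] by (auto simp: chd_def)

lemma col_pos: "A \<in> T \<Longrightarrow> 1 \<le> col A \<and> col A < 2 * n"
  using col_range[of A] T_less[of A] by auto

lemma card_nodes: "card nodes = n - 1"
proof -
  have "inj_on sp nodes"
    using col_inj col_node nodes_T by (metis inj_onI)
  moreover have "sp ` nodes = {1..<n}"
  proof (intro equalityI subsetI)
    fix k assume "k \<in> sp ` nodes"
    then obtain B where "B \<in> nodes" "k = sp B" by blast
    then show "k \<in> {1..<n}" using node_split(1,2)[of B] T_less[OF nodes_T, of B] by auto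
  next
    fix k assume "k \<in> {1..<n}"
    then show "k \<in> sp ` nodes" using sp_surj[OF root_in, of k] by auto
  qed
  ultimately show ?thesis using card_image[of sp nodes] by simp
qed

text \<open>The position of a node when the nodes are sorted by \<open>h\<close>. Equal values do
  occur, for instance at the two halves of an interval, and are separated by the column.\<close>

definition rank :: "(nat \<times> nat \<Rightarrow> real) \<Rightarrow> nat \<times> nat \<Rightarrow> nat" where
  "rank h B = card {C \<in> nodes. h C < h B \<or> h C = h B \<and> col C < col B}"

lemma rank_mono:
  assumes "B \<in> nodes" "C \<in> nodes" "h C < h B \<or> h C = h B \<and> col C < col B"
  shows "rank h C < rank h B"
  unfolding rank_def by (rule psubset_card_mono) (use finite_nodes assms in auto)

lemma rank_inj: assumes "B \<in> nodes" "C \<in> nodes" "rank h B = rank h C" shows "B = C"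
proof (rule ccontr)
  assume "B \<noteq> C"
  then have "col B \<noteq> col C" using col_inj nodes_T assms by blast
  then show False using rank_mono[OF assms(1,2), of h] rank_mono[OF assms(2,1), of h] assms(3) by linarith
qed

lemma rank_image: "rank h ` nodes = {..<n - 1}"
proof (rule card_subset_eq)
  show "rank h ` nodes \<subseteq> {..<n - 1}"
  proof
    fix r assume "r \<in> rank h ` nodes"
    then obtain B where B: "B \<in> nodes" "r = rank h B" by blast
    have "rank h B < card nodes"
      unfolding rank_def by (rule psubset_card_mono) (use finite_nodes B in auto)
    then show "r \<in> {..<n - 1}" using B card_nodes by simp
  qed
  have "inj_on (rank h) nodes" using rank_inj by (auto intro: inj_onI)
  then show "card (rank h ` nodes) = card {..<n - 1}" by (simp add: card_image card_nodes)
qed simp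

end

section \<open>Standard dyadic intervals\<close>

text \<open>The ends of an s.d. interval are multiples of the length of any s.d. interval that is
  not longer, and its midpoint is one for any that is strictly shorter. No multiple of its own
  length lies in the interior of the shorter interval.\<close>

lemma sd_threshold:
  assumes "sd_interval a b" "sd_interval c d"
  shows "b - a \<le> d - c \<Longrightarrow> (b \<le> c \<or> c \<le> a) \<and> (b \<le> d \<or> d \<le> a)"
    and "b - a < d - c \<Longrightarrow> b \<le> (c + d) / 2 \<or> (c + d) / 2 \<le> a"
proof -
  obtain k m where km: "a = real k / 2 ^ m" "b = (real k + 1) / 2 ^ m" using assms(1) by (auto simp: sd_interval_def)
  obtain l p where lp: "c = real l / 2 ^ p" "d = (real l + 1) / 2 ^ p" using assms(2) by (auto simp: sd_interval_def)
  have len: "b - a = 1 / 2 ^ m" "d - c = 1 / 2 ^ p" by (simp_all add: km lp diff_divide_distrib[symmetric])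
  have cancel: "real t / 2 ^ r = real (t * 2 ^ s) / (2 ^ r * 2 ^ s)" for t r s :: nat
    by simp
  have thr: "b \<le> real t / 2 ^ m \<or> real t / 2 ^ m \<le> a" for t
  proof -
    have "k + 1 \<le> t \<or> t \<le> k" by linarith
    then have "real k + 1 \<le> real t \<or> real t \<le> real k" by linarith
    then show ?thesis unfolding km by (auto intro: divide_right_mono)
  qed
  show "(b \<le> c \<or> c \<le> a) \<and> (b \<le> d \<or> d \<le> a)" if "b - a \<le> d - c"
  proof -
    have "(2::real) ^ p \<le> 2 ^ m" using that unfolding len by (simp add: frac_le field_simps)
    then have "p \<le> m" by simp
    then have e: "(2::real) ^ m = 2 ^ p * 2 ^ (m - p)" by (simp flip: power_add)
    have "c = real (l * 2 ^ (m - p)) / 2 ^ m" "d = real ((l + 1) * 2 ^ (m - p)) / 2 ^ m"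
      unfolding e cancel[symmetric] lp by simp_all
    then show ?thesis using thr by metis
  qed
  show "b \<le> (c + d) / 2 \<or> (c + d) / 2 \<le> a" if "b - a < d - c"
  proof -
    have "(2::real) ^ p < 2 ^ m" using that unfolding len by (simp add: field_simps)
    then have "Suc p \<le> m" by simp
    then have e: "(2::real) ^ m = 2 ^ Suc p * 2 ^ (m - Suc p)" by (metis le_add_diff_inverse power_add)
    have "(c + d) / 2 = (2 * real l + 1) / 2 ^ Suc p" unfolding lp by (simp add: field_simps)
    also have "\<dots> = real ((2 * l + 1) * 2 ^ (m - Suc p)) / 2 ^ m" unfolding e cancel[symmetric] by simp
    finally show ?thesis using thr by metis
  qed
qed

lemma sd_halves:
  assumes "sd_interval c d" shows "sd_interval c ((c + d) / 2)" "sd_interval ((c + d) / 2) d"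
proof -
  obtain l p where lp: "l < 2 ^ p" "c = real l / 2 ^ p" "d = (real l + 1) / 2 ^ p" using assms by (auto simp: sd_interval_def)
  have "2 * l < 2 ^ Suc p" "2 * l + 1 < 2 ^ Suc p" using lp(1) by auto
  moreover have "c = real (2 * l) / 2 ^ Suc p" "(c + d) / 2 = (real (2 * l) + 1) / 2 ^ Suc p"
    "(c + d) / 2 = real (2 * l + 1) / 2 ^ Suc p" "d = (real (2 * l + 1) + 1) / 2 ^ Suc p"
    unfolding lp by (simp_all add: field_simps)
  ultimately show "sd_interval c ((c + d) / 2)" "sd_interval ((c + d) / 2) d"
    unfolding sd_interval_def by blast+
qed

definition ilen :: "real list \<Rightarrow> nat \<times> nat \<Rightarrow> real" where "ilen I A = I ! snd A - I ! fst A"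

lemma sd_partition_props:
  assumes "sd_partition n I"
  shows "1 \<le> n" "i \<le> n \<Longrightarrow> j \<le> n \<Longrightarrow> I ! i < I ! j \<longleftrightarrow> i < j" "i \<le> n \<Longrightarrow> j \<le> n \<Longrightarrow> I ! i \<le> I ! j \<longleftrightarrow> i \<le> j"
    "length I = Suc n" "I ! 0 = 0" "I ! n = 1"
proof -
  show l: "length I = Suc n" and e: "I ! 0 = 0" "I ! n = 1" using assms by (auto simp: sd_partition_def)
  show "1 \<le> n" using e by (cases n) auto
  have s: "sorted_wrt (<) I" using assms by (simp add: sd_partition_def)
  have lt: "I ! i < I ! j" if "i < j" "j \<le> n" for i j using sorted_wrt_nth_less[OF s that(1)] that l by simp
  show "i \<le> n \<Longrightarrow> j \<le> n \<Longrightarrow> I ! i < I ! j \<longleftrightarrow> i < j" using lt[of i j] lt[of j i] by (cases i j rule: linorder_cases) auto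
  show "i \<le> n \<Longrightarrow> j \<le> n \<Longrightarrow> I ! i \<le> I ! j \<longleftrightarrow> i \<le> j" using lt[of i j] lt[of j i] by (cases i j rule: linorder_cases) auto
qed

text \<open>If the midpoint were not a point of the partition, it would lie inside a leaf. By
  \<open>sd_threshold\<close> this leaf would be at least as long as the whole interval, hence equal
  to it.\<close>

lemma split_index_props:
  assumes I: "sd_partition n I" and A: "(i, j) \<in> tree_edges I" "j \<noteq> Suc i"
  shows "i < split_index I i j" "split_index I i j < j" "I ! split_index I i j = (I ! i + I ! j) / 2"
proof -
  note P = sd_partition_props[OF I]
  have ij: "i < j" "j \<le> n" "sd_interval (I ! i) (I ! j)" using A P(4) by (auto simp: tree_edges_def)
  define mid where "mid = (I ! i + I ! j) / 2"
  have lt: "I ! i < I ! j" using P(2)[of i j] ij by auto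
  then have mid: "I ! i < mid" "mid < I ! j" by (auto simp: mid_def)
  define k where "k = (LEAST k. mid \<le> I ! k)"
  have k: "mid \<le> I ! k" unfolding k_def by (rule LeastI[of _ j]) (use mid in simp)
  have kj: "k \<le> j" unfolding k_def by (rule Least_le) (use mid in simp)
  have ik: "i < k" using P(2)[of i k] k mid kj ij by auto
  have km: "I ! (k - 1) < mid" using not_less_Least[of "k - 1" "\<lambda>k. mid \<le> I ! k"] ik by (auto simp: k_def[symmetric])
  have "I ! k = mid"
  proof (rule ccontr)
    assume "I ! k \<noteq> mid"
    then have kk: "mid < I ! k" using k by simp
    have "sd_interval (I ! i) (I ! (i + 1))" if "i < n" for i using I that by (simp add: sd_partition_def)
    from this[of "k - 1"] have leaf: "sd_interval (I ! (k - 1)) (I ! k)" using ik kj ij by simp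
    have "\<not> I ! k - I ! (k - 1) < I ! j - I ! i"
      using sd_threshold(2)[OF leaf ij(3)] km kk unfolding mid_def[symmetric] by auto
    moreover have "I ! i \<le> I ! (k - 1)" "I ! k \<le> I ! j" using P(3)[of i "k - 1"] P(3)[of k j] ik kj ij by auto
    ultimately have "I ! i = I ! (k - 1)" "I ! k = I ! j" by linarith+
    then have "i = k - 1" "k = j" using P(2)[of i "k - 1"] P(2)[of k j] ik kj ij by (auto, linarith)
    then show False using A(2) ik by simp
  qed
  moreover have "k < j" using calculation mid kj by (cases "k = j") auto
  moreover have "split_index I i j = k"
    unfolding split_index_def
  proof (rule the_equality)
    show "k < length I \<and> I ! k = (I ! i + I ! j) / 2" using \<open>I ! k = mid\<close> kj ij P(4) by (simp add: mid_def)
    show "l = k" if "l < length I \<and> I ! l = (I ! i + I ! j) / 2" for l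
      using that \<open>I ! k = mid\<close> P(2)[of l k] P(2)[of k l] P(4) kj ij by (cases l k rule: linorder_cases) (auto simp: mid_def)
  qed
  ultimately show "i < split_index I i j" "split_index I i j < j" "I ! split_index I i j = (I ! i + I ! j) / 2"
    using ik by (simp_all add: mid_def)
qed

lemma sd_partition_plane_tree:
  assumes I: "sd_partition n I"
  shows "plane_tree n (tree_edges I) (\<lambda>A. split_index I (fst A) (snd A))"
proof -
  note P = sd_partition_props[OF I]
  define sp where "sp = (\<lambda>A. split_index I (fst A) (snd A))"
  have T: "fst A < snd A \<and> snd A \<le> n \<and> sd_interval (I ! fst A) (I ! snd A)" if "A \<in> tree_edges I" for A
    using that P(4) by (auto simp: tree_edges_def)
  have spl: "fst A < sp A" "sp A < snd A" "I ! sp A = (I ! fst A + I ! snd A) / 2"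
    if "A \<in> tree_edges I" "snd A \<noteq> Suc (fst A)" for A
    using split_index_props[OF I, of "fst A" "snd A"] that by (simp_all add: sp_def)
  \<comment> \<open>By symmetry \<open>A\<close> may be taken not to be longer than
    \<open>B\<close>: it then avoids the two ends of \<open>B\<close> and, if strictly shorter, the
    midpoint.\<close>
  have lam: "snd A \<le> fst B \<or> snd B \<le> fst A \<or> A = B \<or>
      (snd B \<noteq> Suc (fst B) \<and> (fst B \<le> fst A \<and> snd A \<le> sp B \<or> sp B \<le> fst A \<and> snd A \<le> snd B))"
    if A: "A \<in> tree_edges I" and B: "B \<in> tree_edges I" and len: "ilen I A \<le> ilen I B" for A B
  proof -
    note TA = T[OF A] and TB = T[OF B]
    have le: "I ! i \<le> I ! j \<Longrightarrow> i \<le> n \<Longrightarrow> j \<le> n \<Longrightarrow> i \<le> j" for i j using P(3) by simp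
    note thr = sd_threshold[of "I ! fst A" "I ! snd A" "I ! fst B" "I ! snd B"]
    have n: "fst A \<le> n" "snd A \<le> n" "fst B \<le> n" "snd B \<le> n" using TA TB by auto
    have "(I ! snd A \<le> I ! fst B \<or> I ! fst B \<le> I ! fst A) \<and> (I ! snd A \<le> I ! snd B \<or> I ! snd B \<le> I ! fst A)"
      using thr(1) TA TB len unfolding ilen_def by blast
    then have 1: "snd A \<le> fst B \<or> fst B \<le> fst A" "snd A \<le> snd B \<or> snd B \<le> fst A" using n P(3) by auto
    show ?thesis
    proof (cases "ilen I A = ilen I B")
      case True
      then have "I ! snd B - I ! fst B \<le> I ! snd A - I ! fst A" unfolding ilen_def by simp
      then have "(I ! snd B \<le> I ! fst A \<or> I ! fst A \<le> I ! fst B) \<and> (I ! snd B \<le> I ! snd A \<or> I ! snd A \<le> I ! fst B)"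
        using sd_threshold(1)[of "I ! fst B" "I ! snd B" "I ! fst A" "I ! snd A"] TA TB by blast
      then have "snd B \<le> fst A \<or> fst A \<le> fst B" "snd B \<le> snd A \<or> snd A \<le> fst B" using n P(3) by auto
      then show ?thesis using 1 TA TB by (auto simp: prod_eq_iff)
    next
      case False
      then have lt: "ilen I A < ilen I B" using len by simp
      consider "snd A \<le> fst B" | "snd B \<le> fst A" | "fst B \<le> fst A" "snd A \<le> snd B" using 1 by blast
      then show ?thesis
      proof cases
        case 3
        have nl: "snd B \<noteq> Suc (fst B)"
        proof
          assume "snd B = Suc (fst B)"
          then have "A = B" using 3 TA by (auto simp: prod_eq_iff)
          then show False using lt by simp
        qed
        have "I ! snd A \<le> I ! sp B \<or> I ! sp B \<le> I ! fst A"
          using thr(2) TA TB lt unfolding ilen_def spl(3)[OF B nl] by blast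
        then have "snd A \<le> sp B \<or> sp B \<le> fst A" using le[of "snd A" "sp B"] le[of "sp B" "fst A"] TA TB spl(1,2)[OF B nl] by auto
        then show ?thesis using 3 nl by blast
      qed auto
    qed
  qed
  show ?thesis
    unfolding sp_def[symmetric]
  proof
    show "fst A < snd A \<and> snd A \<le> n" if "A \<in> tree_edges I" for A using T[OF that] by blast
    show "(0, n) \<in> tree_edges I"
      using P(1,4,5,6) by (auto simp: tree_edges_def sd_interval_def intro!: exI[of _ 0])
    show "(i, Suc i) \<in> tree_edges I" if "i < n" for i
      using I that P(4) by (simp add: tree_edges_def sd_partition_def)
    show "fst A < sp A \<and> sp A < snd A \<and> (fst A, sp A) \<in> tree_edges I \<and> (sp A, snd A) \<in> tree_edges I"
      if "A \<in> tree_edges I" "snd A \<noteq> Suc (fst A)" for A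
      using spl(1,2)[OF that] T[OF that(1)] sd_halves[of "I ! fst A" "I ! snd A", folded spl(3)[OF that]] P(4)
      by (auto simp: tree_edges_def)
    show "snd A \<le> fst B \<or> snd B \<le> fst A \<or> A = B \<or>
      (snd B \<noteq> Suc (fst B) \<and> (fst B \<le> fst A \<and> snd A \<le> sp B \<or> sp B \<le> fst A \<and> snd A \<le> snd B)) \<or>
      (snd A \<noteq> Suc (fst A) \<and> (fst A \<le> fst B \<and> snd B \<le> sp A \<or> sp A \<le> fst B \<and> snd B \<le> snd A))"
      if "A \<in> tree_edges I" "B \<in> tree_edges I" for A B
      using lam[OF that] lam[OF that(2,1)] by (cases "ilen I A \<le> ilen I B") auto
  qed
qed

section \<open>Drawings of a tree\<close>

text \<open>Vertices of a drawing of the tangle: \<open>Bot k\<close> is the \<open>k\<close>-th point on the bottom line,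
  \<open>Low B\<close> and \<open>Apx B\<close> are the lower and the upper point of the crossing at the node \<open>B\<close>, and
  \<open>Pv B d\<close> and \<open>Qv B d\<close> subdivide the edge from \<open>Apx B\<close> to the left or right child.\<close>

datatype tlab = Bot nat | Low "nat \<times> nat" | Qv "nat \<times> nat" bool | Pv "nat \<times> nat" bool | Apx "nat \<times> nat" | Cap nat

context plane_tree
begin

text \<open>A leaf ends on the bottom line and receives the label of its point there, which the two
  halves of the diagram will share.\<close>

definition low_label :: "nat \<times> nat \<Rightarrow> tlab" where
  "low_label A = (if leaf A then Bot (col A) else Low A)"

definition arc_edges :: "nat \<times> nat \<Rightarrow> bool \<Rightarrow> (tlab \<times> tlab) set" where
  "arc_edges B d = {(Apx B, Pv B d), (Pv B d, Qv B d), (Qv B d, low_label (chd B d))}"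

definition cap_edges :: "(tlab \<times> tlab) set" where
  "cap_edges = {(Bot 0, Cap 0), (Cap 0, Cap 1), (Cap 1, Cap 2), (Cap 2, Cap 3), (Cap 3, low_label (0, n))}"

definition half_graph :: "(tlab \<times> tlab) set" where
  "half_graph = (\<Union>B\<in>nodes. arc_edges B True \<union> arc_edges B False \<union> {(Low B, Bot (col B))}) \<union> cap_edges"

lemma finite_half_graph: "finite half_graph"
  using finite_nodes by (auto simp: half_graph_def arc_edges_def cap_edges_def)

lemma half_graphE:
  assumes "(l, l') \<in> half_graph"
  obtains (arc) B d where "B \<in> nodes" "(l, l') \<in> arc_edges B d" | (strand) B where "B \<in> nodes" "l = Low B" "l' = Bot (col B)"
    | (cap) "(l, l') \<in> cap_edges"
  using assms unfolding half_graph_def by blast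

definition low_height :: "(nat \<times> nat \<Rightarrow> real) \<Rightarrow> nat \<times> nat \<Rightarrow> real" where
  "low_height h A = (if leaf A then 0 else h A)"

text \<open>\<open>h\<close> gives the heights of the nodes and \<open>c\<close> that of the cap. The left and right edges are
  straight for \<open>w = 1/3\<close>, and consist of three segments parallel to the axes for \<open>w = 0\<close>.\<close>

fun tpos :: "(nat \<times> nat \<Rightarrow> real) \<Rightarrow> real \<Rightarrow> real \<Rightarrow> tlab \<Rightarrow> R3" where
  "tpos h c w (Bot k) = (real k, 0, 0)"
| "tpos h c w (Low A) = (real (col A), h A, 0)"
| "tpos h c w (Apx B) = (real (col B), h B, 1)"
| "tpos h c w (Pv B d) = (real (col B) + (real (col (chd B d)) - real (col B)) * (1 - 2 * w),
    h B - (h B - low_height h (chd B d)) * w, 1 - w)"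
| "tpos h c w (Qv B d) = (real (col B) + (real (col (chd B d)) - real (col B)) * (1 - w),
    h B - (h B - low_height h (chd B d)) * (2 * w), w)"
| "tpos h c w (Cap k) = (if k = 0 then (0, c, 0) else if k = 1 then (real (col (0, n)) * w, c, 1 - 3 * w)
    else if k = 2 then (real (col (0, n)) * (1 - w), c, 1 - 3 * w) else (real (col (0, n)), c, 0))"

lemma tpos_low_label: "tpos h c w (low_label A) = (real (col A), low_height h A, 0)"
  by (simp add: low_label_def low_height_def)

text \<open>Heights are compared along branches and with the cap only, so nodes on different
  branches may be moved past each other.\<close>

definition admissible :: "(nat \<times> nat \<Rightarrow> real) \<Rightarrow> real \<Rightarrow> bool" where
  "admissible h c \<longleftrightarrow> 0 < c \<and> (\<forall>B\<in>nodes. 0 < h B \<and> h B < c) \<and> (\<forall>A\<in>nodes. \<forall>B\<in>nodes. below A B \<longrightarrow> h A < h B)"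

end

section \<open>Embeddedness of the drawings\<close>

locale tree_drawing = plane_tree +
  fixes h :: "nat \<times> nat \<Rightarrow> real" and c w :: real
  assumes adm: "admissible h c" and w: "0 \<le> w" "w \<le> 1/3"
begin

abbreviation p :: "tlab \<Rightarrow> R3" where "p \<equiv> tpos h c w"

lemma c_pos: "0 < c" and h_pos: "B \<in> nodes \<Longrightarrow> 0 < h B" and h_cap: "B \<in> nodes \<Longrightarrow> h B < c"
  and h_below: "A \<in> nodes \<Longrightarrow> B \<in> nodes \<Longrightarrow> below A B \<Longrightarrow> h A < h B"
  using adm by (auto simp: admissible_def)

lemma low_nonneg: "A \<in> T \<Longrightarrow> 0 \<le> low_height h A"
  using h_pos[of A] by (auto simp: low_height_def nodes_def)

lemma low_less: "B \<in> nodes \<Longrightarrow> low_height h (chd B d) < h B"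
  using h_below[of "chd B d" B] chd_below[of B d] node_split(3)[of B d] h_pos[of B]
  by (auto simp: low_height_def nodes_def)

lemma low_cap: "A \<in> T \<Longrightarrow> low_height h A < c"
  using h_cap[of A] c_pos by (auto simp: low_height_def nodes_def)

lemma below_low: "B \<in> nodes \<Longrightarrow> A \<in> T \<Longrightarrow> below B A \<Longrightarrow> h B < low_height h A"
  using h_below[of B A] by (auto simp: low_height_def nodes_def below_def)

text \<open>For \<open>w = 0\<close> single coordinates are constant on parts of the arc, but
  \<open>s * X1 + X2 + X3\<close> decreases strictly along all of it for every \<open>w\<close>. The
  sign \<open>s\<close> treats left and right edges alike.\<close>

lemma arc_bounds:
  fixes d :: bool
  assumes B: "B \<in> nodes"
  defines "s \<equiv> if d then 1 else - 1 :: real" and "A \<equiv> chd B d"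
  shows "s * col A \<le> s * X1 (p (Qv B d))" "s * X1 (p (Qv B d)) < s * col B"
    "s * col A \<le> s * X1 (p (Pv B d))" "s * X1 (p (Pv B d)) < s * col B" "s * col A < s * col B"
    "low_height h A < X2 (p (Qv B d))" "X2 (p (Qv B d)) \<le> h B"
    "low_height h A < X2 (p (Pv B d))" "X2 (p (Pv B d)) \<le> h B"
    "s * X1 (p (Pv B d)) + X2 (p (Pv B d)) + X3 (p (Pv B d)) < s * col B + h B + 1"
    "s * X1 (p (Qv B d)) + X2 (p (Qv B d)) + X3 (p (Qv B d)) < s * X1 (p (Pv B d)) + X2 (p (Pv B d)) + X3 (p (Pv B d))"
    "s * col A + low_height h A < s * X1 (p (Qv B d)) + X2 (p (Qv B d)) + X3 (p (Qv B d))"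
proof -
  define g where "g = s * (real (col B) - real (col A))"
  define k where "k = h B - low_height h A"
  have g: "g > 0" using col_chd[OF B, of d] by (auto simp: g_def s_def A_def split: if_splits)
  have k: "k > 0" using low_less[OF B, of d] by (simp add: k_def A_def)
  have X: "s * X1 (p (Pv B d)) = s * col B - g * (1 - 2 * w)" "s * X1 (p (Qv B d)) = s * col B - g * (1 - w)"
    "s * col A = s * col B - g"
    by (simp_all add: g_def A_def algebra_simps)
  have Y: "X2 (p (Pv B d)) = h B - k * w" "X2 (p (Qv B d)) = h B - k * (2 * w)" "low_height h A = h B - k"
    by (simp_all add: k_def A_def)
  have Z: "X3 (p (Pv B d)) = 1 - w" "X3 (p (Qv B d)) = w" by simp_all
  have mult: "x * (1 - 2 * w) = x - 2 * (x * w)" "x * (1 - w) = x - x * w" "x * (2 * w) = 2 * (x * w)" for x :: real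
    by (simp_all add: algebra_simps)
  have gw: "0 \<le> g * w" "g * w \<le> g * (1/3)" using g w by (auto intro!: mult_left_mono)
  have kw: "0 \<le> k * w" "k * w \<le> k * (1/3)" using k w by (auto intro!: mult_left_mono)
  show "s * col A \<le> s * X1 (p (Qv B d))" "s * X1 (p (Qv B d)) < s * col B"
    "s * col A \<le> s * X1 (p (Pv B d))" "s * X1 (p (Pv B d)) < s * col B" "s * col A < s * col B"
    unfolding X using g gw by (simp_all add: algebra_simps)
  show "low_height h A < X2 (p (Qv B d))" "X2 (p (Qv B d)) \<le> h B"
    "low_height h A < X2 (p (Pv B d))" "X2 (p (Pv B d)) \<le> h B"
    unfolding Y using k kw by (simp_all add: algebra_simps)
  show "s * X1 (p (Pv B d)) + X2 (p (Pv B d)) + X3 (p (Pv B d)) < s * col B + h B + 1"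
    "s * X1 (p (Qv B d)) + X2 (p (Qv B d)) + X3 (p (Qv B d)) < s * X1 (p (Pv B d)) + X2 (p (Pv B d)) + X3 (p (Pv B d))"
    "s * col A + low_height h A < s * X1 (p (Qv B d)) + X2 (p (Qv B d)) + X3 (p (Qv B d))"
    unfolding X Y Z mult using g gw k kw w by linarith+
qed

text \<open>Of the box around an arc, two sides are touched at one end of the arc only; this is what
  the comparison with the rest of the drawing relies on.\<close>

lemma arc_point:
  assumes B: "B \<in> nodes" and e: "(l, l') \<in> arc_edges B d" and q: "q \<in> closed_segment (p l) (p l')"
  defines "A \<equiv> chd B d"
  shows "min (col A) (col B) \<le> X1 q" "X1 q \<le> max (col A) (col B)" "low_height h A \<le> X2 q" "X2 q \<le> h B"
    "X1 q = col B \<Longrightarrow> l = Apx B \<and> q = p (Apx B)"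
    "X2 q = low_height h A \<Longrightarrow> l' = low_label A \<and> q = p (low_label A)"
proof -
  define s where "s = (if d then 1 else - 1 :: real)"
  note bd = arc_bounds[OF B, of d, folded s_def A_def]
  have lin: "linear (\<lambda>q. s * X1 q)" by (auto intro!: linearI simp: algebra_simps)
  have pa: "X1 (p (Apx B)) = col B" "X2 (p (Apx B)) = h B" by simp_all
  have pb: "X1 (p (low_label A)) = col A" "X2 (p (low_label A)) = low_height h A" by (simp_all add: tpos_low_label)
  have lo: "low_height h A < h B" using low_less[OF B] by (simp add: A_def)
  from e consider "l = Apx B" "l' = Pv B d" | "l = Pv B d" "l' = Qv B d" | "l = Qv B d" "l' = low_label A"
    by (auto simp: arc_edges_def A_def)
  then have *: "s * col A \<le> s * X1 q \<and> s * X1 q \<le> s * col B \<and> low_height h A \<le> X2 q \<and> X2 q \<le> h B \<and>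
    (X1 q = col B \<longrightarrow> l = Apx B \<and> q = p (Apx B)) \<and> (X2 q = low_height h A \<longrightarrow> l' = low_label A \<and> q = p (low_label A))"
  proof cases
    case 1
    note q = q[unfolded 1]
    have "low_height h A < X2 q" by (rule seg_gt[OF linear_X(3) q]) (use bd lo pa in auto)
    moreover have "X2 q \<le> h B" by (rule seg_le[OF linear_X(3) q]) (use bd pa in auto)
    moreover have "s * col A \<le> s * X1 q" by (rule seg_ge[OF lin q]) (use bd pa in auto)
    moreover have "s * X1 q \<le> s * col B" by (rule seg_le[OF lin q]) (use bd pa in auto)
    moreover have "q = p (Apx B)" if "X1 q = col B" by (rule seg_start[OF lin q]) (use bd pa that in auto)
    ultimately show ?thesis using 1 by auto
  next
    case 2
    note q = q[unfolded 2]
    have "low_height h A < X2 q" by (rule seg_gt[OF linear_X(3) q]) (use bd in auto)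
    moreover have "X2 q \<le> h B" by (rule seg_le[OF linear_X(3) q]) (use bd in auto)
    moreover have "s * col A \<le> s * X1 q" by (rule seg_ge[OF lin q]) (use bd in auto)
    moreover have "s * X1 q < s * col B" by (rule seg_lt[OF lin q]) (use bd in auto)
    ultimately show ?thesis by auto
  next
    case 3
    note q = q[unfolded 3]
    have "low_height h A \<le> X2 q" by (rule seg_ge[OF linear_X(3) q]) (use bd pb in auto)
    moreover have "X2 q \<le> h B" by (rule seg_le[OF linear_X(3) q]) (use bd pb lo in auto)
    moreover have "s * col A \<le> s * X1 q" by (rule seg_ge[OF lin q]) (use bd pb in auto)
    moreover have "s * X1 q < s * col B" by (rule seg_lt[OF lin q]) (use bd pb in auto)
    moreover have "q = p (low_label A)" if "X2 q = low_height h A"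
      by (rule seg_end[OF linear_X(3) q]) (use bd pb that in auto)
    ultimately show ?thesis using 3 by auto
  qed
  then show "low_height h A \<le> X2 q" "X2 q \<le> h B"
    "X1 q = col B \<Longrightarrow> l = Apx B \<and> q = p (Apx B)"
    "X2 q = low_height h A \<Longrightarrow> l' = low_label A \<and> q = p (low_label A)" by auto
  show "min (col A) (col B) \<le> X1 q" "X1 q \<le> max (col A) (col B)"
    using * by (auto simp: s_def min_def max_def split: if_splits)
qed

lemma arc_same:
  assumes B: "B \<in> nodes" and e: "(l, l') \<in> arc_edges B d" "(r, r') \<in> arc_edges B d" "(l, l') \<noteq> (r, r')"
    and q: "q \<in> closed_segment (p l) (p l')" "q \<in> closed_segment (p r) (p r')"
  shows "q \<in> p ` ({l, l'} \<inter> {r, r'})"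
proof -
  define s where "s = (if d then 1 else - 1 :: real)"
  define f where "f q = s * X1 q + X2 q + X3 q" for q :: R3
  note bd = arc_bounds(10-12)[OF B, of d, folded s_def]
  have lin: "linear f" unfolding f_def by (auto intro!: linearI simp: algebra_simps)
  have f: "f (p (Pv B d)) < f (p (Apx B))" "f (p (Qv B d)) < f (p (Pv B d))" "f (p (low_label (chd B d))) < f (p (Qv B d))"
    using bd by (simp_all add: f_def tpos_low_label)
  have e1: "f (p (Pv B d)) \<le> f q" if "q \<in> closed_segment (p (Apx B)) (p (Pv B d))"
    by (rule seg_ge[OF lin that]) (use f in auto)
  have e2: "f q \<le> f (p (Pv B d))" "f (p (Qv B d)) \<le> f q" "f q = f (p (Pv B d)) \<Longrightarrow> q = p (Pv B d)"
    "f q = f (p (Qv B d)) \<Longrightarrow> q = p (Qv B d)" if "q \<in> closed_segment (p (Pv B d)) (p (Qv B d))"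
    using seg_le[OF lin that, of "f (p (Pv B d))"] seg_ge[OF lin that, of "f (p (Qv B d))"]
      seg_start[OF lin that] seg_end[OF lin that] f by auto
  have e3: "f q \<le> f (p (Qv B d))" if "q \<in> closed_segment (p (Qv B d)) (p (low_label (chd B d)))"
    by (rule seg_le[OF lin that]) (use f in auto)
  have main: "q = p (Pv B d) \<and> (l', r) = (Pv B d, Pv B d) \<or> q = p (Qv B d) \<and> (l', r) = (Qv B d, Qv B d)"
    if "(l, l', r, r') \<in> {(Apx B, Pv B d, Pv B d, Qv B d), (Pv B d, Qv B d, Qv B d, low_label (chd B d)), (Apx B, Pv B d, Qv B d, low_label (chd B d))}"
      and q: "q \<in> closed_segment (p l) (p l')" "q \<in> closed_segment (p r) (p r')" for l l' r r'
    using that(1)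
  proof (elim insertE emptyE)
    assume c: "(l, l', r, r') = (Apx B, Pv B d, Pv B d, Qv B d)"
    then show ?thesis using e1 e2 q by auto
  next
    assume c: "(l, l', r, r') = (Pv B d, Qv B d, Qv B d, low_label (chd B d))"
    then show ?thesis using e2 e3 q by auto
  next
    assume c: "(l, l', r, r') = (Apx B, Pv B d, Qv B d, low_label (chd B d))"
    then show ?thesis using e1 e3 q f by auto
  qed
  have "(l, l', r, r') \<in> {(Apx B, Pv B d, Pv B d, Qv B d), (Pv B d, Qv B d, Qv B d, low_label (chd B d)), (Apx B, Pv B d, Qv B d, low_label (chd B d))} \<or>
    (r, r', l, l') \<in> {(Apx B, Pv B d, Pv B d, Qv B d), (Pv B d, Qv B d, Qv B d, low_label (chd B d)), (Apx B, Pv B d, Qv B d, low_label (chd B d))}"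
    using e by (auto simp: arc_edges_def)
  then show ?thesis using main[of l l' r r'] main[of r r' l l'] q by auto
qed

text \<open>The two arcs at one node lie on different sides of its abscissa. Otherwise, by
  \<open>edge_vs_edge\<close>, one arc hangs beneath the other, and heights separate them except
  where \<open>B'\<close> is the child itself; there the upper arc arrives at level 0 and the lower
  one starts at level 1.\<close>

lemma arc_arc:
  assumes B: "B \<in> nodes" "B' \<in> nodes" and e: "(l, l') \<in> arc_edges B d" "(r, r') \<in> arc_edges B' d'" "(l, l') \<noteq> (r, r')"
    and q: "q \<in> closed_segment (p l) (p l')" "q \<in> closed_segment (p r) (p r')"
  shows "q \<in> p ` ({l, l'} \<inter> {r, r'})"
proof -
  note P = arc_point[OF B(1) e(1) q(1)] and P' = arc_point[OF B(2) e(2) q(2)]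
  show ?thesis
  proof (cases "B = B'")
    case True
    show ?thesis
    proof (cases "d = d'")
      case True then show ?thesis using arc_same[OF B(1) e(1) _ e(3) q] e(2) \<open>B = B'\<close> by simp
    next
      case False
      have "X1 q = col B"
        using P(1,2) P'(1,2) between_chd[OF B(1), of d] between_chd[OF B(1), of d'] False True by (cases d) auto
      then have "l = Apx B \<and> q = p (Apx B)" "r = Apx B' \<and> q = p (Apx B')" using P(5) P'(5) True by auto
      then show ?thesis using True by auto
    qed
  next
    case False
    have no: False
      if B: "B \<in> nodes" "B' \<in> nodes" and h: "below B' (chd B d) \<or> B' = chd B d" and e: "(l, l') \<in> arc_edges B d" "(r, r') \<in> arc_edges B' d'"
        and q: "q \<in> closed_segment (p l) (p l')" "q \<in> closed_segment (p r) (p r')" for B B' d d' l l' r r'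
    proof -
      note P = arc_point[OF B(1) e(1) q(1)] and P' = arc_point[OF B(2) e(2) q(2)]
      from h show False
      proof
        assume "below B' (chd B d)"
        then show False using below_low[OF B(2) node_split(3)[OF B(1)]] P(3) P'(4) by fastforce
      next
        assume b: "B' = chd B d"
        then have "low_height h (chd B d) = h B'" using nodes_leaf[OF B(2)] by (simp add: low_height_def)
        then have "q = p (low_label (chd B d))" using P(3,6) P'(4) by force
        then have "X3 q = 0" "X1 q = col B'" using b by (simp_all add: tpos_low_label)
        then show False using P'(5) by simp
      qed
    qed
    have sep: "\<not> max (col (chd B d)) (col B) < min (col (chd B' d')) (col B')" "\<not> max (col (chd B' d')) (col B') < min (col (chd B d)) (col B)"
      using P(1,2) P'(1,2) by linarith+
    then show ?thesis
      using edge_vs_edge[OF B False, of d d'] no[OF B _ e(1,2) q] no[OF B(2,1) _ e(2,1) q(2,1)] by blast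
  qed
qed

lemma strand_point:
  assumes B: "B \<in> nodes" and q: "q \<in> closed_segment (p (Low B)) (p (Bot (col B)))"
  shows "X1 q = col B" "X3 q = 0" "0 \<le> X2 q" "X2 q \<le> h B" "X2 q = h B \<Longrightarrow> q = p (Low B)" "X2 q = 0 \<Longrightarrow> q = p (Bot (col B))"
proof -
  show "X1 q = col B" using seg_le[OF linear_X(1) q, of "col B"] seg_ge[OF linear_X(1) q, of "col B"] by simp
  show "X3 q = 0" using seg_le[OF linear_X(4) q, of 0] seg_ge[OF linear_X(4) q, of 0] by simp
  show "0 \<le> X2 q" using seg_ge[OF linear_X(3) q, of 0] h_pos[OF B] by simp
  show "X2 q \<le> h B" using seg_le[OF linear_X(3) q, of "h B"] h_pos[OF B] by simp
  show "X2 q = h B \<Longrightarrow> q = p (Low B)" using seg_start[OF linear_X(3) q] h_pos[OF B] by simp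
  show "X2 q = 0 \<Longrightarrow> q = p (Bot (col B))" using seg_end[OF linear_X(3) q] h_pos[OF B] by simp
qed

text \<open>The only contact is at a child where the arc ends. At their common node the arc is at
  level 1 and the strand at level 0; and if \<open>B\<close> is beneath \<open>B'\<close>, the arc
  stays within one half of \<open>B'\<close>, while the strand runs at the midpoint.\<close>

lemma arc_strand:
  assumes B: "B \<in> nodes" "B' \<in> nodes" and e: "(l, l') \<in> arc_edges B d"
    and q: "q \<in> closed_segment (p l) (p l')" "q \<in> closed_segment (p (Low B')) (p (Bot (col B')))"
  shows "q \<in> p ` ({l, l'} \<inter> {Low B', Bot (col B')})"
proof -
  note P = arc_point[OF B(1) e q(1)] and S = strand_point[OF B(2) q(2)]
  have "\<not> (col B' < min (col (chd B d)) (col B) \<or> max (col (chd B d)) (col B) < col B')"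
    using P(1,2) S(1) by auto
  moreover have "2 * fst B' < col B'" "col B' < 2 * snd B'" using col_range[OF nodes_T[OF B(2)]] by auto
  moreover have "\<not> below B' (chd B d)"
    using below_low[OF B(2) node_split(3)[OF B(1)]] P(3) S(4) by fastforce
  moreover have "B' \<noteq> B"
  proof
    assume "B' = B"
    then have "q = p (Apx B)" using P(5) S(1) by simp
    then show False using S(2) by simp
  qed
  moreover have "\<not> below B B'"
  proof
    assume b: "below B B'"
    obtain e' where "B = chd B' e' \<or> below B (chd B' e')" using below_chd[OF b nodes_T[OF B(1)] nodes_T[OF B(2)]] .
    then have r: "fst (chd B' e') \<le> fst B \<and> snd B \<le> snd (chd B' e')"
      using below_range node_split(3)[OF B(2)] by blast
    have "2 * fst B < col (chd B d)" "col (chd B d) < 2 * snd B" "2 * fst B < col B" "col B < 2 * snd B"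
      using col_range[OF node_split(3)[OF B(1), of d]] chd_range[OF B(1), of d] col_range[OF nodes_T[OF B(1)]] by auto
    then show False using r P(1,2) S(1) col_node[OF B(2)] by (cases e') (auto simp: chd_def)
  qed
  ultimately have "B' = chd B d"
    using node_vs_edge[OF B(1) nodes_T[OF B(2)], of "col B'" d] by blast
  then have lh: "low_height h (chd B d) = h B'" "low_label (chd B d) = Low B'"
    using nodes_leaf[OF B(2)] by (auto simp: low_height_def low_label_def)
  then have "l' = Low B' \<and> q = p (Low B')" using P(3,6) S(4) by force
  then show ?thesis by auto
qed

text \<open>The middle part of the cap is raised to the level \<open>1 - 3 * w\<close>: the cap is
  straight for \<open>w = 1/3\<close> and turns into a row at level 1 with a connection to level 0
  at either end for \<open>w = 0\<close>.\<close>

lemma cap_point: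
  assumes e: "(l, l') \<in> cap_edges" and q: "q \<in> closed_segment (p l) (p l')"
  shows "(l = Bot 0 \<and> X1 q = 0 \<and> X3 q = 0 \<and> 0 \<le> X2 q \<and> (X2 q = 0 \<longrightarrow> q = p (Bot 0)) \<and> (X2 q = c \<longrightarrow> q = p (Cap 0))) \<or>
    (l = Cap 0 \<and> X2 q = c \<and> X1 q \<le> col (0, n) * w) \<or>
    (l = Cap 1 \<and> X2 q = c \<and> X3 q = 1 - 3 * w \<and> col (0, n) * w \<le> X1 q \<and> X1 q \<le> col (0, n) * (1 - w) \<and>
      (X1 q = col (0, n) * w \<longrightarrow> q = p (Cap 1)) \<and> (X1 q = col (0, n) * (1 - w) \<longrightarrow> q = p (Cap 2))) \<or>
    (l = Cap 2 \<and> X2 q = c \<and> col (0, n) * (1 - w) \<le> X1 q) \<or>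
    (l = Cap 3 \<and> X1 q = col (0, n) \<and> X3 q = 0 \<and> low_height h (0, n) \<le> X2 q \<and>
      (X2 q = c \<longrightarrow> q = p (Cap 3)) \<and> (X2 q = low_height h (0, n) \<longrightarrow> q = p (low_label (0, n))))"
proof -
  define r where "r = real (col (0, n))"
  have r: "r \<ge> 1" using col_pos[OF root_in] by (simp add: r_def)
  have rw: "0 \<le> r * w" "r * w \<le> r * (1/3)" using r w by (auto intro!: mult_left_mono)
  have P: "p (Cap 0) = (0, c, 0)" "p (Cap 1) = (r * w, c, 1 - 3 * w)" "p (Cap 2) = (r * (1 - w), c, 1 - 3 * w)" "p (Cap 3) = (r, c, 0)"
    "p (Bot 0) = (0, 0, 0)" "p (low_label (0, n)) = (r, low_height h (0, n), 0)"
    by (simp_all add: r_def tpos_low_label)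
  note lo = low_cap[OF root_in]
  note coords = seg_le[OF linear_X(1) q] seg_ge[OF linear_X(1) q] seg_le[OF linear_X(3) q] seg_ge[OF linear_X(3) q]
    seg_le[OF linear_X(4) q] seg_ge[OF linear_X(4) q]
  note ends = seg_start[OF linear_X(1) q] seg_end[OF linear_X(1) q] seg_start[OF linear_X(3) q] seg_end[OF linear_X(3) q]
  from e consider "l = Bot 0" "l' = Cap 0" | "l = Cap 0" "l' = Cap 1" | "l = Cap 1" "l' = Cap 2" | "l = Cap 2" "l' = Cap 3"
    | "l = Cap 3" "l' = low_label (0, n)" by (auto simp: cap_edges_def)
  then show ?thesis
  proof cases
    case 1
    then show ?thesis using coords(1)[of 0] coords(2)[of 0] coords(4)[of 0] coords(5)[of 0] coords(6)[of 0] ends(3,4) c_pos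
      unfolding 1 P by (intro disjI1) auto
  next
    case 2
    have "X2 q = c" "X1 q \<le> r * w" using coords(1)[of "r * w"] coords(3)[of c] coords(4)[of c] rw unfolding 2 P by auto
    then show ?thesis using 2 unfolding r_def by blast
  next
    case 3
    have ne: "r \<noteq> 0 \<and> 2 * w \<noteq> 1" using r w by auto
    have "r * w < r * (1 - w)" using rw r by (simp add: algebra_simps)
    then have "X2 q = c \<and> X3 q = 1 - 3 * w \<and> r * w \<le> X1 q \<and> X1 q \<le> r * (1 - w) \<and>
      (X1 q = r * w \<longrightarrow> q = p (Cap 1)) \<and> (X1 q = r * (1 - w) \<longrightarrow> q = p (Cap 2))"
      using coords(1)[of "r * (1 - w)"] coords(2)[of "r * w"] coords(3)[of c] coords(4)[of c] coords(5)[of "1 - 3 * w"] coords(6)[of "1 - 3 * w"]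
        ends(1,2) ne unfolding 3 P by auto
    then show ?thesis using 3 unfolding r_def by blast
  next
    case 4
    have "X2 q = c" "r * (1 - w) \<le> X1 q" using coords(2)[of "r * (1 - w)"] coords(3)[of c] coords(4)[of c] rw
      unfolding 4 P by (auto simp: algebra_simps)
    then show ?thesis using 4 unfolding r_def by blast
  next
    case 5
    have "X1 q = r \<and> X3 q = 0 \<and> low_height h (0, n) \<le> X2 q \<and>
      (X2 q = c \<longrightarrow> q = p (Cap 3)) \<and> (X2 q = low_height h (0, n) \<longrightarrow> q = p (low_label (0, n)))"
      using coords(1)[of r] coords(2)[of r] coords(4)[of "low_height h (0, n)"] coords(5)[of 0] coords(6)[of 0] ends(3,4) lo
      unfolding 5 P by auto
    then show ?thesis using 5 unfolding r_def by blast
  qed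
qed

lemma cap_cap:
  assumes e: "(l, l') \<in> cap_edges" "(m, m') \<in> cap_edges" "(l, l') \<noteq> (m, m')"
    and q: "q \<in> closed_segment (p l) (p l')" "q \<in> closed_segment (p m) (p m')"
  shows "q \<in> p ` ({l, l'} \<inter> {m, m'})"
proof -
  define r where "r = real (col (0, n))"
  have r: "r \<ge> 1" using col_pos[OF root_in] by (simp add: r_def)
  have rw: "0 \<le> r * w" "r * w \<le> r * (1/3)" using r w by (auto intro!: mult_left_mono)
  have rw': "r * (1 - w) = r - r * w" by (simp add: algebra_simps)
  have w0: "w = 0" if "r * w = 0" using that r by auto
  have weak: "(l = Bot 0 \<longrightarrow> X1 q = 0 \<and> X3 q = 0) \<and> (l = Cap 0 \<longrightarrow> X1 q \<le> r * w) \<and>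
      (l = Cap 1 \<longrightarrow> X3 q = 1 - 3 * w \<and> r * w \<le> X1 q \<and> X1 q \<le> r * (1 - w)) \<and>
      (l = Cap 2 \<longrightarrow> r * (1 - w) \<le> X1 q) \<and> (l = Cap 3 \<longrightarrow> X1 q = r \<and> X3 q = 0)"
    if "(l, l') \<in> cap_edges" "q \<in> closed_segment (p l) (p l')" for l l'
    using cap_point[OF that, folded r_def] by (elim disjE conjE) simp_all
  have main: "q \<in> p ` ({l, l'} \<inter> {m, m'})"
    if "(l, l') \<in> cap_edges" "(m, m') \<in> cap_edges" and q: "q \<in> closed_segment (p l) (p l')" "q \<in> closed_segment (p m) (p m')"
      and c: "(l, m) \<in> {(Bot 0, Cap 0), (Bot 0, Cap 1), (Bot 0, Cap 2), (Bot 0, Cap 3), (Cap 0, Cap 1), (Cap 0, Cap 2), (Cap 0, Cap 3),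
        (Cap 1, Cap 2), (Cap 1, Cap 3), (Cap 2, Cap 3)}" for l l' m m'
  proof -
    note K = cap_point[OF that(1) q(1), folded r_def] cap_point[OF that(2) q(2), folded r_def]
    note W = weak[OF that(1) q(1)] weak[OF that(2) q(2)]
    have l': "l = Bot 0 \<Longrightarrow> l' = Cap 0" "l = Cap 0 \<Longrightarrow> l' = Cap 1" "l = Cap 1 \<Longrightarrow> l' = Cap 2" "l = Cap 2 \<Longrightarrow> l' = Cap 3"
      using that(1) by (auto simp: cap_edges_def low_label_def split: if_splits)
    from c show ?thesis
    proof (elim insertE emptyE)
      assume c: "(l, m) = (Bot 0, Cap 0)"
      then have "q = p (Cap 0)" using K by auto
      then show ?thesis using c l' by auto
    next
      assume c: "(l, m) = (Bot 0, Cap 1)"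
      then have "X1 q = 0" "X3 q = 0" "X3 q = 1 - 3 * w" "r * w \<le> X1 q" using W by auto
      then show ?thesis using w0 rw by auto
    next
      assume c: "(l, m) = (Bot 0, Cap 2)"
      then have "X1 q = 0" "r * (1 - w) \<le> X1 q" using W by auto
      then show ?thesis using rw rw' r by auto
    next
      assume c: "(l, m) = (Bot 0, Cap 3)"
      then show ?thesis using W r by auto
    next
      assume c: "(l, m) = (Cap 0, Cap 1)"
      then have "q = p (Cap 1)" using K by auto
      then show ?thesis using c l' by auto
    next
      assume c: "(l, m) = (Cap 0, Cap 2)"
      then have "X1 q \<le> r * w" "r * (1 - w) \<le> X1 q" using W by auto
      then show ?thesis using rw rw' r by auto
    next
      assume c: "(l, m) = (Cap 0, Cap 3)"
      then have "X1 q \<le> r * w" "X1 q = r" using W by auto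
      then show ?thesis using rw r by auto
    next
      assume c: "(l, m) = (Cap 1, Cap 2)"
      then have "q = p (Cap 2)" using K by auto
      then show ?thesis using c l' by auto
    next
      assume c: "(l, m) = (Cap 1, Cap 3)"
      then have "X1 q = r" "X3 q = 0" "X3 q = 1 - 3 * w" "X1 q \<le> r * (1 - w)" using W by auto
      then show ?thesis using w0 rw rw' by auto
    next
      assume c: "(l, m) = (Cap 2, Cap 3)"
      then have "q = p (Cap 3)" using K by auto
      then show ?thesis using c l' by auto
    qed
  qed
  have kinds: "x \<in> {Bot 0, Cap 0, Cap 1, Cap 2, Cap 3}" if "(x, x') \<in> cap_edges" for x x'
    using that by (auto simp: cap_edges_def)
  have "l \<noteq> m" using e by (auto simp: cap_edges_def)
  then have "(l, m) \<in> {(Bot 0, Cap 0), (Bot 0, Cap 1), (Bot 0, Cap 2), (Bot 0, Cap 3), (Cap 0, Cap 1), (Cap 0, Cap 2), (Cap 0, Cap 3),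
        (Cap 1, Cap 2), (Cap 1, Cap 3), (Cap 2, Cap 3)} \<or>
      (m, l) \<in> {(Bot 0, Cap 0), (Bot 0, Cap 1), (Bot 0, Cap 2), (Bot 0, Cap 3), (Cap 0, Cap 1), (Cap 0, Cap 2), (Cap 0, Cap 3),
        (Cap 1, Cap 2), (Cap 1, Cap 3), (Cap 2, Cap 3)}"
    using kinds[OF e(1)] kinds[OF e(2)] by (elim insertE emptyE) simp_all
  then show ?thesis
  proof
    assume "(l, m) \<in> {(Bot 0, Cap 0), (Bot 0, Cap 1), (Bot 0, Cap 2), (Bot 0, Cap 3), (Cap 0, Cap 1), (Cap 0, Cap 2), (Cap 0, Cap 3),
        (Cap 1, Cap 2), (Cap 1, Cap 3), (Cap 2, Cap 3)}"
    from main[OF e(1,2) q this] show ?thesis .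
  next
    assume "(m, l) \<in> {(Bot 0, Cap 0), (Bot 0, Cap 1), (Bot 0, Cap 2), (Bot 0, Cap 3), (Cap 0, Cap 1), (Cap 0, Cap 2), (Cap 0, Cap 3),
        (Cap 1, Cap 2), (Cap 1, Cap 3), (Cap 2, Cap 3)}"
    from main[OF e(2,1) q(2,1) this] show ?thesis by (simp only: Int_commute)
  qed
qed

lemma root_highest: "B \<in> nodes \<Longrightarrow> h B \<le> low_height h (0, n) \<and> (h B = low_height h (0, n) \<longrightarrow> B = (0, n))"
  using below_low[of B "(0, n)"] below_root[of B] root_in nodes_T[of B] nodes_leaf[of B]
  by (cases "B = (0, n)") (auto simp: low_height_def)

lemma arc_cap:
  assumes B: "B \<in> nodes" and e: "(l, l') \<in> arc_edges B d" "(m, m') \<in> cap_edges"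
    and q: "q \<in> closed_segment (p l) (p l')" "q \<in> closed_segment (p m) (p m')"
  shows False
proof -
  note P = arc_point[OF B e(1) q(1)]
  have "X1 q \<ge> 1" using P(1) col_pos[OF nodes_T[OF B]] col_pos[OF node_split(3)[OF B, of d]] by auto
  moreover have "X2 q < c" using P(4) h_cap[OF B] by simp
  ultimately have K: "X1 q = col (0, n)" "X3 q = 0" "low_height h (0, n) \<le> X2 q"
    using cap_point[OF e(2) q(2)] by auto
  then have "B = (0, n)" using root_highest[OF B] P(4) by auto
  then have "q = p (Apx B)" using P(5) K(1) by simp
  then show False using K(2) by simp
qed

lemma strand_cap:
  assumes B: "B \<in> nodes" and e: "(m, m') \<in> cap_edges"
    and q: "q \<in> closed_segment (p (Low B)) (p (Bot (col B)))" "q \<in> closed_segment (p m) (p m')"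
  shows "q \<in> p ` ({Low B, Bot (col B)} \<inter> {m, m'})"
proof -
  note S = strand_point[OF B q(1)]
  have "X1 q \<ge> 1" using S(1) col_pos[OF nodes_T[OF B]] by auto
  moreover have "X2 q < c" using S(4) h_cap[OF B] by simp
  ultimately have K: "m = Cap 3" "low_height h (0, n) \<le> X2 q"
    using cap_point[OF e q(2)] by auto
  have root: "B = (0, n)" "X2 q = h B" using root_highest[OF B] S(4) K(2) by auto
  have "m' = low_label (0, n)" using e K(1) by (auto simp: cap_edges_def)
  then have "m' = Low B" using root(1) nodes_leaf[OF B] by (simp add: low_label_def)
  then show ?thesis using S(5) root(2) by auto
qed

lemma embedded_half_graph: "embedded half_graph p"
proof (rule embeddedI)
  fix l l' assume "(l, l') \<in> half_graph"
  then show "p l \<noteq> p l'"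
  proof (cases rule: half_graphE)
    case (arc B d)
    note bd = arc_bounds[OF arc(1), of d]
    have "p (Apx B) \<noteq> p (Pv B d)" using bd(4) by (auto split: if_splits)
    moreover have "p (Pv B d) \<noteq> p (Qv B d)" using bd(11) by force
    moreover have "p (Qv B d) \<noteq> p (low_label (chd B d))" using bd(6) by (auto simp: tpos_low_label)
    ultimately show ?thesis using arc(2) by (auto simp: arc_edges_def simp del: tpos.simps)
  next
    case (strand B)
    then show ?thesis using h_pos[OF strand(1)] by simp
  next
    case cap
    have r: "real (col (0, n)) \<ge> 1" using col_pos[OF root_in] by simp
    have "real (col (0, n)) * w \<le> real (col (0, n)) * (1/3)" using r w by (intro mult_left_mono) auto
    then have "p (Cap 1) \<noteq> p (Cap 2)" using r by (auto simp: algebra_simps)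
    moreover have "p (Cap 0) \<noteq> p (Cap 1)" using r w by auto
    moreover have "p (Cap 2) \<noteq> p (Cap 3)" using r w by auto
    moreover have "p (Bot 0) \<noteq> p (Cap 0)" using c_pos by auto
    moreover have "p (Cap 3) \<noteq> p (low_label (0, n))" using low_cap[OF root_in] by (auto simp: tpos_low_label)
    ultimately show ?thesis using cap by (auto simp: cap_edges_def simp del: tpos.simps)
  qed
next
  fix l l' r r' q
  assume h: "(l, l') \<in> half_graph" "(r, r') \<in> half_graph" "(l, l') \<noteq> (r, r')"
    "q \<in> closed_segment (p l) (p l')" "q \<in> closed_segment (p r) (p r')"
  from h(1) show "q \<in> p ` ({l, l'} \<inter> {r, r'})"
  proof (cases rule: half_graphE)
    case L: (arc B d)
    from h(2) show ?thesis
    proof (cases rule: half_graphE)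
      case R: (arc B' d') then show ?thesis using arc_arc[OF L(1) R(1) L(2) R(2) h(3-5)] by simp
    next
      case R: (strand B') then show ?thesis using arc_strand[OF L(1) R(1) L(2) h(4)] h(5) by simp
    next
      case R: cap then show ?thesis using arc_cap[OF L R h(4,5)] by simp
    qed
  next
    case L: (strand B)
    from h(2) show ?thesis
    proof (cases rule: half_graphE)
      case R: (arc B' d')
      then show ?thesis using arc_strand[OF R(1) L(1) R(2) h(5)] h(4) L by (simp add: Int_commute)
    next
      case R: (strand B')
      have "col B = col B'"
        using strand_point(1)[OF L(1), of q] strand_point(1)[OF R(1), of q] h(4,5) L R by simp
      then have "B = B'" using col_inj nodes_T L(1) R(1) by blast
      then show ?thesis using h(3) L R by simp
    next
      case R: cap then show ?thesis using strand_cap[OF L(1) R, of q] h(4,5) L by simp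
    qed
  next
    case L: cap
    from h(2) show ?thesis
    proof (cases rule: half_graphE)
      case R: (arc B d) then show ?thesis using arc_cap[OF R L h(5,4)] by simp
    next
      case R: (strand B) then show ?thesis using strand_cap[OF R(1) L, of q] h(4,5) by (simp add: Int_commute)
    next
      case R: cap then show ?thesis using cap_cap[OF L R h(3-5)] by simp
    qed
  qed
qed

text \<open>This prepares the gluing with a mirror image: on the bottom line only labels occur that
  both halves share.\<close>

lemma half_graph_bottom:
  assumes e: "(l, l') \<in> half_graph" and q: "q \<in> closed_segment (p l) (p l')"
  shows "0 \<le> X2 q" "X2 q = 0 \<Longrightarrow> \<exists>k. Bot k \<in> {l, l'} \<and> q = p (Bot k)"
proof -
  have "0 \<le> X2 q \<and> (X2 q = 0 \<longrightarrow> (\<exists>k. Bot k \<in> {l, l'} \<and> q = p (Bot k)))"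
    using e
  proof (cases rule: half_graphE)
    case (arc B d)
    note P = arc_point[OF arc q]
    have A: "chd B d \<in> T" using node_split(3)[OF arc(1)] .
    have "0 \<le> X2 q" using P(3) low_nonneg[OF A] by simp
    moreover have "\<exists>k. Bot k \<in> {l, l'} \<and> q = p (Bot k)" if "X2 q = 0"
    proof -
      have z: "low_height h (chd B d) = 0" using P(3) low_nonneg[OF A] that by simp
      have "leaf (chd B d)"
      proof (rule ccontr)
        assume "\<not> leaf (chd B d)"
        then show False using z h_pos[of "chd B d"] A by (auto simp: low_height_def nodes_def)
      qed
      then show ?thesis using P(6) z that by (auto simp: low_label_def)
    qed
    ultimately show ?thesis by blast
  next
    case (strand B)
    then show ?thesis using strand_point[OF strand(1), of q] q by auto
  next
    case cap
    have "leaf (0, n)" if "low_height h (0, n) = 0"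
      using that h_pos[of "(0, n)"] root_in by (auto simp: low_height_def nodes_def split: if_splits)
    then have lr: "low_label (0, n) = Bot (col (0, n))" if "low_height h (0, n) = 0" using that by (simp add: low_label_def)
    have l': "l = Bot 0 \<Longrightarrow> l' = Cap 0" "l = Cap 3 \<Longrightarrow> l' = low_label (0, n)"
      using cap by (auto simp: cap_edges_def)
    show ?thesis using cap_point[OF cap q] c_pos low_nonneg[OF root_in] lr l' by auto
  qed
  then show "0 \<le> X2 q" "X2 q = 0 \<Longrightarrow> \<exists>k. Bot k \<in> {l, l'} \<and> q = p (Bot k)" by auto
qed

end

section \<open>Grid number and Thompson index\<close>

definition flip :: "bool \<Rightarrow> R3 \<Rightarrow> R3" where
  "flip s = (\<lambda>(x, y, z). (x, if s then y else - y, z))"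

lemma flip_apply [simp]: "flip s (x, y, z) = (x, if s then y else - y, z)"
  by (simp add: flip_def)

lemma linear_flip: "linear (flip s)"
  by (cases s) (auto intro!: linearI simp: flip_def)

lemma flip_flip [simp]: "flip s (flip s q) = q"
  by (cases q) auto

lemma inj_flip: "inj (flip s)"
  by (metis flip_flip injI)

lemma X2_flip: "X2 (flip s q) = (if s then X2 q else - X2 q)"
  by (cases q) auto

text \<open>The two halves share the labels of the points on the bottom line.\<close>

fun emb :: "bool \<Rightarrow> tlab \<Rightarrow> bool \<times> tlab" where
  "emb s (Bot k) = (True, Bot k)"
| "emb s l = (s, l)"

definition glue :: "(bool \<Rightarrow> tlab \<Rightarrow> R3) \<Rightarrow> bool \<times> tlab \<Rightarrow> R3" where
  "glue p v = flip (fst v) (p (fst v) (snd v))"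

definition join :: "(bool \<Rightarrow> (tlab \<times> tlab) set) \<Rightarrow> ((bool \<times> tlab) \<times> (bool \<times> tlab)) set" where
  "join E = (\<Union>s. (\<lambda>(a, b). (emb s a, emb s b)) ` E s)"

lemma glue_emb: "(\<And>s k. p s (Bot k) = (real k, 0, 0)) \<Longrightarrow> glue p (emb s l) = flip s (p s l)"
  by (cases l) (simp_all add: glue_def)

lemma joinE:
  assumes "(a, b) \<in> join E"
  obtains s l l' where "(l, l') \<in> E s" "a = emb s l" "b = emb s l'"
  using assms unfolding join_def by auto

lemma realize_join:
  assumes "\<And>s k. p s (Bot k) = (real k, 0, 0)"
  shows "realize (join E) (\<lambda>v. glue p v + w) = (\<Union>s. (\<lambda>q. flip s q + w) ` realize (E s) (p s))"
proof -
  have seg: "closed_segment (flip s a + w) (flip s b + w) = (\<lambda>q. flip s q + w) ` closed_segment a b" for s a b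
    using closed_segment_linear_image[OF linear_flip, of s a b] closed_segment_translation[of w "flip s a" "flip s b"]
    by (simp add: add.commute image_image)
  have "realize (join E) (\<lambda>v. glue p v + w) =
      (\<Union>s. \<Union>(a, b)\<in>E s. closed_segment (glue p (emb s a) + w) (glue p (emb s b) + w))"
    unfolding realize_def join_def by auto
  also have "\<dots> = (\<Union>s. \<Union>(a, b)\<in>E s. (\<lambda>q. flip s q + w) ` closed_segment (p s a) (p s b))"
    unfolding glue_emb[of p, OF assms] seg ..
  also have "\<dots> = (\<Union>s. (\<lambda>q. flip s q + w) ` realize (E s) (p s))"
    unfolding realize_def by (simp add: image_UN case_prod_unfold)
  finally show ?thesis .
qed

text \<open>The halves lie on opposite sides of \<open>X2 = 0\<close>, so a common point is a point
  of the bottom line in both; \<open>emb\<close> has given it one label.\<close>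

lemma embedded_join:
  assumes emb: "\<And>s. embedded (E s) (p s)" and bot: "\<And>s k. p s (Bot k) = (real k, 0, 0)"
    and bottom: "\<And>s l l' q. (l, l') \<in> E s \<Longrightarrow> q \<in> closed_segment (p s l) (p s l') \<Longrightarrow>
      0 \<le> X2 q \<and> (X2 q = 0 \<longrightarrow> (\<exists>k. Bot k \<in> {l, l'} \<and> q = p s (Bot k)))"
  shows "embedded (join E) (glue p)"
proof -
  have half: "embedded (E s) (\<lambda>v. glue p (emb s v))" for s
    using embedded_linear_image[OF emb linear_flip inj_flip, of s s 0] by (simp add: glue_emb[of p, OF bot])
  have hbot: "(if s then 0 \<le> X2 q else X2 q \<le> 0) \<and> (X2 q = 0 \<longrightarrow> (\<exists>k. Bot k \<in> {l, l'} \<and> q = (real k, 0, 0)))"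
    if "(l, l') \<in> E s" "q \<in> closed_segment (glue p (emb s l)) (glue p (emb s l'))" for s l l' q
  proof -
    have "q \<in> flip s ` closed_segment (p s l) (p s l')"
      using that(2) closed_segment_linear_image[OF linear_flip] by (simp add: glue_emb[of p, OF bot])
    then obtain q' where q': "q' \<in> closed_segment (p s l) (p s l')" "q = flip s q'" by blast
    show ?thesis using bottom[OF that(1) q'(1)] by (auto simp: q'(2) X2_flip bot)
  qed
  show ?thesis
  proof (rule embeddedI)
    fix a b assume "(a, b) \<in> join E"
    then show "glue p a \<noteq> glue p b" using embedded_ne[OF half] by (elim joinE) auto
  next
    fix a b c d q
    assume e: "(a, b) \<in> join E" "(c, d) \<in> join E" and ne: "(a, b) \<noteq> (c, d)"
      and q: "q \<in> closed_segment (glue p a) (glue p b)" "q \<in> closed_segment (glue p c) (glue p d)"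
    obtain s l l' where l: "(l, l') \<in> E s" "a = emb s l" "b = emb s l'" using e(1) by (rule joinE)
    obtain r m m' where m: "(m, m') \<in> E r" "c = emb r m" "d = emb r m'" using e(2) by (rule joinE)
    show "q \<in> glue p ` ({a, b} \<inter> {c, d})"
    proof (cases "s = r")
      case True
      have "(l, l') \<noteq> (m, m')" using ne l m True by auto
      then have "q \<in> (\<lambda>v. glue p (emb s v)) ` ({l, l'} \<inter> {m, m'})"
        using embedded_meet[OF half l(1), of m m'] m q l True by blast
      then show ?thesis using l m True by blast
    next
      case False
      note B = hbot[OF l(1), folded l(2,3), OF q(1)] and B' = hbot[OF m(1), folded m(2,3), OF q(2)]
      have "X2 q = 0" using B B' False by (cases s; cases r) auto
      then obtain k k' where k: "Bot k \<in> {l, l'}" "q = (real k, 0, 0)" "Bot k' \<in> {m, m'}" "q = (real k', 0, 0)"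
        using B B' by blast
      then have "k = k'" by simp
      then have "(True, Bot k) \<in> {a, b} \<inter> {c, d}" using k l m by auto
      moreover have "q = glue p (True, Bot k)" using k(2) bot by (simp add: glue_def)
      ultimately show ?thesis by blast
    qed
  qed
qed

section \<open>Grid diagrams from two halves\<close>

text \<open>Rows lie at half-integer heights above the bottom line. Reflection then causes no
  collisions, and the translation by \<open>n - 1/2\<close> takes the rows of both halves to
  integers.\<close>

definition half_grid :: "(nat \<times> nat) set \<Rightarrow> R3 set" where
  "half_grid W =
     (\<Union>(x, r)\<in>W. closed_segment (real x, 0, 0) (real x, real r + 1/2, 0)) \<union>
     (\<Union>r. convex hull ((\<lambda>x. (real x, real r + 1/2, 1)) ` {x. (x, r) \<in> W})) \<union>
     (\<Union>(x, r)\<in>W. closed_segment (real x, real r + 1/2, 0) (real x, real r + 1/2, 1))"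

definition yrow :: "nat \<Rightarrow> bool \<Rightarrow> nat \<Rightarrow> nat" where
  "yrow n s r = (if s then n + r else n - 1 - r)"

definition stack :: "nat \<Rightarrow> (bool \<Rightarrow> (nat \<times> nat) set) \<Rightarrow> (nat \<times> nat) set" where
  "stack n W = {(x, yrow n s r) | s x r. (x, r) \<in> W s}"

definition half_diagram :: "nat \<Rightarrow> (nat \<times> nat) set \<Rightarrow> bool" where
  "half_diagram n W \<longleftrightarrow> W \<subseteq> {..<2 * n} \<times> {..<n} \<and> (\<forall>x<2 * n. \<exists>!r. (x, r) \<in> W) \<and>
     (\<forall>r<n. card {x. (x, r) \<in> W} = 2)"

lemma yrow_inj: "r < n \<Longrightarrow> r' < n \<Longrightarrow> yrow n s r = yrow n s' r' \<longleftrightarrow> s = s' \<and> r = r'"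
  by (auto simp: yrow_def)

lemma yrow_less: "r < n \<Longrightarrow> yrow n s r < 2 * n"
  by (auto simp: yrow_def)

lemma yrow_surj: assumes "j < 2 * n" obtains s r where "r < n" "j = yrow n s r"
proof (cases "j < n")
  case True then show thesis using that[of "n - 1 - j" False] by (simp add: yrow_def)
next
  case False then show thesis using that[of "j - n" True] assms by (simp add: yrow_def)
qed

lemma in_stack:
  assumes "\<And>s. half_diagram n (W s)" "r < n"
  shows "(x, yrow n s r) \<in> stack n W \<longleftrightarrow> (x, r) \<in> W s"
proof
  assume "(x, yrow n s r) \<in> stack n W"
  then obtain s' r' where "yrow n s r = yrow n s' r'" "(x, r') \<in> W s'" by (auto simp: stack_def)
  moreover have "r' < n" using assms(1)[of s'] calculation(2) by (auto simp: half_diagram_def)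
  ultimately show "(x, r) \<in> W s" using yrow_inj[OF assms(2), of r' s s'] by simp
qed (auto simp: stack_def)

lemma stack_grid_diagram:
  assumes W: "\<And>s. half_diagram n (W s)"
  shows "grid_diagram (2 * n) (stack n W)"
proof -
  have sub: "W s \<subseteq> {..<2 * n} \<times> {..<n}" for s using W by (simp add: half_diagram_def)
  have "stack n W \<subseteq> {..<2 * n} \<times> {..<2 * n}"
  proof
    fix q assume "q \<in> stack n W"
    then obtain s x r where q: "q = (x, yrow n s r)" "(x, r) \<in> W s" unfolding stack_def by blast
    have "x < 2 * n" "r < n" using sub[of s] q(2) by auto
    then show "q \<in> {..<2 * n} \<times> {..<2 * n}" using q(1) yrow_less[of r n s] by simp
  qed
  moreover have "card {i. (i, j) \<in> stack n W} = 2" if j: "j < 2 * n" for j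
  proof -
    obtain s r where r: "r < n" "j = yrow n s r" using yrow_surj[OF j] .
    show ?thesis using W[of s] r by (simp add: in_stack[of n W, OF W] half_diagram_def)
  qed
  moreover have "card {j. (i, j) \<in> stack n W} = 2" if i: "i < 2 * n" for i
  proof -
    have "\<forall>s. \<exists>r. (i, r) \<in> W s \<and> (\<forall>r'. (i, r') \<in> W s \<longrightarrow> r' = r)" using W i unfolding half_diagram_def by metis
    then obtain f where f: "\<And>s. (i, f s) \<in> W s" "\<And>s r. (i, r) \<in> W s \<Longrightarrow> r = f s" by metis
    have "{j. (i, j) \<in> stack n W} = {yrow n True (f True), yrow n False (f False)}"
    proof (intro equalityI subsetI)
      fix j assume "j \<in> {j. (i, j) \<in> stack n W}"
      then obtain s r where "j = yrow n s r" "(i, r) \<in> W s" by (auto simp: stack_def)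
      then show "j \<in> {yrow n True (f True), yrow n False (f False)}" using f(2)[of r s] by (cases s) auto
    next
      fix j assume "j \<in> {yrow n True (f True), yrow n False (f False)}"
      then show "j \<in> {j. (i, j) \<in> stack n W}" using f(1) by (auto simp: stack_def)
    qed
    moreover have "f s < n" for s using f(1)[of s] sub[of s] by auto
    ultimately show ?thesis using yrow_inj[of "f True" n "f False" True False] by simp
  qed
  ultimately show ?thesis unfolding grid_diagram_def by blast
qed

lemma stack_grid_link:
  assumes W: "\<And>s. half_diagram n (W s)"
  shows "grid_link (stack n W) = (\<Union>s. (\<lambda>q. flip s q + (0, real n - 1/2, 0)) ` half_grid (W s))"
proof -
  define M where "M s q = flip s q + (0, real n - 1/2, 0)" for s and q :: R3
  have sub: "x < 2 * n" "r < n" if "(x, r) \<in> W s" for s x r using W[of s] that by (auto simp: half_diagram_def)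
  have Mp: "M s (x, real r + 1/2, z) = (x, real (yrow n s r), z)" if "r < n" for s r x z
    using that by (cases s) (auto simp: M_def yrow_def)
  have seg: "closed_segment (M s a) (M s b) = M s ` closed_segment a b" for s a b
    using closed_segment_linear_image[OF linear_flip, of s a b] closed_segment_translation[of "(0, real n - 1/2, 0)" "flip s a" "flip s b"]
    unfolding M_def by (simp add: add.commute image_image)
  have hull: "convex hull (M s ` S) = M s ` (convex hull S)" for s S
  proof -
    have M: "M s ` X = (\<lambda>q. (0, real n - 1/2, 0) + q) ` flip s ` X" for X
      unfolding M_def image_image by (simp only: add.commute)
    show ?thesis unfolding M convex_hull_linear_image[OF linear_flip] convex_hull_translation ..
  qed
  have 1: "(\<Union>i. convex hull {(real i, real j, 0) | j. (i, j) \<in> stack n W}) =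
    (\<Union>s. M s ` (\<Union>(x, r)\<in>W s. closed_segment (real x, 0, 0) (real x, real r + 1/2, 0)))"
  proof -
    have col: "convex hull {(real i, real j, 0) | j. (i, j) \<in> stack n W} =
      (\<Union>s. M s ` (\<Union>r\<in>{r. (i, r) \<in> W s}. closed_segment (real i, 0, 0) (real i, real r + 1/2, 0)))" for i
    proof (cases "i < 2 * n")
      case False
      then have "{(real i, real j, 0 :: real) | j. (i, j) \<in> stack n W} = {}" "{r. (i, r) \<in> W s} = {}" for s
        using sub unfolding stack_def by blast+
      then show ?thesis by simp
    next
      case True
      have "\<forall>s. \<exists>r. (i, r) \<in> W s \<and> (\<forall>r'. (i, r') \<in> W s \<longrightarrow> r' = r)" using W True unfolding half_diagram_def by metis
      then obtain f where f: "\<And>s. (i, f s) \<in> W s" "\<And>s r. (i, r) \<in> W s \<Longrightarrow> r = f s" by metis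
      have fs: "{r. (i, r) \<in> W s} = {f s}" for s using f by blast
      have "{(real i, real j, 0 :: real) | j. (i, j) \<in> stack n W} = {(real i, real (yrow n True (f True)), 0 :: real), (real i, real (yrow n False (f False)), 0 :: real)}"
      proof (intro equalityI subsetI)
        fix q :: R3 assume "q \<in> {(real i, real j, 0 :: real) | j. (i, j) \<in> stack n W}"
        then obtain s r where "q = (real i, real (yrow n s r), 0 :: real)" "(i, r) \<in> W s" by (auto simp: stack_def)
        then show "q \<in> {(real i, real (yrow n True (f True)), 0 :: real), (real i, real (yrow n False (f False)), 0 :: real)}"
          using f(2)[of r s] by (cases s) auto
      next
        fix q :: R3 assume "q \<in> {(real i, real (yrow n True (f True)), 0 :: real), (real i, real (yrow n False (f False)), 0 :: real)}"
        then show "q \<in> {(real i, real j, 0 :: real) | j. (i, j) \<in> stack n W}" using f(1) unfolding stack_def by blast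
      qed
      also have "convex hull \<dots> = closed_segment (real i, real (yrow n True (f True)), 0) (real i, real (yrow n False (f False)), 0)"
        by (simp add: segment_convex_hull)
      \<comment> \<open>The bottom line is at the height \<open>n - 1/2\<close> of the stacked
        diagram, above the rows of one half and below those of the other; the column is split
        there.\<close>
      also have "\<dots> = closed_segment (real i, real (yrow n True (f True)), 0) (real i, real n - 1/2, 0) \<union>
          closed_segment (real i, real n - 1/2, 0) (real i, real (yrow n False (f False)), 0)"
      proof (rule Un_closed_segment[symmetric])
        define y1 y2 where "y1 = real (yrow n True (f True))" and "y2 = real (yrow n False (f False))"
        have y: "real n - 1/2 \<le> y1" "y2 \<le> real n - 1/2" "y2 < y1"
          using sub(2)[OF f(1)[of False]] by (auto simp: y1_def y2_def yrow_def)
        define u where "u = (y1 - (real n - 1/2)) / (y1 - y2)"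
        have u: "0 \<le> u" "u \<le> 1" "u * (y1 - y2) = y1 - (real n - 1/2)" using y by (auto simp: u_def field_simps)
        show "(real i, real n - 1/2, 0) \<in> closed_segment (real i, real (yrow n True (f True)), 0) (real i, real (yrow n False (f False)), 0 :: real)"
          unfolding y1_def[symmetric] y2_def[symmetric] in_segment
          using u by (intro exI[of _ u]) (auto simp: algebra_simps)
      qed
      also have "\<dots> = (\<Union>s. closed_segment (M s (real i, 0, 0)) (M s (real i, real (f s) + 1/2, 0)))"
        using sub(2)[OF f(1)] by (simp add: Mp UNIV_bool) (simp add: M_def closed_segment_commute Un_commute)
      finally show ?thesis unfolding seg fs by simp
    qed
    show ?thesis unfolding col by blast
  qed
  have 2: "(\<Union>j. convex hull {(real i, real j, 1) | i. (i, j) \<in> stack n W}) =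
    (\<Union>s. M s ` (\<Union>r. convex hull ((\<lambda>x. (real x, real r + 1/2, 1)) ` {x. (x, r) \<in> W s})))"
  proof -
    have row: "{(real i, real (yrow n s r), 1) | i. (i, yrow n s r) \<in> stack n W} = M s ` (\<lambda>x. (real x, real r + 1/2, 1)) ` {x. (x, r) \<in> W s}"
      if "r < n" for s r
      unfolding in_stack[of n W, OF W that] image_image Mp[OF that] by blast
    have empty_row: "{(real i, real j, 1 :: real) | i. (i, j) \<in> stack n W} = {}" if "\<not> j < 2 * n" for j
      using that stack_grid_diagram[of n W, OF W] unfolding grid_diagram_def by auto
    have empty_W: "{x. (x, r) \<in> W s} = {}" if "\<not> r < n" for s r
      using that sub by blast
    show ?thesis
    proof (intro equalityI subsetI)
      fix q :: R3 assume "q \<in> (\<Union>j. convex hull {(real i, real j, 1) | i. (i, j) \<in> stack n W})"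
      then obtain j where j: "q \<in> convex hull {(real i, real j, 1) | i. (i, j) \<in> stack n W}" by blast
      then have "j < 2 * n" using empty_row[of j] by (cases "j < 2 * n") auto
      then obtain s r where r: "r < n" "j = yrow n s r" by (rule yrow_surj)
      have "q \<in> M s ` (convex hull ((\<lambda>x. (real x, real r + 1/2, 1)) ` {x. (x, r) \<in> W s}))"
        using j unfolding r(2) row[OF r(1)] hull .
      then show "q \<in> (\<Union>s. M s ` (\<Union>r. convex hull ((\<lambda>x. (real x, real r + 1/2, 1)) ` {x. (x, r) \<in> W s})))" by blast
    next
      fix q :: R3 assume "q \<in> (\<Union>s. M s ` (\<Union>r. convex hull ((\<lambda>x. (real x, real r + 1/2, 1)) ` {x. (x, r) \<in> W s})))"
      then obtain s r where r: "q \<in> M s ` (convex hull ((\<lambda>x. (real x, real r + 1/2, 1)) ` {x. (x, r) \<in> W s}))" by blast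
      then have rn: "r < n" using empty_W[of r s] by (cases "r < n") auto
      have "q \<in> convex hull {(real i, real (yrow n s r), 1) | i. (i, yrow n s r) \<in> stack n W}"
        using r unfolding row[OF rn] hull .
      then show "q \<in> (\<Union>j. convex hull {(real i, real j, 1) | i. (i, j) \<in> stack n W})" by (rule UN_I[OF UNIV_I])
    qed
  qed
  have 3: "(\<Union>(i, j)\<in>stack n W. closed_segment (real i, real j, 0) (real i, real j, 1)) =
    (\<Union>s. M s ` (\<Union>(x, r)\<in>W s. closed_segment (real x, real r + 1/2, 0) (real x, real r + 1/2, 1)))"
  proof -
    have riser: "M s ` closed_segment (real x, real r + 1/2, 0) (real x, real r + 1/2, 1) =
      closed_segment (real x, real (yrow n s r), 0) (real x, real (yrow n s r), 1)" if "(x, r) \<in> W s" for s x r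
      unfolding seg[symmetric] Mp[OF sub(2)[OF that]] ..
    have "(\<Union>s. M s ` (\<Union>(x, r)\<in>W s. closed_segment (real x, real r + 1/2, 0) (real x, real r + 1/2, 1))) =
      (\<Union>s. \<Union>(x, r)\<in>W s. closed_segment (real x, real (yrow n s r), 0) (real x, real (yrow n s r), 1))"
      unfolding image_UN using riser by (intro SUP_cong refl) (simp add: case_prod_unfold)
    then show ?thesis unfolding stack_def by auto
  qed
  show ?thesis
    unfolding grid_link_def 1 2 3 half_grid_def M_def[symmetric] image_Un UN_Un_distrib ..
qed

section \<open>The grid of a tree\<close>

context plane_tree
begin

lemma realize_half_graph:
  "realize half_graph p = (\<Union>B\<in>nodes. \<Union>d. closed_segment (p (Apx B)) (p (Pv B d)) \<union>
      closed_segment (p (Pv B d)) (p (Qv B d)) \<union> closed_segment (p (Qv B d)) (p (low_label (chd B d)))) \<union>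
    (\<Union>B\<in>nodes. closed_segment (p (Low B)) (p (Bot (col B)))) \<union>
    (closed_segment (p (Bot 0)) (p (Cap 0)) \<union> closed_segment (p (Cap 0)) (p (Cap 1)) \<union>
     closed_segment (p (Cap 1)) (p (Cap 2)) \<union> closed_segment (p (Cap 2)) (p (Cap 3)) \<union>
     closed_segment (p (Cap 3)) (p (low_label (0, n))))"
  unfolding realize_def half_graph_def arc_edges_def cap_edges_def by (auto simp: UNIV_bool)

text \<open>The row of a node is taken up by its two child edges, in whose columns it is marked; the
  last row is that of the cap, which joins the strand on the far left to the root edge.\<close>

definition rows :: "(nat \<times> nat \<Rightarrow> nat) \<Rightarrow> (nat \<times> nat) set" where
  "rows k = {(col (chd B d), k B) | B d. B \<in> nodes} \<union> {(0, n - 1), (col (0, n), n - 1)}"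

lemma rows_iff: "(x, r) \<in> rows k \<longleftrightarrow> (\<exists>B\<in>nodes. r = k B \<and> (\<exists>d. x = col (chd B d))) \<or> (x = 0 \<or> x = col (0, n)) \<and> r = n - 1"
  unfolding rows_def by auto

lemma n_pos: "0 < n" using T_less[OF root_in] by simp

lemma rank_less: "B \<in> nodes \<Longrightarrow> rank h B < n - 1"
  using rank_image[of h] by auto

lemma rows_row:
  assumes B: "B \<in> nodes"
  shows "{x. (x, rank h B) \<in> rows (rank h)} = {col (chd B True), col (chd B False)}"
proof -
  have "rank h B \<noteq> n - 1" using rank_less[OF B, of h] by simp
  moreover have "rank h B = rank h C \<longleftrightarrow> C = B" if "C \<in> nodes" for C using rank_inj[OF B that, of h] by auto
  ultimately have "(x, rank h B) \<in> rows (rank h) \<longleftrightarrow> (\<exists>d. x = col (chd B d))" for x unfolding rows_iff using B by blast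
  then show ?thesis unfolding ex_bool_eq by blast
qed

lemma rows_top: "{x. (x, n - 1) \<in> rows (rank h)} = {0, col (0, n)}"
proof -
  have "rank h B \<noteq> n - 1" if "B \<in> nodes" for B using rank_less[OF that, of h] by simp
  then have "(x, n - 1) \<in> rows (rank h) \<longleftrightarrow> x = 0 \<or> x = col (0, n)" for x unfolding rows_iff by metis
  then show ?thesis by blast
qed

lemma half_diagram_rows: "half_diagram n (rows (rank h))"
  unfolding half_diagram_def
proof (intro conjI allI impI)
  have c: "1 \<le> col (0, n)" "col (0, n) < 2 * n" using col_pos[OF root_in] by auto
  show "rows (rank h) \<subseteq> {..<2 * n} \<times> {..<n}"
  proof
    fix x assume "x \<in> rows (rank h)"
    then consider B d where "B \<in> nodes" "x = (col (chd B d), rank h B)" | "x = (0, n - 1)" | "x = (col (0, n), n - 1)"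
      unfolding rows_def by blast
    then show "x \<in> {..<2 * n} \<times> {..<n}"
    proof cases
      case 1 then show ?thesis using rank_less[OF 1(1), of h] col_pos[OF node_split(3)[OF 1(1)], of d] by auto
    qed (use c n_pos in auto)
  qed
next
  fix x assume x: "x < 2 * n"
  have inner: "x = col (chd B d) \<Longrightarrow> B \<in> nodes \<Longrightarrow> x \<noteq> 0 \<and> x \<noteq> col (0, n)" for B d
    using col_pos[OF node_split(3), of B d] col_inj[OF node_split(3) root_in, of B d] chd_not_root[of B d] by auto
  have c: "1 \<le> col (0, n)" using col_pos[OF root_in] by auto
  consider "x = 0" | "x = col (0, n)" | B d where "B \<in> nodes" "x = col (chd B d)"
    using col_surj[of x] parent x by (metis One_nat_def Suc_leI neq0_conv)
  then show "\<exists>!r. (x, r) \<in> rows (rank h)"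
  proof cases
    case 1
    then have "(x, r) \<in> rows (rank h) \<longleftrightarrow> r = n - 1" for r using inner c unfolding rows_iff by auto
    then show ?thesis by simp
  next
    case 2
    then have "(x, r) \<in> rows (rank h) \<longleftrightarrow> r = n - 1" for r using inner c unfolding rows_iff by auto
    then show ?thesis by simp
  next
    case (3 B d)
    have "C = B" if "C \<in> nodes" "x = col (chd C e)" for C e
      using col_inj[OF node_split(3)[OF that(1)] node_split(3)[OF 3(1)]] that(2) 3(2) chd_inj[OF that(1) 3(1)] by metis
    then have "(x, r) \<in> rows (rank h) \<longleftrightarrow> r = rank h B" for r
      using inner[OF 3(2,1)] 3 unfolding rows_iff by blast
    then show ?thesis by simp
  qed
next
  fix r assume r: "r < n"
  show "card {x. (x, r) \<in> rows (rank h)} = 2"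
  proof (cases "r = n - 1")
    case True
    then show ?thesis using rows_top[of h] col_pos[OF root_in] by simp
  next
    case False
    then have "r \<in> rank h ` nodes" using rank_image[of h] r by auto
    then obtain B where B: "B \<in> nodes" "r = rank h B" by blast
    have "col (chd B True) \<noteq> col (chd B False)" using col_chd[OF B(1), of True] col_chd[OF B(1), of False] by simp
    then show ?thesis unfolding B(2) rows_row[OF B(1)] by simp
  qed
qed

text \<open>All conditions are strict inequalities that are linear in the heights and hold at both
  ends of the motion, so they pass to convex combinations. The height of the cap goes from 2 to that
  of the last row.\<close>

lemma admissible_motion:
  assumes h: "\<And>B. B \<in> nodes \<Longrightarrow> 0 < h B \<and> h B \<le> 1"
    and mono: "\<And>A B. A \<in> nodes \<Longrightarrow> B \<in> nodes \<Longrightarrow> below A B \<Longrightarrow> h A < h B" and t: "t \<in> {0..1}"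
  shows "admissible (\<lambda>B. (1 - t) * h B + t * (real (rank h B) + 1/2)) ((1 - t) * 2 + t * (real n - 1/2))"
proof -
  have conv: "(1 - t) * a + t * b < (1 - t) * a' + t * b'" if "a < a'" "b < b'" for a b a' b' :: real
    using that t by (cases "t = 0") (auto intro!: add_le_less_mono mult_left_mono)
  have "(1 - t) * 0 + t * 0 < (1 - t) * 2 + t * (real n - 1/2)" using n_pos by (intro conv) auto
  moreover have "(1 - t) * 0 + t * 0 < (1 - t) * h B + t * (real (rank h B) + 1/2)" if "B \<in> nodes" for B
    using h[OF that] by (intro conv) auto
  moreover have "(1 - t) * h B + t * (real (rank h B) + 1/2) < (1 - t) * 2 + t * (real n - 1/2)" if "B \<in> nodes" for B
    using h[OF that] rank_less[OF that, of h] by (intro conv) auto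
  moreover have "(1 - t) * h A + t * (real (rank h A) + 1/2) < (1 - t) * h B + t * (real (rank h B) + 1/2)"
    if "A \<in> nodes" "B \<in> nodes" "below A B" for A B
    using mono[OF that] rank_mono[OF that(2,1), of h] by (intro conv) auto
  ultimately show ?thesis unfolding admissible_def by simp
qed

text \<open>For \<open>w = 0\<close> an arc consists of a part of a row, a connection between the
  levels and a vertical part down to the child. The strand that descends from the child completes
  the column of the grid.\<close>

lemma realize_right_angled:
  assumes adm: "admissible (\<lambda>B. real (rank h B) + 1/2) (real n - 1/2)"
  shows "realize half_graph (tpos (\<lambda>B. real (rank h B) + 1/2) (real n - 1/2) 0) = half_grid (rows (rank h))"
proof -
  define H where "H = (\<lambda>B. real (rank h B) + 1/2)"
  define c where "c = real n - 1/2"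
  interpret tree_drawing n T sp H c 0
    by unfold_locales (use adm in \<open>simp_all add: H_def c_def\<close>)
  have cn: "real (n - 1) + 1/2 = c" using n_pos by (simp add: c_def)
  have rowsE: "(\<Union>(x, r)\<in>rows (rank h). F x (real r + 1/2)) =
      (\<Union>B\<in>nodes. \<Union>d. F (col (chd B d)) (H B)) \<union> F 0 c \<union> F (col (0, n)) c" for F :: "nat \<Rightarrow> real \<Rightarrow> R3 set"
    unfolding rows_def H_def cn[symmetric] by auto
  have risers: "(\<Union>(x, r)\<in>rows (rank h). closed_segment (real x, real r + 1/2, 0) (real x, real r + 1/2, 1)) =
    (\<Union>B\<in>nodes. \<Union>d. closed_segment (p (Pv B d)) (p (Qv B d))) \<union> closed_segment (p (Cap 0)) (p (Cap 1)) \<union>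
      closed_segment (p (Cap 2)) (p (Cap 3))"
    unfolding rowsE[of "\<lambda>x y. closed_segment (real x, y, 0) (real x, y, 1)"]
    by (simp add: closed_segment_commute[of "(x, y, 1 :: real)" "(x, y, 0)" for x y :: real])
  have horizontal: "(\<Union>r. convex hull ((\<lambda>x. (real x, real r + 1/2, 1)) ` {x. (x, r) \<in> rows (rank h)})) =
    (\<Union>B\<in>nodes. \<Union>d. closed_segment (p (Apx B)) (p (Pv B d))) \<union> closed_segment (p (Cap 1)) (p (Cap 2))"
  proof -
    define F where "F r = convex hull ((\<lambda>x. (real x, real r + 1/2, 1 :: real)) ` {x. (x, r) \<in> rows (rank h)})" for r
    have "F r = {}" if "\<not> r < n" for r
      using that half_diagram_rows[of h] unfolding F_def half_diagram_def by auto
    then have "(\<Union>r. F r) = (\<Union>r\<in>{..<n}. F r)" by auto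
    also have "{..<n} = rank h ` nodes \<union> {n - 1}" using rank_image[of h] n_pos by auto
    also have "(\<Union>r\<in>rank h ` nodes \<union> {n - 1}. F r) = (\<Union>B\<in>nodes. F (rank h B)) \<union> F (n - 1)" by auto
    also have "F (n - 1) = closed_segment (p (Cap 1)) (p (Cap 2))"
      unfolding F_def rows_top cn by (simp add: segment_convex_hull)
    also have "(\<Union>B\<in>nodes. F (rank h B)) = (\<Union>B\<in>nodes. \<Union>d. closed_segment (p (Apx B)) (p (Pv B d)))"
    proof (rule SUP_cong[OF refl])
      fix B assume B: "B \<in> nodes"
      have "F (rank h B) = closed_segment (p (Pv B True)) (p (Pv B False))"
        unfolding F_def rows_row[OF B] by (simp add: segment_convex_hull H_def)
      also have "\<dots> = closed_segment (p (Pv B True)) (p (Apx B)) \<union> closed_segment (p (Apx B)) (p (Pv B False))"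
      proof (rule Un_closed_segment[symmetric])
        define a b where "a = real (col (chd B True))" and "b = real (col (chd B False))"
        have ab: "a < real (col B)" "real (col B) < b"
          using col_chd[OF B, of True] col_chd[OF B, of False] by (simp_all add: a_def b_def)
        define u where "u = (real (col B) - a) / (b - a)"
        have u: "0 \<le> u" "u \<le> 1" "u * (b - a) = real (col B) - a" using ab by (auto simp: u_def field_simps)
        show "p (Apx B) \<in> closed_segment (p (Pv B True)) (p (Pv B False))"
          using u unfolding in_segment by (intro exI[of _ u]) (auto simp: algebra_simps a_def b_def)
      qed
      also have "\<dots> = (\<Union>d. closed_segment (p (Apx B)) (p (Pv B d)))"
        unfolding closed_segment_commute[of "p (Pv B True)"] UNIV_bool by (simp del: tpos.simps add: Un_commute)
      finally show "F (rank h B) = (\<Union>d. closed_segment (p (Apx B)) (p (Pv B d)))" .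
    qed
    finally show ?thesis unfolding F_def .
  qed
  have vertical: "(\<Union>(x, r)\<in>rows (rank h). closed_segment (real x, 0, 0) (real x, real r + 1/2, 0)) =
    (\<Union>B\<in>nodes. \<Union>d. closed_segment (p (Qv B d)) (p (low_label (chd B d)))) \<union>
    (\<Union>B\<in>nodes. closed_segment (p (Low B)) (p (Bot (col B)))) \<union>
    closed_segment (p (Bot 0)) (p (Cap 0)) \<union> closed_segment (p (Cap 3)) (p (low_label (0, n)))"
  proof -
    \<comment> \<open>The strand beneath \<open>A\<close>, empty for a leaf, so that all columns can
      be treated alike.\<close>
    define S where "S A = (if A \<in> nodes then closed_segment (p (Low A)) (p (Bot (col A))) else {})" for A
    have stalk: "closed_segment (real (col A), 0, 0) (real (col A), y, 0) =
      closed_segment (real (col A), y, 0) (p (low_label A)) \<union> S A" if A: "A \<in> T" and y: "low_height H A < y" for A y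
    proof (cases "A \<in> nodes")
      case False
      then have "leaf A" using A by (simp add: nodes_def)
      then show ?thesis using False by (simp add: S_def tpos_low_label low_height_def closed_segment_commute)
    next
      case True
      define u where "u = (y - H A) / y"
      have low: "low_height H A = H A" using nodes_leaf[OF True] by (simp add: low_height_def)
      have yH: "0 < H A" "H A < y" using h_pos[OF True] y low by auto
      then have u: "0 \<le> u" "u \<le> 1" "u * y = y - H A" by (auto simp: u_def field_simps)
      have "(real (col A), H A, 0) \<in> closed_segment (real (col A), y, 0) (real (col A), 0, 0 :: real)"
        using u unfolding in_segment by (intro exI[of _ u]) (auto simp: algebra_simps)
      from Un_closed_segment[OF this] show ?thesis
        using True low by (simp add: S_def tpos_low_label closed_segment_commute)
    qed
    \<comment> \<open>Every node is the root or a child of some node, so the strands in the columns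
      of children and of the root are all strands.\<close>
    have cov: "\<Union>(S ` nodes) = (\<Union>B\<in>nodes. \<Union>d. S (chd B d)) \<union> S (0, n)"
    proof (intro equalityI subsetI)
      fix q assume "q \<in> \<Union>(S ` nodes)"
      then obtain A where A: "A \<in> nodes" "q \<in> S A" by blast
      show "q \<in> (\<Union>B\<in>nodes. \<Union>d. S (chd B d)) \<union> S (0, n)"
        using parent[OF nodes_T[OF A(1)]] A(2) by (cases "A = (0, n)") blast+
    next
      fix q assume "q \<in> (\<Union>B\<in>nodes. \<Union>d. S (chd B d)) \<union> S (0, n)"
      then obtain A where "q \<in> S A" by blast
      then show "q \<in> \<Union>(S ` nodes)" by (cases "A \<in> nodes") (auto simp: S_def)
    qed
    have 1: "(\<Union>B\<in>nodes. closed_segment (p (Low B)) (p (Bot (col B)))) = \<Union>(S ` nodes)" by (simp add: S_def)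
    have 2: "(\<Union>B\<in>nodes. \<Union>d. closed_segment (real (col (chd B d)), 0, 0) (real (col (chd B d)), H B, 0)) =
        (\<Union>B\<in>nodes. \<Union>d. closed_segment (p (Qv B d)) (p (low_label (chd B d))) \<union> S (chd B d))"
      using stalk[OF node_split(3) low_less] by (intro SUP_cong refl) simp
    have 3: "closed_segment (real (col (0, n)), 0, 0) (real (col (0, n)), c, 0) =
        closed_segment (p (Cap 3)) (p (low_label (0, n))) \<union> S (0, n)"
      using stalk[OF root_in low_cap[OF root_in]] by simp
    have 4: "closed_segment (real 0, 0, 0) (real 0, c, 0) = closed_segment (p (Bot 0)) (p (Cap 0))" by simp
    show ?thesis unfolding rowsE[of "\<lambda>x y. closed_segment (real x, 0, 0) (real x, y, 0)"] 1 2 3 4 cov UN_Un_distrib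
      by (simp only: Un_ac)
  qed
  have "realize half_graph p = half_grid (rows (rank h))"
    unfolding realize_half_graph half_grid_def risers horizontal vertical UN_Un_distrib by (simp only: Un_ac)
  then show ?thesis unfolding H_def c_def .
qed

end

section \<open>From the Thompson link to the grid\<close>

lemma Un_thirds:
  fixes a b :: R3
  shows "closed_segment a ((2/3) *\<^sub>R a + (1/3) *\<^sub>R b) \<union> closed_segment ((2/3) *\<^sub>R a + (1/3) *\<^sub>R b) ((1/3) *\<^sub>R a + (2/3) *\<^sub>R b) \<union>
    closed_segment ((1/3) *\<^sub>R a + (2/3) *\<^sub>R b) b = closed_segment a b"
proof -
  have "(2/3) *\<^sub>R a + (1/3) *\<^sub>R b \<in> closed_segment a b"
    unfolding in_segment by (intro exI[of _ "1/3"]) simp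
  moreover have "(1/3) *\<^sub>R a + (2/3) *\<^sub>R b \<in> closed_segment ((2/3) *\<^sub>R a + (1/3) *\<^sub>R b) b"
    unfolding in_segment by (intro exI[of _ "1/2"]) (simp add: prod_eq_iff field_simps)
  ultimately show ?thesis using Un_closed_segment by (metis Un_assoc)
qed

text \<open>For \<open>w = 1/3\<close> the auxiliary vertices trisect the straight edges of the
  tangle; the heights \<open>ilen I\<close> and 2 are those of its definition.\<close>

lemma realize_tangle:
  assumes I: "sd_partition n I"
  defines "sp \<equiv> \<lambda>A. split_index I (fst A) (snd A)"
  shows "realize (plane_tree.half_graph n (tree_edges I) sp) (plane_tree.tpos n sp (ilen I) 2 (1/3)) = capped_tangle I"
proof -
  interpret plane_tree n "tree_edges I" sp unfolding sp_def by (rule sd_partition_plane_tree[OF I])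
  have sp: "sp A = split_index I (fst A) (snd A)" for A by (simp add: sp_def)
  define p where "p = tpos (ilen I) 2 (1/3)"
  have low: "at_level 0 (lower_end I (fst A) (snd A)) = p (low_label A)" for A
    by (simp add: p_def tpos_low_label lower_end_def at_level_def low_height_def col_def leaf_def ilen_def sp)
  have up: "at_level 1 (lower_end I (fst B) (snd B)) = p (Apx B)" "fst (lower_end I (fst B) (snd B)) = real (col B)" if "B \<in> nodes" for B
    using nodes_leaf[OF that] by (simp_all add: p_def lower_end_def at_level_def col_def leaf_def ilen_def sp)
  have Low: "low_label B = Low B" if "B \<in> nodes" for B using nodes_leaf[OF that] by (simp add: low_label_def)
  have arc: "closed_segment (p (Apx B)) (p (Pv B d)) \<union> closed_segment (p (Pv B d)) (p (Qv B d)) \<union>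
      closed_segment (p (Qv B d)) (p (low_label (chd B d))) = closed_segment (p (Apx B)) (p (low_label (chd B d)))" for B d
  proof -
    have "p (Pv B d) = (2/3) *\<^sub>R p (Apx B) + (1/3) *\<^sub>R p (low_label (chd B d))"
      "p (Qv B d) = (1/3) *\<^sub>R p (Apx B) + (2/3) *\<^sub>R p (low_label (chd B d))"
      by (simp_all add: p_def tpos_low_label field_simps)
    then show ?thesis using Un_thirds[of "p (Apx B)" "p (low_label (chd B d))"] by simp
  qed
  have cap: "closed_segment (p (Cap 0)) (p (Cap 1)) \<union> closed_segment (p (Cap 1)) (p (Cap 2)) \<union> closed_segment (p (Cap 2)) (p (Cap 3)) =
      closed_segment (p (Cap 0)) (p (Cap 3))"
  proof -
    have "p (Cap 1) = (2/3) *\<^sub>R p (Cap 0) + (1/3) *\<^sub>R p (Cap 3)" "p (Cap 2) = (1/3) *\<^sub>R p (Cap 0) + (2/3) *\<^sub>R p (Cap 3)"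
      by (simp_all add: p_def)
    then show ?thesis using Un_thirds[of "p (Cap 0)" "p (Cap 3)"] by simp
  qed
  have set: "{(i, j) \<in> tree_edges I. j \<noteq> i + 1} = nodes" by (auto simp: nodes_def leaf_def)
  have tree: "tree_tangle I = (\<Union>B\<in>nodes. closed_segment (p (Low B)) (p (Bot (col B))) \<union>
      (closed_segment (p (Apx B)) (p (low_label (chd B True))) \<union> closed_segment (p (Apx B)) (p (low_label (chd B False)))))"
    unfolding tree_tangle_def set
  proof (rule SUP_cong[OF refl])
    fix B assume B: "B \<in> nodes"
    have k: "split_index I (fst B) (snd B) = sp B" by (simp add: sp)
    have c: "lower_end I (fst B) (sp B) = lower_end I (fst (chd B True)) (snd (chd B True))"
      "lower_end I (sp B) (snd B) = lower_end I (fst (chd B False)) (snd (chd B False))" by (simp_all add: chd_def)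
    show "(case B of (i, j) \<Rightarrow> let k = split_index I i j; v = lower_end I i j in
       closed_segment (at_level 0 v) (fst v, 0, 0) \<union>
       closed_segment (at_level 1 v) (at_level 0 (lower_end I i k)) \<union>
       closed_segment (at_level 1 v) (at_level 0 (lower_end I k j))) =
      closed_segment (p (Low B)) (p (Bot (col B))) \<union>
      (closed_segment (p (Apx B)) (p (low_label (chd B True))) \<union> closed_segment (p (Apx B)) (p (low_label (chd B False))))"
      unfolding case_prod_unfold Let_def k c low up[OF B] Low[OF B] by (simp add: p_def Un_assoc)
  qed
  have l: "length I - 1 = n" using I by (simp add: sd_partition_def)
  have root: "at_level 0 (lower_end I 0 n) = p (low_label (0, n))" "fst (lower_end I 0 n) = real (col (0, n))"
    using low[of "(0, n)"] by (simp_all add: lower_end_def col_def leaf_def sp)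
  have pc: "p (Cap 0) = (0, 2, 0)" "p (Cap 3) = (real (col (0, n)), 2, 0)" "p (Bot 0) = (0, 0, 0)" by (simp_all add: p_def)
  have "capped_tangle I = tree_tangle I \<union> (closed_segment (p (Cap 3)) (p (low_label (0, n))) \<union>
      closed_segment (p (Cap 0)) (p (Cap 3)) \<union> closed_segment (p (Bot 0)) (p (Cap 0)))"
    unfolding capped_tangle_def Let_def l root pc ..
  also have "\<dots> = realize half_graph p"
    unfolding realize_half_graph tree arc cap[symmetric] UNIV_bool by auto
  finally show ?thesis unfolding p_def ..
qed

text \<open>One motion, linear in the heights, takes both halves from the lengths of intervals to
  the rows, while \<open>w\<close> falls from 1/3 to 0. The points on the bottom line stay in place,
  so the halves remain glued at all times.\<close>

lemma thompson_link_grid: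
  assumes sd: "\<And>s. sd_partition n (I s)"
    and K: "ambient_isotopic (stereo ` thompson_link (I True) (I False)) K"
  shows "\<exists>G. grid_diagram (2 * n) G \<and> ambient_isotopic (stereo ` grid_link G) K"
proof -
  define sp where "sp s = (\<lambda>A. split_index (I s) (fst A) (snd A))" for s
  have pt: "plane_tree n (tree_edges (I s)) (sp s)" for s unfolding sp_def by (rule sd_partition_plane_tree[OF sd])
  define E where "E s = plane_tree.half_graph n (tree_edges (I s)) (sp s)" for s
  define nod where "nod s = plane_tree.nodes (tree_edges (I s))" for s
  define rk where "rk s = plane_tree.rank (tree_edges (I s)) (sp s) (ilen (I s))" for s
  define h where "h t s B = (1 - t) * ilen (I s) B + t * (real (rk s B) + 1/2)" for t s B
  define c where "c t = (1 - t) * 2 + t * (real n - 1/2)" for t :: real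
  define p where "p t s = plane_tree.tpos n (sp s) (h t s) (c t) ((1 - t) / 3)" for t s
  have bot: "p t s (Bot k) = (real k, 0, 0)" for t s k
  proof -
    interpret plane_tree n "tree_edges (I s)" "sp s" by (rule pt)
    show ?thesis by (simp add: p_def)
  qed
  have adm: "plane_tree.admissible (tree_edges (I s)) (sp s) (h t s) (c t)" if t: "t \<in> {0..1}" for s t
  proof -
    interpret plane_tree n "tree_edges (I s)" "sp s" by (rule pt)
    note P = sd_partition_props[OF sd[of s]]
    have le: "I s ! i \<le> I s ! j \<longleftrightarrow> i \<le> j" "I s ! i < I s ! j \<longleftrightarrow> i < j" if "i \<le> n" "j \<le> n" for i j
      using P(2,3) that by blast+
    show ?thesis
      unfolding h_def c_def rk_def
    proof (rule admissible_motion[OF _ _ t])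
      fix B assume B: "B \<in> nodes"
      have "I s ! fst B < I s ! snd B" "I s ! 0 \<le> I s ! fst B" "I s ! snd B \<le> I s ! n"
        using T_less[OF nodes_T[OF B]] le by auto
      then show "0 < ilen (I s) B \<and> ilen (I s) B \<le> 1" using P(5,6) by (simp add: ilen_def)
    next
      fix A B assume AB: "A \<in> nodes" "B \<in> nodes" "below A B"
      note n = T_less[OF nodes_T[OF AB(1)]] T_less[OF nodes_T[OF AB(2)]]
      have "fst B \<le> fst A" "snd A \<le> snd B" "fst B < fst A \<or> snd A < snd B"
        using below_range[OF AB(3) nodes_T[OF AB(2)]] below_strict[OF AB(3) nodes_T[OF AB(2)]] by auto
      then have "I s ! fst B \<le> I s ! fst A" "I s ! snd A \<le> I s ! snd B" "I s ! fst B < I s ! fst A \<or> I s ! snd A < I s ! snd B"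
        using n by (simp_all add: le)
      then show "ilen (I s) A < ilen (I s) B" by (auto simp: ilen_def)
    qed
  qed
  have drawing: "tree_drawing n (tree_edges (I s)) (sp s) (h t s) (c t) ((1 - t) / 3)" if t: "t \<in> {0..1}" for s t
    unfolding tree_drawing_def tree_drawing_axioms_def using pt adm[OF t] t by simp
  have emb: "embedded (join E) (glue (p t))" if t: "t \<in> {0..1}" for t
  proof (rule embedded_join[OF _ bot])
    fix s
    interpret tree_drawing n "tree_edges (I s)" "sp s" "h t s" "c t" "(1 - t) / 3" by (rule drawing[OF t])
    show "embedded (E s) (p t s)" unfolding E_def p_def by (rule embedded_half_graph)
    show "0 \<le> X2 q \<and> (X2 q = 0 \<longrightarrow> (\<exists>k. Bot k \<in> {l, l'} \<and> q = p t s (Bot k)))"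
      if "(l, l') \<in> E s" "q \<in> closed_segment (p t s l) (p t s l')" for l l' q
      using half_graph_bottom that unfolding E_def p_def by blast
  qed
  have fin: "finite (join E)"
    unfolding join_def E_def using plane_tree.finite_half_graph[OF pt] by simp
  have "\<exists>f. carries (join E) (glue (p 0)) (glue (p 1)) f"
  proof (rule motion_isotopy[OF fin])
    fix t :: real assume "t \<in> {0..1}"
    then show "embedded (join E) (glue (p t))" by (rule emb)
  next
    fix v :: "bool \<times> tlab"
    obtain s l where v: "v = (s, l)" by (cases v)
    interpret plane_tree n "tree_edges (I s)" "sp s" by (rule pt)
    have low: "continuous_on {0..1} (\<lambda>t. low_height (h t s) A)" for A
      unfolding low_height_def h_def by (cases "leaf A") (auto intro!: continuous_intros)
    have "continuous_on {0..1} (\<lambda>t. p t s l)"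
    proof (cases l)
      case (Cap k)
      then show ?thesis unfolding p_def c_def
        by (cases "k = 0"; cases "k = 1"; cases "k = 2") (auto intro!: continuous_intros)
    qed (auto simp: p_def h_def intro!: continuous_intros low low[unfolded h_def])
    then have "continuous_on {0..1} (\<lambda>t. flip s (p t s l))"
      by (rule bounded_linear.continuous_on[OF linear_conv_bounded_linear[THEN iffD1, OF linear_flip]])
    then show "continuous_on {0..1} (\<lambda>t. glue (p t) v)" by (simp add: v glue_def)
  qed
  then obtain f1 where f1: "carries (join E) (glue (p 0)) (glue (p 1)) f1" ..
  \<comment> \<open>The translation puts the rows at integer heights, the lowest at 0.\<close>
  have "\<exists>f. carries (join E) (glue (p 1)) (\<lambda>v. id (glue (p 1) v) + (0, real n - 1/2, 0)) f"
    by (rule linear_motion[OF fin emb linear_id]) (auto simp flip: scaleR_add_left)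
  then obtain f2 where f2: "carries (join E) (glue (p 1)) (\<lambda>v. glue (p 1) v + (0, real n - 1/2, 0)) f2" by auto
  note f = carries_trans[OF f1 f2]
  have start: "realize (join E) (glue (p 0)) = thompson_link (I True) (I False)"
  proof -
    have "h 0 s = ilen (I s)" for s by (simp add: h_def fun_eq_iff)
    then have "realize (E s) (p 0 s) = capped_tangle (I s)" for s
      using realize_tangle[OF sd, of s] by (simp add: E_def p_def c_def sp_def)
    moreover have "flip True ` S = S" for S by (simp add: flip_def case_prod_unfold)
    moreover have "flip False = (\<lambda>(x, y, z). (x, - y, z))" by (simp add: flip_def)
    ultimately show ?thesis using realize_join[of "p 0" E 0, OF bot] by (simp add: UNIV_bool thompson_link_def Un_commute)
  qed
  define W where "W s = plane_tree.rows n (tree_edges (I s)) (sp s) (rk s)" for s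
  have W: "half_diagram n (W s)" for s
    unfolding W_def rk_def by (rule plane_tree.half_diagram_rows[OF pt])
  have "realize (E s) (p 1 s) = half_grid (W s)" for s
    using plane_tree.realize_right_angled[OF pt, of s "ilen (I s)"] adm[of 1 s]
    unfolding E_def p_def h_def c_def W_def rk_def by simp
  then have "realize (join E) (\<lambda>v. glue (p 1) v + (0, real n - 1/2, 0)) = grid_link (stack n W)"
    using realize_join[of "p 1" E, OF bot] stack_grid_link[of n W, OF W] by simp
  then have "ambient_isotopic (stereo ` grid_link (stack n W)) K"
    using carries_ambient[OF f, of K] K unfolding start by simp
  then show ?thesis using stack_grid_diagram[of n W, OF W] by blast
qed

lemma grid_number_le_thompson_index: "grid_number K \<le> 2 * thompson_index K"
proof (cases "{n. \<exists>g\<in>thompson_F. \<exists>I J. reduced_pair n I J \<and> represents n I J g \<and>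
     ambient_isotopic (stereo ` thompson_link I J) K} = {}")
  case True
  then have "thompson_index K = \<infinity>" unfolding thompson_index_def True by (simp add: top_enat_def)
  then show ?thesis by (simp add: imult_infinity_right)
next
  case False
  then obtain n0 where "n0 \<in> {n. \<exists>g\<in>thompson_F. \<exists>I J. reduced_pair n I J \<and> represents n I J g \<and>
     ambient_isotopic (stereo ` thompson_link I J) K}" by blast
  then have "thompson_index K \<in> enat ` {n. \<exists>g\<in>thompson_F. \<exists>I J. reduced_pair n I J \<and> represents n I J g \<and>
     ambient_isotopic (stereo ` thompson_link I J) K}"
    unfolding thompson_index_def by (intro wellorder_InfI) (rule imageI)
  then obtain n I J where n: "thompson_index K = enat n" "reduced_pair n I J" "ambient_isotopic (stereo ` thompson_link I J) K"
    by blast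
  have "\<exists>G. grid_diagram (2 * n) G \<and> ambient_isotopic (stereo ` grid_link G) K"
    using thompson_link_grid[of n "\<lambda>s. if s then I else J" K] n(2,3) by (simp add: reduced_pair_def)
  then have "grid_number K \<le> enat (2 * n)" unfolding grid_number_def by (intro INF_lower) blast
  also have "\<dots> = 2 * thompson_index K" by (simp add: n(1) numeral_eq_enat)
  finally show ?thesis .
qed

theorem theorem1p15:
  fixes K :: "R4 set"
  assumes "link K"
  shows "grid_number K \<le> 2 * thompson_index K \<and>
    (\<forall>\<Gamma>. orientation_of K \<Gamma> \<longrightarrow>
       bridge_number K \<le> braid_index \<Gamma> \<and>
       ereal_of_enat (braid_index \<Gamma>) \<le> ereal_of_enat (grid_number K) / 2 \<and>
       ereal_of_enat (grid_number K) / 2 \<le> ereal_of_enat (thompson_index K))"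
proof -
  obtain P where P: "polygonal_link P" "ambient_isotopic (stereo ` polygonal_support P) K"
    using assms by (auto simp: link_def)
  obtain vs where "vs \<in> P" using P(1) by (auto simp: polygonal_link_def)
  then have "polygonal_support P \<noteq> {}" by (auto simp: polygonal_support_def path_image_nonempty)
  \<comment> \<open>The empty set would have grid number 0, from the empty grid diagram, but
    infinite braid index, because closed braids are nonempty.\<close>
  then have K: "K \<noteq> {}" using P(2) by (auto simp: ambient_isotopic_def)
  have le: "grid_number K \<le> 2 * thompson_index K" by (rule grid_number_le_thompson_index)
  have "ereal_of_enat (grid_number K) / 2 \<le> ereal_of_enat (thompson_index K)"
  proof (cases "thompson_index K")
    case (enat n)
    then have "grid_number K \<le> enat (2 * n)" using le by (simp add: numeral_eq_enat)
    then obtain m where m: "grid_number K = enat m" "m \<le> 2 * n" by (metis enat_ile enat_ord_simps(1))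
    have "real m / 2 \<le> real n" using m(2) by simp
    then show ?thesis unfolding m(1) enat by simp
  qed simp
  then show ?thesis using le bridge_number_le_braid_index braid_index_le_half_grid[OF _ K] by blast
qed

end
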